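(* Let $\lambda=(\nu_1,\dots,\nu_n)\in\Lambda^+$ be a dominant integral weight of $\mathfrak q(n)$ of the form $\lambda=(\lambda_1,\dots,\lambda_k,\underbrace{0,\dots,0}_{m},-\lambda_{k+m+1},\dots,-\lambda_n)$ with all $\lambda_i>0$, $m\ge0$. (1) $\operatorname{Ext}^1_{\mathfrak{sq}(n)}(L_{\mathfrak{sq}(n)}(\lambda),L_{\mathfrak{sq}(n)}(\lambda))=0$ if $L(\lambda)\not\cong\Pi L(\lambda)$. (2) $\operatorname{Ext}^1_{\mathfrak{sq}(n)}(L_{\mathfrak{sq}(n)}(\lambda),\Pi L_{\mathfrak{sq}(n)}(\lambda))=\operatorname{Ext}^1_{\mathfrak{sq}(n)}(L_{\mathfrak{sq}(n)}(\lambda),L_{\mathfrak{sq}(n)}(\lambda))=0$ if $m>0$, or if $m=0$ and $\frac1{\nu_1}+\dots+\frac1{\nu_n}\ne0$. (3) $\operatorname{Ext}^1_{\mathfrak{sq}(n)}(L_{\mathfrak{sq}(n)}(\lambda),\Pi L_{\mathfrak{sq}(n)}(\lambda))=\mathbb C$ if $m=0$ and $\frac1{\nu_1}+\dots+\frac1{\nu_n}=0$.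
   Context: Ground field $\mathbb C$. $\mathfrak q(n)$ is the Lie superalgebra of matrices $\begin{pmatrix}A&B\\ B&A\end{pmatrix}$, $A,B\in\mathfrak{gl}_n(\mathbb C)$ (even part $B=0$, odd part $A=0$); $\mathfrak{sq}(n)=\{\operatorname{tr}B=0\}$. Both have the same even part. Weights are written by their values on the even diagonal elements with $A=E_{ii}$. The set of dominant integral weights is $\Lambda^+=\{\nu:\nu_i-\nu_{i+1}\in\mathbb Z_{\ge0},\ \nu_i=\nu_j\ (i\neq j)\Rightarrow\nu_i=\nu_j=0\}$. $L(\lambda)$ and $L_{\mathfrak{sq}(n)}(\lambda)$ are the simple finite-dimensional supermodules of highest weight $\lambda$ over $\mathfrak q(n)$ and $\mathfrak{sq}(n)$ respectively (with respect to upper triangular $A,B$), each determined up to the parity change functor $\Pi$. $\operatorname{Ext}^1_{\mathfrak{sq}(n)}$ is taken in the category of finite-dimensional $\mathfrak{sq}(n)$-supermodules semisimple over $\mathfrak{sq}(n)_{\bar0}$, with parity-preserving morphisms. *)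

theory Defs
  imports "Jordan_Normal_Form.VS_Connect" "Jordan_Normal_Form.Matrix_Kernel"
begin

section \<open>Matrix Lie superalgebras\<close>

text \<open>Parities are booleans, \<open>False\<close> being even and \<open>True\<close> being odd.  A (matrix) Lie superalgebra
  is given by the family of its two homogeneous parts, the bracket being the supercommutator.\<close>

type_synonym superalg = "bool \<Rightarrow> complex mat set"

definition elements :: "superalg \<Rightarrow> complex mat set" where
  "elements g = {X + Y | X Y. X \<in> g False \<and> Y \<in> g True}"

definition supercomm :: "bool \<Rightarrow> bool \<Rightarrow> complex mat \<Rightarrow> complex mat \<Rightarrow> complex mat" where
  "supercomm a b X Y = (if a \<and> b then X * Y + Y * X else X * Y - Y * X)"

definition q_mat :: "complex mat \<Rightarrow> complex mat \<Rightarrow> complex mat" where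
  "q_mat A B = four_block_mat A B B A"

definition q_alg :: "nat \<Rightarrow> superalg" where
  "q_alg n a = (if a then {q_mat (0\<^sub>m n n) B | B. B \<in> carrier_mat n n}
                else {q_mat A (0\<^sub>m n n) | A. A \<in> carrier_mat n n})"

definition sq_alg :: "nat \<Rightarrow> superalg" where
  "sq_alg n a = (if a then {q_mat (0\<^sub>m n n) B | B. B \<in> carrier_mat n n \<and> (\<Sum>i<n. B $$ (i, i)) = 0}
                 else {q_mat A (0\<^sub>m n n) | A. A \<in> carrier_mat n n})"


section \<open>Finite-dimensional supermodules\<close>

text \<open>A finite-dimensional supermodule is given in a homogeneous basis: \<open>par\<close> lists the parities of
  the basis vectors (in any order), \<open>act\<close> sends an element of the superalgebra to its matrix in
  that basis.  The value of \<open>act\<close> off \<open>elements g\<close> is irrelevant.\<close>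

record smod =
  par :: "bool list"
  act :: "complex mat \<Rightarrow> complex mat"

definition sdim :: "smod \<Rightarrow> nat" where
  "sdim M = length (par M)"

text \<open>\<open>homog rs cs a F\<close>: the matrix \<open>F\<close>, from a space with parities \<open>cs\<close> to one with parities \<open>rs\<close>,
  is homogeneous of parity \<open>a\<close>.\<close>

definition homog :: "bool list \<Rightarrow> bool list \<Rightarrow> bool \<Rightarrow> complex mat \<Rightarrow> bool" where
  "homog rs cs a F \<longleftrightarrow> F \<in> carrier_mat (length rs) (length cs) \<and>
     (\<forall>i < length rs. \<forall>j < length cs. F $$ (i, j) \<noteq> 0 \<longrightarrow> (rs ! i \<noteq> cs ! j) = a)"

definition supermodule :: "superalg \<Rightarrow> smod \<Rightarrow> bool" where
  "supermodule g M \<longleftrightarrow>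
     (\<forall>X \<in> elements g. act M X \<in> carrier_mat (sdim M) (sdim M)) \<and>
     (\<forall>X \<in> elements g. \<forall>Y \<in> elements g. act M (X + Y) = act M X + act M Y) \<and>
     (\<forall>c. \<forall>X \<in> elements g. act M (c \<cdot>\<^sub>m X) = c \<cdot>\<^sub>m act M X) \<and>
     (\<forall>a. \<forall>X \<in> g a. homog (par M) (par M) a (act M X)) \<and>
     (\<forall>a b. \<forall>X \<in> g a. \<forall>Y \<in> g b.
        act M (supercomm a b X Y) = supercomm a b (act M X) (act M Y))"

text \<open>Morphisms preserve parity.\<close>

definition smod_hom :: "superalg \<Rightarrow> smod \<Rightarrow> smod \<Rightarrow> complex mat set" where
  "smod_hom g M N = {F. homog (par N) (par M) False F \<and>
     (\<forall>X \<in> elements g. F * act M X = act N X * F)}"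

definition smod_iso :: "superalg \<Rightarrow> smod \<Rightarrow> smod \<Rightarrow> bool" where
  "smod_iso g M N \<longleftrightarrow> (\<exists>F \<in> smod_hom g M N. \<exists>G \<in> smod_hom g N M.
     G * F = 1\<^sub>m (sdim M) \<and> F * G = 1\<^sub>m (sdim N))"

text \<open>Parity change \<open>\<Pi> M = M \<otimes> \<complex>\<^sup>0\<^sup>|\<^sup>1\<close>: the action is unchanged.  The convention in which odd elements
  act with the opposite sign gives an isomorphic module.\<close>

definition parity_change :: "smod \<Rightarrow> smod" where
  "parity_change M = \<lparr>par = map Not (par M), act = act M\<rparr>"

abbreviation cvec_subspace :: "nat \<Rightarrow> complex vec set \<Rightarrow> bool" where
  "cvec_subspace d W \<equiv> VectorSpace.subspace class_ring W (module_vec TYPE(complex) d)"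

definition stable_under :: "complex mat set \<Rightarrow> smod \<Rightarrow> complex vec set \<Rightarrow> bool" where
  "stable_under S M W \<longleftrightarrow> (\<forall>X \<in> S. \<forall>w \<in> W. act M X *\<^sub>v w \<in> W)"

definition graded_subspace :: "bool list \<Rightarrow> complex vec set \<Rightarrow> bool" where
  "graded_subspace ps W \<longleftrightarrow> cvec_subspace (length ps) W \<and>
     (\<forall>w \<in> W. \<forall>a. vec (length ps) (\<lambda>i. if ps ! i = a then w $ i else 0) \<in> W)"

definition simple_smod :: "superalg \<Rightarrow> smod \<Rightarrow> bool" where
  "simple_smod g M \<longleftrightarrow> supermodule g M \<and> sdim M \<noteq> 0 \<and>
     (\<forall>W. graded_subspace (par M) W \<and> stable_under (elements g) M W \<longrightarrow>
        W = {0\<^sub>v (sdim M)} \<or> W = carrier_vec (sdim M))"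

definition semisimple_over_even :: "superalg \<Rightarrow> smod \<Rightarrow> bool" where
  "semisimple_over_even g M \<longleftrightarrow>
     (\<forall>W. cvec_subspace (sdim M) W \<and> stable_under (g False) M W \<longrightarrow>
        (\<exists>W'. cvec_subspace (sdim M) W' \<and> stable_under (g False) M W' \<and>
           W \<inter> W' = {0\<^sub>v (sdim M)} \<and> {w + w' | w w'. w \<in> W \<and> w' \<in> W'} = carrier_vec (sdim M)))"

text \<open>The objects of the category in which \<open>Ext\<^sup>1\<close> is taken.\<close>

definition cat_F :: "superalg \<Rightarrow> smod set" where
  "cat_F g = {M. supermodule g M \<and> semisimple_over_even g M}"


section \<open>Weights\<close>

text \<open>Weights of \<open>q(n)\<close> are vectors of dimension \<open>n\<close>; indices start at \<open>0\<close>.\<close>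

definition dominant_integral :: "nat \<Rightarrow> complex vec set" where
  "dominant_integral n = {\<nu> \<in> carrier_vec n.
     (\<forall>i. Suc i < n \<longrightarrow> \<nu> $ i - \<nu> $ Suc i \<in> \<nat>) \<and>
     (\<forall>i < n. \<forall>j < n. i \<noteq> j \<and> \<nu> $ i = \<nu> $ j \<longrightarrow> \<nu> $ i = 0 \<and> \<nu> $ j = 0)}"

definition strictly_upper :: "nat \<Rightarrow> complex mat set" where
  "strictly_upper n = {A \<in> carrier_mat n n. \<forall>i < n. \<forall>j \<le> i. A $$ (i, j) = 0}"

definition diag_unit :: "nat \<Rightarrow> nat \<Rightarrow> complex mat" where
  "diag_unit n i = mat n n (\<lambda>(r, s). if r = i \<and> s = i then 1 else 0)"

text \<open>The nilradical of the Borel subalgebra of upper triangular \<open>A, B\<close> is the same for \<open>q(n)\<close> and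
  \<open>sq(n)\<close>, as strictly upper triangular matrices have trace zero.\<close>

definition has_highest_weight :: "nat \<Rightarrow> complex vec \<Rightarrow> smod \<Rightarrow> bool" where
  "has_highest_weight n \<nu> M \<longleftrightarrow> (\<exists>v \<in> carrier_vec (sdim M). v \<noteq> 0\<^sub>v (sdim M) \<and>
     (\<forall>A \<in> strictly_upper n. \<forall>B \<in> strictly_upper n. act M (q_mat A B) *\<^sub>v v = 0\<^sub>v (sdim M)) \<and>
     (\<forall>i < n. act M (q_mat (diag_unit n i) (0\<^sub>m n n)) *\<^sub>v v = (\<nu> $ i) \<cdot>\<^sub>v v))"

text \<open>For \<open>g\<close> one of \<open>q(n)\<close>, \<open>sq(n)\<close>: the module \<open>M\<close> is an \<open>L\<^sub>g(\<nu>)\<close>.\<close>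

definition simple_highest_weight :: "superalg \<Rightarrow> nat \<Rightarrow> complex vec \<Rightarrow> smod \<Rightarrow> bool" where
  "simple_highest_weight g n \<nu> M \<longleftrightarrow> simple_smod g M \<and> has_highest_weight n \<nu> M"


section \<open>Yoneda \<open>Ext\<^sup>1\<close>\<close>

text \<open>A triple \<open>(E, i, p)\<close> stands for the sequence \<open>0 \<rightarrow> N \<rightarrow> E \<rightarrow> M \<rightarrow> 0\<close> with maps \<open>i\<close> and \<open>p\<close>.\<close>

type_synonym ext = "smod \<times> complex mat \<times> complex mat"

definition extensions :: "superalg \<Rightarrow> smod \<Rightarrow> smod \<Rightarrow> ext set" where
  "extensions g M N = {(E, i, p). E \<in> cat_F g \<and> i \<in> smod_hom g N E \<and> p \<in> smod_hom g E M \<and>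
     mat_kernel i = {0\<^sub>v (sdim N)} \<and>
     (\<lambda>v. i *\<^sub>v v) ` carrier_vec (sdim N) = mat_kernel p \<and>
     (\<lambda>v. p *\<^sub>v v) ` carrier_vec (sdim E) = carrier_vec (sdim M)}"

text \<open>\<open>ext_map g a c e e'\<close>: there is a morphism of short exact sequences from \<open>e\<close> to \<open>e'\<close> which is
  \<open>a\<close> on the subobjects and \<open>c\<close> on the quotients.\<close>

fun ext_map :: "superalg \<Rightarrow> complex mat \<Rightarrow> complex mat \<Rightarrow> ext \<Rightarrow> ext \<Rightarrow> bool" where
  "ext_map g a c (E, i, p) (E', i', p') \<longleftrightarrow>
     (\<exists>f \<in> smod_hom g E E'. f * i = i' * a \<and> p' * f = c * p)"

definition ext_equiv :: "superalg \<Rightarrow> smod \<Rightarrow> smod \<Rightarrow> (ext \<times> ext) set" where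
  "ext_equiv g M N = {(e, e'). e \<in> extensions g M N \<and> e' \<in> extensions g M N \<and>
     ext_map g (1\<^sub>m (sdim N)) (1\<^sub>m (sdim M)) e e'}"

definition mat_dsum :: "complex mat \<Rightarrow> complex mat \<Rightarrow> complex mat" where
  "mat_dsum A B = four_block_mat A (0\<^sub>m (dim_row A) (dim_col B)) (0\<^sub>m (dim_row B) (dim_col A)) B"

definition smod_dsum :: "smod \<Rightarrow> smod \<Rightarrow> smod" where
  "smod_dsum M N = \<lparr>par = par M @ par N, act = (\<lambda>X. mat_dsum (act M X) (act N X))\<rparr>"

fun ext_dsum :: "ext \<Rightarrow> ext \<Rightarrow> ext" where
  "ext_dsum (E, i, p) (E', i', p') = (smod_dsum E E', mat_dsum i i', mat_dsum p p')"

definition diag_map :: "nat \<Rightarrow> complex mat" where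
  "diag_map d = 1\<^sub>m d @\<^sub>r 1\<^sub>m d"

definition codiag_map :: "nat \<Rightarrow> complex mat" where
  "codiag_map d = transpose_mat (diag_map d)"

definition split_ext :: "smod \<Rightarrow> smod \<Rightarrow> ext" where
  "split_ext M N = (smod_dsum N M, 1\<^sub>m (sdim N) @\<^sub>r 0\<^sub>m (sdim M) (sdim N),
     transpose_mat (0\<^sub>m (sdim N) (sdim M) @\<^sub>r 1\<^sub>m (sdim M)))"

text \<open>Baer sum: the class of \<open>\<nabla>(e\<^sub>1 \<oplus> e\<^sub>2)\<Delta>\<close>.  A morphism of short exact sequences that is the identity
  on the quotients (on the subobjects) exhibits its target as a pushout of its source (its source as
  a pullback of its target), so the auxiliary extension \<open>e'\<close> below is \<open>\<nabla>(e\<^sub>1 \<oplus> e\<^sub>2)\<close> and \<open>e\<close> is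
  \<open>e'\<Delta>\<close>, and the set is a full equivalence class.\<close>

definition baer_sum :: "superalg \<Rightarrow> smod \<Rightarrow> smod \<Rightarrow> ext set \<Rightarrow> ext set \<Rightarrow> ext set" where
  "baer_sum g M N C\<^sub>1 C\<^sub>2 = {e \<in> extensions g M N.
     \<exists>e\<^sub>1 \<in> C\<^sub>1. \<exists>e\<^sub>2 \<in> C\<^sub>2. \<exists>e' \<in> extensions g (smod_dsum M M) N.
       ext_map g (codiag_map (sdim N)) (1\<^sub>m (sdim (smod_dsum M M))) (ext_dsum e\<^sub>1 e\<^sub>2) e' \<and>
       ext_map g (1\<^sub>m (sdim N)) (diag_map (sdim M)) e e'}"

text \<open>Scalar multiplication: pushout along \<open>c \<cdot> id\<^sub>N\<close>.\<close>

definition ext_smult :: "superalg \<Rightarrow> smod \<Rightarrow> smod \<Rightarrow> complex \<Rightarrow> ext set \<Rightarrow> ext set" where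
  "ext_smult g M N c C = {e' \<in> extensions g M N.
     \<exists>e \<in> C. ext_map g (c \<cdot>\<^sub>m 1\<^sub>m (sdim N)) (1\<^sub>m (sdim M)) e e'}"

definition Ext1 :: "superalg \<Rightarrow> smod \<Rightarrow> smod \<Rightarrow> (complex, ext set) module" where
  "Ext1 g M N = \<lparr>carrier = extensions g M N // ext_equiv g M N,
     mult = undefined, one = undefined,
     zero = ext_equiv g M N `` {split_ext M N},
     add = baer_sum g M N,
     smult = ext_smult g M N\<rparr>"

definition is_zero_space :: "(complex, 'a) module \<Rightarrow> bool" where
  "is_zero_space V \<longleftrightarrow> carrier V = {\<zero>\<^bsub>V\<^esub>}"

text \<open>\<open>V\<close> is isomorphic to \<open>\<complex>\<close> as a complex vector space.\<close>

definition iso_to_C :: "(complex, 'a) module \<Rightarrow> bool" where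
  "iso_to_C V \<longleftrightarrow> (\<exists>\<phi>. bij_betw \<phi> (UNIV :: complex set) (carrier V) \<and>
     (\<forall>x y. \<phi> (x + y) = \<phi> x \<oplus>\<^bsub>V\<^esub> \<phi> y) \<and> (\<forall>c x. \<phi> (c * x) = c \<odot>\<^bsub>V\<^esub> \<phi> x))"

end

theory Submission
  imports Defs "HOL-Library.Function_Algebras" "HOL-Library.Product_Plus" "Jordan_Normal_Form.Spectral_Radius"
begin

text \<open>By a Casimir argument, a supermodule spanned by weight vectors is semisimple over the even part.
  Hence the extensions of \<open>L\<close> by \<open>N\<close>, which is \<open>L\<close> or \<open>\<Pi> L\<close>, split over the even part, and \<open>Ext\<^sup>1\<close> is
  the space of odd cocycles modulo the coboundaries of even equivariant maps \<open>L \<rightarrow> N\<close>.  A map on the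
  highest weight space \<open>T\<close> that is compatible with the diagonal elements extends to \<open>L\<close> (generate a
  submodule by its graph), so a cocycle is a coboundary once this holds on \<open>T\<close> for the diagonal odd
  elements \<open>b\<close>, \<open>\<Sum> b\<^sub>i = 0\<close>.  These act on \<open>T\<close> as a Clifford algebra for the form \<open>\<Sum> \<nu>\<^sub>i b\<^sub>i c\<^sub>i\<close>.
  Anisotropic directions of an orthogonal basis are split off one at a time; only the radical
  remains.  If some \<open>\<nu>\<^sub>i\<close> vanish, the cocycle vanishes on it.  Otherwise the radical is nonzero
  exactly if \<open>\<Sum> 1 / \<nu>\<^sub>i = 0\<close>, and it is then spanned by \<open>(1 / \<nu>\<^sub>i)\<^sub>i\<close>.  The value of a cocycle there
  anticommutes with the Clifford algebra; this determines it up to a scalar for \<open>N = \<Pi> L\<close>, where a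
  nonsplit cocycle is given by the even action twisted by the parity, and makes it zero for \<open>N = L\<close> and
  even \<open>n\<close>.  For odd \<open>n\<close> the product of the generators of the Clifford algebra of \<open>q(n)\<close> yields
  \<open>L(\<lambda>) \<cong> \<Pi> L(\<lambda>)\<close>.\<close>

section \<open>Triangular decomposition of matrices\<close>

text \<open>The reciprocals come from the hyperplane of traceless diagonals: a vector u orthogonal
  to it for the form has \<open>\<nu>\<^sub>i u\<^sub>i\<close> constant, so for nonzero
  \<open>\<nu>\<^sub>i\<close> it is a multiple of the reciprocals, and these lie in the hyperplane
  exactly if they sum to zero. The radical acts by zero on the highest weight space, so no
  correction by a map on that space can change the value of a cocycle there; this value is the whole
  obstruction. Semisimplicity over the even part matters twice. It lets cocycles be normalised to
  vanish on even elements; conversely a cocycle defines a class only if its extension module lies in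
  the category. Since the centre of \<open>gl(n)\<close> may act by Jordan blocks, complete
  reducibility is proved for modules spanned by weight vectors, a property that normalised cocycles
  preserve. Highest weight spaces are usually not one-dimensional, so arguments on them use
  simplicity under the diagonal elements instead of a generator. Parity is carried by a sign
  operator, which treats \<open>L\<close> and \<open>\<Pi> L\<close> together through one
  sign.\<close>

definition munit :: "nat \<Rightarrow> nat \<Rightarrow> nat \<Rightarrow> complex mat" where
  "munit n i j = mat n n (\<lambda>(r, s). if r = i \<and> s = j then 1 else 0)"

definition dg :: "nat \<Rightarrow> (nat \<Rightarrow> complex) \<Rightarrow> complex mat" where
  "dg n b = mat n n (\<lambda>(r, s). if r = s then b r else 0)"

definition strictly_lower :: "nat \<Rightarrow> complex mat set" where
  "strictly_lower n = {A \<in> carrier_mat n n. \<forall>i < n. \<forall>j < n. i \<le> j \<longrightarrow> A $$ (i, j) = 0}"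

definition lower_part :: "nat \<Rightarrow> complex mat \<Rightarrow> complex mat" where
  "lower_part n A = mat n n (\<lambda>(i, j). if j < i then A $$ (i, j) else 0)"

definition upper_part :: "nat \<Rightarrow> complex mat \<Rightarrow> complex mat" where
  "upper_part n A = mat n n (\<lambda>(i, j). if i < j then A $$ (i, j) else 0)"

lemma munit_carrier [simp, intro]: "munit n i j \<in> carrier_mat n n"
  by (simp add: munit_def)

lemma dg_carrier [simp, intro]: "dg n b \<in> carrier_mat n n"
  by (simp add: dg_def)

lemma lower_part_carrier [simp, intro]: "lower_part n A \<in> carrier_mat n n"
  and upper_part_carrier [simp, intro]: "upper_part n A \<in> carrier_mat n n"
  by (simp_all add: lower_part_def upper_part_def)

lemma strictly_upper_carrier: "X \<in> strictly_upper n \<Longrightarrow> X \<in> carrier_mat n n"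
  by (simp add: strictly_upper_def)

lemma lower_part_strictly_lower: "lower_part n A \<in> strictly_lower n"
  by (simp add: strictly_lower_def lower_part_def)

lemma upper_part_strictly_upper: "upper_part n A \<in> strictly_upper n"
  by (simp add: strictly_upper_def upper_part_def)

lemma triangular_decomposition:
  assumes "A \<in> carrier_mat n n"
  shows "A = lower_part n A + dg n (\<lambda>i. A $$ (i, i)) + upper_part n A"
  using assms by (intro eq_matI) (auto simp: lower_part_def dg_def upper_part_def)

lemma mult_mat_index:
  assumes "A \<in> carrier_mat n n" "B \<in> carrier_mat n n" "i < n" "j < n"
  shows "(A * B) $$ (i, j) = (\<Sum>k<n. A $$ (i, k) * B $$ (k, j))"
  using assms by (auto simp: scalar_prod_def atLeast0LessThan intro!: sum.cong)

text \<open>Only units at nonzero entries of \<open>A\<close> enter the step, so a zero pattern of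
  \<open>A\<close> (triangular, diagonal) can be exploited.\<close>

lemma mat_unit_induct:
  assumes A: "A \<in> carrier_mat n n" and zero: "P (0\<^sub>m n n)"
    and step: "\<And>X c i j. X \<in> carrier_mat n n \<Longrightarrow> P X \<Longrightarrow> i < n \<Longrightarrow> j < n \<Longrightarrow> A $$ (i, j) \<noteq> 0 \<Longrightarrow>
      P (c \<cdot>\<^sub>m munit n i j + X)"
  shows "P A"
proof -
  have *: "P (mat n n (\<lambda>p. if p \<in> F then A $$ p else 0))" if "finite F" "F \<subseteq> {..<n} \<times> {..<n}" for F
    using that
  proof (induction F rule: finite_induct)
    case empty
    have "mat n n (\<lambda>p. if p \<in> {} then A $$ p else 0) = 0\<^sub>m n n" by (intro eq_matI) auto
    then show ?case using zero by simp
  next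
    case (insert p F)
    obtain i j where p: "p = (i, j)" "i < n" "j < n" using insert.prems by (cases p) auto
    let ?X = "mat n n (\<lambda>p. if p \<in> F then A $$ p else 0)"
    have X: "P ?X" using insert by auto
    have eq: "mat n n (\<lambda>q. if q \<in> insert p F then A $$ q else 0) = A $$ (i, j) \<cdot>\<^sub>m munit n i j + ?X"
      using insert.hyps p by (intro eq_matI) (auto simp: munit_def)
    show ?case
    proof (cases "A $$ (i, j) = 0")
      case True
      have "mat n n (\<lambda>q. if q \<in> insert p F then A $$ q else 0) = ?X"
        using True p by (intro eq_matI) auto
      then show ?thesis using X by simp
    next
      case False
      then show ?thesis unfolding eq using step[of ?X i j] X p by simp
    qed
  qed
  have "mat n n (\<lambda>p. if p \<in> {..<n} \<times> {..<n} then A $$ p else 0) = A"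
    using A by (intro eq_matI) auto
  then show ?thesis using *[of "{..<n} \<times> {..<n}"] by simp
qed

lemma dg_mult_left:
  assumes "A \<in> carrier_mat n n"
  shows "dg n b * A = mat n n (\<lambda>(i, j). b i * A $$ (i, j))"
proof (rule eq_matI)
  fix i j assume "i < dim_row (mat n n (\<lambda>(i, j). b i * A $$ (i, j)))"
    and "j < dim_col (mat n n (\<lambda>(i, j). b i * A $$ (i, j)))"
  then have ij: "i < n" "j < n" by auto
  have "(dg n b * A) $$ (i, j) = (\<Sum>k<n. dg n b $$ (i, k) * A $$ (k, j))"
    using mult_mat_index[of "dg n b" n A i j] assms ij by simp
  also have "\<dots> = (\<Sum>k<n. if k = i then b i * A $$ (i, j) else 0)"
    using ij by (intro sum.cong) (auto simp: dg_def)
  finally show "(dg n b * A) $$ (i, j) = mat n n (\<lambda>(i, j). b i * A $$ (i, j)) $$ (i, j)"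
    using ij by simp
qed (use assms in \<open>auto simp: dg_def\<close>)

lemma dg_mult_right:
  assumes "A \<in> carrier_mat n n"
  shows "A * dg n b = mat n n (\<lambda>(i, j). A $$ (i, j) * b j)"
proof (rule eq_matI)
  fix i j assume "i < dim_row (mat n n (\<lambda>(i, j). A $$ (i, j) * b j))"
    and "j < dim_col (mat n n (\<lambda>(i, j). A $$ (i, j) * b j))"
  then have ij: "i < n" "j < n" by auto
  have "(A * dg n b) $$ (i, j) = (\<Sum>k<n. A $$ (i, k) * dg n b $$ (k, j))"
    using mult_mat_index[of A n "dg n b" i j] assms ij by simp
  also have "\<dots> = (\<Sum>k<n. if k = j then A $$ (i, j) * b j else 0)"
    using ij by (intro sum.cong) (auto simp: dg_def)
  finally show "(A * dg n b) $$ (i, j) = mat n n (\<lambda>(i, j). A $$ (i, j) * b j) $$ (i, j)"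
    using ij by simp
qed (use assms in \<open>auto simp: dg_def\<close>)

lemma munit_mult:
  assumes "i < n" "j < n" "k < n" "l < n"
  shows "munit n i j * munit n k l = (if j = k then munit n i l else 0\<^sub>m n n)"
proof (rule eq_matI)
  fix r s assume "r < dim_row (if j = k then munit n i l else 0\<^sub>m n n)"
    and "s < dim_col (if j = k then munit n i l else 0\<^sub>m n n)"
  then have rs: "r < n" "s < n" by (auto simp: munit_def split: if_splits)
  have "(munit n i j * munit n k l) $$ (r, s) = (\<Sum>t<n. munit n i j $$ (r, t) * munit n k l $$ (t, s))"
    using mult_mat_index[of "munit n i j" n "munit n k l" r s] rs by simp
  also have "\<dots> = (\<Sum>t<n. if t = j then (if r = i \<and> s = l \<and> j = k then 1 else 0) else 0)"
    using rs by (intro sum.cong) (auto simp: munit_def)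
  finally show "(munit n i j * munit n k l) $$ (r, s) = (if j = k then munit n i l else 0\<^sub>m n n) $$ (r, s)"
    using rs assms by (auto simp: munit_def)
qed (auto simp: munit_def)

lemma dg_mult_dg: "dg n b * dg n c = dg n (\<lambda>i. b i * c i)"
  unfolding dg_mult_left[OF dg_carrier] by (intro eq_matI) (auto simp: dg_def)

lemma dg_add: "dg n b + dg n c = dg n (\<lambda>i. b i + c i)"
  by (intro eq_matI) (auto simp: dg_def)

lemma dg_smult: "a \<cdot>\<^sub>m dg n c = dg n (\<lambda>i. a * c i)"
  by (intro eq_matI) (auto simp: dg_def)

lemma supercomm_carrier:
  assumes "X \<in> carrier_mat n n" "Y \<in> carrier_mat n n"
  shows "supercomm a b X Y \<in> carrier_mat n n"
  using assms by (auto simp: supercomm_def intro!: add_carrier_mat minus_carrier_mat mult_carrier_mat)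

lemma supercomm_strictly_upper_dg:
  assumes "X \<in> strictly_upper n"
  shows "supercomm a b X (dg n c) \<in> strictly_upper n"
  using assms unfolding supercomm_def
  by (auto simp: strictly_upper_def dg_mult_left dg_mult_right)

lemma supercomm_dg_munit:
  assumes "i < n" "j < n"
  shows "supercomm False a (dg n b) (munit n i j) = (b i - b j) \<cdot>\<^sub>m munit n i j"
  unfolding supercomm_def dg_mult_left[OF munit_carrier] dg_mult_right[OF munit_carrier]
  by (intro eq_matI) (auto simp: munit_def left_diff_distrib)

lemma munit_diag_eq_dg: "munit n i i = dg n (\<lambda>j. if j = i then 1 else 0)"
  by (intro eq_matI) (auto simp: munit_def dg_def)

section \<open>Triangular representations\<close>

definition homog_part :: "nat \<Rightarrow> complex mat set \<Rightarrow> bool \<Rightarrow> complex mat set" where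
  "homog_part n Od a = (if a then Od else carrier_mat n n)"

text \<open>A pair \<open>a, X\<close> stands for the matrix \<open>q_mat X 0\<close> or \<open>q_mat 0 X\<close>.  The set \<open>Od\<close> of odd parts is
  \<open>{0}\<close> for \<open>gl(n)\<close>, the traceless matrices for \<open>sq(n)\<close>, everything for \<open>q(n)\<close>.\<close>

locale tri_rep = vector_space scale
  for scale :: "complex \<Rightarrow> 'v::ab_group_add \<Rightarrow> 'v" (infixr "*s" 75) +
  fixes n :: nat and Od :: "complex mat set" and R :: "bool \<Rightarrow> complex mat \<Rightarrow> 'v \<Rightarrow> 'v"
  assumes Od_carrier: "Od \<subseteq> carrier_mat n n"
    and Od_low: "\<And>X. X \<in> Od \<Longrightarrow> lower_part n X \<in> Od"
    and Od_dg: "\<And>X. X \<in> Od \<Longrightarrow> dg n (\<lambda>i. X $$ (i, i)) \<in> Od"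
    and Od_up: "\<And>X. X \<in> Od \<Longrightarrow> upper_part n X \<in> Od"
    and Od_unit: "\<And>X i j. X \<in> Od \<Longrightarrow> i < n \<Longrightarrow> j < n \<Longrightarrow> i \<noteq> j \<Longrightarrow> X $$ (i, j) \<noteq> 0 \<Longrightarrow>
      munit n i j \<in> Od"
    and part_add: "\<And>a X Y. X \<in> homog_part n Od a \<Longrightarrow> Y \<in> homog_part n Od a \<Longrightarrow> X + Y \<in> homog_part n Od a"
    and part_smult: "\<And>a c X. X \<in> homog_part n Od a \<Longrightarrow> c \<cdot>\<^sub>m X \<in> homog_part n Od a"
    and part_br: "\<And>a b X Y. X \<in> homog_part n Od a \<Longrightarrow> Y \<in> homog_part n Od b \<Longrightarrow>
       supercomm a b X Y \<in> homog_part n Od (a \<noteq> b)"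
    and R_add: "\<And>a X v w. X \<in> homog_part n Od a \<Longrightarrow> R a X (v + w) = R a X v + R a X w"
    and R_scale: "\<And>a X c v. X \<in> homog_part n Od a \<Longrightarrow> R a X (c *s v) = c *s R a X v"
    and R_plus: "\<And>a X Y v. X \<in> homog_part n Od a \<Longrightarrow> Y \<in> homog_part n Od a \<Longrightarrow>
       R a (X + Y) v = R a X v + R a Y v"
    and R_smult: "\<And>a c X v. X \<in> homog_part n Od a \<Longrightarrow> R a (c \<cdot>\<^sub>m X) v = c *s R a X v"
    and R_br: "\<And>a b X Y v. X \<in> homog_part n Od a \<Longrightarrow> Y \<in> homog_part n Od b \<Longrightarrow>
       R (a \<noteq> b) (supercomm a b X Y) v =
         (if a \<and> b then R a X (R b Y v) + R b Y (R a X v) else R a X (R b Y v) - R b Y (R a X v))"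
begin

abbreviation G :: "bool \<Rightarrow> complex mat set" where "G \<equiv> homog_part n Od"

lemma G_carrier: "X \<in> G a \<Longrightarrow> X \<in> carrier_mat n n"
  using Od_carrier by (auto simp: homog_part_def split: if_splits)

lemma G_False [simp]: "G False = carrier_mat n n" and G_True [simp]: "G True = Od"
  by (simp_all add: homog_part_def)

lemma G_low: "X \<in> G a \<Longrightarrow> lower_part n X \<in> G a"
  and G_dg: "X \<in> G a \<Longrightarrow> dg n (\<lambda>i. X $$ (i, i)) \<in> G a"
  and G_up: "X \<in> G a \<Longrightarrow> upper_part n X \<in> G a"
  using Od_low Od_dg Od_up by (auto simp: homog_part_def)

lemma R_zero: "X \<in> G a \<Longrightarrow> R a X 0 = 0"
  using R_scale[of X a 0 0] by simp

lemma R_diff: "X \<in> G a \<Longrightarrow> R a X (v - w) = R a X v - R a X w"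
  using R_add[of X a "v - w" w] by (simp add: algebra_simps)

lemma R_uminus: "X \<in> G a \<Longrightarrow> R a X (- v) = - R a X v"
  using R_diff[of X a 0 v] by (simp add: R_zero)

lemma R_sum: "X \<in> G a \<Longrightarrow> R a X (\<Sum>i\<in>I. f i) = (\<Sum>i\<in>I. R a X (f i))"
  by (induction I rule: infinite_finite_induct) (auto simp: R_zero R_add)

lemma R_zero_mat: "0\<^sub>m n n \<in> G a \<Longrightarrow> R a (0\<^sub>m n n) v = 0"
  using R_smult[of "0\<^sub>m n n" a 0 v] by simp

lemma R_swap:
  assumes "X \<in> G a" "Y \<in> G b"
  shows "R a X (R b Y v) = R (a \<noteq> b) (supercomm a b X Y) v
    + (if a \<and> b then - 1 else 1) *s R b Y (R a X v)"
  using R_br[OF assms, of v] by (auto simp: algebra_simps)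

text \<open>Stands for \<open>U(n\<^sup>-) V0\<close> without an enveloping algebra: only lowering
  operators are applied. Stability under all of \<open>G\<close> is a theorem about suitable
  \<open>V0\<close>, not part of the closure.\<close>

inductive_set cl :: "'v set \<Rightarrow> 'v set" for V0 where
  base: "v \<in> V0 \<Longrightarrow> v \<in> cl V0"
| zero: "0 \<in> cl V0"
| add: "v \<in> cl V0 \<Longrightarrow> w \<in> cl V0 \<Longrightarrow> v + w \<in> cl V0"
| scale: "v \<in> cl V0 \<Longrightarrow> c *s v \<in> cl V0"
| low: "v \<in> cl V0 \<Longrightarrow> Y \<in> G a \<Longrightarrow> Y \<in> strictly_lower n \<Longrightarrow> R a Y v \<in> cl V0"

lemma cl_subspace: "subspace (cl V0)"
  by (auto simp: subspace_def intro: cl.intros)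

lemma cl_minimal:
  assumes "V0 \<subseteq> U" "subspace U"
    and "\<And>a Y v. Y \<in> G a \<Longrightarrow> Y \<in> strictly_lower n \<Longrightarrow> v \<in> U \<Longrightarrow> R a Y v \<in> U"
  shows "cl V0 \<subseteq> U"
proof
  fix w assume "w \<in> cl V0"
  then show "w \<in> U"
    by induction (use assms in \<open>auto simp: subspace_def\<close>)
qed

definition upkilled :: "'v \<Rightarrow> bool" where
  "upkilled v \<longleftrightarrow> (\<forall>a X. X \<in> G a \<longrightarrow> X \<in> strictly_upper n \<longrightarrow> R a X v = 0)"

lemma upkilledD: "upkilled v \<Longrightarrow> X \<in> G a \<Longrightarrow> X \<in> strictly_upper n \<Longrightarrow> R a X v = 0"
  by (auto simp: upkilled_def)

lemma upkilled_zero: "upkilled 0"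
  and upkilled_add: "upkilled v \<Longrightarrow> upkilled w \<Longrightarrow> upkilled (v + w)"
  and upkilled_scale: "upkilled v \<Longrightarrow> upkilled (c *s v)"
  by (auto simp: upkilled_def R_zero R_add R_scale)

text \<open>Diagonal elements normalise the strictly upper triangular ones, so the commutator that
  arises from moving past a diagonal element still kills the vector.\<close>

lemma upkilled_dg:
  assumes "upkilled v" "dg n c \<in> G b"
  shows "upkilled (R b (dg n c) v)"
  unfolding upkilled_def
proof (intro allI impI)
  fix a X assume X: "X \<in> G a" "X \<in> strictly_upper n"
  have "supercomm a b X (dg n c) \<in> strictly_upper n"
    by (rule supercomm_strictly_upper_dg[OF X(2)])
  then have "R (a \<noteq> b) (supercomm a b X (dg n c)) v = 0"
    using upkilledD[OF assms(1) part_br[OF X(1) assms(2)]] by simp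
  then show "R a X (R b (dg n c) v) = 0"
    using upkilledD[OF assms(1) X] by (simp add: R_swap[OF X(1) assms(2)] R_zero[OF assms(2)])
qed

text \<open>Straightening: an element is moved to the right past the lowering operators until it
  meets \<open>V0\<close>, where its triangular parts lower, preserve or kill. The element is
  universally quantified in the induction, because a commutator with a lowering operator need not
  stay in the triangular part it came from.\<close>

lemma cl_stable:
  assumes V0: "subspace V0" and up: "\<And>v. v \<in> V0 \<Longrightarrow> upkilled v"
    and diag: "\<And>a b v. dg n b \<in> G a \<Longrightarrow> v \<in> V0 \<Longrightarrow> R a (dg n b) v \<in> V0"
    and w: "w \<in> cl V0" and X: "X \<in> G a"
  shows "R a X w \<in> cl V0"
  using w X
proof (induction arbitrary: a X)
  case (base v)
  have X: "X \<in> G a" by fact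
  have "R a X v = R a (lower_part n X + dg n (\<lambda>i. X $$ (i, i)) + upper_part n X) v"
    using triangular_decomposition[OF G_carrier[OF X]] by simp
  also have "\<dots> = R a (lower_part n X) v + R a (dg n (\<lambda>i. X $$ (i, i))) v + R a (upper_part n X) v"
    using R_plus part_add G_low[OF X] G_dg[OF X] G_up[OF X] by simp
  also have "R a (upper_part n X) v = 0"
    using upkilledD[OF up[OF base(1)] G_up[OF X] upper_part_strictly_upper] .
  finally show ?case
    using cl.low[OF cl.base[OF base(1)] G_low[OF X] lower_part_strictly_lower]
      diag[OF G_dg[OF X] base(1)] by (auto intro: cl.intros)
next
  case zero
  then show ?case by (simp add: R_zero cl.zero)
next
  case (add v w)
  then show ?case by (simp add: R_add cl.add)
next
  case (scale v c)
  then show ?case by (simp add: R_scale cl.scale)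
next
  case (low v Y b)
  have "R (a \<noteq> b) (supercomm a b X Y) v \<in> cl V0"
    using low.IH part_br[OF low.prems low.hyps(2)] by blast
  moreover have "R b Y (R a X v) \<in> cl V0"
    using cl.low[OF low.IH[OF low.prems] low.hyps(2,3)] .
  ultimately show ?case
    unfolding R_swap[OF low.prems low.hyps(2)] by (intro cl.add cl.scale)
qed

end

section \<open>Weights\<close>

text \<open>Adds the root \<open>e_i - e_j\<close>, the weight of
  \<open>munit n i j\<close>.\<close>

definition wshift :: "(nat \<Rightarrow> complex) \<Rightarrow> nat \<Rightarrow> nat \<Rightarrow> nat \<Rightarrow> complex" where
  "wshift \<mu> i j k = \<mu> k + (if k = i then 1 else 0) - (if k = j then 1 else 0)"

text \<open>The partial sums are the coefficients of \<open>\<nu> - \<mu>\<close> in the basis of simple roots.\<close>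

definition wle :: "nat \<Rightarrow> (nat \<Rightarrow> complex) \<Rightarrow> (nat \<Rightarrow> complex) \<Rightarrow> bool" where
  "wle n \<mu> \<nu> \<longleftrightarrow> (\<forall>i<n. (\<Sum>j\<le>i. \<nu> j - \<mu> j) \<in> \<nat>) \<and> (\<Sum>j<n. \<nu> j - \<mu> j) = 0"

text \<open>A height function: the eigenvalue of the diagonal element
  \<open>(n, n - 1, ..., 1)\<close>, which every positive root raises by a positive integer.\<close>

definition wdeg :: "nat \<Rightarrow> (nat \<Rightarrow> complex) \<Rightarrow> complex" where
  "wdeg n \<mu> = (\<Sum>i<n. (of_nat n - of_nat i) * \<mu> i)"

text \<open>The value \<open>(\<mu>, \<mu> + 2\<rho>)\<close> of the Casimir operator on a singular
  vector, in the shape in which the double sum over matrix units produces it.\<close>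

definition casimir_value :: "nat \<Rightarrow> (nat \<Rightarrow> complex) \<Rightarrow> complex" where
  "casimir_value n \<mu> = (\<Sum>i<n. \<Sum>j<n. if i < j then \<mu> i - \<mu> j else if i = j then \<mu> i * \<mu> i else 0)"

definition wdom :: "nat \<Rightarrow> (nat \<Rightarrow> complex) \<Rightarrow> bool" where
  "wdom n \<mu> \<longleftrightarrow> (\<forall>i. Suc i < n \<longrightarrow> \<mu> i - \<mu> (Suc i) \<in> \<nat>)"

lemma wle_refl: "wle n \<mu> \<mu>"
  by (simp add: wle_def)

lemma wdeg_wshift:
  assumes "i < n" "j < n"
  shows "wdeg n (wshift \<mu> i j) = wdeg n \<mu> + of_nat j - of_nat i"
proof -
  have "wdeg n (wshift \<mu> i j) = wdeg n \<mu> + (\<Sum>k<n. if k = i then of_nat n - of_nat k else 0)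
      - (\<Sum>k<n. if k = j then of_nat n - of_nat k else 0)"
    unfolding wdeg_def sum.distrib[symmetric] sum_subtractf[symmetric]
    by (intro sum.cong) (auto simp: wshift_def algebra_simps)
  then show ?thesis using assms by simp
qed

lemma wle_wshift:
  assumes "wle n \<mu> \<nu>" "j < i" "i < n"
  shows "wle n (wshift \<mu> i j) \<nu>"
  unfolding wle_def
proof (intro conjI allI impI)
  have *: "(\<Sum>k\<in>K. \<nu> k - wshift \<mu> i j k) = (\<Sum>k\<in>K. \<nu> k - \<mu> k)
      - (\<Sum>k\<in>K. if k = i then 1 else 0) + (\<Sum>k\<in>K. if k = j then 1 else 0)" for K
    unfolding sum.distrib[symmetric] sum_subtractf[symmetric]
    by (intro sum.cong) (auto simp: wshift_def)
  show "(\<Sum>k<n. \<nu> k - wshift \<mu> i j k) = 0"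
    unfolding * using assms by (simp add: wle_def)
  fix l assume "l < n"
  have N: "(\<Sum>k\<le>l. \<nu> k - \<mu> k) \<in> \<nat>" using assms(1) \<open>l < n\<close> by (simp add: wle_def)
  show "(\<Sum>k\<le>l. \<nu> k - wshift \<mu> i j k) \<in> \<nat>"
    unfolding * using assms(2) N by auto
qed

text \<open>With \<open>x = \<nu> - \<mu>\<close> the partial sums are coefficients of simple roots
  and the differences of \<open>g\<close> are pairings with simple coroots; in the application both
  are nonnegative integers.\<close>

lemma summation_by_parts:
  "(\<Sum>i\<le>N. x i * g i) = (\<Sum>j\<le>N. x j) * g N + (\<Sum>i<N. (\<Sum>j\<le>i. x j) * (g i - g (Suc i) :: complex))"
  by (induction N) (simp_all add: algebra_simps)

lemma wle_eqI:
  assumes "wle n \<mu> \<nu>" and zero: "\<And>i. i < n \<Longrightarrow> (\<Sum>j\<le>i. \<nu> j - \<mu> j) = 0"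
    and "\<forall>i\<ge>n. \<mu> i = 0" "\<forall>i\<ge>n. \<nu> i = 0"
  shows "\<mu> = \<nu>"
proof
  fix i show "\<mu> i = \<nu> i"
  proof (cases "i < n")
    case True
    show ?thesis
    proof (cases i)
      case 0 then show ?thesis using zero[of 0] True by simp
    next
      case (Suc k) then show ?thesis using zero[of i] zero[of k] True by simp
    qed
  qed (use assms(3,4) in auto)
qed

lemma wle_partial_sums_nat:
  assumes "wle n \<mu> \<nu>"
  obtains K where "\<And>i. i < n \<Longrightarrow> (\<Sum>j\<le>i. \<nu> j - \<mu> j) = of_nat (K i)"
proof -
  have "\<forall>i. \<exists>k. i < n \<longrightarrow> (\<Sum>j\<le>i. \<nu> j - \<mu> j) = of_nat k"
    using assms by (auto simp: wle_def Nats_def)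
  then show ?thesis using that by metis
qed

lemma wle_antisym:
  assumes "wle n \<mu> \<nu>" "wle n \<nu> \<mu>" "\<forall>i\<ge>n. \<mu> i = 0" "\<forall>i\<ge>n. \<nu> i = 0"
  shows "\<mu> = \<nu>"
proof (rule wle_eqI[OF assms(1) _ assms(3,4)])
  fix i assume i: "i < n"
  obtain K where K: "\<And>i. i < n \<Longrightarrow> (\<Sum>j\<le>i. \<nu> j - \<mu> j) = of_nat (K i)"
    using wle_partial_sums_nat[OF assms(1)] by blast
  obtain K' where K': "\<And>i. i < n \<Longrightarrow> (\<Sum>j\<le>i. \<mu> j - \<nu> j) = of_nat (K' i)"
    using wle_partial_sums_nat[OF assms(2)] by blast
  have "of_nat (K i + K' i) = (\<Sum>j\<le>i. \<nu> j - \<mu> j) + (\<Sum>j\<le>i. \<mu> j - \<nu> j)"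
    using K[OF i] K'[OF i] by simp
  also have "\<dots> = 0" by (simp add: sum.distrib[symmetric])
  finally have "K i = 0" by (metis add_is_0 of_nat_eq_0_iff)
  then show "(\<Sum>j\<le>i. \<nu> j - \<mu> j) = 0" using K[OF i] by simp
qed

text \<open>Here \<open>2\<rho>\<close> has the coordinates \<open>n - 1 - 2 * i\<close>, indices
  starting at 0.\<close>

lemma casimir_value_alt:
  "casimir_value n \<mu> = (\<Sum>i<n. \<mu> i * (\<mu> i + of_nat n - 1 - 2 * of_nat i))"
proof (induction n)
  case 0 then show ?case by (simp add: casimir_value_def)
next
  case (Suc n)
  have "casimir_value (Suc n) \<mu> = casimir_value n \<mu> + (\<Sum>i<n. \<mu> i - \<mu> n) + \<mu> n * \<mu> n"
    unfolding casimir_value_def by (simp add: sum.distrib)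
  also have "\<dots> = (\<Sum>i<n. \<mu> i * (\<mu> i + of_nat n - 1 - 2 * of_nat i) + \<mu> i) + \<mu> n * \<mu> n - of_nat n * \<mu> n"
    unfolding Suc by (simp add: sum.distrib sum_subtractf)
  also have "(\<Sum>i<n. \<mu> i * (\<mu> i + of_nat n - 1 - 2 * of_nat i) + \<mu> i)
      = (\<Sum>i<n. \<mu> i * (\<mu> i + of_nat (Suc n) - 1 - 2 * of_nat i))"
    by (intro sum.cong) (auto simp: algebra_simps)
  finally show ?case by (simp add: algebra_simps)
qed

text \<open>\<open>(\<nu> - \<mu>, \<nu> + \<mu> + 2\<rho>) > 0\<close> if \<open>\<mu> < \<nu>\<close> are dominant.\<close>

lemma casimir_value_inj:
  assumes "wle n \<mu> \<nu>" "wdom n \<mu>" "wdom n \<nu>" "casimir_value n \<mu> = casimir_value n \<nu>"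
    and "\<forall>i\<ge>n. \<mu> i = 0" "\<forall>i\<ge>n. \<nu> i = 0"
  shows "\<mu> = \<nu>"
proof (cases n)
  case 0 then show ?thesis using assms(5,6) by auto
next
  case (Suc N)
  obtain K where K: "\<And>i. i < n \<Longrightarrow> (\<Sum>j\<le>i. \<nu> j - \<mu> j) = of_nat (K i)"
    using wle_partial_sums_nat[OF assms(1)] by blast
  have last: "(\<Sum>j\<le>N. \<nu> j - \<mu> j) = 0"
    using assms(1) by (simp add: wle_def Suc lessThan_Suc_atMost)
  have "\<forall>i. \<exists>k. i < N \<longrightarrow> \<mu> i - \<mu> (Suc i) + (\<nu> i - \<nu> (Suc i)) = of_nat k"
    using assms(2,3) Suc unfolding wdom_def Nats_def by (metis Nats_add Nats_cases Nats_def Suc_mono)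
  then obtain J where J: "\<And>i. i < N \<Longrightarrow> \<mu> i - \<mu> (Suc i) + (\<nu> i - \<nu> (Suc i)) = of_nat (J i)"
    by metis
  \<comment> \<open>This is \<open>\<nu> + \<mu> + 2\<rho>\<close>. Its difference along a simple
    root is \<open>J i + 2\<close>, where 2 is the contribution of \<open>2\<rho>\<close>; being
    positive, it forces every \<open>K i\<close> with \<open>i < N\<close> to vanish.\<close>
  define g where "g i = \<nu> i + \<mu> i + of_nat n - 1 - 2 * of_nat i" for i
  have "0 = casimir_value n \<nu> - casimir_value n \<mu>" using assms(4) by simp
  also have "\<dots> = (\<Sum>i\<le>N. (\<nu> i - \<mu> i) * g i)"
    unfolding casimir_value_alt sum_subtractf[symmetric] Suc lessThan_Suc_atMost
    by (intro sum.cong) (auto simp: g_def Suc algebra_simps)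
  also have "\<dots> = (\<Sum>i<N. (\<Sum>j\<le>i. \<nu> j - \<mu> j) * (g i - g (Suc i)))"
    unfolding summation_by_parts last by simp
  also have "\<dots> = (\<Sum>i<N. of_nat (K i * (J i + 2)))"
  proof (intro sum.cong refl)
    fix i assume i: "i \<in> {..<N}"
    have "g i - g (Suc i) = of_nat (J i + 2)" using J[of i] i by (simp add: g_def algebra_simps)
    then show "(\<Sum>j\<le>i. \<nu> j - \<mu> j) * (g i - g (Suc i)) = of_nat (K i * (J i + 2))"
      using K[of i] i Suc by (simp add: algebra_simps)
  qed
  also have "\<dots> = of_nat (\<Sum>i<N. K i * (J i + 2))" by (simp only: of_nat_sum)
  finally have "(\<Sum>i<N. K i * (J i + 2)) = 0" by (metis of_nat_eq_0_iff)
  then have "K i = 0" if "i < N" for i using that by auto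
  then show ?thesis using K last Suc
    by (intro wle_eqI[OF assms(1) _ assms(5,6)]) (metis less_Suc_eq of_nat_0)
qed

section \<open>Weight vectors and the weights of generated submodules\<close>

context tri_rep
begin

text \<open>The support condition makes a weight a single function on \<open>nat\<close>, so that
  weights can be compared by plain equality.\<close>

definition wt :: "(nat \<Rightarrow> complex) \<Rightarrow> 'v \<Rightarrow> bool" where
  "wt \<mu> w \<longleftrightarrow> (\<forall>i\<ge>n. \<mu> i = 0) \<and> (\<forall>i<n. R False (munit n i i) w = \<mu> i *s w)"

lemma wt_zero: "\<forall>i\<ge>n. \<mu> i = 0 \<Longrightarrow> wt \<mu> 0"
  and wt_add: "wt \<mu> v \<Longrightarrow> wt \<mu> w \<Longrightarrow> wt \<mu> (v + w)"
  and wt_scale: "wt \<mu> v \<Longrightarrow> wt \<mu> (c *s v)"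
  by (auto simp: wt_def R_zero R_add R_scale scale_right_distrib scale_left_commute)

lemma wt_supp: "wt \<mu> w \<Longrightarrow> \<forall>i\<ge>n. \<mu> i = 0"
  by (simp add: wt_def)

lemma wt_dg:
  assumes "wt \<mu> w"
  shows "R False (dg n b) w = (\<Sum>i<n. b i * \<mu> i) *s w"
proof -
  have "R False (dg n b) w = (\<Sum>i<n. dg n b $$ (i, i) * \<mu> i) *s w"
  proof (rule mat_unit_induct[OF dg_carrier[of n b]])
    show "R False (0\<^sub>m n n) w = (\<Sum>i<n. 0\<^sub>m n n $$ (i, i) * \<mu> i) *s w"
      by (simp add: R_zero_mat)
    fix X c i j
    assume X: "X \<in> carrier_mat n n" and IH: "R False X w = (\<Sum>i<n. X $$ (i, i) * \<mu> i) *s w"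
      and ij: "i < n" "j < n" "dg n b $$ (i, j) \<noteq> 0"
    then have [simp]: "j = i" by (auto simp: dg_def split: if_splits)
    have "R False (c \<cdot>\<^sub>m munit n i j + X) w = (c * \<mu> i) *s w + R False X w"
      using X assms ij by (subst R_plus) (auto simp: R_smult wt_def)
    also have "\<dots> = ((\<Sum>k<n. if k = i then c * \<mu> k else 0) + (\<Sum>i<n. X $$ (i, i) * \<mu> i)) *s w"
      using ij unfolding IH by (simp add: scale_left_distrib)
    also have "(\<Sum>k<n. if k = i then c * \<mu> k else 0) + (\<Sum>i<n. X $$ (i, i) * \<mu> i)
        = (\<Sum>k<n. (c \<cdot>\<^sub>m munit n i j + X) $$ (k, k) * \<mu> k)"
      unfolding sum.distrib[symmetric] using X
      by (intro sum.cong) (auto simp: munit_def algebra_simps)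
    finally show "R False (c \<cdot>\<^sub>m munit n i j + X) w
      = (\<Sum>k<n. (c \<cdot>\<^sub>m munit n i j + X) $$ (k, k) * \<mu> k) *s w" .
  qed
  also have "(\<Sum>i<n. dg n b $$ (i, i) * \<mu> i) = (\<Sum>i<n. b i * \<mu> i)"
    by (intro sum.cong) (auto simp: dg_def)
  finally show ?thesis .
qed

lemma wtI_dg: "\<forall>i\<ge>n. \<mu> i = 0 \<Longrightarrow> (\<And>b. R False (dg n b) w = (\<Sum>i<n. b i * \<mu> i) *s w) \<Longrightarrow> wt \<mu> w"
  unfolding wt_def munit_diag_eq_dg
  by (auto simp: if_distrib[of "\<lambda>x. x * _"] sum.delta cong: if_cong)

text \<open>Reduces an action to matrix units in the support of \<open>X\<close>. The units need not
  lie in \<open>G a\<close> (for traceless matrices the diagonal ones do not), hence membership is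
  part of the step.\<close>

lemma R_unit_induct:
  assumes "X \<in> G a" "subspace U"
    and step: "\<And>i j. i < n \<Longrightarrow> j < n \<Longrightarrow> X $$ (i, j) \<noteq> 0 \<Longrightarrow> munit n i j \<in> G a \<and> R a (munit n i j) v \<in> U"
  shows "R a X v \<in> U"
proof -
  have "0 \<cdot>\<^sub>m X = 0\<^sub>m n n" using G_carrier[OF assms(1)] by (intro eq_matI) auto
  then have Z: "0\<^sub>m n n \<in> G a" using part_smult[OF assms(1), of 0] by simp
  have "X \<in> G a \<and> R a X v \<in> U"
  proof (rule mat_unit_induct[OF G_carrier[OF assms(1)]])
    show "0\<^sub>m n n \<in> G a \<and> R a (0\<^sub>m n n) v \<in> U"
      using Z assms(2) by (simp add: R_zero_mat subspace_0)
    fix Y c i j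
    assume Y: "Y \<in> G a \<and> R a Y v \<in> U" and ij: "i < n" "j < n" "X $$ (i, j) \<noteq> 0"
    have "munit n i j \<in> G a \<and> R a (munit n i j) v \<in> U" by (rule step[OF ij])
    then show "c \<cdot>\<^sub>m munit n i j + Y \<in> G a \<and> R a (c \<cdot>\<^sub>m munit n i j + Y) v \<in> U"
      using Y assms(2) by (simp add: R_plus R_smult part_add part_smult subspace_add subspace_scale del: G_True G_False)
  qed
  then show ?thesis ..
qed

lemma unit_in_G: "X \<in> G a \<Longrightarrow> i < n \<Longrightarrow> j < n \<Longrightarrow> i \<noteq> j \<Longrightarrow> X $$ (i, j) \<noteq> 0 \<Longrightarrow> munit n i j \<in> G a"
  using Od_unit by (cases a) auto

lemma wt_shift:
  assumes w: "wt \<mu> w" and ij: "i < n" "j < n" and G: "munit n i j \<in> G a"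
  shows "wt (wshift \<mu> i j) (R a (munit n i j) w)"
proof (rule wtI_dg)
  show "\<forall>k\<ge>n. wshift \<mu> i j k = 0" using wt_supp[OF w] ij by (auto simp: wshift_def)
  fix b
  have "R False (dg n b) (R a (munit n i j) w)
      = R a ((b i - b j) \<cdot>\<^sub>m munit n i j) w + R a (munit n i j) (R False (dg n b) w)"
    using R_swap[of "dg n b" False "munit n i j" a w] G
    by (simp add: supercomm_dg_munit[OF ij] del: G_True)
  also have "\<dots> = (b i - b j + (\<Sum>k<n. b k * \<mu> k)) *s R a (munit n i j) w"
    using G by (simp add: R_smult R_scale wt_dg[OF w] scale_left_distrib del: G_True)
  also have "b i - b j + (\<Sum>k<n. b k * \<mu> k) =
      (\<Sum>k<n. if k = i then b k else 0) - (\<Sum>k<n. if k = j then b k else 0) + (\<Sum>k<n. b k * \<mu> k)"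
    using ij by simp
  also have "\<dots> = (\<Sum>k<n. b k * wshift \<mu> i j k)"
    unfolding sum.distrib[symmetric] sum_subtractf[symmetric]
    by (intro sum.cong) (auto simp: wshift_def algebra_simps)
  finally show "R False (dg n b) (R a (munit n i j) w) = (\<Sum>k<n. b k * wshift \<mu> i j k) *s R a (munit n i j) w" .
qed

text \<open>One weight \<open>\<mu>1\<close> is eliminated by applying
  \<open>E_ii - \<mu>1 i\<close> at a coordinate where it differs from \<open>\<mu>\<close>. The
  component at \<open>\<mu>\<close> only picks up a nonzero factor, which is divided out at the
  end.\<close>

lemma weight_components_aux:
  assumes "finite F" "subspace U" and H: "\<And>i u. i < n \<Longrightarrow> u \<in> U \<Longrightarrow> R False (munit n i i) u \<in> U"
    and "\<And>\<mu>. \<mu> \<in> F \<Longrightarrow> wt \<mu> (x \<mu>)" "(\<Sum>\<mu>\<in>F. x \<mu>) \<in> U" "\<mu> \<in> F"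
  shows "x \<mu> \<in> U"
  using assms(1,4-6)
proof (induction F arbitrary: x \<mu> rule: finite_psubset_induct)
  case (psubset F)
  show ?case
  proof (cases "F = {\<mu>}")
    case True then show ?thesis using psubset.prems by simp
  next
    case False
    then obtain \<mu>1 where \<mu>1: "\<mu>1 \<in> F" "\<mu>1 \<noteq> \<mu>" using psubset.prems(3) by blast
    then obtain i where i: "\<mu> i \<noteq> \<mu>1 i" by (metis ext)
    have "i < n" using i wt_supp psubset.prems(1) \<mu>1(1) psubset.prems(3) by (metis not_less)
    have "R False (munit n i i) (\<Sum>\<kappa>\<in>F. x \<kappa>) = (\<Sum>\<kappa>\<in>F. \<kappa> i *s x \<kappa>)"
      using psubset.prems(1) \<open>i < n\<close> by (auto simp: R_sum wt_def intro!: sum.cong)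
    then have "R False (munit n i i) (\<Sum>\<kappa>\<in>F. x \<kappa>) - \<mu>1 i *s (\<Sum>\<kappa>\<in>F. x \<kappa>) = (\<Sum>\<kappa>\<in>F. (\<kappa> i - \<mu>1 i) *s x \<kappa>)"
      by (simp add: scale_sum_right sum_subtractf[symmetric] scale_left_diff_distrib)
    also have "\<dots> = (\<Sum>\<kappa>\<in>F - {\<mu>1}. (\<kappa> i - \<mu>1 i) *s x \<kappa>)"
      using psubset.hyps(1) \<mu>1(1) by (simp add: sum.remove)
    finally have s: "(\<Sum>\<kappa>\<in>F - {\<mu>1}. (\<kappa> i - \<mu>1 i) *s x \<kappa>) \<in> U"
      using H[OF \<open>i < n\<close>] psubset.prems(2) assms(2) by (metis subspace_diff subspace_scale)
    have "(\<mu> i - \<mu>1 i) *s x \<mu> \<in> U"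
    proof (rule psubset.IH[of "F - {\<mu>1}" "\<lambda>\<kappa>. (\<kappa> i - \<mu>1 i) *s x \<kappa>"])
      show "F - {\<mu>1} \<subset> F" using \<mu>1(1) by blast
      show "\<And>\<kappa>. \<kappa> \<in> F - {\<mu>1} \<Longrightarrow> wt \<kappa> ((\<kappa> i - \<mu>1 i) *s x \<kappa>)"
        using psubset.prems(1) by (auto intro: wt_scale)
      show "\<mu> \<in> F - {\<mu>1}" using psubset.prems(3) \<mu>1(2) by simp
    qed (rule s)
    then have "inverse (\<mu> i - \<mu>1 i) *s (\<mu> i - \<mu>1 i) *s x \<mu> \<in> U"
      by (rule subspace_scale[OF assms(2)])
    then show ?thesis using i by simp
  qed
qed

lemma span_family:
  assumes "w \<in> span {y. \<exists>\<mu>. P \<mu> \<and> y \<in> B \<mu>}" "\<And>\<mu>. P \<mu> \<Longrightarrow> subspace (B \<mu>)"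
  obtains F x where "finite F" "\<And>\<mu>. \<mu> \<in> F \<Longrightarrow> P \<mu> \<and> x \<mu> \<in> B \<mu>" "w = (\<Sum>\<mu>\<in>F. x \<mu>)"
proof -
  have "\<exists>F x. finite F \<and> (\<forall>\<mu>\<in>F. P \<mu> \<and> x \<mu> \<in> B \<mu>) \<and> w = (\<Sum>\<mu>\<in>F. x \<mu>)"
    using assms(1)
  proof (induction rule: span_induct_alt)
    case base
    show ?case by (rule exI[of _ "{}"]) simp
  next
    case (step c y z)
    then obtain F x where F: "finite F" "\<forall>\<mu>\<in>F. P \<mu> \<and> x \<mu> \<in> B \<mu>" "z = (\<Sum>\<mu>\<in>F. x \<mu>)" by blast
    from step(1) obtain \<mu> where \<mu>: "P \<mu>" "y \<in> B \<mu>" by blast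
    have cy: "c *s y \<in> B \<mu>" using assms(2)[OF \<mu>(1)] \<mu>(2) by (rule subspace_scale)
    show ?case
    proof (cases "\<mu> \<in> F")
      case True
      have "c *s y + x \<mu> \<in> B \<mu>" using assms(2)[OF \<mu>(1)] cy F(2) True by (blast intro: subspace_add)
      moreover have "(\<Sum>\<kappa>\<in>F. (x(\<mu> := c *s y + x \<mu>)) \<kappa>) = c *s y + z"
        using F(1,3) True by (simp add: sum.remove[of F \<mu>])
      ultimately show ?thesis using F \<mu>
        by (intro exI[of _ F] exI[of _ "x(\<mu> := c *s y + x \<mu>)"]) auto
    next
      case False
      have "(\<Sum>\<kappa>\<in>F. (x(\<mu> := c *s y)) \<kappa>) = (\<Sum>\<kappa>\<in>F. x \<kappa>)"
        by (intro sum.cong) (use False in auto)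
      then have "(\<Sum>\<kappa>\<in>insert \<mu> F. (x(\<mu> := c *s y)) \<kappa>) = c *s y + z"
        using F(1,3) False by (simp only: sum.insert) simp
      then show ?thesis using F \<mu> cy False
        by (intro exI[of _ "insert \<mu> F"] exI[of _ "x(\<mu> := c *s y)"]) auto
    qed
  qed
  then show ?thesis using that by blast
qed

lemma weight_component:
  assumes w: "w \<in> span {y. \<exists>\<mu>. P \<mu> \<and> y \<in> B \<mu>}" and B: "\<And>\<mu>. P \<mu> \<Longrightarrow> subspace (B \<mu>)"
    and wtB: "\<And>\<mu> y. P \<mu> \<Longrightarrow> y \<in> B \<mu> \<Longrightarrow> wt \<mu> y" and wt: "wt \<mu>1 w" and nz: "w \<noteq> 0"
  shows "P \<mu>1 \<and> w \<in> B \<mu>1"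
proof -
  obtain F x where F: "finite F" "\<And>\<mu>. \<mu> \<in> F \<Longrightarrow> P \<mu> \<and> x \<mu> \<in> B \<mu>" "w = (\<Sum>\<mu>\<in>F. x \<mu>)"
    using span_family[OF w B] by blast
  \<comment> \<open>\<open>w\<close> is subtracted at its own weight, so that the components add up
    to zero and the one at \<open>\<mu>1\<close> vanishes. If \<open>\<mu>1\<close> were not in
    \<open>F\<close>, that component would be \<open>- w\<close>, against
    \<open>w \<noteq> 0\<close>.\<close>
  let ?x = "\<lambda>\<mu>. (if \<mu> \<in> F then x \<mu> else 0) - (if \<mu> = \<mu>1 then w else 0)"
  have sum: "(\<Sum>\<mu>\<in>insert \<mu>1 F. ?x \<mu>) \<in> {0}"
  proof -
    have "(\<Sum>\<mu>\<in>insert \<mu>1 F. if \<mu> \<in> F then x \<mu> else 0) = (\<Sum>\<mu>\<in>F. x \<mu>)"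
      by (intro sum.mono_neutral_cong_right) (use F(1) in auto)
    moreover have "(\<Sum>\<mu>\<in>insert \<mu>1 F. if \<mu> = \<mu>1 then w else 0) = w"
      using F(1) by (simp add: sum.delta)
    ultimately show ?thesis using F(3) by (simp add: sum_subtractf)
  qed
  have "?x \<mu>1 \<in> {0}"
  proof (rule weight_components_aux[OF _ _ _ _ sum])
    fix \<mu> assume \<mu>: "\<mu> \<in> insert \<mu>1 F"
    have "wt \<mu> (if \<mu> \<in> F then x \<mu> else 0)"
      using F(2) wtB \<mu> wt by (auto intro!: wt_zero dest!: wt_supp)
    moreover have "wt \<mu> ((-1) *s (if \<mu> = \<mu>1 then w else 0))"
    proof -
      have "\<forall>i\<ge>n. \<mu> i = 0" using \<mu> wt_supp[OF wt] wt_supp[OF wtB] F(2) by blast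
      then show ?thesis using wt by (intro wt_scale) (auto intro: wt_zero)
    qed
    ultimately have "wt \<mu> ((if \<mu> \<in> F then x \<mu> else 0) + (- 1) *s (if \<mu> = \<mu>1 then w else 0))"
      by (rule wt_add)
    then show "wt \<mu> (?x \<mu>)" by (simp only: scale_minus_left scale_one add_uminus_conv_diff)
  qed (use F(1) in \<open>auto simp: R_zero\<close>)
  then have "\<mu>1 \<in> F" "x \<mu>1 = w" using nz by (auto split: if_splits)
  then show ?thesis using F(2) by blast
qed

text \<open>Lowering strictly decreases the weight, so a component of weight \<open>\<nu>\<close>
  cannot come from a lowering operator. The last clause of the family records this.\<close>

lemma cl_weights:
  assumes V0: "subspace V0" "\<And>v. v \<in> V0 \<Longrightarrow> wt \<nu> v"
  shows "cl V0 \<subseteq> span {y. \<exists>\<mu>. (wle n \<mu> \<nu> \<and> (\<forall>i\<ge>n. \<mu> i = 0)) \<and>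
    y \<in> {y. wt \<mu> y \<and> y \<in> cl V0 \<and> (\<mu> = \<nu> \<longrightarrow> y \<in> V0)}}"
    (is "_ \<subseteq> span ?S")
proof -
  have "cl V0 \<subseteq> span ?S \<inter> cl V0"
  proof (rule cl_minimal)
    show "V0 \<subseteq> span ?S \<inter> cl V0" using V0(2) wle_refl by (auto intro!: span_base cl.base dest: wt_supp)
    show "subspace (span ?S \<inter> cl V0)" by (intro subspace_inter subspace_span cl_subspace)
    fix a Y v assume Y: "Y \<in> G a" "Y \<in> strictly_lower n" and v: "v \<in> span ?S \<inter> cl V0"
    have "R a Y v \<in> span ?S"
      using IntD1[OF v]
    proof (induction rule: span_induct_alt)
      case base then show ?case using R_zero[OF Y(1)] by (simp add: span_zero)
    next
      case (step c y z)
      from step(1) obtain \<mu> where \<mu>: "wle n \<mu> \<nu>" "wt \<mu> y" "y \<in> cl V0" by blast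
      have "R a Y y \<in> span ?S"
      proof (rule R_unit_induct[OF Y(1) subspace_span])
        fix i j assume ij: "i < n" "j < n" "Y $$ (i, j) \<noteq> 0"
        then have "j < i" using Y(2) by (auto simp: strictly_lower_def not_less[symmetric])
        then have mG: "munit n i j \<in> G a" using unit_in_G[OF Y(1)] ij by simp
        have low: "munit n i j \<in> strictly_lower n" using \<open>j < i\<close> by (auto simp: strictly_lower_def munit_def)
        have w: "wt (wshift \<mu> i j) (R a (munit n i j) y)" by (rule wt_shift[OF \<mu>(2) ij(1,2) mG])
        have le: "wle n (wshift \<mu> i j) \<nu>" by (rule wle_wshift[OF \<mu>(1) \<open>j < i\<close> ij(1)])
        \<comment> \<open>Were the lowered weight equal to \<open>\<nu>\<close>, then
          \<open>\<nu>\<close> would lie below \<open>\<mu>\<close>, which lies below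
          \<open>\<nu>\<close>; the two would agree although the shift changes coordinate
          \<open>i\<close>.\<close>
        have ne: "wshift \<mu> i j \<noteq> \<nu>"
        proof
          assume eq: "wshift \<mu> i j = \<nu>"
          have "wle n \<nu> \<mu>"
            unfolding wle_def
          proof (intro conjI allI impI)
            fix l assume "l < n"
            obtain K where K: "\<And>i. i < n \<Longrightarrow> (\<Sum>j\<le>i. \<nu> j - \<mu> j) = of_nat (K i)"
              using wle_partial_sums_nat[OF \<mu>(1)] by blast
            have "(\<Sum>k\<le>l. \<mu> k - \<nu> k) = - (\<Sum>k\<le>l. if k = i then 1 else 0) + (\<Sum>k\<le>l. if k = j then 1 else 0)"
              unfolding eq[symmetric] sum_negf[symmetric] sum.distrib[symmetric]
              by (intro sum.cong) (auto simp: wshift_def)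
            then show "(\<Sum>k\<le>l. \<mu> k - \<nu> k) \<in> \<nat>" using \<open>j < i\<close> by auto
          next
            have "(\<Sum>k<n. \<nu> k - \<mu> k) = 0" using \<mu>(1) by (simp add: wle_def)
            then show "(\<Sum>k<n. \<mu> k - \<nu> k) = 0" by (simp add: sum_subtractf)
          qed
          then have "\<mu> = \<nu>" using wle_antisym[OF \<mu>(1)] wt_supp[OF \<mu>(2)] wt_supp[OF w] eq by blast
          then have "wshift \<mu> i j i = \<mu> i" using eq by simp
          then show False using \<open>j < i\<close> by (simp add: wshift_def)
        qed
        have "R a (munit n i j) y \<in> cl V0" by (rule cl.low[OF \<mu>(3) mG low])
        then show "munit n i j \<in> G a \<and> R a (munit n i j) y \<in> span ?S"
          using w le ne mG wt_supp[OF w] by (auto intro!: span_base)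
      qed
      then show ?case using step(2) Y(1)
        by (simp add: R_add R_scale span_add span_scale del: G_True)
    qed
    then show "R a Y v \<in> span ?S \<inter> cl V0" using cl.low[OF _ Y] v by blast
  qed
  then show ?thesis by blast
qed

lemma cl_weight:
  assumes V0: "subspace V0" "\<And>v. v \<in> V0 \<Longrightarrow> wt \<nu> v" and w: "w \<in> cl V0" "wt \<mu> w" "w \<noteq> 0"
  shows "wle n \<mu> \<nu> \<and> (\<mu> = \<nu> \<longrightarrow> w \<in> V0)"
proof -
  have "(wle n \<mu> \<nu> \<and> (\<forall>i\<ge>n. \<mu> i = 0)) \<and> w \<in> {y. wt \<mu> y \<and> y \<in> cl V0 \<and> (\<mu> = \<nu> \<longrightarrow> y \<in> V0)}"
  proof (rule weight_component[OF _ _ _ w(2,3)])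
    show "w \<in> span {y. \<exists>\<mu>. (wle n \<mu> \<nu> \<and> (\<forall>i\<ge>n. \<mu> i = 0)) \<and>
        y \<in> {y. wt \<mu> y \<and> y \<in> cl V0 \<and> (\<mu> = \<nu> \<longrightarrow> y \<in> V0)}}"
      using cl_weights[OF V0] w(1) by blast
    fix \<mu> assume "wle n \<mu> \<nu> \<and> (\<forall>i\<ge>n. \<mu> i = 0)"
    then show "subspace {y. wt \<mu> y \<and> y \<in> cl V0 \<and> (\<mu> = \<nu> \<longrightarrow> y \<in> V0)}"
      using V0(1) by (auto simp: subspace_def intro: wt_zero wt_add wt_scale cl.intros)
  qed auto
  then show ?thesis by blast
qed

end

section \<open>Complete reducibility for \<open>gl(n)\<close>\<close>

context tri_rep
begin

abbreviation e :: "nat \<Rightarrow> nat \<Rightarrow> 'v \<Rightarrow> 'v" where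
  "e i j \<equiv> R False (munit n i j)"

definition estable :: "'v set \<Rightarrow> bool" where
  "estable U \<longleftrightarrow> subspace U \<and> (\<forall>i<n. \<forall>j<n. \<forall>u\<in>U. e i j u \<in> U)"

lemma estable_subspace: "estable U \<Longrightarrow> subspace U"
  and estable_e: "estable U \<Longrightarrow> i < n \<Longrightarrow> j < n \<Longrightarrow> u \<in> U \<Longrightarrow> e i j u \<in> U"
  by (auto simp: estable_def)

lemma estable_zero: "estable {0}"
  by (simp add: estable_def R_zero)

lemma e_add: "e i j (v + w) = e i j v + e i j w"
  and e_scale: "e i j (c *s v) = c *s e i j v"
  and e_diff: "e i j (v - w) = e i j v - e i j w"
  and e_0: "e i j 0 = 0"
  and e_sum: "e i j (\<Sum>k\<in>I. f k) = (\<Sum>k\<in>I. e i j (f k))"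
  by (simp_all add: R_add R_scale R_diff R_zero R_sum)

lemma e_comm:
  assumes "i < n" "j < n" "k < n" "l < n"
  shows "e i j (e k l v) = e k l (e i j v) + (if j = k then e i l v else 0) - (if l = i then e k j v else 0)"
proof -
  have "supercomm False False (munit n i j) (munit n k l)
      = (if j = k then munit n i l else 0\<^sub>m n n) + (- 1) \<cdot>\<^sub>m (if l = i then munit n k j else 0\<^sub>m n n)"
    unfolding supercomm_def munit_mult[OF assms] munit_mult[OF assms(3,4,1,2)]
    by (intro eq_matI) (auto simp: munit_def)
  then have "R False (supercomm False False (munit n i j) (munit n k l)) v
      = (if j = k then e i l v else 0) - (if l = i then e k j v else 0)"
    by (simp add: R_plus R_smult R_zero_mat)
  then show ?thesis
    using R_swap[of "munit n i j" False "munit n k l" False v] by simp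
qed

definition casimir :: "'v \<Rightarrow> 'v" where
  "casimir v = (\<Sum>i<n. \<Sum>j<n. e i j (e j i v))"

lemma casimir_add: "casimir (v + w) = casimir v + casimir w"
  and casimir_scale: "casimir (c *s v) = c *s casimir v"
  by (simp_all add: casimir_def e_add e_scale sum.distrib scale_sum_right)

lemma casimir_diff: "casimir (v - w) = casimir v - casimir w"
  by (simp add: casimir_def e_diff sum_subtractf)

lemma casimir_zero: "casimir 0 = 0"
  by (simp add: casimir_def e_0)

text \<open>Moving \<open>e k l\<close> through both factors leaves four sums of commutator terms.
  After an exchange of summation they cancel in pairs: the first with the fourth, the second with
  the third.\<close>

lemma casimir_e:
  assumes "k < n" "l < n"
  shows "casimir (e k l v) = e k l (casimir v)"
proof -
  have *: "e i j (e j i (e k l v)) = e k l (e i j (e j i v))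
      + (if j = k then e i l (e j i v) else 0) - (if l = i then e k j (e j i v) else 0)
      + (if i = k then e i j (e j l v) else 0) - (if l = j then e i j (e k i v) else 0)"
    if ij: "i < n" "j < n" for i j
  proof -
    have "e i j (e j i (e k l v)) = e i j (e k l (e j i v)) + (if i = k then e i j (e j l v) else 0)
        - (if l = j then e i j (e k i v) else 0)"
      unfolding e_comm[OF ij(2,1) assms, of v] by (auto simp: e_add e_diff e_0)
    then show ?thesis unfolding e_comm[OF ij assms, of "e j i v"] by (auto simp: algebra_simps)
  qed
  have "casimir (e k l v) = e k l (casimir v)
     + (\<Sum>i<n. \<Sum>j<n. if j = k then e i l (e j i v) else 0) - (\<Sum>i<n. \<Sum>j<n. if l = i then e k j (e j i v) else 0)
     + (\<Sum>i<n. \<Sum>j<n. if i = k then e i j (e j l v) else 0) - (\<Sum>i<n. \<Sum>j<n. if l = j then e i j (e k i v) else 0)"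
    unfolding casimir_def e_sum sum.distrib[symmetric] sum_subtractf[symmetric]
    by (intro sum.cong refl) (use * in auto)
  also have "(\<Sum>i<n. \<Sum>j<n. if l = i then e k j (e j i v) else 0) = (\<Sum>j<n. \<Sum>i<n. if l = i then e k j (e j i v) else 0)"
    by (rule sum.swap)
  also have "(\<Sum>i<n. \<Sum>j<n. if i = k then e i j (e j l v) else 0) = (\<Sum>j<n. \<Sum>i<n. if i = k then e i j (e j l v) else 0)"
    by (rule sum.swap)
  finally show ?thesis using assms by (simp add: sum.delta sum.delta')
qed

lemma casimir_estable: "estable U \<Longrightarrow> u \<in> U \<Longrightarrow> casimir u \<in> U"
  unfolding casimir_def by (intro subspace_sum estable_subspace) (auto intro: estable_e)

text \<open>For \<open>i < j\<close> the product \<open>e i j (e j i v)\<close> is reordered so that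
  the raising operator acts first and lands in \<open>U\<close>; the commutator contributes
  \<open>\<mu> i - \<mu> j\<close>. Working modulo \<open>U\<close> covers vectors that are singular
  only in a quotient, without forming quotients.\<close>

lemma casimir_singular_mod:
  assumes U: "estable U" and \<mu>: "wt \<mu> v" and up: "\<And>i j. i < j \<Longrightarrow> j < n \<Longrightarrow> e i j v \<in> U"
  shows "casimir v - casimir_value n \<mu> *s v \<in> U"
proof -
  note S = estable_subspace[OF U]
  have eq: "casimir v - casimir_value n \<mu> *s v
      = (\<Sum>i<n. \<Sum>j<n. e i j (e j i v) - (if i < j then \<mu> i - \<mu> j else if i = j then \<mu> i * \<mu> i else 0) *s v)"
    by (simp add: casimir_def casimir_value_def scale_sum_left sum_subtractf)
  have "e i j (e j i v) - (if i < j then \<mu> i - \<mu> j else if i = j then \<mu> i * \<mu> i else 0) *s v \<in> U"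
    if ij: "i < n" "j < n" for i j
  proof -
    have d: "e k k v = \<mu> k *s v" if "k < n" for k using \<mu> that by (simp add: wt_def)
    consider "i < j" | "i = j" | "j < i" by linarith
    then show ?thesis
    proof cases
      case 1
      have "e i j (e j i v) - (\<mu> i - \<mu> j) *s v = e j i (e i j v)"
        using 1 ij by (simp add: e_comm[OF ij ij(2,1)] d scale_left_diff_distrib)
      then show ?thesis using 1 estable_e[OF U ij(2,1) up[OF 1 ij(2)]] by simp
    next
      case 2
      then show ?thesis using ij S by (simp add: d e_scale subspace_0)
    next
      case 3
      then show ?thesis using estable_e[OF U ij up[OF 3 ij(1)]] by simp
    qed
  qed
  then show ?thesis unfolding eq by (intro subspace_sum[OF S]) auto
qed

lemma R_trivial_odd:
  assumes "Od = {0\<^sub>m n n}" "X \<in> Od"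
  shows "R True X v = 0"
proof -
  have "X = 0\<^sub>m n n" using assms by simp
  then show ?thesis using assms(2) R_zero_mat[of True v] by simp
qed

lemma casimir_cl:
  assumes "\<And>v. v \<in> V0 \<Longrightarrow> casimir v = c *s v" "Od = {0\<^sub>m n n}" "w \<in> cl V0"
  shows "casimir w = c *s w"
  using assms(3)
proof induction
  case (low v Y a)
  show ?case
  proof (cases a)
    case True
    then show ?thesis using low R_trivial_odd[OF assms(2)] by (simp add: casimir_zero)
  next
    case False
    have "R False Y v \<in> {x. casimir x = c *s x}"
    proof (rule R_unit_induct)
      show "Y \<in> G False" using low False by simp
      show "subspace {x. casimir x = c *s x}"
        by (auto simp: subspace_def casimir_zero casimir_add casimir_scale scale_right_distrib scale_left_commute)
    qed (use low in \<open>auto simp: casimir_e e_scale\<close>)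
    then show ?thesis using False by simp
  qed
qed (auto simp: assms(1) casimir_zero casimir_add casimir_scale scale_right_distrib scale_left_commute)

text \<open>The product of the operators \<open>casimir - c\<close> over the list. It serves to kill
  components with the listed eigenvalues while scaling the others by nonzero factors.\<close>

primrec casimir_poly :: "complex list \<Rightarrow> 'v \<Rightarrow> 'v" where
  "casimir_poly [] v = v"
| "casimir_poly (c # cs) v = casimir (casimir_poly cs v) - c *s casimir_poly cs v"

lemma casimir_poly_add: "casimir_poly cs (v + w) = casimir_poly cs v + casimir_poly cs w"
  and casimir_poly_scale: "casimir_poly cs (d *s v) = d *s casimir_poly cs v"
  by (induction cs) (simp_all add: casimir_add casimir_scale algebra_simps scale_right_distrib
      scale_right_diff_distrib scale_left_commute)

lemma casimir_poly_zero: "casimir_poly cs 0 = 0"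
  using casimir_poly_scale[of cs 0 0] by simp

lemma casimir_poly_e: "k < n \<Longrightarrow> l < n \<Longrightarrow> casimir_poly cs (e k l v) = e k l (casimir_poly cs v)"
  by (induction cs) (simp_all add: casimir_e e_diff e_scale)

lemma casimir_poly_eigen: "casimir v = c *s v \<Longrightarrow> casimir_poly cs v = (\<Prod>d\<leftarrow>cs. c - d) *s v"
  by (induction cs) (simp_all add: casimir_scale scale_left_diff_distrib algebra_simps)

lemma casimir_poly_append: "casimir_poly (cs @ ds) v = casimir_poly cs (casimir_poly ds v)"
  by (induction cs) simp_all

lemma casimir_poly_commute: "casimir_poly cs (casimir v) = casimir (casimir_poly cs v)"
  by (induction cs) (simp_all add: casimir_diff casimir_scale)

lemma casimir_poly_swap: "casimir_poly cs (casimir_poly ds v) = casimir_poly ds (casimir_poly cs v)"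
proof (induction ds)
  case (Cons d ds)
  have "casimir_poly cs (casimir_poly (d # ds) v)
      = casimir_poly cs (casimir (casimir_poly ds v) + (- d) *s casimir_poly ds v)" by simp
  then show ?case using Cons by (simp only: casimir_poly_add casimir_poly_scale casimir_poly_commute) simp
qed simp

lemma casimir_poly_estable: "estable U \<Longrightarrow> u \<in> U \<Longrightarrow> casimir_poly cs u \<in> U"
  by (induction cs) (auto intro!: subspace_diff subspace_scale casimir_estable simp: estable_subspace)

lemma casimir_poly_mod:
  assumes U: "estable U" and v: "casimir v - c *s v \<in> U"
  shows "casimir_poly cs v - (\<Prod>d\<leftarrow>cs. c - d) *s v \<in> U"
proof (induction cs)
  case Nil
  then show ?case using estable_subspace[OF U] by (simp add: subspace_0)
next
  case (Cons d cs)
  note S = estable_subspace[OF U]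
  let ?p = "casimir_poly cs v" and ?k = "\<Prod>d\<leftarrow>cs. c - d"
  have "casimir_poly (d # cs) v - (\<Prod>d\<leftarrow>d # cs. c - d) *s v
      = casimir (?p - ?k *s v) - d *s (?p - ?k *s v) + ?k *s (casimir v - c *s v)"
    by (simp add: casimir_diff casimir_scale algebra_simps scale_left_diff_distrib scale_right_diff_distrib)
  also have "\<dots> \<in> U"
    by (rule subspace_add[OF S subspace_diff[OF S casimir_estable[OF U Cons] subspace_scale[OF S Cons]]
          subspace_scale[OF S v]])
  finally show ?case .
qed

lemma upkilled_units:
  assumes "Od = {0\<^sub>m n n}" "\<And>i j. i < j \<Longrightarrow> j < n \<Longrightarrow> e i j v = 0"
  shows "upkilled v"
  unfolding upkilled_def
proof (intro allI impI)
  fix a X assume X: "X \<in> G a" "X \<in> strictly_upper n"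
  show "R a X v = 0"
  proof (cases a)
    case True then show ?thesis using X(1) R_trivial_odd[OF assms(1)] by simp
  next
    case False
    have "R False X v \<in> {0}"
    proof (rule R_unit_induct)
      fix i j assume ij: "i < n" "j < n" "X $$ (i, j) \<noteq> 0"
      then have "i < j" using X(2) by (auto simp: strictly_upper_def not_le[symmetric])
      then show "munit n i j \<in> G False \<and> e i j v \<in> {0}" using assms(2) ij by simp
    qed (use X False in auto)
    then show ?thesis using False by simp
  qed
qed

lemma munit_strictly_upper: "i < j \<Longrightarrow> munit n i j \<in> strictly_upper n"
  by (auto simp: strictly_upper_def munit_def)

end

text \<open>Stands in for finite dimension: all that is needed of it for weights is that the height
  element has finitely many eigenvalues on \<open>V\<close>.\<close>

locale fin_rep = tri_rep scale n Od R
  for scale :: "complex \<Rightarrow> 'v::ab_group_add \<Rightarrow> 'v" (infixr "*s" 75) and n Od R +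
  fixes V :: "'v set"
  assumes V_sub: "subspace V"
    and V_stable: "\<And>a X v. X \<in> G a \<Longrightarrow> v \<in> V \<Longrightarrow> R a X v \<in> V"
    and V_fin: "finite {c. \<exists>w\<in>V. w \<noteq> 0 \<and> R False (dg n (\<lambda>i. of_nat n - of_nat i)) w = c *s w}"
begin

lemma V_estable: "estable V"
  using V_sub V_stable by (auto simp: estable_def)

lemma wdeg_eigen: "wt \<mu> w \<Longrightarrow> R False (dg n (\<lambda>i. of_nat n - of_nat i)) w = wdeg n \<mu> *s w"
  by (simp add: wt_dg wdeg_def)

lemma finite_wdeg: "finite {wdeg n \<mu> | \<mu> w. w \<in> V \<and> w \<noteq> 0 \<and> wt \<mu> w}"
  by (rule finite_subset[OF _ V_fin]) (use wdeg_eigen in blast)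

text \<open>\<open>sl(2)\<close>-theory modulo a submodule \<open>U\<close>: \<open>e f\<^sup>k\<^sup>+\<^sup>1 v = (k + 1) (m - k) f\<^sup>k v\<close>.\<close>

lemma singular_mod_dominant:
  assumes U: "estable U" and v: "v \<in> V" "v \<notin> U" "wt \<mu> v" and i: "Suc i < n" and e: "e i (Suc i) v \<in> U"
  shows "\<mu> i - \<mu> (Suc i) \<in> \<nat>"
proof -
  note S = estable_subspace[OF U]
  define m where "m = \<mu> i - \<mu> (Suc i)"
  define f where "f k = (e (Suc i) i ^^ k) v" for k
  have f_Suc: "f (Suc k) = e (Suc i) i (f k)" for k by (simp add: f_def)
  have fV: "f k \<in> V" for k
    by (induction k) (use v(1) V_stable in \<open>auto simp: f_def\<close>)
  have "\<exists>\<kappa>. wt \<kappa> (f k) \<and> wdeg n \<kappa> = wdeg n \<mu> - of_nat k \<and> \<kappa> i - \<kappa> (Suc i) = m - 2 * of_nat k" for k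
  proof (induction k)
    case 0 then show ?case using v(3) by (auto simp: f_def m_def)
  next
    case (Suc k)
    then obtain \<kappa> where \<kappa>: "wt \<kappa> (f k)" "wdeg n \<kappa> = wdeg n \<mu> - of_nat k" "\<kappa> i - \<kappa> (Suc i) = m - 2 * of_nat k"
      by blast
    show ?case
    proof (intro exI conjI)
      show "wt (wshift \<kappa> (Suc i) i) (f (Suc k))" unfolding f_Suc using i \<kappa>(1) by (intro wt_shift) auto
      show "wdeg n (wshift \<kappa> (Suc i) i) = wdeg n \<mu> - of_nat (Suc k)"
        using i \<kappa>(2) by (simp add: wdeg_wshift)
      show "wshift \<kappa> (Suc i) i i - wshift \<kappa> (Suc i) i (Suc i) = m - 2 * of_nat (Suc k)"
        using \<kappa>(3) by (simp add: wshift_def algebra_simps)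
    qed
  qed
  then obtain \<kappa> where \<kappa>: "\<And>k. wt (\<kappa> k) (f k)" "\<And>k. wdeg n (\<kappa> k) = wdeg n \<mu> - of_nat k"
    "\<And>k. \<kappa> k i - \<kappa> k (Suc i) = m - 2 * of_nat k" by metis
  \<comment> \<open>The degrees of the \<open>f k\<close> are pairwise distinct and only finitely
    many values occur on \<open>V\<close>, so the string breaks off.\<close>
  have "\<exists>k. f k = 0"
  proof (rule ccontr)
    assume "\<nexists>k. f k = 0"
    then have "range (\<lambda>k. wdeg n (\<kappa> k)) \<subseteq> {wdeg n \<mu> | \<mu> w. w \<in> V \<and> w \<noteq> 0 \<and> wt \<mu> w}"
      using \<kappa>(1) fV by blast
    then have "finite (range (\<lambda>k. wdeg n (\<kappa> k)))" by (rule finite_subset[OF _ finite_wdeg])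
    moreover have "inj (\<lambda>k. wdeg n (\<kappa> k))" by (auto simp: inj_def \<kappa>(2))
    ultimately show False using finite_imageD by blast
  qed
  then have ex: "\<exists>k. f k \<in> U" using subspace_0[OF S] by metis
  \<comment> \<open>At the first index where the string enters \<open>U\<close>, the identity modulo
    \<open>U\<close> leaves a scalar multiple of a vector outside \<open>U\<close>. The scalar must
    vanish, so \<open>m\<close> is the preceding index.\<close>
  define K where "K = (LEAST k. f k \<in> U)"
  have "f K \<in> U" unfolding K_def using ex by (rule LeastI_ex)
  moreover have "f 0 \<notin> U" using v(2) by (simp add: f_def)
  ultimately obtain k where k: "K = Suc k" by (cases K) auto
  have notU: "f k \<notin> U" using not_less_Least[of k "\<lambda>k. f k \<in> U"] k unfolding K_def[symmetric] by simp
  have rel: "e i (Suc i) (f (Suc k)) - ((of_nat k + 1) * (m - of_nat k)) *s f k \<in> U" for k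
  proof (induction k)
    case 0
    have "e i (Suc i) (f (Suc 0)) - ((of_nat 0 + 1) * (m - of_nat 0)) *s f 0 = e (Suc i) i (e i (Suc i) v)"
      using i v(3) by (simp add: f_def e_comm[of i "Suc i" "Suc i" i v] wt_def m_def scale_left_diff_distrib)
    then show ?case using estable_e[OF U] i e by simp
  next
    case (Suc k)
    let ?c = "(of_nat k + 1) * (m - of_nat k)"
    have "e i (Suc i) (f (Suc (Suc k))) = e (Suc i) i (e i (Suc i) (f (Suc k)))
        + (\<kappa> (Suc k) i - \<kappa> (Suc k) (Suc i)) *s f (Suc k)"
      unfolding f_Suc[of "Suc k"] using i \<kappa>(1)[of "Suc k"]
      by (simp add: e_comm[of i "Suc i" "Suc i" i "f (Suc k)"] wt_def scale_left_diff_distrib)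
    also have "\<dots> = e (Suc i) i (e i (Suc i) (f (Suc k)) - ?c *s f k) + (?c + (m - 2 * of_nat (Suc k))) *s f (Suc k)"
      by (simp add: \<kappa>(3) e_diff e_scale f_Suc scale_left_distrib)
    also have "?c + (m - 2 * of_nat (Suc k)) = (of_nat (Suc k) + 1) * (m - of_nat (Suc k))"
      by (simp add: algebra_simps)
    finally have "e i (Suc i) (f (Suc (Suc k))) - ((of_nat (Suc k) + 1) * (m - of_nat (Suc k))) *s f (Suc k)
      = e (Suc i) i (e i (Suc i) (f (Suc k)) - ?c *s f k)" by simp
    then show ?case using estable_e[OF U _ _ Suc] i by simp
  qed
  have "e i (Suc i) (f (Suc k)) \<in> U"
    using \<open>f K \<in> U\<close> k i estable_e[OF U] by simp
  then have "((of_nat k + 1) * (m - of_nat k)) *s f k \<in> U"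
    using subspace_diff[OF S _ rel[of k]] by fastforce
  then have cU: "inverse ((of_nat k + 1) * (m - of_nat k)) *s ((of_nat k + 1) * (m - of_nat k)) *s f k \<in> U"
    by (rule subspace_scale[OF S])
  have "(of_nat k + 1) * (m - of_nat k) = 0"
  proof (rule ccontr)
    assume nz: "(of_nat k + 1) * (m - of_nat k) \<noteq> 0"
    have "f k \<in> U" using cU by (simp only: scale_scale left_inverse[OF nz] scale_one)
    then show False using notU by blast
  qed
  moreover have "of_nat k + 1 \<noteq> (0 :: complex)" by (metis of_nat_Suc of_nat_eq_0_iff nat.distinct(1) add.commute)
  ultimately have "m = of_nat k" by simp
  then show ?thesis by (simp add: m_def)
qed

lemma upkilled_dominant:
  assumes "v \<in> V" "v \<noteq> 0" "wt \<mu> v" "upkilled v"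
  shows "wdom n \<mu>"
  unfolding wdom_def
proof (intro allI impI)
  fix i assume "Suc i < n"
  then show "\<mu> i - \<mu> (Suc i) \<in> \<nat>"
    using singular_mod_dominant[OF estable_zero, of v \<mu> i] assms
      upkilledD[OF assms(4), of "munit n i (Suc i)" False] munit_strictly_upper[of i "Suc i"] by simp
qed

text \<open>Raising increases \<open>wdeg\<close> by a positive integer, so its real part has a
  maximum among finitely many values. \<open>Q\<close> is not assumed to survive raising: it is used
  both for lying in a submodule and for lying outside one.\<close>

lemma max_wdeg_vector:
  assumes "v \<in> V" "v \<noteq> 0" "wt \<mu> v" "Q v"
  obtains w \<kappa> where "w \<in> V" "w \<noteq> 0" "wt \<kappa> w" "Q w"
    "\<And>i j. i < j \<Longrightarrow> j < n \<Longrightarrow> e i j w = 0 \<or> \<not> Q (e i j w)"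
proof -
  let ?A = "{(w, \<kappa>). w \<in> V \<and> w \<noteq> 0 \<and> wt \<kappa> w \<and> Q w}"
  have "finite ((\<lambda>(w, \<kappa>). Re (wdeg n \<kappa>)) ` ?A)"
    by (rule finite_subset[of _ "Re ` {wdeg n \<mu> | \<mu> w. w \<in> V \<and> w \<noteq> 0 \<and> wt \<mu> w}"])
      (use finite_wdeg in auto)
  moreover have "(v, \<mu>) \<in> ?A" using assms by simp
  ultimately obtain w \<kappa> where w: "(w, \<kappa>) \<in> ?A"
    and max: "\<And>w' \<kappa>'. (w', \<kappa>') \<in> ?A \<Longrightarrow> Re (wdeg n \<kappa>') \<le> Re (wdeg n \<kappa>)"
  proof -
    assume a: "finite ((\<lambda>(w, \<kappa>). Re (wdeg n \<kappa>)) ` ?A)" "(v, \<mu>) \<in> ?A"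
      and th: "\<And>w \<kappa>. (w, \<kappa>) \<in> ?A \<Longrightarrow> (\<And>w' \<kappa>'. (w', \<kappa>') \<in> ?A \<Longrightarrow> Re (wdeg n \<kappa>') \<le> Re (wdeg n \<kappa>)) \<Longrightarrow> thesis"
    let ?m = "Max ((\<lambda>(w, \<kappa>). Re (wdeg n \<kappa>)) ` ?A)"
    have "?m \<in> (\<lambda>(w, \<kappa>). Re (wdeg n \<kappa>)) ` ?A" using a by (intro Max_in) blast+
    then obtain p where p: "p \<in> ?A" "?m = (\<lambda>(w, \<kappa>). Re (wdeg n \<kappa>)) p" by blast
    obtain w \<kappa> where wk: "p = (w, \<kappa>)" by (cases p)
    show thesis
    proof (rule th)
      show "(w, \<kappa>) \<in> ?A" using p wk by simp
      fix w' \<kappa>' assume "(w', \<kappa>') \<in> ?A"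
      then have "Re (wdeg n \<kappa>') \<in> (\<lambda>(w, \<kappa>). Re (wdeg n \<kappa>)) ` ?A" by force
      then have "Re (wdeg n \<kappa>') \<le> ?m" using a(1) by (intro Max_ge)
      then show "Re (wdeg n \<kappa>') \<le> Re (wdeg n \<kappa>)" using p(2) wk by simp
    qed
  qed
  show thesis
  proof (rule that[of w \<kappa>])
    fix i j :: nat assume ij: "i < j" "j < n"
    show "e i j w = 0 \<or> \<not> Q (e i j w)"
    proof (rule ccontr)
      assume "\<not> (e i j w = 0 \<or> \<not> Q (e i j w))"
      then have "(e i j w, wshift \<kappa> i j) \<in> ?A"
        using w ij V_stable by (auto intro!: wt_shift)
      from max[OF this] show False using ij by (simp add: wdeg_wshift)
    qed
  qed (use w in auto)
qed

text \<open>Stability under the diagonal units puts the weight components of an element of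
  \<open>W\<close> into \<open>W\<close>; for a nonzero element one of them is nonzero.\<close>

lemma nonzero_weight_vector:
  assumes W: "estable W" "W \<subseteq> V" "W \<noteq> {0}" and span: "V \<subseteq> span {w \<in> V. \<exists>\<mu>. wt \<mu> w}"
  obtains w \<mu> where "w \<in> W" "w \<noteq> 0" "wt \<mu> w"
proof -
  obtain w where w: "w \<in> W" "w \<noteq> 0" using W(1,3) subspace_0[OF estable_subspace] by blast
  have "w \<in> span {y. \<exists>\<mu>. (\<forall>i\<ge>n. \<mu> i = 0) \<and> y \<in> {y. wt \<mu> y}}"
  proof (rule subsetD[OF _ w(1)])
    have "{w \<in> V. \<exists>\<mu>. wt \<mu> w} \<subseteq> {y. \<exists>\<mu>. (\<forall>i\<ge>n. \<mu> i = 0) \<and> y \<in> {y. wt \<mu> y}}"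
      by (auto dest: wt_supp)
    then show "W \<subseteq> span {y. \<exists>\<mu>. (\<forall>i\<ge>n. \<mu> i = 0) \<and> y \<in> {y. wt \<mu> y}}"
      using W(2) span span_mono by blast
  qed
  then obtain F x where F: "finite F" "\<And>\<mu>. \<mu> \<in> F \<Longrightarrow> (\<forall>i\<ge>n. \<mu> i = 0) \<and> x \<mu> \<in> {y. wt \<mu> y}" "w = (\<Sum>\<mu>\<in>F. x \<mu>)"
    by (rule span_family) (auto simp: subspace_def intro: wt_zero wt_add wt_scale)
  have "\<exists>\<mu>\<in>F. x \<mu> \<noteq> 0" using F(3) w(2) by (metis sum.neutral)
  then obtain \<mu> where \<mu>: "\<mu> \<in> F" "x \<mu> \<noteq> 0" by blast
  have "x \<mu> \<in> W"
  proof (rule weight_components_aux[OF F(1) estable_subspace[OF W(1)] _ _ _ \<mu>(1)])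
    show "e i i u \<in> W" if "i < n" "u \<in> W" for i u using estable_e[OF W(1) that(1,1,2)] .
    show "wt \<kappa> (x \<kappa>)" if "\<kappa> \<in> F" for \<kappa> using F(2)[OF that] by simp
    show "(\<Sum>\<mu>\<in>F. x \<mu>) \<in> W" using F(3) w(1) by simp
  qed
  then show thesis using that \<mu> F(2) by blast
qed

end

text \<open>The even Lie algebra as a degenerate case of the common setting, the zero matrix being
  the only odd element. \<open>V_weights\<close> excludes a centre that acts by Jordan
  blocks.\<close>

locale gl_rep = fin_rep scale n Od R V
  for scale :: "complex \<Rightarrow> 'v::ab_group_add \<Rightarrow> 'v" (infixr "*s" 75) and n Od R V +
  assumes Od_zero: "Od = {0\<^sub>m n n}"
    and V_weights: "V \<subseteq> span {w \<in> V. \<exists>\<mu>. wt \<mu> w}"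
begin

section \<open>Submodules generated by singular weight vectors\<close>

lemma cl_singular_estable:
  assumes "upkilled v" "wt \<mu> v"
  shows "estable (cl (span {v}))"
proof -
  have s: "\<exists>c. w = c *s v" if "w \<in> span {v}" for w
    using that by (auto simp: span_singleton)
  have "R a X w \<in> cl (span {v})" if "w \<in> cl (span {v})" "X \<in> G a" for a X w
  proof (rule cl_stable[OF subspace_span _ _ that])
    fix w assume "w \<in> span {v}"
    then show "upkilled w" using s assms(1) upkilled_scale by blast
  next
    fix a b w assume "dg n b \<in> G a" "w \<in> span {v}"
    then obtain c where c: "w = c *s v" using s by blast
    show "R a (dg n b) w \<in> span {v}"
    proof (cases a)
      case True
      then show ?thesis using \<open>dg n b \<in> G a\<close> R_trivial_odd[OF Od_zero] by (simp add: span_zero)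
    next
      case False
      then show ?thesis using c wt_dg[OF wt_scale[OF assms(2)]] by (simp add: span_scale span_base)
    qed
  qed
  then show ?thesis by (auto simp: estable_def cl_subspace)
qed

lemma casimir_singular:
  assumes "upkilled v" "wt \<mu> v"
  shows "casimir v = casimir_value n \<mu> *s v"
  using casimir_singular_mod[OF estable_zero assms(2)] upkilledD[OF assms(1), of _ False]
    munit_strictly_upper by simp

lemma casimir_cl_singular:
  assumes "upkilled v" "wt \<mu> v" "w \<in> cl (span {v})"
  shows "casimir w = casimir_value n \<mu> *s w"
  by (rule casimir_cl[OF _ Od_zero assms(3)])
    (use casimir_singular[OF assms(1,2)] in \<open>auto simp: span_singleton casimir_scale scale_left_commute\<close>)

lemma span_singleton_wt: "wt \<mu> v \<Longrightarrow> w \<in> span {v} \<Longrightarrow> wt \<mu> w"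
  by (auto simp: span_singleton intro: wt_scale)

lemma cl_singular_subset: "estable U \<Longrightarrow> v \<in> U \<Longrightarrow> cl (span {v}) \<subseteq> U"
proof (rule cl_minimal)
  assume U: "estable U" "v \<in> U"
  show "span {v} \<subseteq> U" using U estable_subspace by (intro span_minimal) auto
  show "subspace U" using U estable_subspace by blast
  fix a Y w assume Y: "Y \<in> G a" "w \<in> U"
  show "R a Y w \<in> U"
  proof (cases a)
    case True then show ?thesis using Y R_trivial_odd[OF Od_zero] U by (simp add: subspace_0 estable_subspace)
  next
    case False
    have "R False Y w \<in> U"
      by (rule R_unit_induct) (use Y U False estable_subspace estable_e in auto)
    then show ?thesis using False by simp
  qed
qed

text \<open>A nonzero intersection contains a singular weight vector, by maximal height. Its weight
  lies below \<open>\<mu>\<close>, is dominant and has the same Casimir value, hence equals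
  \<open>\<mu>\<close>; so the vector is a multiple of \<open>v\<close>, which would put
  \<open>v\<close> into \<open>U\<close>.\<close>

lemma cl_singular_simple:
  assumes v: "v \<in> V" "upkilled v" "wt \<mu> v" and U: "estable U" "v \<notin> U"
  shows "U \<inter> cl (span {v}) = {0}"
proof (rule ccontr)
  let ?N = "U \<inter> cl (span {v})"
  assume ne: "?N \<noteq> {0}"
  have N: "estable ?N"
    using U(1) cl_singular_estable[OF v(2,3)] by (auto simp: estable_def intro: subspace_inter)
  have clV: "cl (span {v}) \<subseteq> V" using cl_singular_subset[OF V_estable v(1)] .
  obtain w \<kappa> where "w \<in> ?N" "w \<noteq> 0" "wt \<kappa> w"
    using nonzero_weight_vector[OF N _ ne V_weights] clV by blast
  then obtain w \<kappa> where w: "w \<in> V" "w \<noteq> 0" "wt \<kappa> w" "w \<in> ?N"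
    and up: "\<And>i j. i < j \<Longrightarrow> j < n \<Longrightarrow> e i j w = 0 \<or> e i j w \<notin> ?N"
    using max_wdeg_vector[of w \<kappa> "\<lambda>w. w \<in> ?N"] clV by blast
  have upw: "upkilled w"
  proof (rule upkilled_units[OF Od_zero])
    fix i j :: nat assume ij: "i < j" "j < n"
    then have "e i j w \<in> ?N" using estable_e[OF N _ _ w(4)] by simp
    then show "e i j w = 0" using up[OF ij] by blast
  qed
  have "casimir_value n \<kappa> *s w = casimir_value n \<mu> *s w"
    using casimir_singular[OF upw w(3)] casimir_cl_singular[OF v(2,3) IntD2[OF w(4)]] by (rule trans[OF sym])
  then have cas: "casimir_value n \<kappa> = casimir_value n \<mu>" using w(2) by simp
  have le: "wle n \<kappa> \<mu> \<and> (\<kappa> = \<mu> \<longrightarrow> w \<in> span {v})"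
    using cl_weight[OF subspace_span span_singleton_wt[OF v(3)] _ w(3,2)] w(4) by blast
  have "v \<noteq> 0" using U subspace_0[OF estable_subspace] by blast
  have "\<kappa> = \<mu>"
    using casimir_value_inj[OF _ _ _ cas] le upkilled_dominant[OF w(1,2,3) upw]
      upkilled_dominant[OF v(1) \<open>v \<noteq> 0\<close> v(3,2)] wt_supp[OF w(3)] wt_supp[OF v(3)] by blast
  then obtain c where "w = c *s v" using le by (auto simp: span_singleton)
  then have "v = inverse c *s w" using w(2) by auto
  then show False using U w(4) subspace_scale[OF estable_subspace[OF U(1)]] by (metis IntD1)
qed

text \<open>A sum of simple submodules, by \<open>cl_singular_simple\<close>; complete reducibility
  rests on its being all of \<open>V\<close>.\<close>

definition singular_span :: "'v set" where
  "singular_span = span (\<Union>v \<in> {v \<in> V. upkilled v \<and> (\<exists>\<mu>. wt \<mu> v)}. cl (span {v}))"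

lemma singular_span_estable: "estable singular_span"
  unfolding estable_def
proof (intro conjI allI impI ballI)
  let ?S = "\<Union>v \<in> {v \<in> V. upkilled v \<and> (\<exists>\<mu>. wt \<mu> v)}. cl (span {v})"
  show "subspace singular_span" by (simp add: singular_span_def)
  fix i j u assume ij: "i < n" "j < n" and "u \<in> singular_span"
  then have "u \<in> span ?S" by (simp add: singular_span_def)
  then show "e i j u \<in> singular_span"
    unfolding singular_span_def
  proof (induction rule: span_induct_alt)
    case base then show ?case by (simp add: e_0 span_zero)
  next
    case (step c y z)
    from step(1) obtain v \<mu> where v: "v \<in> V" "upkilled v" "wt \<mu> v" "y \<in> cl (span {v})" by blast
    have "e i j y \<in> cl (span {v})" by (rule estable_e[OF cl_singular_estable[OF v(2,3)] ij v(4)])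
    then have "e i j y \<in> ?S" using v by blast
    then show ?case using step(2) by (simp add: e_add e_scale span_add span_scale span_base)
  qed
qed

text \<open>Keeps track of the dominant weight \<open>\<nu>\<close> of the generator behind each
  Casimir eigenvalue, together with \<open>wle n \<mu> \<nu>\<close>; this allows eigenvalues to be
  told apart by \<open>casimir_value_inj\<close>.\<close>

lemma singular_span_weight_component:
  assumes "x \<in> singular_span" "wt \<mu> x" "x \<noteq> 0"
  shows "x \<in> span {y. wt \<mu> y \<and> (\<exists>\<nu>. wdom n \<nu> \<and> (\<forall>i\<ge>n. \<nu> i = 0) \<and> wle n \<mu> \<nu> \<and> casimir y = casimir_value n \<nu> *s y)}"
    (is "x \<in> span (?B \<mu>)")
proof -
  have "(\<forall>i\<ge>n. \<mu> i = 0) \<and> x \<in> span (?B \<mu>)"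
  proof (rule weight_component[OF _ _ _ assms(2,3)])
    let ?T = "{y. \<exists>\<mu>. (\<forall>i\<ge>n. \<mu> i = 0) \<and> y \<in> span (?B \<mu>)}"
    have "(\<Union>v \<in> {v \<in> V. upkilled v \<and> (\<exists>\<mu>. wt \<mu> v)}. cl (span {v})) \<subseteq> span ?T"
    proof
      fix y assume "y \<in> (\<Union>v \<in> {v \<in> V. upkilled v \<and> (\<exists>\<mu>. wt \<mu> v)}. cl (span {v}))"
      then obtain v \<nu> where v: "v \<in> V" "upkilled v" "wt \<nu> v" "y \<in> cl (span {v})" by blast
      show "y \<in> span ?T"
      proof (cases "v = 0")
        case True
        then have "y = 0" using cl_singular_subset[OF estable_zero, of v] v(4) by blast
        then show ?thesis by (simp add: span_zero)
      next
        case False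
        then have dom: "wdom n \<nu>" using upkilled_dominant v by blast
        have "y \<in> span {y. \<exists>\<mu>. (wle n \<mu> \<nu> \<and> (\<forall>i\<ge>n. \<mu> i = 0)) \<and>
            y \<in> {y. wt \<mu> y \<and> y \<in> cl (span {v}) \<and> (\<mu> = \<nu> \<longrightarrow> y \<in> span {v})}}"
          using cl_weights[OF subspace_span span_singleton_wt[OF v(3)]] v(4) by blast
        also have "\<dots> \<subseteq> span ?T"
          using casimir_cl_singular[OF v(2,3)] dom wt_supp[OF v(3)]
          by (intro span_mono) (blast intro: span_base)
        finally show ?thesis .
      qed
    qed
    then show "x \<in> span ?T" using assms(1) span_minimal[OF _ subspace_span] unfolding singular_span_def by blast
    fix \<mu> y assume "\<forall>i\<ge>n. \<mu> i = 0" "y \<in> span (?B \<mu>)"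
    then show "wt \<mu> y"
      using span_minimal[of "?B \<mu>" "{y. wt \<mu> y}"]
      by (auto simp: subspace_def intro: wt_zero wt_add wt_scale)
  qed auto
  then show ?thesis by blast
qed

lemma casimir_poly_kills:
  assumes "x \<in> span {y. \<exists>c. Q c \<and> casimir y = c *s y}"
  shows "\<exists>cs. (\<forall>c\<in>set cs. Q c) \<and> casimir_poly cs x = 0"
  using assms
proof (induction rule: span_induct_alt)
  case base
  show ?case by (rule exI[of _ "[]"]) simp
next
  case (step c y z)
  then obtain cs d where cs: "\<forall>c\<in>set cs. Q c" "casimir_poly cs z = 0" and d: "Q d" "casimir y = d *s y" by blast
  have "casimir_poly (d # cs) y = 0" using casimir_poly_eigen[OF d(2), of "d # cs"] by simp
  moreover have "casimir_poly (d # cs) z = 0" using cs(2) by (simp add: casimir_zero)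
  ultimately have "casimir_poly (d # cs) (c *s y + z) = 0"
    by (simp only: casimir_poly_add casimir_poly_scale) simp
  then show ?case using cs(1) d(1) by (intro exI[of _ "d # cs"]) auto
qed

text \<open>A weight vector \<open>w\<close> outside the span of maximal height is singular modulo
  it. A polynomial in the Casimir operator then kills all raised vectors \<open>e i j w\<close> but
  not the class of \<open>w\<close>, and so corrects \<open>w\<close> to a genuinely singular vector
  outside the span, which is absurd.\<close>

lemma V_singular_span: "V \<subseteq> singular_span"
proof -
  have "v \<in> singular_span" if v: "v \<in> V" "wt \<mu> v" for v \<mu>
  proof (rule ccontr)
    note st = singular_span_estable
    assume "v \<notin> singular_span"
    then have nz: "v \<noteq> 0" using subspace_0[OF estable_subspace[OF st]] by blast
    obtain w \<kappa> where w: "w \<in> V" "w \<noteq> 0" "wt \<kappa> w" "w \<notin> singular_span"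
      and up: "\<And>i j. i < j \<Longrightarrow> j < n \<Longrightarrow> e i j w = 0 \<or> e i j w \<in> singular_span"
      by (rule max_wdeg_vector[OF v(1) nz v(2), of "\<lambda>v. v \<notin> singular_span"])
        (use \<open>v \<notin> singular_span\<close> in auto)
    then have up: "e i j w \<in> singular_span" if "i < j" "j < n" for i j
      using that subspace_0[OF estable_subspace[OF st]] by force
    have dom: "wdom n \<kappa>"
      unfolding wdom_def using singular_mod_dominant[OF st w(1,4,3)] up by simp
    \<comment> \<open>Every Casimir eigenvalue in \<open>e i j w\<close> belongs to a dominant
      weight above the raised weight, hence strictly above \<open>\<kappa>\<close>, and so differs
      from the value of \<open>\<kappa>\<close>.\<close>
    have ex: "\<exists>cs. (\<forall>c\<in>set cs. c \<noteq> casimir_value n \<kappa>) \<and> casimir_poly cs (e i j w) = 0" if ij: "i < j" "j < n" for i j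
    proof (cases "e i j w = 0")
      case True then show ?thesis by (intro exI[of _ "[]"]) simp
    next
      case False
      let ?\<kappa> = "wshift \<kappa> i j"
      have "wt ?\<kappa> (e i j w)" using w(3) ij by (intro wt_shift) auto
      then have "e i j w \<in> span {y. wt ?\<kappa> y \<and> (\<exists>\<nu>. wdom n \<nu> \<and> (\<forall>i\<ge>n. \<nu> i = 0) \<and> wle n ?\<kappa> \<nu> \<and>
          casimir y = casimir_value n \<nu> *s y)}"
        using singular_span_weight_component[OF up[OF ij] _ False] by blast
      also have "\<dots> \<subseteq> span {y. \<exists>c. c \<noteq> casimir_value n \<kappa> \<and> casimir y = c *s y}"
      proof (rule span_mono, safe)
        fix y \<nu> assume \<nu>: "wdom n \<nu>" "\<forall>i\<ge>n. \<nu> i = 0" "wle n ?\<kappa> \<nu>" "casimir y = casimir_value n \<nu> *s y"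
        have "wshift ?\<kappa> j i = \<kappa>" by (auto simp: wshift_def)
        then have le: "wle n \<kappa> \<nu>" using wle_wshift[OF \<nu>(3) ij] by simp
        have "casimir_value n \<nu> \<noteq> casimir_value n \<kappa>"
        proof
          assume "casimir_value n \<nu> = casimir_value n \<kappa>"
          then have "\<nu> = \<kappa>" using casimir_value_inj[OF le dom \<nu>(1)] wt_supp[OF w(3)] \<nu>(2) by simp
          then have "wle n ?\<kappa> \<kappa>" using \<nu>(3) by simp
          obtain K where K: "\<And>i. i < n \<Longrightarrow> (\<Sum>l\<le>i. \<kappa> l - ?\<kappa> l) = of_nat (K i)"
            using wle_partial_sums_nat[OF \<open>wle n ?\<kappa> \<kappa>\<close>] by blast
          have "(\<Sum>l\<le>i. \<kappa> l - ?\<kappa> l) = - (\<Sum>l\<le>i. if l = i then 1 else 0)"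
            unfolding sum_negf[symmetric] using ij by (intro sum.cong) (auto simp: wshift_def)
          then have "of_nat (K i) = (- 1 :: complex)" using K[of i] ij by simp
          then have "of_nat (K i + 1) = (0 :: complex)" by simp
          then show False by (metis add_is_0 of_nat_eq_0_iff one_neq_zero)
        qed
        then show "\<exists>c. c \<noteq> casimir_value n \<kappa> \<and> casimir y = c *s y" using \<nu>(4) by blast
      qed
      finally show ?thesis by (rule casimir_poly_kills)
    qed
    \<comment> \<open>One list for all positive roots: concatenation works because Casimir
      polynomials commute.\<close>
    have common: "\<exists>cs. (\<forall>c\<in>set cs. c \<noteq> casimir_value n \<kappa>) \<and> (\<forall>(i, j)\<in>P. casimir_poly cs (e i j w) = 0)"
      if "finite P" "P \<subseteq> {(i, j). i < j \<and> j < n}" for P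
      using that
    proof (induction P rule: finite_induct)
      case empty show ?case by (rule exI[of _ "[]"]) simp
    next
      case (insert p P)
      obtain i j where p: "p = (i, j)" by (cases p)
      obtain cs ds where "\<forall>c\<in>set cs. c \<noteq> casimir_value n \<kappa>" "\<forall>(i, j)\<in>P. casimir_poly cs (e i j w) = 0"
        and "\<forall>c\<in>set ds. c \<noteq> casimir_value n \<kappa>" "casimir_poly ds (e i j w) = 0"
        using insert ex[of i j] p by auto
      moreover from this have "casimir_poly (cs @ ds) (e i j w) = 0"
        by (simp add: casimir_poly_append casimir_poly_zero)
      moreover from calculation have "\<forall>(i, j)\<in>P. casimir_poly (cs @ ds) (e i j w) = 0"
        by (auto simp: casimir_poly_append casimir_poly_swap[of cs ds] casimir_poly_zero)
      ultimately show ?case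
        by (intro exI[of _ "cs @ ds"]) (auto simp: p)
    qed
    have "finite {(i, j). i < j \<and> j < n}"
      by (rule finite_subset[of _ "{..<n} \<times> {..<n}"]) auto
    from common[OF this subset_refl] obtain cs where cs: "\<forall>c\<in>set cs. c \<noteq> casimir_value n \<kappa>"
      "\<And>i j. i < j \<Longrightarrow> j < n \<Longrightarrow> casimir_poly cs (e i j w) = 0" by auto
    \<comment> \<open>Singular because the polynomial commutes with raising, and congruent modulo
      \<open>singular_span\<close> to a multiple of \<open>w\<close> by a product of nonzero
      factors.\<close>
    let ?w = "casimir_poly cs w"
    have "upkilled ?w"
      using cs(2) casimir_poly_e by (intro upkilled_units[OF Od_zero]) (metis order.strict_trans)
    moreover have "?w \<in> V" using casimir_poly_estable[OF V_estable w(1)] .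
    moreover have "wt \<kappa> ?w"
      using w(3) by (auto simp: wt_def casimir_poly_e[symmetric] casimir_poly_scale)
    ultimately have "?w \<in> singular_span"
      unfolding singular_span_def by (blast intro: span_base cl.base)
    moreover have "?w - (\<Prod>d\<leftarrow>cs. casimir_value n \<kappa> - d) *s w \<in> singular_span"
      by (rule casimir_poly_mod[OF st casimir_singular_mod[OF st w(3) up]])
    ultimately have "(\<Prod>d\<leftarrow>cs. casimir_value n \<kappa> - d) *s w \<in> singular_span"
      using subspace_diff[OF estable_subspace[OF st]] by fastforce
    then have "inverse (\<Prod>d\<leftarrow>cs. casimir_value n \<kappa> - d) *s (\<Prod>d\<leftarrow>cs. casimir_value n \<kappa> - d) *s w \<in> singular_span"
      by (rule subspace_scale[OF estable_subspace[OF st]])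
    moreover have "(\<Prod>d\<leftarrow>cs. casimir_value n \<kappa> - d) \<noteq> 0"
      using cs(1) by (induction cs) auto
    ultimately show False using w(4) by simp
  qed
  then have "{w \<in> V. \<exists>\<mu>. wt \<mu> w} \<subseteq> singular_span" by blast
  then show ?thesis
    using V_weights span_minimal[OF _ estable_subspace[OF singular_span_estable]] by blast
qed

text \<open>Among the submodules that meet \<open>W\<close> trivially a maximal one is taken by
  Zorn's lemma, as the setting carries no dimension. If the sum were not \<open>V\<close>, some
  singular weight vector would lie outside; the module it generates meets the sum trivially and
  would enlarge the maximal one.\<close>

theorem complete_reducibility:
  assumes W: "estable W" "W \<subseteq> V"
  obtains W' where "estable W'" "W' \<subseteq> V" "W \<inter> W' = {0}" "{w + w' | w w'. w \<in> W \<and> w' \<in> W'} = V"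
proof -
  let ?A = "{W'. estable W' \<and> W' \<subseteq> V \<and> W \<inter> W' = {0}}"
  have "\<exists>M\<in>?A. \<forall>X\<in>?A. M \<subseteq> X \<longrightarrow> X = M"
  proof (rule subset_Zorn_nonempty)
    have "{0} \<in> ?A"
      using estable_zero subspace_0[OF V_sub] subspace_0[OF estable_subspace[OF W(1)]] by auto
    then show "?A \<noteq> {}" by blast
    fix C assume C: "C \<noteq> {}" "subset.chain ?A C"
    then have CA: "C \<subseteq> ?A" and ch: "\<And>X Y. X \<in> C \<Longrightarrow> Y \<in> C \<Longrightarrow> X \<subseteq> Y \<or> Y \<subseteq> X"
      by (auto simp: subset.chain_def)
    have "subspace (\<Union> C)"
      unfolding subspace_def
    proof (intro conjI ballI allI)
      show "0 \<in> \<Union> C" using C(1) CA subspace_0[OF estable_subspace] by blast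
      fix x y assume "x \<in> \<Union> C" "y \<in> \<Union> C"
      then obtain X Y where "X \<in> C" "Y \<in> C" "x \<in> X" "y \<in> Y" by blast
      then obtain Z where "Z \<in> C" "x \<in> Z" "y \<in> Z" using ch by blast
      then show "x + y \<in> \<Union> C" using CA subspace_add[OF estable_subspace] by blast
    next
      fix c x assume "x \<in> \<Union> C"
      then show "c *s x \<in> \<Union> C" using CA subspace_scale[OF estable_subspace] by blast
    qed
    moreover have "e i j u \<in> \<Union> C" if "i < n" "j < n" "u \<in> \<Union> C" for i j u
      using that CA estable_e by blast
    ultimately have "estable (\<Union> C)" by (auto simp: estable_def)
    then show "\<Union> C \<in> ?A" using CA C(1) by blast
  qed
  then obtain W' where W'A: "W' \<in> ?A" and maxA: "\<forall>X\<in>?A. W' \<subseteq> X \<longrightarrow> X = W'" by (rule bexE)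
  then have W': "estable W'" "W' \<subseteq> V" "W \<inter> W' = {0}" by simp_all
  have max: "X = W'" if "estable X" "X \<subseteq> V" "W \<inter> X = {0}" "W' \<subseteq> X" for X
    using bspec[OF maxA, of X] that by simp
  let ?sum = "\<lambda>A B. {w + w' | w w'. w \<in> A \<and> w' \<in> B}"
  have sum_estable: "estable (?sum A B)" if "estable A" "estable B" for A B
  proof -
    have "subspace (?sum A B)"
      using subspace_sums[OF estable_subspace[OF that(1)] estable_subspace[OF that(2)]] .
    moreover have "e i j u \<in> ?sum A B" if "i < n" "j < n" "u \<in> ?sum A B" for i j u
      using that \<open>estable A\<close> \<open>estable B\<close> by (auto simp: e_add) (metis estable_e)
    ultimately show ?thesis by (auto simp: estable_def)
  qed
  have U: "estable (?sum W W')" by (rule sum_estable[OF W(1) W'(1)])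
  have UV: "?sum W W' \<subseteq> V" using W(2) W'(2) subspace_add[OF V_sub] by blast
  have "V \<subseteq> ?sum W W'"
  proof (rule ccontr)
    assume "\<not> V \<subseteq> ?sum W W'"
    have "\<exists>v \<mu>. v \<in> V \<and> upkilled v \<and> wt \<mu> v \<and> v \<notin> ?sum W W'"
    proof (rule ccontr)
      assume "\<not> ?thesis"
      then have "(\<Union>v \<in> {v \<in> V. upkilled v \<and> (\<exists>\<mu>. wt \<mu> v)}. cl (span {v})) \<subseteq> ?sum W W'"
        using cl_singular_subset[OF U] by blast
      then have "singular_span \<subseteq> ?sum W W'"
        unfolding singular_span_def by (rule span_minimal[OF _ estable_subspace[OF U]])
      then show False using V_singular_span \<open>\<not> V \<subseteq> ?sum W W'\<close> by blast
    qed
    then obtain v \<mu> where v: "v \<in> V" "upkilled v" "wt \<mu> v" "v \<notin> ?sum W W'" by blast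
    let ?N = "cl (span {v})"
    have N: "estable ?N" using cl_singular_estable[OF v(2,3)] .
    have disj: "?sum W W' \<inter> ?N = {0}" by (rule cl_singular_simple[OF v(1-3) U v(4)])
    have "?sum W' ?N = W'"
    proof (rule max)
      show "estable (?sum W' ?N)" by (rule sum_estable[OF W'(1) N])
      show "?sum W' ?N \<subseteq> V"
        using W'(2) cl_singular_subset[OF V_estable v(1)] subspace_add[OF V_sub] by blast
      show "W' \<subseteq> ?sum W' ?N"
        using cl.zero[of "span {v}"] by force
      show "W \<inter> ?sum W' ?N = {0}"
      proof
        show "{0} \<subseteq> W \<inter> ?sum W' ?N"
          using subspace_0[OF estable_subspace[OF W(1)]] subspace_0[OF estable_subspace[OF W'(1)]] cl.zero[of "span {v}"]
          by force
        show "W \<inter> ?sum W' ?N \<subseteq> {0}"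
        proof safe
          fix w' c assume *: "w' + c \<in> W" "w' \<in> W'" "c \<in> ?N"
          have "c = (w' + c) + (- w')" by simp
          moreover have "- w' \<in> W'" using *(2) subspace_neg[OF estable_subspace[OF W'(1)]] by blast
          ultimately have "c \<in> ?sum W W'" using *(1) by blast
          then have "c = 0" using disj *(3) by blast
          then show "w' + c = 0" using * W'(3) by auto
        qed
      qed
    qed
    moreover have "v \<in> ?sum W' ?N"
      using subspace_0[OF estable_subspace[OF W'(1)]] cl.base[of v "span {v}"] span_base[of v "{v}"] by force
    ultimately have "v \<in> W'" by simp
    then show False using v(4) subspace_0[OF estable_subspace[OF W(1)]] by force
  qed
  then show thesis using that W' UV by blast
qed

end

section \<open>Simple highest weight modules\<close>

text \<open>The grading is encoded by its sign operator \<open>\<sigma>\<close>: graded subspaces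
  are the \<open>\<sigma>\<close>-stable ones, and even (odd) maps are those that commute
  (anticommute) with it. \<open>eigenvector\<close> is the form in which finite dimension over the
  complex numbers enters Schur's lemma.\<close>

locale hw_rep = fin_rep scale n Od R V
  for scale :: "complex \<Rightarrow> 'v::ab_group_add \<Rightarrow> 'v" (infixr "*s" 75) and n Od R V +
  fixes \<sigma> :: "'v \<Rightarrow> 'v" and \<nu> :: "nat \<Rightarrow> complex" and v0 :: 'v
  assumes \<sigma>_add: "\<sigma> (v + w) = \<sigma> v + \<sigma> w"
    and \<sigma>_scale: "\<sigma> (c *s v) = c *s \<sigma> v"
    and \<sigma>_\<sigma>: "\<sigma> (\<sigma> v) = v"
    and \<sigma>_V: "v \<in> V \<Longrightarrow> \<sigma> v \<in> V"
    and \<sigma>_R: "X \<in> G a \<Longrightarrow> \<sigma> (R a X v) = (if a then - 1 else 1) *s R a X (\<sigma> v)"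
    and simple: "subspace U \<Longrightarrow> U \<subseteq> V \<Longrightarrow> (\<And>a X u. X \<in> G a \<Longrightarrow> u \<in> U \<Longrightarrow> R a X u \<in> U) \<Longrightarrow>
      (\<And>u. u \<in> U \<Longrightarrow> \<sigma> u \<in> U) \<Longrightarrow> U = {0} \<or> U = V"
    and hw: "v0 \<in> V" "v0 \<noteq> 0" "upkilled v0" "wt \<nu> v0"
    and eigenvector: "(\<And>v w. v \<in> V \<Longrightarrow> w \<in> V \<Longrightarrow> F (v + w) = F v + F w) \<Longrightarrow>
      (\<And>c v. v \<in> V \<Longrightarrow> F (c *s v) = c *s F v) \<Longrightarrow> (\<And>v. v \<in> V \<Longrightarrow> F v \<in> V) \<Longrightarrow>
      \<exists>c w. w \<in> V \<and> w \<noteq> 0 \<and> F w = c *s w"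
begin

section \<open>The highest weight space and Schur's lemma\<close>

lemma \<sigma>_0: "\<sigma> 0 = 0"
  using \<sigma>_scale[of 0 0] by simp

lemma \<sigma>_uminus: "\<sigma> (- v) = - \<sigma> v"
  using \<sigma>_scale[of "- 1" v] by simp

lemma \<sigma>_even: "X \<in> carrier_mat n n \<Longrightarrow> \<sigma> (R False X v) = R False X (\<sigma> v)"
  and \<sigma>_odd: "X \<in> Od \<Longrightarrow> \<sigma> (R True X v) = - R True X (\<sigma> v)"
  using \<sigma>_R[of X False v] \<sigma>_R[of X True v] by simp_all

definition T :: "'v set" where "T = {w \<in> V. upkilled w \<and> wt \<nu> w}"

lemma T_V: "w \<in> T \<Longrightarrow> w \<in> V" and T_upkilled: "w \<in> T \<Longrightarrow> upkilled w" and T_wt: "w \<in> T \<Longrightarrow> wt \<nu> w"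
  by (auto simp: T_def)

lemma v0_T: "v0 \<in> T"
  using hw by (simp add: T_def)

lemma \<nu>_supp: "\<forall>i\<ge>n. \<nu> i = 0"
  using wt_supp[OF hw(4)] .

lemma zero_in_G: "0\<^sub>m n n \<in> G a \<longleftrightarrow> Od \<noteq> {} \<or> \<not> a"
proof (cases a)
  case True
  have "0\<^sub>m n n \<in> Od" if "X \<in> Od" for X
  proof -
    have "0 \<cdot>\<^sub>m X = 0\<^sub>m n n" using that Od_carrier by (intro eq_matI) auto
    then show ?thesis using part_smult[of X True 0] that by simp
  qed
  then show ?thesis using True by auto
qed simp

lemma R_dg_commute:
  assumes "dg n b \<in> G a"
  shows "R False (dg n c) (R a (dg n b) v) = R a (dg n b) (R False (dg n c) v)"
proof -
  have "supercomm False a (dg n c) (dg n b) = 0\<^sub>m n n"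
    by (simp add: supercomm_def dg_mult_dg mult.commute)
  moreover have "0\<^sub>m n n \<in> G a" using assms by (cases a) (auto simp: zero_in_G[of True, simplified])
  ultimately show ?thesis
    using R_swap[of "dg n c" False "dg n b" a v] assms by (simp add: R_zero_mat del: G_True)
qed

lemma wt_R_dg:
  assumes "wt \<mu> v" "dg n b \<in> G a"
  shows "wt \<mu> (R a (dg n b) v)"
  using assms(1) wt_supp[OF assms(1)]
  by (intro wtI_dg) (auto simp: R_dg_commute[OF assms(2)] wt_dg R_scale[OF assms(2)])

lemma wt_\<sigma>: "wt \<mu> v \<Longrightarrow> wt \<mu> (\<sigma> v)"
  by (auto simp: wt_def \<sigma>_even[symmetric] \<sigma>_scale)

lemma upkilled_\<sigma>: "upkilled v \<Longrightarrow> upkilled (\<sigma> v)"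
  unfolding upkilled_def
proof (intro allI impI)
  fix a X assume v: "\<forall>a X. X \<in> G a \<longrightarrow> X \<in> strictly_upper n \<longrightarrow> R a X v = 0"
    and X: "X \<in> G a" "X \<in> strictly_upper n"
  have "(if a then - 1 else 1) *s R a X (\<sigma> v) = 0" using \<sigma>_R[OF X(1), of v] v X by (simp add: \<sigma>_0 del: G_True G_False)
  then show "R a X (\<sigma> v) = 0" by (simp split: if_splits)
qed

lemma singular_space_closed:
  fixes \<mu> defines "U \<equiv> {w \<in> V. upkilled w \<and> wt \<mu> w}"
  assumes "\<forall>i\<ge>n. \<mu> i = 0"
  shows "subspace U" "\<And>a b v. dg n b \<in> G a \<Longrightarrow> v \<in> U \<Longrightarrow> R a (dg n b) v \<in> U" "\<And>v. v \<in> U \<Longrightarrow> \<sigma> v \<in> U"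
  using assms(2) V_sub unfolding U_def
  by (auto simp: subspace_def V_stable upkilled_dg wt_R_dg \<sigma>_V upkilled_\<sigma> wt_\<sigma>
      intro: wt_zero wt_add wt_scale upkilled_zero upkilled_add upkilled_scale simp del: G_True G_False)

lemmas T_sub = singular_space_closed(1)[OF \<nu>_supp, folded T_def]
  and T_diag = singular_space_closed(2)[OF \<nu>_supp, folded T_def]
  and T_\<sigma> = singular_space_closed(3)[OF \<nu>_supp, folded T_def]

lemma cl_simple:
  assumes U: "subspace U" "U \<subseteq> V" "\<And>v. v \<in> U \<Longrightarrow> upkilled v"
    and diag: "\<And>a b v. dg n b \<in> G a \<Longrightarrow> v \<in> U \<Longrightarrow> R a (dg n b) v \<in> U"
    and sig: "\<And>v. v \<in> U \<Longrightarrow> \<sigma> v \<in> U"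
    and nz: "v \<in> U" "v \<noteq> 0"
  shows "cl U = V"
proof -
  have "cl U \<subseteq> V" by (rule cl_minimal[OF U(2) V_sub]) (rule V_stable)
  moreover have "R a X u \<in> cl U" if "X \<in> G a" "u \<in> cl U" for a X u
    by (rule cl_stable[OF U(1,3) diag that(2,1)])
  moreover have "\<sigma> u \<in> cl U" if "u \<in> cl U" for u
    using that
  proof induction
    case (low v Y a)
    then show ?case using \<sigma>_R[OF low.hyps(2), of v] cl.low[of "\<sigma> v" U Y a] cl.scale by simp
  qed (auto simp: \<sigma>_0 \<sigma>_add \<sigma>_scale sig intro: cl.intros)
  ultimately have "cl U = {0} \<or> cl U = V"
    using simple[OF cl_subspace] by blast
  then show ?thesis using nz cl.base by blast
qed

lemma cl_T: "cl T = V"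
  using cl_simple[of T] T_sub T_diag T_\<sigma> v0_T hw(2) T_V T_upkilled by blast

lemma weight_in_V:
  assumes "w \<in> V" "wt \<mu> w" "w \<noteq> 0"
  shows "wle n \<mu> \<nu>" "\<mu> = \<nu> \<Longrightarrow> w \<in> T"
  using cl_weight[OF T_sub T_wt _ assms(2,3)] assms(1) cl_T by auto

lemma wt_\<nu>_T: "w \<in> V \<Longrightarrow> wt \<nu> w \<Longrightarrow> w \<in> T"
  using weight_in_V(2)[of w \<nu>] subspace_0[OF T_sub] by (cases "w = 0") auto

lemma V_weight_span: "V \<subseteq> span {w \<in> V. \<exists>\<mu>. wt \<mu> w}"
proof -
  have "V \<subseteq> span {y. \<exists>\<mu>. (wle n \<mu> \<nu> \<and> (\<forall>i\<ge>n. \<mu> i = 0)) \<and> y \<in> {y. wt \<mu> y \<and> y \<in> V \<and> (\<mu> = \<nu> \<longrightarrow> y \<in> T)}}"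
    using cl_weights[OF T_sub T_wt] unfolding cl_T .
  also have "\<dots> \<subseteq> span {w \<in> V. \<exists>\<mu>. wt \<mu> w}" by (rule span_mono) blast
  finally show ?thesis .
qed

text \<open>A nonzero \<open>U\<close> generates \<open>V\<close>, and in the generated module the
  vectors of weight \<open>\<nu>\<close> are those of \<open>U\<close> alone, by
  \<open>cl_weight\<close>.\<close>

lemma top_simple:
  assumes U: "subspace U" "U \<subseteq> T"
    and diag: "\<And>a b v. dg n b \<in> G a \<Longrightarrow> v \<in> U \<Longrightarrow> R a (dg n b) v \<in> U"
    and sig: "\<And>v. v \<in> U \<Longrightarrow> \<sigma> v \<in> U"
  shows "U = {0} \<or> U = T"
proof (rule disjCI)
  assume "U \<noteq> T"
  show "U = {0}"
  proof (rule ccontr)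
    assume "U \<noteq> {0}"
    then obtain v where "v \<in> U" "v \<noteq> 0" using subspace_0[OF U(1)] by blast
    then have "cl U = V"
      using cl_simple[OF U(1) _ _ diag sig] U(2) T_V T_upkilled by blast
    have "T \<subseteq> U"
    proof
      fix w assume w: "w \<in> T"
      show "w \<in> U"
        using cl_weight[OF U(1) _ _ T_wt[OF w]] U T_wt T_V[OF w] \<open>cl U = V\<close> subspace_0[OF U(1)]
        by (cases "w = 0") auto
    qed
    then show False using U(2) \<open>U \<noteq> T\<close> by blast
  qed
qed

text \<open>The singular vectors of weight \<open>\<mu>\<close> generate \<open>V\<close>, so
  \<open>\<nu>\<close> lies below \<open>\<mu>\<close> as well as above it.\<close>

lemma singular_weight:
  assumes w: "w \<in> V" "upkilled w" "wt \<mu> w" "w \<noteq> 0"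
  shows "\<mu> = \<nu>"
proof -
  let ?U = "{w \<in> V. upkilled w \<and> wt \<mu> w}"
  note U = singular_space_closed[OF wt_supp[OF w(3)]]
  have "cl ?U = V"
    using w by (intro cl_simple[OF U(1) _ _ U(2,3)]) auto
  then have "wle n \<nu> \<mu>"
    using cl_weight[OF U(1) _ _ hw(4,2)] hw(1) by auto
  then show ?thesis
    using wle_antisym[OF weight_in_V(1)[OF w(1,3,4)]] wt_supp[OF w(3)] \<nu>_supp by blast
qed

text \<open>\<open>F\<close> commutes with \<open>\<sigma>\<close>, so its eigenspaces are graded
  and simplicity in the graded sense applies to them.\<close>

lemma schur:
  assumes F: "\<And>v w. v \<in> V \<Longrightarrow> w \<in> V \<Longrightarrow> F (v + w) = F v + F w" "\<And>c v. v \<in> V \<Longrightarrow> F (c *s v) = c *s F v"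
    "\<And>v. v \<in> V \<Longrightarrow> F v \<in> V"
    and "\<And>a X v. X \<in> G a \<Longrightarrow> v \<in> V \<Longrightarrow> F (R a X v) = R a X (F v)" "\<And>v. v \<in> V \<Longrightarrow> F (\<sigma> v) = \<sigma> (F v)"
  obtains c where "\<And>v. v \<in> V \<Longrightarrow> F v = c *s v"
proof -
  obtain c w where w: "w \<in> V" "w \<noteq> 0" "F w = c *s w" using eigenvector[OF F] by blast
  let ?U = "{v \<in> V. F v = c *s v}"
  have "F 0 = 0" using F(2)[OF subspace_0[OF V_sub], of 0] by simp
  then have sub: "subspace ?U"
    using V_sub F(1,2) by (auto simp: subspace_def scale_right_distrib scale_left_commute)
  have "?U = {0} \<or> ?U = V"
  proof (rule simple[OF sub])
    fix a X u assume X: "X \<in> G a" and u: "u \<in> ?U"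
    then show "R a X u \<in> ?U" using assms(4)[OF X] V_stable[OF X] R_scale[OF X] by simp
  next
    fix u assume "u \<in> ?U"
    then show "\<sigma> u \<in> ?U" using assms(5) \<sigma>_V \<sigma>_scale by simp
  qed auto
  then have "?U = V" using w by blast
  then show thesis using that by blast
qed

text \<open>The conditions on \<open>f\<close> under which \<open>(p, q) \<mapsto> (X p + f X q, X q)\<close> is a supermodule,
  \<open>\<epsilon> = 1\<close> or \<open>-1\<close> according to whether the parity of the first summand is that of the second
  or the opposite one.\<close>

definition cocycle :: "complex \<Rightarrow> (bool \<Rightarrow> complex mat \<Rightarrow> 'v \<Rightarrow> 'v) \<Rightarrow> bool" where
  "cocycle \<epsilon> f \<longleftrightarrow> \<epsilon> * \<epsilon> = 1 \<and>
    (\<forall>a X. X \<in> G a \<longrightarrow>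
      (\<forall>v w. f a X (v + w) = f a X v + f a X w) \<and> (\<forall>c v. f a X (c *s v) = c *s f a X v) \<and>
      (\<forall>Y v. Y \<in> G a \<longrightarrow> f a (X + Y) v = f a X v + f a Y v) \<and> (\<forall>c v. f a (c \<cdot>\<^sub>m X) v = c *s f a X v) \<and>
      (\<forall>v\<in>V. f a X v \<in> V) \<and>
      (\<forall>v. \<epsilon> *s \<sigma> (f a X v) = (if a then - 1 else 1) *s f a X (\<sigma> v)) \<and>
      (\<forall>b Y v. Y \<in> G b \<longrightarrow> f (a \<noteq> b) (supercomm a b X Y) v = f a X (R b Y v) + R a X (f b Y v)
         + (if a \<and> b then 1 else - 1) *s (f b Y (R a X v) + R b Y (f a X v))))"

section \<open>Extension modules on pairs, and maps determined by the highest weight space\<close>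

lemma cocycle_zero: "\<epsilon> * \<epsilon> = 1 \<Longrightarrow> cocycle \<epsilon> (\<lambda>a X v. 0)"
  unfolding cocycle_def using subspace_0[OF V_sub] by (auto simp: R_zero \<sigma>_0 simp del: G_True G_False)

lemma pair_vector_space: "vector_space (\<lambda>c (p, q). (c *s p, c *s q))"
  by unfold_locales (auto simp: scale_right_distrib scale_left_distrib)

text \<open>The cocycle identity is the bracket relation for the first coordinate. The point is that
  generated submodules and their weights become available for the extension module.\<close>

lemma pair_tri_rep:
  assumes "cocycle \<epsilon> f"
  shows "tri_rep (\<lambda>c (p, q). (c *s p, c *s q)) n Od (\<lambda>a X (p, q). (R a X p + f a X q, R a X q))"
proof -
  interpret P: vector_space "\<lambda>c (p, q). (c *s p, c *s q)" by (rule pair_vector_space)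
  note c = assms[unfolded cocycle_def, THEN conjunct2, rule_format]
  show ?thesis
  proof (unfold_locales, goal_cases)
    case (9 a X v w)
    then show ?case using c[OF 9] R_add[OF 9] by (auto simp: split_beta algebra_simps simp del: G_True G_False)
  next
    case (10 a X d v)
    then show ?case using c[OF 10] R_scale[OF 10] by (auto simp: split_beta scale_right_distrib simp del: G_True G_False)
  next
    case (11 a X Y v)
    then show ?case using c[OF 11(1)] R_plus[OF 11] by (auto simp: split_beta algebra_simps simp del: G_True G_False)
  next
    case (12 a d X v)
    then show ?case using c[OF 12] R_smult[OF 12] by (auto simp: split_beta scale_right_distrib simp del: G_True G_False)
  next
    case (13 a b X Y v)
    have f: "f (a \<noteq> b) (supercomm a b X Y) w = f a X (R b Y w) + R a X (f b Y w)
         + (if a \<and> b then 1 else - 1) *s (f b Y (R a X w) + R b Y (f a X w))" for w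
      using c[OF 13(1)] 13(2) by blast
    show ?case
      using R_br[OF 13] f R_add[OF 13(1)] R_add[OF 13(2)]
      by (auto simp: split_beta algebra_simps simp del: G_True G_False)
  qed (fact Od_carrier, (fact Od_low Od_dg Od_up Od_unit part_add part_smult part_br)+)
qed

text \<open>A Goursat argument in the extension module: \<open>f_up\<close> makes the graph of
  \<open>t\<close> consist of singular vectors, and \<open>W\<close> is the submodule it generates.
  Its part inside the first summand is a graded submodule, proper because the vectors of weight
  \<open>\<nu>\<close> in \<open>W\<close> form just the graph of \<open>t\<close>; hence it is
  zero. The projection to the second summand is onto, so \<open>W\<close> is the graph of
  \<open>h\<close>.\<close>

lemma extend_from_top:
  assumes f: "cocycle \<epsilon> f"
    and f_up: "\<And>a X v. X \<in> G a \<Longrightarrow> X \<in> strictly_upper n \<Longrightarrow> v \<in> T \<Longrightarrow> f a X v = 0"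
    and t_add: "\<And>v w. v \<in> T \<Longrightarrow> w \<in> T \<Longrightarrow> t (v + w) = t v + t w"
    and t_scale: "\<And>c v. v \<in> T \<Longrightarrow> t (c *s v) = c *s t v"
    and t_T: "\<And>v. v \<in> T \<Longrightarrow> t v \<in> T"
    and t_\<sigma>: "\<And>v. v \<in> T \<Longrightarrow> t (\<sigma> v) = \<epsilon> *s \<sigma> (t v)"
    and t_diag: "\<And>a b v. dg n b \<in> G a \<Longrightarrow> v \<in> T \<Longrightarrow> t (R a (dg n b) v) = R a (dg n b) (t v) + f a (dg n b) v"
  obtains h where "\<And>v w. v \<in> V \<Longrightarrow> w \<in> V \<Longrightarrow> h (v + w) = h v + h w"
    "\<And>c v. v \<in> V \<Longrightarrow> h (c *s v) = c *s h v" "\<And>v. v \<in> V \<Longrightarrow> h v \<in> V"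
    "\<And>v. v \<in> T \<Longrightarrow> h v = t v" "\<And>v. v \<in> V \<Longrightarrow> h (\<sigma> v) = \<epsilon> *s \<sigma> (h v)"
    "\<And>a X v. X \<in> G a \<Longrightarrow> v \<in> V \<Longrightarrow> h (R a X v) = R a X (h v) + f a X v"
proof -
  let ?S = "\<lambda>c (p, q). (c *s p, c *s q)"
  let ?E = "\<lambda>a X (p, q). (R a X p + f a X q, R a X q)"
  interpret E: tri_rep ?S n Od ?E by (rule pair_tri_rep[OF f])
  note c = f[unfolded cocycle_def, THEN conjunct2, rule_format]
  have \<epsilon>: "\<epsilon> * \<epsilon> = 1" using f by (simp add: cocycle_def)
  have t0: "t 0 = 0" using t_scale[OF subspace_0[OF T_sub], of 0] by simp
  define gr where "gr = {(t q, q) | q. q \<in> T}"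
  define W where "W = E.cl gr"
  have gr_sub: "E.subspace gr"
    using T_sub unfolding E.subspace_def gr_def
    by (auto simp: subspace_def t0 t_add[symmetric] t_scale[symmetric] zero_prod_def)
  have gr_up: "E.upkilled x" if "x \<in> gr" for x
    using that T_upkilled t_T f_up unfolding E.upkilled_def gr_def
    by (auto simp: zero_prod_def upkilled_def simp del: G_True G_False)
  have gr_diag: "?E a (dg n b) x \<in> gr" if "dg n b \<in> G a" "x \<in> gr" for a b x
    using that T_diag t_diag unfolding gr_def by (auto simp del: G_True G_False)
  have W_stable: "?E a X x \<in> W" if "X \<in> G a" "x \<in> W" for a X x
    using E.cl_stable[OF gr_sub gr_up gr_diag _ that(1)] that(2) unfolding W_def by blast
  have W_sub: "E.subspace W" unfolding W_def by (rule E.cl_subspace)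
  have W_add: "x + y \<in> W" if "x \<in> W" "y \<in> W" for x y using E.subspace_add[OF W_sub that] .
  have W_scale: "(d *s p, d *s q) \<in> W" if "(p, q) \<in> W" for d p q
    using E.subspace_scale[OF W_sub that] by simp
  have W_0: "(0, 0) \<in> W" using E.subspace_0[OF W_sub] by (simp add: zero_prod_def)
  have W_V: "W \<subseteq> V \<times> V"
    unfolding W_def
  proof (rule E.cl_minimal)
    show "gr \<subseteq> V \<times> V" using t_T T_V by (auto simp: gr_def)
    show "E.subspace (V \<times> V)" using V_sub by (auto simp: E.subspace_def subspace_def zero_prod_def)
    fix a Y x assume "Y \<in> G a" "x \<in> V \<times> V"
    then show "?E a Y x \<in> V \<times> V" using V_stable c subspace_add[OF V_sub] by (cases x) (auto simp del: G_True G_False)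
  qed
  \<comment> \<open>The sign operator of the extension module is \<open>\<epsilon> \<sigma>\<close>
    on the first summand and \<open>\<sigma>\<close> on the second.\<close>
  have W_\<sigma>: "(\<epsilon> *s \<sigma> (fst x), \<sigma> (snd x)) \<in> W" if "x \<in> W" for x
    using that unfolding W_def
  proof induction
    case (base x)
    then show ?case using t_\<sigma> T_\<sigma> by (intro E.cl.base) (force simp: gr_def)
  next
    case zero
    then show ?case using W_0 by (simp add: \<sigma>_0 W_def)
  next
    case (add x y)
    then show ?case using E.cl.add[OF add.IH] by (simp add: \<sigma>_add scale_right_distrib)
  next
    case (scale x d)
    have "?S d (\<epsilon> *s \<sigma> (fst x), \<sigma> (snd x)) \<in> E.cl gr" by (rule E.cl.scale[OF scale.IH])
    moreover have "?S d (\<epsilon> *s \<sigma> (fst x), \<sigma> (snd x)) = (\<epsilon> *s \<sigma> (fst (?S d x)), \<sigma> (snd (?S d x)))"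
      by (simp only: split_beta fst_conv snd_conv \<sigma>_scale scale_left_commute)
    ultimately show ?case by (simp only:)
  next
    case (low x Y a)
    let ?s = "(if a then - 1 else 1) :: complex"
    have 1: "\<sigma> (R a Y w) = ?s *s R a Y (\<sigma> w)" "\<epsilon> *s \<sigma> (f a Y w) = ?s *s f a Y (\<sigma> w)" for w
      using \<sigma>_R[OF low.hyps(2)] c[OF low.hyps(2)] by blast+
    have "?S ?s (?E a Y (\<epsilon> *s \<sigma> (fst x), \<sigma> (snd x))) \<in> E.cl gr"
      by (intro E.cl.scale E.cl.low low)
    moreover have "?S ?s (?E a Y (\<epsilon> *s \<sigma> (fst x), \<sigma> (snd x)))
        = (\<epsilon> *s \<sigma> (fst (?E a Y x)), \<sigma> (snd (?E a Y x)))"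
      by (simp only: split_beta fst_conv snd_conv \<sigma>_add scale_right_distrib 1 R_scale[OF low.hyps(2)]
          scale_left_commute)
    ultimately show ?case by (simp only:)
  qed
  have W_T: "x \<in> gr" if "x \<in> W" "E.wt \<nu> x" for x
  proof (cases "x = 0")
    case True then show ?thesis using E.subspace_0[OF gr_sub] by simp
  next
    case False
    have gr_wt: "E.wt \<nu> y" if y: "y \<in> gr" for y
    proof -
      obtain q where q: "y = (t q, q)" "q \<in> T" using y by (auto simp: gr_def)
      \<comment> \<open>\<open>t\<close> maps \<open>T\<close> to itself and thus preserves the
        weight; compatibility with the even diagonal leaves no room for \<open>f\<close>.\<close>
      have "f False (munit n i i) q = 0" if "i < n" for i
      proof -
        have "t (R False (munit n i i) q) = R False (munit n i i) (t q) + f False (munit n i i) q"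
          unfolding munit_diag_eq_dg using q(2) by (intro t_diag) simp_all
        then show ?thesis using T_wt[OF q(2)] T_wt[OF t_T[OF q(2)]] that t_scale[OF q(2)] by (simp add: wt_def)
      qed
      then show ?thesis
        using T_wt[OF q(2)] T_wt[OF t_T[OF q(2)]] unfolding E.wt_def wt_def by (simp add: q(1))
    qed
    show ?thesis using E.cl_weight[OF gr_sub gr_wt _ that(2) False] that(1) by (simp add: W_def)
  qed
  \<comment> \<open>\<open>?K\<close> measures how far \<open>W\<close> is from being a graph,
    \<open>?P\<close> is the domain of that graph.\<close>
  let ?K = "{p. (p, 0) \<in> W}" and ?P = "{q. \<exists>p. (p, q) \<in> W}"
  have "?K = {0} \<or> ?K = V"
  proof (rule simple)
    show "subspace ?K"
      using W_0 W_add[of "(_, 0)" "(_, 0)"] W_scale[of _ 0] by (auto simp: subspace_def)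
    show "?K \<subseteq> V" using W_V by blast
    fix a X u assume X: "X \<in> G a" and u: "u \<in> ?K"
    have "f a X 0 = 0" using c[OF X] scale_zero_left by metis
    then show "R a X u \<in> ?K" using W_stable[OF X, of "(u, 0)"] u by (simp add: R_zero[OF X])
  next
    fix u assume "u \<in> ?K"
    then have "(\<epsilon> *s \<sigma> u, 0) \<in> W" using W_\<sigma>[of "(u, 0)"] by (simp add: \<sigma>_0)
    then show "\<sigma> u \<in> ?K" using W_scale[of "\<epsilon> *s \<sigma> u" 0 \<epsilon>] \<epsilon> by simp
  qed
  moreover have "?K \<noteq> V"
  proof
    assume "?K = V"
    then have v0W: "(v0, 0) \<in> W" using hw(1) by blast
    have f0: "f False X 0 = 0" if "X \<in> carrier_mat n n" for X
      using c[of X False] that scale_zero_left by (metis G_False)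
    have "E.wt \<nu> (v0, 0)" using hw(4) unfolding E.wt_def wt_def by (simp add: R_zero f0)
    then have "(v0, 0) \<in> gr" using W_T v0W by blast
    then show False using hw(2) t0 by (auto simp: gr_def)
  qed
  ultimately have K: "?K = {0}" by blast
  have "?P = {0} \<or> ?P = V"
  proof (rule simple)
    show "subspace ?P"
      unfolding subspace_def using W_0 W_add W_scale by (auto simp: subspace_def) (metis add_Pair, blast)
    show "?P \<subseteq> V" using W_V by blast
    fix a X u assume X: "X \<in> G a" and "u \<in> ?P"
    then obtain p where "(p, u) \<in> W" by blast
    from W_stable[OF X this] show "R a X u \<in> ?P" by auto
  next
    fix u assume "u \<in> ?P"
    then show "\<sigma> u \<in> ?P" using W_\<sigma> by force
  qed
  moreover have "v0 \<in> ?P" using v0_T unfolding W_def gr_def by (blast intro: E.cl.base)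
  ultimately have P: "?P = V" using hw(2) by blast
  have uniq: "p = p'" if "(p, q) \<in> W" "(p', q) \<in> W" for p p' q
  proof -
    have "(p, q) + (- 1 *s p', - 1 *s q) \<in> W" by (rule W_add[OF that(1) W_scale[OF that(2)]])
    then have "p - p' \<in> ?K" by simp
    then show ?thesis using K by simp
  qed
  define h where "h q = (SOME p. (p, q) \<in> W)" for q
  have hW: "(h q, q) \<in> W" if "q \<in> V" for q
    using that P unfolding h_def by (metis (mono_tags, lifting) mem_Collect_eq someI_ex)
  have hI: "h q = p" if "(p, q) \<in> W" for p q
    using uniq[OF hW that] that W_V by blast
  show thesis
  proof
    fix v w c assume v: "v \<in> V"
    show "h (c *s v) = c *s h v" by (rule hI[OF W_scale[OF hW[OF v]]])
    show "h v \<in> V" using hW[OF v] W_V by blast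
    show "h (\<sigma> v) = \<epsilon> *s \<sigma> (h v)" using W_\<sigma>[OF hW[OF v]] by (intro hI) simp
    assume w: "w \<in> V"
    show "h (v + w) = h v + h w" using W_add[OF hW[OF v] hW[OF w]] by (intro hI) simp
  next
    fix v assume "v \<in> T"
    then show "h v = t v" unfolding W_def gr_def by (intro hI) (auto simp: W_def gr_def intro: E.cl.base)
  next
    fix a X v assume X: "X \<in> G a" and v: "v \<in> V"
    show "h (R a X v) = R a X (h v) + f a X v" using W_stable[OF X hW[OF v]] by (intro hI) simp
  qed
qed

text \<open>Extension with the zero cocycle turns \<open>t\<close> into an endomorphism of
  \<open>V\<close>, to which \<open>schur\<close> applies.\<close>

lemma top_schur:
  assumes t: "\<And>v w. v \<in> T \<Longrightarrow> w \<in> T \<Longrightarrow> t (v + w) = t v + t w" "\<And>c v. v \<in> T \<Longrightarrow> t (c *s v) = c *s t v"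
    "\<And>v. v \<in> T \<Longrightarrow> t v \<in> T" "\<And>v. v \<in> T \<Longrightarrow> t (\<sigma> v) = \<sigma> (t v)"
    and diag: "\<And>a b v. dg n b \<in> G a \<Longrightarrow> v \<in> T \<Longrightarrow> t (R a (dg n b) v) = R a (dg n b) (t v)"
  obtains c where "\<And>v. v \<in> T \<Longrightarrow> t v = c *s v"
proof -
  have "cocycle 1 (\<lambda>a X v. 0)" by (rule cocycle_zero) simp
  then obtain h where h: "\<And>v w. v \<in> V \<Longrightarrow> w \<in> V \<Longrightarrow> h (v + w) = h v + h w"
    "\<And>c v. v \<in> V \<Longrightarrow> h (c *s v) = c *s h v" "\<And>v. v \<in> V \<Longrightarrow> h v \<in> V"
    "\<And>v. v \<in> T \<Longrightarrow> h v = t v" "\<And>v. v \<in> V \<Longrightarrow> h (\<sigma> v) = 1 *s \<sigma> (h v)"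
    "\<And>a X v. X \<in> G a \<Longrightarrow> v \<in> V \<Longrightarrow> h (R a X v) = R a X (h v) + 0"
    by (rule extend_from_top[where t = t]) (use t diag in \<open>auto simp del: G_True G_False\<close>)
  obtain c where "\<And>v. v \<in> V \<Longrightarrow> h v = c *s v"
    by (rule schur[of h]) (use h in \<open>auto simp del: G_True G_False\<close>)
  then show thesis using that h(4) T_V by metis
qed

end

section \<open>Orthogonal bases of hyperplanes\<close>

definition dform :: "nat \<Rightarrow> (nat \<Rightarrow> complex) \<Rightarrow> (nat \<Rightarrow> complex) \<Rightarrow> (nat \<Rightarrow> complex) \<Rightarrow> complex" where
  "dform n r b c = (\<Sum>i<n. b i * c i * r i)"

primrec orthogonal_list :: "nat \<Rightarrow> (nat \<Rightarrow> complex) \<Rightarrow> (nat \<Rightarrow> complex) list \<Rightarrow> bool" where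
  "orthogonal_list n r [] \<longleftrightarrow> True"
| "orthogonal_list n r (b # bs) \<longleftrightarrow>
    dform n r b b \<noteq> 0 \<and> (\<forall>c\<in>set bs. dform n r b c = 0) \<and> orthogonal_list n r bs"

definition zero_sum :: "nat set \<Rightarrow> (nat \<Rightarrow> complex) set" where
  "zero_sum S = {b. (\<forall>i. i \<notin> S \<longrightarrow> b i = 0) \<and> (\<Sum>i\<in>S. b i) = 0}"

text \<open>The linear span in the shape \<open>c * b + w\<close>, so that passing from
  \<open>B\<close> to its span is a single inductive step.\<close>

inductive lincomb :: "(nat \<Rightarrow> complex) set \<Rightarrow> (nat \<Rightarrow> complex) \<Rightarrow> bool" for B where
  zero: "lincomb B (\<lambda>_. 0)"
| step: "b \<in> B \<Longrightarrow> lincomb B w \<Longrightarrow> lincomb B (\<lambda>i. c * b i + w i)"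

lemma lincomb_mono: "lincomb B w \<Longrightarrow> B \<subseteq> C \<Longrightarrow> lincomb C w"
  by (induction rule: lincomb.induct) (auto intro: lincomb.intros)

lemma dform_commute: "dform n r b c = dform n r c b"
  by (simp add: dform_def mult.commute)

lemma dform_restrict:
  assumes "S \<subseteq> {..<n}" "\<And>i. i \<notin> S \<Longrightarrow> b i = 0"
  shows "dform n r b c = (\<Sum>i\<in>S. b i * c i * r i)"
  unfolding dform_def by (rule sum.mono_neutral_right) (use assms in auto)

lemma zero_sum_mono: "S \<subseteq> S' \<Longrightarrow> finite S' \<Longrightarrow> b \<in> zero_sum S \<Longrightarrow> b \<in> zero_sum S'"
  unfolding zero_sum_def using sum.mono_neutral_right[of S' S b] by auto

lemma zero_sum_delta:
  assumes "i \<in> S" "j \<in> S" "finite S"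
  shows "(\<lambda>k. (if k = i then 1 else 0) - (if k = j then 1 else 0)) \<in> zero_sum S"
  using assms by (auto simp: zero_sum_def sum_subtractf)

text \<open>If every sum with one index removed vanished, each \<open>1 / r j\<close> would equal
  the total sum, which would then equal \<open>card S\<close> times itself.\<close>

lemma reciprocal_sum_remove:
  fixes r :: "nat \<Rightarrow> complex"
  assumes "finite S" "(\<Sum>i\<in>S. 1 / r i) \<noteq> 0" "card S \<noteq> 1"
  obtains j where "j \<in> S" "(\<Sum>i\<in>S - {j}. 1 / r i) \<noteq> 0"
proof -
  let ?s = "\<Sum>i\<in>S. 1 / r i"
  have "\<exists>j\<in>S. (\<Sum>i\<in>S - {j}. 1 / r i) \<noteq> 0"
  proof (rule ccontr)
    assume neg: "\<not> ?thesis"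
    have each: "1 / r j = ?s" if "j \<in> S" for j
    proof -
      have "(\<Sum>i\<in>S - {j}. 1 / r i) = 0" using neg that by blast
      then show ?thesis using sum.remove[OF assms(1) that, of "\<lambda>i. 1 / r i"] by (simp only: add_0_right)
    qed
    have "?s = (\<Sum>i\<in>S. ?s)" by (rule sum.cong[OF refl each])
    also have "\<dots> = of_nat (card S) * ?s" by (rule sum_constant)
    finally have "of_nat (card S) = (1 :: complex)" using assms(2) by (metis mult_cancel_right1)
    then show False using assms(3) by (metis of_nat_eq_1_iff)
  qed
  then show thesis using that by blast
qed

text \<open>A nonzero sum of reciprocals means that the form is nondegenerate on the hyperplane.
  \<open>reciprocal_sum_remove\<close> preserves this when an index is dropped, and one vector
  orthogonal to the smaller hyperplane completes the basis.\<close>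

lemma orthogonal_basis:
  assumes "finite S" "S \<subseteq> {..<n}" "\<And>i. i \<in> S \<Longrightarrow> r i \<noteq> 0" "(\<Sum>i\<in>S. 1 / r i) \<noteq> 0"
  shows "\<exists>bs. Suc (length bs) = card S \<and> orthogonal_list n r bs \<and> set bs \<subseteq> zero_sum S \<and>
    (\<forall>b\<in>zero_sum S. lincomb (set bs) b)"
  using assms
proof (induction S rule: finite_psubset_induct)
  case (psubset S)
  show ?case
  proof (cases "card S = 1")
    case True
    then obtain j where "S = {j}" by (rule card_1_singletonE)
    then have "b = (\<lambda>_. 0)" if "b \<in> zero_sum S" for b
      using that by (auto simp: zero_sum_def)
    then show ?thesis using True by (intro exI[of _ "[]"]) (auto intro: lincomb.zero)
  next
    case False
    obtain j where j: "j \<in> S" "(\<Sum>i\<in>S - {j}. 1 / r i) \<noteq> 0"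
      using reciprocal_sum_remove[OF psubset.hyps(1) psubset.prems(3) False] by blast
    let ?S = "S - {j}"
    let ?s = "\<Sum>i\<in>?S. 1 / r i"
    have fin: "finite ?S" using psubset.hyps(1) by simp
    obtain bs where bs: "Suc (length bs) = card ?S" "orthogonal_list n r bs" "set bs \<subseteq> zero_sum ?S"
      "\<And>b. b \<in> zero_sum ?S \<Longrightarrow> lincomb (set bs) b"
      using psubset.IH[of ?S] j psubset.prems by blast
    \<comment> \<open>\<open>r i * x i = 1\<close> on the remaining indices makes \<open>x\<close>
      orthogonal to the smaller hyperplane, and the entry \<open>- ?s\<close> makes it sum to zero.
      Its square is \<open>?s * r j\<close> times the reciprocal sum over \<open>S\<close>.\<close>
    define x where "x i = (if i = j then - ?s else if i \<in> S then 1 / r i else 0)" for i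
    have S_eq: "S = insert j ?S" using j by blast
    have sumS: "(\<Sum>i\<in>S. g i) = g j + (\<Sum>i\<in>?S. g i)" for g :: "nat \<Rightarrow> complex"
      using sum.remove[OF psubset.hyps(1) j(1)] .
    have xS: "(\<Sum>i\<in>?S. x i * h i) = (\<Sum>i\<in>?S. h i / r i)" for h
      by (intro sum.cong) (auto simp: x_def)
    have x_zero: "x \<in> zero_sum S"
      using xS[of "\<lambda>_. 1"] j(1) by (simp add: zero_sum_def sumS) (simp add: x_def)
    have x_out: "x i = 0" if "i \<notin> S" for i using that j by (auto simp: x_def)
    have "dform n r x x = x j * x j * r j + (\<Sum>i\<in>?S. x i * (x i * r i))"
      by (subst dform_restrict[OF psubset.prems(1) x_out]) (simp_all add: sumS mult.assoc)
    also have "(\<Sum>i\<in>?S. x i * (x i * r i)) = ?s"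
      unfolding xS using psubset.prems(2) by (intro sum.cong) (auto simp: x_def)
    also have "x j * x j * r j + ?s = ?s * r j * (1 / r j + ?s)"
      using psubset.prems(2)[OF j(1)] by (simp add: x_def field_simps)
    also have "1 / r j + ?s = (\<Sum>i\<in>S. 1 / r i)" using sumS by simp
    finally have q: "dform n r x x \<noteq> 0"
      using j(2) psubset.prems(2)[OF j(1)] psubset.prems(3) by (metis mult_eq_0_iff)
    have orth: "dform n r x c = 0" if "c \<in> zero_sum ?S" for c
    proof -
      have "dform n r x c = x j * c j * r j + (\<Sum>i\<in>?S. x i * (c i * r i))"
        by (subst dform_restrict[OF psubset.prems(1) x_out]) (simp_all add: sumS mult.assoc)
      also have "(\<Sum>i\<in>?S. x i * (c i * r i)) = (\<Sum>i\<in>?S. c i)"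
        unfolding xS using psubset.prems(2) by (intro sum.cong) auto
      finally show ?thesis using that by (simp add: zero_sum_def)
    qed
    have span: "lincomb (set (x # bs)) b" if b: "b \<in> zero_sum S" for b
    proof -
      let ?c = "- b j / ?s"
      define b' where "b' i = b i - ?c * x i" for i
      have "b' \<in> zero_sum ?S"
      proof -
        have "b' j = 0" using j(2) by (simp add: b'_def x_def)
        moreover have "(\<Sum>i\<in>S. b' i) = 0"
          using b x_zero unfolding b'_def sum_subtractf sum_distrib_left[symmetric] zero_sum_def by simp
        moreover have "b' i = 0" if "i \<notin> S" for i using b x_out[OF that] that by (simp add: b'_def zero_sum_def)
        ultimately show ?thesis using sumS[of b'] by (auto simp: zero_sum_def)
      qed
      then have "lincomb (set (x # bs)) b'" using bs(4) by (auto intro: lincomb_mono)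
      then have "lincomb (set (x # bs)) (\<lambda>i. ?c * x i + b' i)" by (intro lincomb.step) auto
      then show ?thesis by (simp add: b'_def)
    qed
    have "Suc (length (x # bs)) = card S"
      unfolding card.remove[OF psubset.hyps(1) j(1)] using bs(1) by simp
    moreover have "set (x # bs) \<subseteq> zero_sum S"
      using x_zero bs(3) zero_sum_mono[of ?S S] psubset.hyps(1) by auto
    moreover have "orthogonal_list n r (x # bs)" using q orth bs(2,3) by auto
    ultimately show ?thesis using span by (intro exI[of _ "x # bs"] conjI ballI)
  qed
qed

text \<open>Once some \<open>r j\<close> vanishes, no condition on reciprocals is needed:
  \<open>e_i - e_j\<close> has square \<open>r i\<close> and is orthogonal to every vector that
  vanishes at \<open>i\<close>.\<close>

lemma orthogonal_basis_mod_radical: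
  assumes "finite A" "A \<union> S \<subseteq> {..<n}" "A \<inter> S = {}" "\<And>i. i \<in> A \<Longrightarrow> r i \<noteq> 0"
    and S: "\<And>i. i \<in> S \<Longrightarrow> r i = 0" "j \<in> S"
  shows "\<exists>bs. orthogonal_list n r bs \<and> set bs \<subseteq> zero_sum (A \<union> S) \<and>
    (\<forall>b\<in>zero_sum (A \<union> S). lincomb (set bs \<union> zero_sum S) b)"
  using assms(1-4)
proof (induction A rule: finite_induct)
  case empty
  have "lincomb (zero_sum S) b" if "b \<in> zero_sum S" for b
    using lincomb.step[OF that lincomb.zero, of 1] by simp
  then show ?case by (intro exI[of _ "[]"]) auto
next
  case (insert i A)
  have finS: "finite S" using insert.prems(1) finite_subset by auto
  obtain bs where bs: "orthogonal_list n r bs" "set bs \<subseteq> zero_sum (A \<union> S)"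
    "\<And>b. b \<in> zero_sum (A \<union> S) \<Longrightarrow> lincomb (set bs \<union> zero_sum S) b"
    using insert by auto
  define x where "x = (\<lambda>k. (if k = i then 1 else 0) - (if k = j then 1 else (0::complex)))"
  have ij: "i \<noteq> j" "i < n" "j < n" "i \<notin> A \<union> S" using insert S(2) by auto
  have x_zero: "x \<in> zero_sum (insert i A \<union> S)"
    unfolding x_def using insert.hyps(1) finS S(2) by (intro zero_sum_delta) auto
  have dx: "dform n r x c = c i * r i" for c
  proof -
    have "dform n r x c = (\<Sum>k<n. (if k = i then c k * r k else 0) - (if k = j then c k * r k else 0))"
      unfolding dform_def by (intro sum.cong) (auto simp: x_def)
    then show ?thesis using ij S by (simp add: sum_subtractf)
  qed
  have span: "lincomb (set (x # bs) \<union> zero_sum S) b" if b: "b \<in> zero_sum (insert i A \<union> S)" for b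
  proof -
    define b' where "b' k = b k - b i * x k" for k
    have "b' \<in> zero_sum (A \<union> S)"
    proof -
      have z: "b' i = 0" using ij by (simp add: b'_def x_def)
      moreover have "(\<Sum>k\<in>insert i A \<union> S. b' k) = 0"
        using b x_zero unfolding b'_def sum_subtractf sum_distrib_left[symmetric] zero_sum_def by simp
      moreover have "b' k = 0" if "k \<notin> A \<union> S" for k
        using b x_zero that z by (cases "k = i") (simp_all add: b'_def zero_sum_def)
      ultimately show ?thesis using ij insert.hyps(1) finS by (auto simp: zero_sum_def)
    qed
    then have "lincomb (set (x # bs) \<union> zero_sum S) b'" using bs(3) by (auto intro: lincomb_mono)
    then have "lincomb (set (x # bs) \<union> zero_sum S) (\<lambda>k. b i * x k + b' k)" by (intro lincomb.step) auto
    then show ?thesis by (simp add: b'_def)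
  qed
  have "x i = 1" using ij by (simp add: x_def)
  then have "dform n r x x \<noteq> 0" using insert.prems(3) by (simp add: dx)
  moreover have "dform n r x c = 0" if "c \<in> set bs" for c
    using that bs(2) ij by (auto simp: dx zero_sum_def)
  moreover have "set (x # bs) \<subseteq> zero_sum (insert i A \<union> S)"
    using x_zero bs(2) zero_sum_mono[of "A \<union> S" "insert i A \<union> S"] insert.hyps(1) finS by auto
  ultimately show ?case using bs(1) span by (intro exI[of _ "x # bs"] conjI ballI) simp_all
qed

text \<open>Differences of adjacent coordinates suffice; only for these does
  \<open>zero_pair\<close> supply information. The last coordinate is cleared in each step of the
  induction.\<close>

lemma zero_sum_interval:
  "b \<in> zero_sum {k..<k + m} \<Longrightarrow>
    lincomb {\<lambda>j. (if j = i then 1 else 0) - (if j = Suc i then 1 else 0) | i. k \<le> i \<and> Suc i < k + m} b"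
proof (induction m arbitrary: b)
  case 0
  then have "b = (\<lambda>_. 0)" by (auto simp: zero_sum_def)
  then show ?case by (simp add: lincomb.zero)
next
  case (Suc m)
  show ?case
  proof (cases m)
    case 0
    then have "b = (\<lambda>_. 0)" using Suc.prems by (auto simp: zero_sum_def)
    then show ?thesis by (simp add: lincomb.zero)
  next
    case (Suc l)
    let ?u = "\<lambda>j. (if j = k + l then 1 else 0) - (if j = Suc (k + l) then 1 else (0::complex))"
    define b' where "b' j = b j + b (Suc (k + l)) * ?u j" for j
    have u: "?u \<in> zero_sum {k..<k + Suc m}" using Suc by (intro zero_sum_delta) auto
    have "b' \<in> zero_sum {k..<k + m}"
    proof -
      have z: "b' (k + m) = 0" using Suc by (simp add: b'_def)
      have "(\<Sum>j\<in>{k..<k + Suc m}. b' j) = 0"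
        using Suc.prems u unfolding b'_def sum.distrib sum_distrib_left[symmetric] zero_sum_def by simp
      then have "(\<Sum>j\<in>{k..<k + m}. b' j) = 0" using z by simp
      moreover have "b' j = 0" if "j \<notin> {k..<k + m}" for j
      proof (cases "j = k + m")
        case False
        then show ?thesis using Suc.prems u that by (auto simp: b'_def zero_sum_def)
      qed (use z in simp)
      ultimately show ?thesis by (simp add: zero_sum_def)
    qed
    have *: "lincomb {\<lambda>j. (if j = i then 1 else 0) - (if j = Suc i then 1 else 0) | i. k \<le> i \<and> Suc i < k + Suc m} b'"
      by (rule lincomb_mono[OF Suc.IH[OF \<open>b' \<in> zero_sum {k..<k + m}\<close>]]) auto
    have "lincomb {\<lambda>j. (if j = i then 1 else 0) - (if j = Suc i then 1 else 0) | i. k \<le> i \<and> Suc i < k + Suc m}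
      (\<lambda>j. (- b (Suc (k + l))) * ?u j + b' j)"
      by (rule lincomb.step[OF _ *]) (use Suc in auto)
    then show ?thesis by (simp add: b'_def)
  qed
qed

section \<open>The highest weight space as a Clifford module\<close>

context hw_rep
begin

abbreviation y :: "(nat \<Rightarrow> complex) \<Rightarrow> 'v \<Rightarrow> 'v" where "y b \<equiv> R True (dg n b)"

lemma y_T: "dg n b \<in> Od \<Longrightarrow> v \<in> T \<Longrightarrow> y b v \<in> T"
  using T_diag[of b True] by simp

lemma y_add: "dg n b \<in> Od \<Longrightarrow> y b (v + w) = y b v + y b w"
  and y_scale: "dg n b \<in> Od \<Longrightarrow> y b (c *s v) = c *s y b v"
  and y_diff: "dg n b \<in> Od \<Longrightarrow> y b (v - w) = y b v - y b w"
  and y_uminus: "dg n b \<in> Od \<Longrightarrow> y b (- v) = - y b v"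
  and y_0: "dg n b \<in> Od \<Longrightarrow> y b 0 = 0"
  by (simp_all add: R_add R_scale R_diff R_zero R_uminus)

lemma y_lin: "dg n b \<in> Od \<Longrightarrow> dg n w \<in> Od \<Longrightarrow> y (\<lambda>i. c * b i + w i) v = c *s y b v + y w v"
  using R_plus[of "c \<cdot>\<^sub>m dg n b" True "dg n w" v] R_smult[of "dg n b" True c v] part_smult[of "dg n b" True c]
  by (simp add: dg_add dg_smult)

lemma y_zero_fun: "dg n b \<in> Od \<Longrightarrow> y (\<lambda>_. 0) v = 0"
  using R_smult[of "dg n b" True 0 v] by (simp add: dg_smult)

lemma dg_lin_Od: "dg n b \<in> Od \<Longrightarrow> dg n w \<in> Od \<Longrightarrow> dg n (\<lambda>i. c * b i + w i) \<in> Od"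
  using part_add[of "c \<cdot>\<^sub>m dg n b" True "dg n w"] part_smult[of "dg n b" True c]
  by (simp add: dg_add dg_smult)

text \<open>The bracket of two odd diagonal elements is the even diagonal element with entries
  \<open>2 * b i * c i\<close>, which acts on \<open>T\<close> by its weight.\<close>

lemma clifford:
  assumes "dg n b \<in> Od" "dg n c \<in> Od" "v \<in> T"
  shows "y b (y c v) = (2 * dform n \<nu> b c) *s v - y c (y b v)"
proof -
  have "R False (supercomm True True (dg n b) (dg n c)) v = (2 * dform n \<nu> b c) *s v"
    unfolding supercomm_def dg_mult_dg
    by (simp add: dg_add wt_dg[OF T_wt[OF assms(3)]] dform_def sum_distrib_left algebra_simps)
  then show ?thesis
    using R_br[of "dg n b" True "dg n c" True v] assms by (simp add: algebra_simps)
qed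

lemma clifford_square:
  assumes "dg n b \<in> Od" "v \<in> T"
  shows "y b (y b v) = dform n \<nu> b b *s v"
proof -
  have "2 *s y b (y b v) = 2 *s dform n \<nu> b b *s v"
    using clifford[OF assms(1,1,2)] by (simp add: scale_left_distrib[of 1 1, simplified] eq_diff_eq)
  then show ?thesis by (simp only: scale_cancel_left) simp
qed

text \<open>\<open>y u\<close> anticommutes with all \<open>y b\<close> and squares to zero, so its
  image is a graded subspace of \<open>T\<close> stable under the diagonal elements. By
  \<open>top_simple\<close> it is \<open>{0}\<close> or \<open>T\<close>, and nilpotency excludes
  \<open>T\<close>.\<close>

lemma radical_acts_trivially:
  assumes u: "dg n u \<in> Od" and rad: "\<And>b. dg n b \<in> Od \<Longrightarrow> dform n \<nu> b u = 0" and v: "v \<in> T"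
  shows "y u v = 0"
proof -
  have anti: "y b (y u w) = - y u (y b w)" if "dg n b \<in> Od" "w \<in> T" for b w
    using clifford[OF that(1) u that(2)] rad[OF that(1)] by simp
  have sq: "y u (y u w) = 0" if "w \<in> T" for w
    using clifford_square[OF u that] rad[OF u] by simp
  let ?U = "y u ` T"
  have "?U = {0} \<or> ?U = T"
  proof (rule top_simple)
    show "subspace ?U"
    proof -
      have "0 \<in> ?U" using y_0[OF u] subspace_0[OF T_sub] by (metis imageI)
      then show ?thesis
        using T_sub by (auto simp: subspace_def y_add[OF u, symmetric] y_scale[OF u, symmetric])
    qed
    show "?U \<subseteq> T" using y_T[OF u] by blast
    fix a b v assume b: "dg n b \<in> G a" and "v \<in> ?U"
    then obtain w where w: "v = y u w" "w \<in> T" by blast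
    show "R a (dg n b) v \<in> ?U"
    proof (cases a)
      case True
      then have "R a (dg n b) v = y u (- y b w)" using w b anti by (simp add: y_uminus[OF u])
      then show ?thesis using y_T[of b w] b True w(2) subspace_neg[OF T_sub] by auto
    next
      case False
      have "R False (dg n b) v = y u (R False (dg n b) w)"
        unfolding w(1) using u by (intro R_dg_commute) simp
      then show ?thesis using T_diag[of b False w] w(2) False by simp
    qed
  next
    fix v assume "v \<in> ?U"
    then obtain w where w: "v = y u w" "w \<in> T" by blast
    have "\<sigma> v = y u (- \<sigma> w)" using w \<sigma>_odd[OF u] y_uminus[OF u] by simp
    then show "\<sigma> v \<in> ?U" using T_\<sigma>[OF w(2)] subspace_neg[OF T_sub] by auto
  qed
  moreover have False if "?U = T"
  proof -
    obtain w where "v0 = y u w" "w \<in> T" using v0_T \<open>?U = T\<close> by blast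
    moreover obtain w' where "w = y u w'" "w' \<in> T" using \<open>w \<in> T\<close> \<open>?U = T\<close> by blast
    ultimately show False using sq hw(2) by simp
  qed
  ultimately show ?thesis using v by blast
qed

text \<open>For an orthogonal list this is the volume element of the Clifford algebra it
  generates.\<close>

definition zprod :: "(nat \<Rightarrow> complex) list \<Rightarrow> 'v \<Rightarrow> 'v" where
  "zprod bs v = foldr y bs v"

lemma zprod_simps [simp]: "zprod [] v = v" "zprod (b # bs) v = y b (zprod bs v)"
  by (simp_all add: zprod_def)

lemma zprod_linear:
  assumes "\<And>b. b \<in> set bs \<Longrightarrow> dg n b \<in> Od"
  shows "zprod bs (v + w) = zprod bs v + zprod bs w" "zprod bs (c *s v) = c *s zprod bs v"
    "v \<in> T \<Longrightarrow> zprod bs v \<in> T" "zprod bs (\<sigma> v) = (- 1) ^ length bs *s \<sigma> (zprod bs v)"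
    "zprod bs (- v) = - zprod bs v"
  using assms by (induction bs) (auto simp: y_add y_scale y_T \<sigma>_odd y_uminus scale_minus_left)

lemma zprod_inj:
  assumes "\<And>b. b \<in> set bs \<Longrightarrow> dg n b \<in> Od" "orthogonal_list n \<nu> bs" "v \<in> T" "zprod bs v = 0"
  shows "v = 0"
  using assms
proof (induction bs)
  case (Cons b bs)
  have "zprod bs v \<in> T" using Cons.prems by (intro zprod_linear(3)) auto
  then have "dform n \<nu> b b *s zprod bs v = 0"
    using clifford_square[of b "zprod bs v"] Cons.prems y_0[of b] by simp
  then show ?case using Cons by simp
qed simp

lemma zprod_anticommute:
  assumes "\<And>b v. b \<in> set bs \<Longrightarrow> v \<in> T \<Longrightarrow> \<psi> (y b v) = - y b (\<psi> v)"
    "\<And>b. b \<in> set bs \<Longrightarrow> dg n b \<in> Od" "v \<in> T"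
  shows "\<psi> (zprod bs v) = (- 1) ^ length bs *s zprod bs (\<psi> v)"
  using assms
proof (induction bs)
  case (Cons b bs)
  have "zprod bs v \<in> T" using Cons.prems by (intro zprod_linear(3)) auto
  then have "\<psi> (zprod (b # bs) v) = - y b (\<psi> (zprod bs v))" using Cons.prems by simp
  also have "\<dots> = - y b ((- 1) ^ length bs *s zprod bs (\<psi> v))" using Cons by simp
  finally show ?case using Cons.prems by (simp add: y_scale scale_minus_left)
qed simp

lemma zprod_orthogonal:
  assumes "dg n c \<in> Od" "\<And>b. b \<in> set bs \<Longrightarrow> dform n \<nu> c b = 0"
    "\<And>b. b \<in> set bs \<Longrightarrow> dg n b \<in> Od" "v \<in> T"
  shows "y c (zprod bs v) = (- 1) ^ length bs *s zprod bs (y c v)"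
  by (rule zprod_anticommute) (use assms clifford[OF assms(1)] in auto)

text \<open>\<open>c\<close> anticommutes with the other factors but commutes with its own, so there
  is one sign fewer than in \<open>zprod_orthogonal\<close>.\<close>

lemma zprod_member:
  assumes "\<And>b. b \<in> set bs \<Longrightarrow> dg n b \<in> Od" "orthogonal_list n \<nu> bs" "v \<in> T" "c \<in> set bs"
  shows "y c (zprod bs v) = - ((- 1) ^ length bs *s zprod bs (y c v))"
  using assms
proof (induction bs)
  case (Cons b bs)
  have bO: "dg n b \<in> Od" and z: "zprod bs v \<in> T" and bsO: "\<And>b. b \<in> set bs \<Longrightarrow> dg n b \<in> Od"
    using Cons.prems by (auto intro!: zprod_linear(3))
  show ?case
  proof (cases "c = b")
    case True
    have "y b (zprod bs v) = (- 1) ^ length bs *s zprod bs (y b v)"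
      by (rule zprod_orthogonal[OF bO _ bsO Cons.prems(3)]) (use Cons.prems in auto)
    then show ?thesis using True by (simp add: y_scale[OF bO] scale_minus_left)
  next
    case False
    then have c: "c \<in> set bs" "dg n c \<in> Od" using Cons.prems by auto
    have "dform n \<nu> c b = 0" using Cons.prems(2) c(1) dform_commute by auto
    then have "y c (zprod (b # bs) v) = - y b (y c (zprod bs v))"
      using clifford[OF c(2) bO z] by simp
    also have "y c (zprod bs v) = - ((- 1) ^ length bs *s zprod bs (y c v))"
      using Cons.IH[OF bsO _ Cons.prems(3) c(1)] Cons.prems(2) by simp
    finally show ?thesis by (simp add: y_scale[OF bO] y_uminus[OF bO] scale_minus_left)
  qed
qed simp

end

section \<open>Cocycles on simple highest weight modules\<close>

lemma not_wle_raise: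
  assumes "i < j" "j < n"
  shows "\<not> wle n (wshift \<mu> i j) \<mu>"
proof
  assume "wle n (wshift \<mu> i j) \<mu>"
  then obtain K where K: "\<And>l. l < n \<Longrightarrow> (\<Sum>k\<le>l. \<mu> k - wshift \<mu> i j k) = of_nat (K l)"
    using wle_partial_sums_nat by blast
  have "(\<Sum>k\<le>i. \<mu> k - wshift \<mu> i j k) = - (\<Sum>k\<le>i. if k = i then 1 else 0)"
    unfolding sum_negf[symmetric] using assms by (intro sum.cong) (auto simp: wshift_def)
  then have "of_nat (K i) = (- 1 :: complex)" using K[of i] assms by simp
  then have "of_nat (K i + 1) = (0 :: complex)" by simp
  then show False by (metis add_is_0 of_nat_eq_0_iff one_neq_zero)
qed

lemma dg_cong: "(\<And>i. i < n \<Longrightarrow> b i = c i) \<Longrightarrow> dg n b = dg n c"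
  by (intro eq_matI) (auto simp: dg_def)

text \<open>A cocycle normalised to vanish on even elements. The mixed cocycle identity then reads
  as equivariance \<open>f_equiv\<close>, and \<open>f_br\<close> has right side 0 because the
  bracket of odd elements is even.\<close>

locale odd_cocycle = hw_rep scale n Od R V \<sigma> \<nu> v0
  for scale :: "complex \<Rightarrow> 'v::ab_group_add \<Rightarrow> 'v" (infixr "*s" 75) and n Od R V \<sigma> \<nu> v0 +
  fixes \<epsilon> :: complex and f :: "complex mat \<Rightarrow> 'v \<Rightarrow> 'v"
  assumes \<epsilon>: "\<epsilon> * \<epsilon> = 1"
    and f_add: "X \<in> Od \<Longrightarrow> f X (v + w) = f X v + f X w"
    and f_scale: "X \<in> Od \<Longrightarrow> f X (c *s v) = c *s f X v"
    and f_plus: "X \<in> Od \<Longrightarrow> Y \<in> Od \<Longrightarrow> f (X + Y) v = f X v + f Y v"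
    and f_smult: "X \<in> Od \<Longrightarrow> f (c \<cdot>\<^sub>m X) v = c *s f X v"
    and f_V: "X \<in> Od \<Longrightarrow> v \<in> V \<Longrightarrow> f X v \<in> V"
    and f_\<sigma>: "X \<in> Od \<Longrightarrow> \<epsilon> *s \<sigma> (f X v) = - f X (\<sigma> v)"
    and f_equiv: "A \<in> carrier_mat n n \<Longrightarrow> X \<in> Od \<Longrightarrow>
      f (A * X - X * A) v = R False A (f X v) - f X (R False A v)"
    and f_br: "X \<in> Od \<Longrightarrow> Y \<in> Od \<Longrightarrow>
      f X (R True Y v) + R True X (f Y v) + f Y (R True X v) + R True Y (f X v) = 0"
begin

abbreviation \<phi> :: "(nat \<Rightarrow> complex) \<Rightarrow> 'v \<Rightarrow> 'v" where "\<phi> b \<equiv> f (dg n b)"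

lemma cocycle_full: "cocycle \<epsilon> (\<lambda>a X v. if a then f X v else 0)"
  unfolding cocycle_def
proof (intro conjI allI impI ballI)
  show "\<epsilon> * \<epsilon> = 1" by (rule \<epsilon>)
  fix a b X Y v assume X: "X \<in> G a" and Y: "Y \<in> G b"
  have *: "f (X * A - A * X) v = f X (R False A v) - R False A (f X v)" if "A \<in> carrier_mat n n" "X \<in> Od" for A X
  proof -
    have X: "X \<in> carrier_mat n n" using that Od_carrier by blast
    have "A * X - X * A \<in> Od" using part_br[of A False X True] that by (simp add: supercomm_def)
    moreover have "X * A - A * X = (- 1) \<cdot>\<^sub>m (A * X - X * A)"
      using that(1) X by (intro eq_matI) auto
    ultimately show ?thesis using f_smult[of "A * X - X * A" "- 1" v] f_equiv[OF that] by simp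
  qed
  show "(if a \<noteq> b then f (supercomm a b X Y) v else 0) = (if a then f X (R b Y v) else 0) +
      R a X (if b then f Y v else 0) + (if a \<and> b then 1 else - 1) *s
      ((if b then f Y (R a X v) else 0) + R b Y (if a then f X v else 0))"
    using X Y f_br[of X Y v] f_equiv[of X Y v] *[of Y X]
    by (cases a; cases b) (auto simp: R_zero supercomm_def algebra_simps)
qed (use f_add f_scale f_plus f_smult f_V f_\<sigma> subspace_0[OF V_sub] in \<open>auto simp: \<sigma>_0 split: if_splits\<close>)

section \<open>Restriction of a cocycle to the highest weight space\<close>

lemma f_0: "X \<in> Od \<Longrightarrow> f X 0 = 0"
  using f_scale[of X 0 0] by simp

lemma f_uminus: "X \<in> Od \<Longrightarrow> f X (- v) = - f X v"
  using f_scale[of X "- 1" v] by simp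

lemma f_zero_mat: "0\<^sub>m n n \<in> Od \<Longrightarrow> f (0\<^sub>m n n) v = 0"
  using f_smult[of "0\<^sub>m n n" 0 v] by simp

lemma \<phi>_lin: "dg n b \<in> Od \<Longrightarrow> dg n w \<in> Od \<Longrightarrow> \<phi> (\<lambda>i. c * b i + w i) v = c *s \<phi> b v + \<phi> w v"
  using f_plus[of "c \<cdot>\<^sub>m dg n b" "dg n w" v] f_smult[of "dg n b" c v] part_smult[of "dg n b" True c]
  by (simp add: dg_add dg_smult)

text \<open>Diagonal matrices commute, so by equivariance the weight \<open>\<nu>\<close> is
  preserved; and in \<open>V\<close> every vector of weight \<open>\<nu>\<close> is
  singular.\<close>

lemma \<phi>_T:
  assumes "dg n b \<in> Od" "v \<in> T"
  shows "\<phi> b v \<in> T"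
proof (rule wt_\<nu>_T)
  show "\<phi> b v \<in> V" using f_V assms T_V by blast
  show "wt \<nu> (\<phi> b v)"
  proof (rule wtI_dg[OF \<nu>_supp])
    fix c
    have comm: "dg n c * dg n b - dg n b * dg n c = 0\<^sub>m n n"
      by (simp add: dg_mult_dg mult.commute)
    have "0\<^sub>m n n \<in> Od" using zero_in_G[of True] assms(1) by auto
    then have "R False (dg n c) (\<phi> b v) = \<phi> b (R False (dg n c) v)"
      using f_equiv[OF dg_carrier assms(1), of c v] unfolding comm by (simp add: f_zero_mat)
    then show "R False (dg n c) (\<phi> b v) = (\<Sum>i<n. c i * \<nu> i) *s \<phi> b v"
      using wt_dg[OF T_wt[OF assms(2)]] f_scale[OF assms(1)] by simp
  qed
qed

text \<open>The value would have weight \<open>\<nu>\<close> plus a positive root, which does not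
  occur in \<open>V\<close>. The weight is read off in the extension module, where
  \<open>(0, v)\<close> has weight \<open>\<nu>\<close> since the cocycle vanishes on even
  elements.\<close>

lemma f_upper:
  assumes X: "X \<in> Od" "X \<in> strictly_upper n" and v: "v \<in> T"
  shows "f X v = 0"
proof -
  let ?S = "\<lambda>c (p, q). (c *s p, c *s q)"
  let ?E = "\<lambda>a X (p, q). (R a X p + (if a then f X q else 0), R a X q)"
  interpret E: tri_rep ?S n Od ?E by (rule pair_tri_rep[OF cocycle_full])
  have "?E True X (0, v) \<in> {0}"
  proof (rule E.R_unit_induct)
    show "X \<in> E.G True" using X by simp
    fix i j assume ij: "i < n" "j < n" "X $$ (i, j) \<noteq> 0"
    then have lt: "i < j" using X(2) by (auto simp: strictly_upper_def not_le[symmetric])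
    then have M: "munit n i j \<in> Od" using Od_unit[OF X(1)] ij by simp
    have "E.wt \<nu> (0, v)" using T_wt[OF v] by (simp add: E.wt_def wt_def R_zero)
    then have "E.wt (wshift \<nu> i j) (?E True (munit n i j) (0, v))"
      using ij M by (intro E.wt_shift) auto
    then have "wt (wshift \<nu> i j) (f (munit n i j) v)"
      unfolding E.wt_def wt_def using M by (auto simp: R_zero)
    moreover have "f (munit n i j) v \<in> V" using f_V[OF M] T_V[OF v] by blast
    ultimately have "f (munit n i j) v = 0"
      using weight_in_V(1) not_wle_raise[OF lt ij(2)] by blast
    moreover have "R True (munit n i j) v = 0"
      using upkilledD[OF T_upkilled[OF v], of "munit n i j" True] M munit_strictly_upper[OF lt] by simp
    ultimately show "munit n i j \<in> E.G True \<and> ?E True (munit n i j) (0, v) \<in> {0}"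
      using M by (simp add: R_zero zero_prod_def)
  qed (simp add: E.subspace_def)
  then show ?thesis using X by (simp add: R_zero zero_prod_def)
qed

text \<open>The coboundary equation on \<open>T\<close> in the single direction \<open>b\<close>, so
  that directions can be treated one at a time with the same \<open>t\<close>.\<close>

definition top_splits :: "('v \<Rightarrow> 'v) \<Rightarrow> (nat \<Rightarrow> complex) \<Rightarrow> bool" where
  "top_splits t b \<longleftrightarrow> (\<forall>v\<in>T. t (y b v) = y b (t v) + \<phi> b v)"

definition top_hom :: "('v \<Rightarrow> 'v) \<Rightarrow> bool" where
  "top_hom t \<longleftrightarrow> (\<forall>v\<in>T. \<forall>w\<in>T. t (v + w) = t v + t w) \<and> (\<forall>c. \<forall>v\<in>T. t (c *s v) = c *s t v) \<and>
     (\<forall>v\<in>T. t v \<in> T) \<and> (\<forall>v\<in>T. t (\<sigma> v) = \<epsilon> *s \<sigma> (t v))"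

definition coboundary :: bool where
  "coboundary \<longleftrightarrow> (\<exists>h. (\<forall>v\<in>V. \<forall>w\<in>V. h (v + w) = h v + h w) \<and> (\<forall>c. \<forall>v\<in>V. h (c *s v) = c *s h v) \<and>
     (\<forall>v\<in>V. h v \<in> V) \<and> (\<forall>v\<in>V. h (\<sigma> v) = \<epsilon> *s \<sigma> (h v)) \<and>
     (\<forall>A\<in>carrier_mat n n. \<forall>v\<in>V. h (R False A v) = R False A (h v)) \<and>
     (\<forall>X\<in>Od. \<forall>v\<in>V. h (R True X v) = R True X (h v) + f X v))"

lemma coboundary_if_top_splits:
  assumes t: "top_hom t" and s: "\<And>b. dg n b \<in> Od \<Longrightarrow> top_splits t b"
  shows coboundary
proof -
  obtain h where h: "\<And>v w. v \<in> V \<Longrightarrow> w \<in> V \<Longrightarrow> h (v + w) = h v + h w"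
    "\<And>c v. v \<in> V \<Longrightarrow> h (c *s v) = c *s h v" "\<And>v. v \<in> V \<Longrightarrow> h v \<in> V"
    "\<And>v. v \<in> V \<Longrightarrow> h (\<sigma> v) = \<epsilon> *s \<sigma> (h v)"
    "\<And>a X v. X \<in> G a \<Longrightarrow> v \<in> V \<Longrightarrow> h (R a X v) = R a X (h v) + (if a then f X v else 0)"
  proof (rule extend_from_top[OF cocycle_full, of t])
    show "(if a then f X v else 0) = 0" if "X \<in> G a" "X \<in> strictly_upper n" "v \<in> T" for a X v
      using that f_upper by auto
    show "t (R a (dg n b) v) = R a (dg n b) (t v) + (if a then f (dg n b) v else 0)"
      if "dg n b \<in> G a" "v \<in> T" for a b v
    proof (cases a)
      case True
      then show ?thesis using s[of b] that by (simp add: top_splits_def)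
    next
      case False
      have "t v \<in> T" "t (c *s v) = c *s t v" for c using t that(2) by (auto simp: top_hom_def)
      then show ?thesis using False wt_dg[OF T_wt] that(2) by simp
    qed
  qed (use t in \<open>auto simp: top_hom_def\<close>)
  show ?thesis unfolding coboundary_def
  proof (intro exI[of _ h] conjI ballI allI)
    show "h (R False A v) = R False A (h v)" if "A \<in> carrier_mat n n" "v \<in> V" for A v
      using h(5)[of A False v] that by simp
    show "h (R True X v) = R True X (h v) + f X v" if "X \<in> Od" "v \<in> V" for X v
      using h(5)[of X True v] that by simp
  qed (use h in auto)
qed

lemma top_splits_lincomb:
  assumes t: "top_hom t" and B: "\<And>b. b \<in> B \<Longrightarrow> dg n b \<in> Od \<and> top_splits t b" and "0\<^sub>m n n \<in> Od"
    and "lincomb B b"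
  shows "dg n b \<in> Od \<and> top_splits t b"
  using assms(4)
proof induction
  case zero
  have z: "dg n (\<lambda>_. 0) = 0\<^sub>m n n" by (intro eq_matI) (auto simp: dg_def)
  have "t 0 = 0" using t subspace_0[OF T_sub] scale_zero_left by (metis top_hom_def)
  then show ?case
    using assms(3) R_zero_mat[of True] f_zero_mat by (simp add: z top_splits_def)
next
  case (step b w c)
  have b: "dg n b \<in> Od" "top_splits t b" using B[OF step(1)] by auto
  have "t (y (\<lambda>i. c * b i + w i) v) = y (\<lambda>i. c * b i + w i) (t v) + \<phi> (\<lambda>i. c * b i + w i) v" if v: "v \<in> T" for v
  proof -
    have "t (c *s y b v + y w v) = c *s t (y b v) + t (y w v)"
      using t y_T[OF b(1) v] y_T[OF conjunct1[OF step(3)] v] subspace_scale[OF T_sub]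
      by (simp add: top_hom_def)
    then show ?thesis using b step(3) v
      by (simp add: y_lin \<phi>_lin top_splits_def scale_right_distrib)
  qed
  then show ?case using dg_lin_Od b step(3) by (simp add: top_splits_def)
qed

text \<open>For \<open>y\<^sup>2 = q \<noteq> 0\<close> and \<open>\<chi> y = - y \<chi>\<close> the map \<open>s = - y \<chi> / (2 q)\<close> satisfies \<open>s y - y s = \<chi>\<close>.\<close>

lemma top_splits_orthogonal_list:
  assumes "\<And>b. b \<in> set bs \<Longrightarrow> dg n b \<in> Od" "orthogonal_list n \<nu> bs"
  shows "\<exists>t. top_hom t \<and> (\<forall>b\<in>set bs. top_splits t b)"
  using assms
proof (induction bs)
  case Nil
  have "top_hom (\<lambda>v. 0)" using subspace_0[OF T_sub] by (simp add: top_hom_def \<sigma>_0)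
  then show ?case by auto
next
  case (Cons x bs)
  then obtain t where t: "top_hom t" "\<And>b. b \<in> set bs \<Longrightarrow> top_splits t b" by auto
  have t_add: "t (v + w) = t v + t w" and t_scale: "t (c *s v) = c *s t v" and t_T: "t v \<in> T"
    and t_\<sigma>: "t (\<sigma> v) = \<epsilon> *s \<sigma> (t v)" if "v \<in> T" "w \<in> T" for v w c
    using t(1) that by (auto simp: top_hom_def)
  have x: "dg n x \<in> Od" and q: "dform n \<nu> x x \<noteq> 0" using Cons.prems by auto
  note yx = y_add[OF x] y_scale[OF x] y_diff[OF x] y_uminus[OF x]
  \<comment> \<open>The defect of \<open>t\<close> in the new direction \<open>x\<close>; the
    correction \<open>s\<close> has to absorb it without disturbing the directions in
    \<open>bs\<close>.\<close>
  define \<chi> where "\<chi> v = \<phi> x v - t (y x v) + y x (t v)" for v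
  define c where "c = - 1 / (2 * dform n \<nu> x x)"
  define s where "s v = c *s y x (\<chi> v)" for v
  have \<chi>_T: "\<chi> v \<in> T" if "v \<in> T" for v
    unfolding \<chi>_def using that by (intro subspace_add[OF T_sub] subspace_diff[OF T_sub] \<phi>_T y_T t_T x)
  have \<chi>_add: "\<chi> (v + w) = \<chi> v + \<chi> w" if "v \<in> T" "w \<in> T" for v w
    using that y_T[OF x] by (simp add: \<chi>_def f_add[OF x] yx t_add)
  have \<chi>_scale: "\<chi> (d *s v) = d *s \<chi> v" if "v \<in> T" for v d
    using that y_T[OF x] by (simp add: \<chi>_def f_scale[OF x] yx t_scale scale_right_distrib scale_right_diff_distrib)
  have t_uminus: "t (- v) = - t v" if "v \<in> T" for v
    using t_scale[OF that that, of "- 1"] by simp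
  have \<chi>_uminus: "\<chi> (- v) = - \<chi> v" if "v \<in> T" for v
    using \<chi>_scale[OF that, of "- 1"] by simp
  have x\<sigma>: "y x (\<sigma> w) = - \<sigma> (y x w)" for w using \<sigma>_odd[OF x, of w] by simp
  have f\<sigma>: "\<phi> x (\<sigma> w) = - (\<epsilon> *s \<sigma> (\<phi> x w))" for w using f_\<sigma>[OF x, of w] by simp
  have \<chi>_\<sigma>: "\<chi> (\<sigma> v) = - (\<epsilon> *s \<sigma> (\<chi> v))" if v: "v \<in> T" for v
    using v y_T[OF x v] t_T[OF v v]
    by (simp add: \<chi>_def x\<sigma> f\<sigma> t_uminus[OF T_\<sigma>] t_\<sigma> yx \<sigma>_add \<sigma>_uminus scale_right_distrib scale_right_diff_distrib
        \<sigma>_add[of _ "- _", simplified])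
  have s_hom: "top_hom s"
    unfolding top_hom_def s_def
    using \<chi>_T \<chi>_add \<chi>_scale \<chi>_\<sigma>
    by (auto simp: yx x\<sigma> \<sigma>_scale \<sigma>_uminus scale_right_distrib scale_left_commute intro!: subspace_scale[OF T_sub] y_T[OF x])
  \<comment> \<open>The cocycle identity at \<open>X = Y\<close> yields the relation for
    \<open>\<phi> x\<close> twice over; the part coming from \<open>t\<close> cancels because
    \<open>y x\<close> squares to a scalar.\<close>
  have anti_x: "\<chi> (y x v) = - y x (\<chi> v)" if v: "v \<in> T" for v
  proof -
    have tv: "t v \<in> T" using t_T v by blast
    have "\<phi> x (y x v) + y x (\<phi> x v) + (\<phi> x (y x v) + y x (\<phi> x v)) = 0"
      using f_br[OF x x, of v] by (simp add: add.assoc)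
    then have "2 *s (\<phi> x (y x v) + y x (\<phi> x v)) = 0"
      by (simp only: scale_left_distrib[of 1 1, simplified])
    then have "\<phi> x (y x v) + y x (\<phi> x v) = 0" by simp
    moreover have "t (y x (y x v)) = y x (y x (t v))"
      using t_scale[OF v v] by (simp add: clifford_square[OF x v] clifford_square[OF x tv])
    ultimately show ?thesis
      by (simp add: \<chi>_def yx algebra_simps add_eq_0_iff)
  qed
  have s_x: "s (y x v) = y x (s v) + \<chi> v" if v: "v \<in> T" for v
  proof -
    have sq: "y x (y x (\<chi> v)) = dform n \<nu> x x *s \<chi> v" by (rule clifford_square[OF x \<chi>_T[OF v]])
    have "s (y x v) - y x (s v) = (- 2 * c * dform n \<nu> x x) *s \<chi> v"
      by (simp add: s_def anti_x[OF v] yx sq scale_left_distrib[symmetric] scale_left_diff_distrib[symmetric]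
          scale_minus_left[symmetric] del: scale_minus_left)
    also have "- 2 * c * dform n \<nu> x x = 1" using q by (simp add: c_def)
    finally show ?thesis by (simp add: algebra_simps)
  qed
  \<comment> \<open>By orthogonality \<open>y x\<close> anticommutes with \<open>y b\<close>, and so
    does \<open>\<chi>\<close> because \<open>t\<close> already splits \<open>b\<close>. Their
    product commutes with \<open>y b\<close>, so the equation for \<open>b\<close> survives the
    correction.\<close>
  have s_b: "s (y b v) = y b (s v)" if b: "b \<in> set bs" and v: "v \<in> T" for b v
  proof -
    have bO: "dg n b \<in> Od" and orth: "dform n \<nu> b x = 0" "dform n \<nu> x b = 0"
      using Cons.prems b dform_commute by auto
    note yb = y_add[OF bO] y_scale[OF bO] y_diff[OF bO] y_uminus[OF bO]
    have bx: "y b (y x w) = - y x (y b w)" if "w \<in> T" for w using clifford[OF bO x that] orth by simp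
    have tb: "t (y b w) = y b (t w) + \<phi> b w" if "w \<in> T" for w using t(2)[OF b] that by (simp add: top_splits_def)
    have "t (y x (y b v)) = - (y b (t (y x v)) + \<phi> b (y x v))"
      using bx[OF v] tb[OF y_T[OF x v]] t_uminus[OF y_T[OF x y_T[OF bO v]]]
      by (metis minus_minus)
    moreover have "y x (t (y b v)) = - y b (y x (t v)) + y x (\<phi> b v)"
      using bx[OF t_T[OF v v]] by (simp add: tb[OF v] yx)
    moreover have "\<phi> x (y b v) + y x (\<phi> b v) + \<phi> b (y x v) + y b (\<phi> x v) = 0" by (rule f_br[OF x bO])
    ultimately have anti: "\<chi> (y b v) = - y b (\<chi> v)"
      by (simp add: \<chi>_def yb algebra_simps) (metis (no_types, lifting) add.assoc add.commute add_eq_0_iff2 minus_add_cancel)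
    show ?thesis
      using bx[OF \<chi>_T[OF v]] by (simp add: s_def anti yx yb)
  qed
  have hom: "top_hom (\<lambda>v. t v + s v)"
    using t(1) s_hom subspace_add[OF T_sub]
    by (auto simp: top_hom_def scale_right_distrib \<sigma>_add)
  moreover have "top_splits (\<lambda>v. t v + s v) x"
    using s_x by (auto simp: top_splits_def \<chi>_def yx)
  moreover have "top_splits (\<lambda>v. t v + s v) b" if "b \<in> set bs" for b
    using s_b[OF that] t(2)[OF that] y_add[of b] Cons.prems(1)[of b] that by (auto simp: top_splits_def)
  ultimately show ?case by (intro exI[of _ "\<lambda>v. t v + s v"]) auto
qed

end

section \<open>The traceless hyperplane and its radical\<close>

definition traceless :: "nat \<Rightarrow> complex mat set" where
  "traceless n = {X \<in> carrier_mat n n. (\<Sum>i<n. X $$ (i, i)) = 0}"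

lemma dg_traceless: "dg n b \<in> traceless n \<longleftrightarrow> (\<Sum>i<n. b i) = 0"
proof -
  have "(\<Sum>i<n. dg n b $$ (i, i)) = (\<Sum>i<n. b i)" by (intro sum.cong) (auto simp: dg_def)
  then show ?thesis by (simp add: traceless_def)
qed

lemma zero_sum_traceless: "S \<subseteq> {..<n} \<Longrightarrow> b \<in> zero_sum S \<Longrightarrow> dg n b \<in> traceless n"
  using zero_sum_mono[of S "{..<n}" b] by (simp add: dg_traceless zero_sum_def)

text \<open>The radical of the form on the hyperplane is spanned by the vector of reciprocals.\<close>

definition reciprocals :: "nat \<Rightarrow> (nat \<Rightarrow> complex) \<Rightarrow> nat \<Rightarrow> complex" where
  "reciprocals n r i = (if i < n then 1 / r i else 0)"

text \<open>Without index 0 the reciprocals sum to \<open>- 1 / r 0\<close>, so the smaller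
  hyperplane is nondegenerate; the vector of reciprocals supplies the missing coordinate. Hence
  \<open>n - 2\<close> anisotropic vectors.\<close>

lemma degenerate_basis:
  assumes "0 < n" "\<forall>i<n. r i \<noteq> 0" "(\<Sum>i<n. 1 / r i) = 0"
  shows "\<exists>bs. n = Suc (Suc (length bs)) \<and> orthogonal_list n r bs \<and> set bs \<subseteq> zero_sum {..<n} \<and>
    (\<forall>b\<in>zero_sum {..<n}. lincomb (insert (reciprocals n r) (set bs)) b)"
proof -
  let ?S = "{..<n} - {0}" and ?u = "reciprocals n r"
  have split: "(\<Sum>i<n. g i) = g 0 + (\<Sum>i\<in>?S. g i)" for g :: "nat \<Rightarrow> complex"
    using sum.remove[of "{..<n}" 0 g] assms(1) by simp
  have "(\<Sum>i\<in>?S. 1 / r i) = - (1 / r 0)"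
    using assms(3) unfolding split by (simp add: add_eq_0_iff)
  then have "(\<Sum>i\<in>?S. 1 / r i) \<noteq> 0" using assms(1,2) by simp
  from orthogonal_basis[OF _ _ _ this, of n] obtain bs where bs: "Suc (length bs) = card ?S"
    "orthogonal_list n r bs" "set bs \<subseteq> zero_sum ?S" "\<And>b. b \<in> zero_sum ?S \<Longrightarrow> lincomb (set bs) b"
    using assms(2) by auto
  have u: "?u \<in> zero_sum {..<n}" using assms(3) by (simp add: zero_sum_def reciprocals_def)
  show ?thesis
  proof (intro exI[of _ bs] conjI ballI)
    show "n = Suc (Suc (length bs))" using bs(1) assms(1) by simp
    show "orthogonal_list n r bs" by (rule bs)
    show "set bs \<subseteq> zero_sum {..<n}" using bs(3) zero_sum_mono[of ?S "{..<n}"] by auto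
    fix b assume b: "b \<in> zero_sum {..<n}"
    \<comment> \<open>\<open>?u 0 = 1 / r 0\<close>, so this coefficient clears coordinate
      0.\<close>
    define b' where "b' i = b i - b 0 * r 0 * ?u i" for i
    have "b' \<in> zero_sum ?S"
    proof -
      have z: "b' 0 = 0" using assms(1,2) by (simp add: b'_def reciprocals_def)
      have "(\<Sum>i<n. b' i) = 0"
        using b u unfolding b'_def sum_subtractf sum_distrib_left[symmetric] zero_sum_def by simp
      then have "(\<Sum>i\<in>?S. b' i) = 0" using split[of b'] z by (simp only: add_0_left)
      moreover have "b' i = 0" if "i \<notin> ?S" for i
        using that z b u by (cases "i = 0") (simp_all add: b'_def zero_sum_def)
      ultimately show ?thesis unfolding zero_sum_def by blast
    qed
    then have "lincomb (insert ?u (set bs)) b'" using bs(4) by (auto intro: lincomb_mono)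
    then have "lincomb (insert ?u (set bs)) (\<lambda>i. b 0 * r 0 * ?u i + b' i)" by (intro lincomb.step) auto
    then show "lincomb (insert ?u (set bs)) b" by (simp add: b'_def)
  qed
qed

text \<open>The trace is pairing with the reciprocals, which is why they are orthogonal to the
  hyperplane.\<close>

lemma dform_reciprocals:
  assumes "\<forall>i<n. r i \<noteq> 0"
  shows "dform n r b (reciprocals n r) = (\<Sum>i<n. b i)"
  unfolding dform_def by (intro sum.cong) (use assms in \<open>auto simp: reciprocals_def\<close>)

context hw_rep
begin

lemma reciprocals_act_trivially:
  assumes "Od = traceless n" "\<forall>i<n. \<nu> i \<noteq> 0" "(\<Sum>i<n. 1 / \<nu> i) = 0" "v \<in> T"
  shows "dg n (reciprocals n \<nu>) \<in> Od" "y (reciprocals n \<nu>) v = 0"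
proof -
  show u: "dg n (reciprocals n \<nu>) \<in> Od"
    using assms(3) by (simp add: assms(1) dg_traceless reciprocals_def)
  show "y (reciprocals n \<nu>) v = 0"
  proof (rule radical_acts_trivially[OF u _ assms(4)])
    fix b assume "dg n b \<in> Od"
    then show "dform n \<nu> b (reciprocals n \<nu>) = 0"
      by (simp add: dform_reciprocals[OF assms(2)] assms(1) dg_traceless)
  qed
qed

text \<open>If \<open>\<nu>\<^sub>i = \<nu>\<^sub>i\<^sub>+\<^sub>1 = 0\<close>, then the even \<open>E\<^sub>i\<^sub>+\<^sub>1\<^sub>i\<close> annihilates the highest weight space,
  since it maps it to singular vectors of another weight.\<close>

lemma zero_pair:
  assumes Od: "Od = traceless n" and i: "Suc i < n" "\<nu> i = 0" "\<nu> (Suc i) = 0" and v: "v \<in> T"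
  defines "u \<equiv> \<lambda>j. (if j = i then 1 else 0) - (if j = Suc i then 1 else (0::complex))"
  shows "dg n u \<in> Od" "y u v = 0" "R False (munit n (Suc i) i) v = 0"
proof -
  have sum_u: "(\<Sum>j<n. u j) = 0" using i(1) by (simp add: u_def sum_subtractf)
  then show uO: "dg n u \<in> Od" by (simp add: Od dg_traceless)
  show yu: "y u v = 0"
  proof (rule radical_acts_trivially[OF uO _ v])
    fix b
    show "dform n \<nu> b u = 0"
      unfolding dform_def by (rule sum.neutral) (use i in \<open>auto simp: u_def\<close>)
  qed
  let ?F = "munit n (Suc i) i"
  let ?w = "R False ?F v"
  have "upkilled ?w"
    unfolding upkilled_def
  proof (intro allI impI)
    fix a X assume X: "X \<in> G a" "X \<in> strictly_upper n"
    have Xc: "X \<in> carrier_mat n n" by (rule strictly_upper_carrier[OF X(2)])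
    let ?C = "supercomm a False X ?F"
    have Cc: "?C \<in> carrier_mat n n" by (rule supercomm_carrier[OF Xc munit_carrier])
    have CG: "?C \<in> G a" using part_br[OF X(1), of ?F False] by simp
    have C: "?C $$ (r, s) = (if s = i then X $$ (r, Suc i) else 0) - (if r = Suc i then X $$ (i, s) else 0)"
      if rs: "r < n" "s < n" for r s
    proof -
      have "(X * ?F) $$ (r, s) = (\<Sum>t<n. if t = Suc i then (if s = i then X $$ (r, Suc i) else 0) else 0)"
        unfolding mult_mat_index[OF Xc munit_carrier rs] using rs by (intro sum.cong) (auto simp: munit_def)
      moreover have "(?F * X) $$ (r, s) = (\<Sum>t<n. if t = i then (if r = Suc i then X $$ (i, s) else 0) else 0)"
        unfolding mult_mat_index[OF munit_carrier Xc rs] using rs by (intro sum.cong) (auto simp: munit_def)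
      ultimately show ?thesis
        using rs i(1) carrier_matD[OF Xc] carrier_matD[OF munit_carrier[of n "Suc i" i]] by (simp add: supercomm_def)
    qed
    have "lower_part n ?C = 0\<^sub>m n n"
      using X(2) i(1) by (intro eq_matI) (auto simp: lower_part_def C strictly_upper_def)
    moreover have "dg n (\<lambda>j. ?C $$ (j, j)) = X $$ (i, Suc i) \<cdot>\<^sub>m dg n u"
      using X(2) i(1) by (intro eq_matI) (auto simp: dg_def C u_def strictly_upper_def)
    ultimately have dec: "?C = X $$ (i, Suc i) \<cdot>\<^sub>m dg n u + upper_part n ?C"
      using triangular_decomposition[OF Cc] by simp
    have uG: "dg n u \<in> G a" using uO by (cases a) auto
    have "R a (dg n u) v = 0"
    proof (cases a)
      case True then show ?thesis using yu by simp
    next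
      case False
      have "(\<Sum>j<n. u j * \<nu> j) = 0" by (rule sum.neutral) (use i in \<open>auto simp: u_def\<close>)
      then show ?thesis using False wt_dg[OF T_wt[OF v]] by simp
    qed
    then have "R a ?C v = 0"
      using upkilledD[OF T_upkilled[OF v] G_up[OF CG] upper_part_strictly_upper] part_smult[OF uG] G_up[OF CG]
      by (subst dec) (simp add: R_plus R_smult[OF uG] del: G_True G_False)
    then show "R a X ?w = 0"
      using R_swap[OF X(1), of ?F False v] upkilledD[OF T_upkilled[OF v] X] by (simp add: R_zero)
  qed
  moreover have "?w \<in> V" using V_stable[of ?F False v] T_V[OF v] by simp
  moreover have "wt (wshift \<nu> (Suc i) i) ?w" using T_wt[OF v] i(1) by (intro wt_shift) auto
  moreover have "wshift \<nu> (Suc i) i \<noteq> \<nu>"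
  proof
    assume "wshift \<nu> (Suc i) i = \<nu>"
    then have "wshift \<nu> (Suc i) i i = \<nu> i" by simp
    then show False by (simp add: wshift_def)
  qed
  ultimately show "?w = 0" using singular_weight by blast
qed

end

section \<open>Cocycles according to the radical\<close>

context odd_cocycle
begin

text \<open>Directions in \<open>bs\<close> are split by a common \<open>t\<close>; in the
  directions of \<open>N\<close> the action and the cocycle vanish on \<open>T\<close>, so that any
  \<open>t\<close> splits them.\<close>

lemma coboundary_if_spanned:
  assumes Od: "Od = traceless n" and bs: "set bs \<subseteq> zero_sum {..<n}" "orthogonal_list n \<nu> bs"
    and N: "N \<subseteq> zero_sum {..<n}" "\<And>b v. b \<in> N \<Longrightarrow> v \<in> T \<Longrightarrow> y b v = 0 \<and> \<phi> b v = 0"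
    and span: "\<And>b. b \<in> zero_sum {..<n} \<Longrightarrow> lincomb (set bs \<union> N) b"
  shows coboundary
proof -
  have bsO: "dg n b \<in> Od" if "b \<in> set bs" for b
    using that bs(1) zero_sum_traceless[of "{..<n}" n b] by (auto simp: Od)
  obtain t where t: "top_hom t" "\<And>b. b \<in> set bs \<Longrightarrow> top_splits t b"
    using top_splits_orthogonal_list[OF bsO bs(2)] by blast
  have t0: "t 0 = 0" using t(1) subspace_0[OF T_sub] scale_zero_left by (metis top_hom_def)
  have N_splits: "dg n b \<in> Od \<and> top_splits t b" if b: "b \<in> N" for b
  proof -
    have "y b (t v) = 0 \<and> y b v = 0 \<and> \<phi> b v = 0" if "v \<in> T" for v
      using N(2)[OF b that] N(2)[OF b, of "t v"] t(1) that by (simp add: top_hom_def)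
    then have "top_splits t b" by (simp add: top_splits_def t0)
    moreover have "dg n b \<in> Od" using N(1) b zero_sum_traceless[of "{..<n}" n b] by (auto simp: Od)
    ultimately show ?thesis by simp
  qed
  have z: "0\<^sub>m n n \<in> Od" by (simp add: Od traceless_def)
  show ?thesis
  proof (rule coboundary_if_top_splits[OF t(1)])
    fix b assume b: "dg n b \<in> Od"
    \<comment> \<open>\<open>dg\<close> ignores \<open>b\<close> from index \<open>n\<close> on,
      whereas \<open>zero_sum\<close> demands zeros there.\<close>
    let ?b = "\<lambda>i. if i < n then b i else 0"
    have eq: "dg n b = dg n ?b" by (rule dg_cong) simp
    have "?b \<in> zero_sum {..<n}" using b by (simp add: Od dg_traceless zero_sum_def)
    then have *: "lincomb (set bs \<union> N) ?b" by (rule span)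
    have "dg n ?b \<in> Od \<and> top_splits t ?b"
      by (rule top_splits_lincomb[OF t(1) _ z *]) (use t(2) N_splits bsO in blast)
    then show "top_splits t b" unfolding top_splits_def eq by blast
  qed
qed

theorem coboundary_nondegenerate:
  assumes Od: "Od = traceless n" and \<nu>: "\<forall>i<n. \<nu> i \<noteq> 0" "(\<Sum>i<n. 1 / \<nu> i) \<noteq> 0"
  shows coboundary
proof -
  obtain bs where "orthogonal_list n \<nu> bs" "set bs \<subseteq> zero_sum {..<n}"
    "\<And>b. b \<in> zero_sum {..<n} \<Longrightarrow> lincomb (set bs) b"
    using orthogonal_basis[OF _ _ _ \<nu>(2), of n] \<nu>(1) by auto
  then show ?thesis by (intro coboundary_if_spanned[OF Od, of bs "{}"]) auto
qed

text \<open>The radical consists of the zero-sum vectors supported where \<open>\<nu>\<close>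
  vanishes. An adjacent difference there is, up to sign, the bracket of the even
  \<open>E_(i+1,i)\<close> with the odd \<open>E_(i,i+1)\<close>. The former kills \<open>T\<close>
  by \<open>zero_pair\<close>, the cocycle at the latter vanishes on \<open>T\<close> by
  \<open>f_upper\<close>, and so by equivariance does its value at the difference.\<close>

theorem coboundary_zeros:
  assumes Od: "Od = traceless n" and m: "k + m \<le> n" "0 < m"
    and \<nu>: "\<And>i. i < n \<Longrightarrow> \<nu> i = 0 \<longleftrightarrow> k \<le> i \<and> i < k + m"
  shows coboundary
proof -
  let ?S = "{k..<k + m}"
  let ?A = "{..<n} - ?S"
  let ?N = "{\<lambda>j. (if j = i then 1 else 0) - (if j = Suc i then 1 else 0 :: complex) | i. k \<le> i \<and> Suc i < k + m}"
  have un: "?A \<union> ?S = {..<n}" using m by auto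
  have "\<exists>bs. orthogonal_list n \<nu> bs \<and> set bs \<subseteq> zero_sum (?A \<union> ?S) \<and>
      (\<forall>b\<in>zero_sum (?A \<union> ?S). lincomb (set bs \<union> zero_sum ?S) b)"
    by (rule orthogonal_basis_mod_radical[of _ _ _ _ k]) (use \<nu> m in auto)
  then obtain bs where bs: "orthogonal_list n \<nu> bs" "set bs \<subseteq> zero_sum {..<n}"
    "\<And>b. b \<in> zero_sum {..<n} \<Longrightarrow> lincomb (set bs \<union> zero_sum ?S) b"
    unfolding un by blast
  show ?thesis
  proof (rule coboundary_if_spanned[OF Od bs(2,1)])
    show "?N \<subseteq> zero_sum {..<n}" using m(1) zero_sum_delta[of _ "{..<n}"] by auto
    fix b v assume b: "b \<in> ?N" and v: "v \<in> T"
    then obtain i where i: "k \<le> i" "Suc i < k + m"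
      and b_eq: "b = (\<lambda>j. (if j = i then 1 else 0) - (if j = Suc i then 1 else 0))" by blast
    have i': "Suc i < n" "\<nu> i = 0" "\<nu> (Suc i) = 0" using i m \<nu> by auto
    note z = zero_pair[OF Od i' v, folded b_eq]
    let ?E = "munit n i (Suc i)" and ?F = "munit n (Suc i) i"
    have E: "?E \<in> Od" unfolding Od traceless_def by (auto simp: munit_def)
    have "?F * ?E - ?E * ?F = (- 1) \<cdot>\<^sub>m dg n b"
      using i' by (simp add: munit_mult b_eq) (intro eq_matI; auto simp: munit_def dg_def)
    then have "- \<phi> b v = R False ?F (f ?E v) - f ?E (R False ?F v)"
      using f_equiv[OF munit_carrier E, of "Suc i" i v] f_smult[OF z(1), of "- 1" v] by simp
    moreover have "f ?E v = 0" by (rule f_upper[OF E munit_strictly_upper v]) simp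
    ultimately have "\<phi> b v = 0" using z(3) f_0[OF E] by (simp add: R_zero)
    then show "y b v = 0 \<and> \<phi> b v = 0" using z(2) by simp
  next
    fix b assume "b \<in> zero_sum {..<n}"
    then have "lincomb (set bs \<union> zero_sum ?S) b" by (rule bs(3))
    then show "lincomb (set bs \<union> ?N) b"
    proof (induction rule: lincomb.induct)
      case zero show ?case by (rule lincomb.zero)
    next
      case (step b w c)
      show ?case
      proof (cases "b \<in> set bs")
        case True then show ?thesis using step by (intro lincomb.step) auto
      next
        case False
        then have "b \<in> zero_sum ?S" using step by blast
        then have "lincomb ?N b" by (rule zero_sum_interval)
        then have "lincomb (set bs \<union> ?N) b" by (rule lincomb_mono) blast
        then show ?thesis
        proof (induction rule: lincomb.induct)
          case zero show ?case using step(3) by simp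
        next
          case (step b' w' c')
          have "lincomb (set bs \<union> ?N) (\<lambda>i. (c * c') * b' i + (c * w' i + w i))"
            by (rule lincomb.step[OF step(1,3)])
          then show ?case by (simp add: algebra_simps)
        qed
      qed
    qed
  qed
qed

lemma coboundary_degenerate:
  assumes Od: "Od = traceless n" and n: "0 < n" and \<nu>: "\<forall>i<n. \<nu> i \<noteq> 0" "(\<Sum>i<n. 1 / \<nu> i) = 0"
    and \<phi>: "\<And>v. v \<in> T \<Longrightarrow> \<phi> (reciprocals n \<nu>) v = 0"
  shows coboundary
proof -
  obtain bs where bs: "orthogonal_list n \<nu> bs" "set bs \<subseteq> zero_sum {..<n}"
    "\<And>b. b \<in> zero_sum {..<n} \<Longrightarrow> lincomb (insert (reciprocals n \<nu>) (set bs)) b"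
    using degenerate_basis[of n \<nu>, OF n \<nu>] by auto
  show ?thesis
  proof (rule coboundary_if_spanned[OF Od bs(2,1), of "{reciprocals n \<nu>}"])
    show "{reciprocals n \<nu>} \<subseteq> zero_sum {..<n}" using \<nu>(2) by (simp add: zero_sum_def reciprocals_def)
    show "y b v = 0 \<and> \<phi> b v = 0" if "b \<in> {reciprocals n \<nu>}" "v \<in> T" for b v
      using that reciprocals_act_trivially(2)[OF Od \<nu>, of v] \<phi>[of v] by simp
    show "lincomb (set bs \<union> {reciprocals n \<nu>}) b" if "b \<in> zero_sum {..<n}" for b
      using bs(3)[OF that] by simp
  qed
qed

text \<open>The radical vector acts by zero on \<open>T\<close>, which removes two of the four terms
  of the cocycle identity.\<close>

lemma \<phi>_reciprocals_anticommute:
  assumes Od: "Od = traceless n" and \<nu>: "\<forall>i<n. \<nu> i \<noteq> 0" "(\<Sum>i<n. 1 / \<nu> i) = 0"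
    and b: "dg n b \<in> Od" and v: "v \<in> T"
  shows "\<phi> (reciprocals n \<nu>) (y b v) = - y b (\<phi> (reciprocals n \<nu>) v)"
proof -
  note u = reciprocals_act_trivially[OF Od \<nu>]
  have "\<phi> (reciprocals n \<nu>) (y b v) + y (reciprocals n \<nu>) (\<phi> b v) + \<phi> b (y (reciprocals n \<nu>) v)
      + y b (\<phi> (reciprocals n \<nu>) v) = 0"
    by (rule f_br[OF u(1)[OF v] b])
  then show ?thesis using u(2)[OF v] u(2)[OF \<phi>_T[OF b v]] f_0[OF b] by (simp add: add_eq_0_iff2)
qed

text \<open>The list \<open>bs\<close> has \<open>n - 2\<close> elements, an even number, so the
  product z of its generators commutes with \<open>\<sigma>\<close> and anticommutes with every
  \<open>y b\<close>. Hence z followed after \<open>\<sigma>\<close> commutes with all of them and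
  is a scalar \<open>a\<close>, nonzero since z is injective. The value at the reciprocals commutes
  with z but, for \<open>\<epsilon> = 1\<close>, anticommutes with \<open>\<sigma>\<close>;
  comparison gives \<open>a = - a\<close> unless it vanishes.\<close>

theorem coboundary_even_rank:
  assumes Od: "Od = traceless n" and n: "0 < n" "even n"
    and \<nu>: "\<forall>i<n. \<nu> i \<noteq> 0" "(\<Sum>i<n. 1 / \<nu> i) = 0" and "\<epsilon> = 1"
  shows coboundary
proof (rule coboundary_degenerate[OF Od n(1) \<nu>])
  fix v assume v: "v \<in> T"
  let ?u = "reciprocals n \<nu>"
  note u = reciprocals_act_trivially[OF Od \<nu>]
  have uO: "dg n ?u \<in> Od" by (rule u(1)[OF v])
  obtain bs where bs: "n = Suc (Suc (length bs))" "orthogonal_list n \<nu> bs" "set bs \<subseteq> zero_sum {..<n}"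
    "\<And>b. b \<in> zero_sum {..<n} \<Longrightarrow> lincomb (insert ?u (set bs)) b"
    using degenerate_basis[of n \<nu>, OF n(1) \<nu>] by auto
  have bsO: "dg n b \<in> Od" if "b \<in> set bs" for b
    using that bs(3) zero_sum_traceless[of "{..<n}" n b] by (auto simp: Od)
  have ev: "(- 1) ^ length bs = (1 :: complex)" using n(2) bs(1) by simp
  note z = zprod_linear[OF bsO]
  have anti: "y b (zprod bs w) = - zprod bs (y b w)" if "lincomb (insert ?u (set bs)) b" "w \<in> T" for b w
  proof -
    have "dg n b \<in> Od \<and> y b (zprod bs w) = - zprod bs (y b w)"
      using that(1)
    proof induction
      case zero
      have "dg n (\<lambda>_. 0) \<in> Od" by (simp add: Od dg_traceless)
      then show ?case using y_zero_fun z(2)[of bs 0 0] by simp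
    next
      case (step b' w' c)
      have "dg n b' \<in> Od \<and> y b' (zprod bs w) = - zprod bs (y b' w)"
      proof (cases "b' \<in> set bs")
        case True
        then show ?thesis using zprod_member[OF bsO bs(2) that(2) True] bsO ev by simp
      next
        case False
        then have "b' = ?u" using step(1) by simp
        then show ?thesis using uO u(2)[OF that(2)] u(2)[OF z(3)[OF _ that(2)]] z(2)[of bs 0 0] by simp
      qed
      then show ?case using step(3) by (simp add: y_lin z dg_lin_Od scale_right_distrib[symmetric])
    qed
    then show ?thesis by blast
  qed
  obtain a where a: "\<And>v. v \<in> T \<Longrightarrow> zprod bs (\<sigma> v) = a *s v"
  proof (rule top_schur[of "\<lambda>v. zprod bs (\<sigma> v)"])
    fix d b w assume b: "dg n b \<in> G d" and w: "w \<in> T"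
    show "zprod bs (\<sigma> (R d (dg n b) w)) = R d (dg n b) (zprod bs (\<sigma> w))"
    proof (cases d)
      case True
      let ?b = "\<lambda>i. if i < n then b i else 0"
      have eq: "dg n b = dg n ?b" by (rule dg_cong) simp
      have bO: "dg n b \<in> Od" using b True by simp
      then have "?b \<in> zero_sum {..<n}" by (simp add: Od dg_traceless zero_sum_def)
      from anti[OF bs(4)[OF this] T_\<sigma>[OF w]] show ?thesis
        using bO True \<sigma>_odd[of "dg n b" w] by (simp add: z(5) flip: eq)
    next
      case False
      have "\<sigma> (R False (dg n b) w) = R False (dg n b) (\<sigma> w)" by (rule \<sigma>_even) simp
      then show ?thesis
        using False wt_dg[OF T_wt[OF T_\<sigma>[OF w]]] wt_dg[OF T_wt[OF z(3)[OF _ T_\<sigma>[OF w]]]] z(2) by simp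
    qed
  qed (auto simp: \<sigma>_add \<sigma>_scale z(1,2) T_\<sigma> z(4) ev intro!: z(3) T_\<sigma>)
  have "a \<noteq> 0"
  proof
    assume "a = 0"
    then have "\<sigma> v0 = 0" using zprod_inj[OF bsO bs(2) T_\<sigma>[OF v0_T]] a[OF v0_T] by simp
    then show False using \<sigma>_\<sigma>[of v0] \<sigma>_0 hw(2) by simp
  qed
  let ?\<psi> = "\<phi> ?u"
  have \<psi>T: "?\<psi> w \<in> T" if "w \<in> T" for w using \<phi>_T[OF uO that] .
  have \<psi>z: "?\<psi> (zprod bs w) = zprod bs (?\<psi> w)" if "w \<in> T" for w
    using zprod_anticommute[of bs ?\<psi> w] \<phi>_reciprocals_anticommute[OF Od \<nu> bsO] bsO that ev by simp
  have "a *s ?\<psi> v = ?\<psi> (zprod bs (\<sigma> v))" using a[OF v] f_scale[OF uO] by simp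
  also have "\<dots> = zprod bs (?\<psi> (\<sigma> v))" by (rule \<psi>z[OF T_\<sigma>[OF v]])
  also have "?\<psi> (\<sigma> v) = - \<sigma> (?\<psi> v)" using f_\<sigma>[OF uO, of v] \<open>\<epsilon> = 1\<close> by (simp add: eq_neg_iff_add_eq_0 add.commute)
  also have "zprod bs (- \<sigma> (?\<psi> v)) = - (a *s ?\<psi> v)" using a[OF \<psi>T[OF v]] by (simp add: z(5))
  finally have "a *s ?\<psi> v + a *s ?\<psi> v = 0" by (simp add: eq_neg_iff_add_eq_0)
  then have "(2 * a) *s ?\<psi> v = 0" by (simp add: scale_left_distrib[symmetric])
  then show "?\<psi> v = 0" using \<open>a \<noteq> 0\<close> by simp
qed

text \<open>For \<open>\<epsilon> = - 1\<close> the value at the reciprocals commutes with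
  \<open>\<sigma>\<close>. Both it and \<open>\<sigma>\<close> anticommute with the odd diagonal
  elements, so their composite commutes with everything and \<open>top_schur\<close>
  applies.\<close>

theorem degenerate_opposite_parity:
  assumes Od: "Od = traceless n" and n: "0 < n"
    and \<nu>: "\<forall>i<n. \<nu> i \<noteq> 0" "(\<Sum>i<n. 1 / \<nu> i) = 0" and \<epsilon>': "\<epsilon> = - 1"
  obtains c where "\<And>v. v \<in> T \<Longrightarrow> \<phi> (reciprocals n \<nu>) v = c *s \<sigma> v"
proof -
  let ?\<psi> = "\<phi> (reciprocals n \<nu>)"
  have uO: "dg n (reciprocals n \<nu>) \<in> Od" by (rule reciprocals_act_trivially(1)[OF Od \<nu> v0_T])
  have \<psi>\<sigma>: "?\<psi> (\<sigma> w) = \<sigma> (?\<psi> w)" for w using f_\<sigma>[OF uO, of w] \<epsilon>' by simp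
  obtain c where c: "\<And>v. v \<in> T \<Longrightarrow> ?\<psi> (\<sigma> v) = c *s v"
  proof (rule top_schur[of "\<lambda>v. ?\<psi> (\<sigma> v)"])
    fix d b w assume b: "dg n b \<in> G d" and w: "w \<in> T"
    show "?\<psi> (\<sigma> (R d (dg n b) w)) = R d (dg n b) (?\<psi> (\<sigma> w))"
    proof (cases d)
      case True
      then show ?thesis
        using b \<phi>_reciprocals_anticommute[OF Od \<nu>, of b "\<sigma> w"] T_\<sigma>[OF w] \<sigma>_odd[of "dg n b" w] f_uminus[OF uO] by simp
    next
      case False
      have "\<sigma> (R False (dg n b) w) = R False (dg n b) (\<sigma> w)" by (rule \<sigma>_even) simp
      then show ?thesis
        using False wt_dg[OF T_wt[OF T_\<sigma>[OF w]]] wt_dg[OF T_wt[OF \<phi>_T[OF uO T_\<sigma>[OF w]]]] f_scale[OF uO] by simp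
    qed
  qed (auto simp: \<sigma>_add \<sigma>_scale f_add[OF uO] f_scale[OF uO] T_\<sigma> \<psi>\<sigma> \<phi>_T[OF uO])
  have "?\<psi> v = c *s \<sigma> v" if "v \<in> T" for v using c[OF T_\<sigma>[OF that]] by (simp add: \<sigma>_\<sigma>)
  then show thesis using that by blast
qed

end

section \<open>The nonsplit class, and the parity automorphism for \<open>q(n)\<close>\<close>

context hw_rep
begin

text \<open>The class of the module \<open>Ind L\<close>, induced from \<open>sq(n)\<close> to \<open>q(n)\<close> and restricted to \<open>sq(n)\<close>.\<close>

lemma standard_cocycle:
  "odd_cocycle scale n Od R V \<sigma> \<nu> v0 (- 1) (\<lambda>X v. c *s R False X (\<sigma> v))"
proof (unfold_locales, goal_cases)
  have C: "X \<in> carrier_mat n n" if "X \<in> Od" for X using that Od_carrier by blast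
  {
    case 1 show ?case by simp
  next
    case (2 X v w) then show ?case by (simp add: \<sigma>_add R_add C scale_right_distrib)
  next
    case (3 X d v) then show ?case by (simp add: \<sigma>_scale R_scale C mult.commute)
  next
    case (4 X Y v) then show ?case by (simp add: R_plus C scale_right_distrib)
  next
    case (5 X d v) then show ?case by (simp add: R_smult C mult.commute)
  next
    case (6 X v) then show ?case using V_stable[of X False] \<sigma>_V subspace_scale[OF V_sub] C by simp
  next
    case (7 X v) then show ?case by (simp add: \<sigma>_even C \<sigma>_scale)
  next
    case (8 A X v)
    then show ?case
      using R_br[of A False X False "\<sigma> v"] C
      by (simp add: supercomm_def \<sigma>_even R_scale scale_right_diff_distrib)
  next
    \<comment> \<open>\<open>R True (X * Y - Y * X)\<close> arises in two ways, as the bracket of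
      the even copy of \<open>X\<close> with the odd copy of \<open>Y\<close> and, with the opposite
      sign, the other way round; this makes the four terms cancel.\<close>
    case (9 X Y v)
    have 1: "R True (X * Y - Y * X) w = R False X (R True Y w) - R True Y (R False X w)" for w
      using R_br[of X False Y True w] 9 C by (simp add: supercomm_def)
    have 2: "R True (Y * X - X * Y) w = R False Y (R True X w) - R True X (R False Y w)" for w
      using R_br[of Y False X True w] 9 C by (simp add: supercomm_def)
    have "Y * X - X * Y = (- 1) \<cdot>\<^sub>m (X * Y - Y * X)"
      using C[OF 9(1)] C[OF 9(2)] by (intro eq_matI) auto
    moreover have "X * Y - Y * X \<in> Od" using part_br[of X False Y True] 9 C by (simp add: supercomm_def)
    ultimately have 3: "R True (Y * X - X * Y) w = - R True (X * Y - Y * X) w" for w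
      using R_smult[of "X * Y - Y * X" True "- 1" w] by simp
    have 4: "R False Y (R True X w) - R True X (R False Y w) + (R False X (R True Y w) - R True Y (R False X w)) = 0" for w
      unfolding 1[of w, symmetric] 2[of w, symmetric] 3[of w] by simp
    have "c *s R False X (\<sigma> (R True Y v)) + R True X (c *s R False Y (\<sigma> v)) + c *s R False Y (\<sigma> (R True X v))
        + R True Y (c *s R False X (\<sigma> v))
      = - (c *s (R False Y (R True X (\<sigma> v)) - R True X (R False Y (\<sigma> v)) + (R False X (R True Y (\<sigma> v)) - R True Y (R False X (\<sigma> v)))))"
      using 9 C by (simp add: \<sigma>_odd R_uminus R_scale scale_right_distrib scale_right_diff_distrib)
    then show ?case unfolding 4 by simp
  }
qed

text \<open>Evaluation at the reciprocals on \<open>v0\<close>: the odd diagonal element acts by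
  zero on both sides, while its even copy acts by
  \<open>\<Sum> (1 / \<nu>\<^sub>i) \<nu>\<^sub>i = n\<close>.\<close>

theorem standard_cocycle_not_coboundary:
  assumes Od: "Od = traceless n" and n: "0 < n"
    and \<nu>: "\<forall>i<n. \<nu> i \<noteq> 0" "(\<Sum>i<n. 1 / \<nu> i) = 0"
    and h: "h 0 = 0" "\<And>v. v \<in> V \<Longrightarrow> h v \<in> V" "\<And>c v. v \<in> V \<Longrightarrow> h (c *s v) = c *s h v"
      "\<And>A v. A \<in> carrier_mat n n \<Longrightarrow> v \<in> V \<Longrightarrow> h (R False A v) = R False A (h v)"
      "\<And>X v. X \<in> Od \<Longrightarrow> v \<in> V \<Longrightarrow> h (R True X v) = R True X (h v) + c *s R False X (\<sigma> v)"
  shows "c = 0"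
proof -
  let ?u = "reciprocals n \<nu>"
  note u = reciprocals_act_trivially[OF Od \<nu>]
  have "wt \<nu> (h v0)"
    using hw(4) h(3)[OF hw(1)] h(4)[OF munit_carrier hw(1)] by (simp add: wt_def flip: h(4)[OF _ hw(1)])
  then have "h v0 \<in> T" using wt_\<nu>_T h(2) hw(1) by blast
  then have "c *s R False (dg n ?u) (\<sigma> v0) = 0"
    using h(5)[OF u(1)[OF v0_T] hw(1)] u(2)[OF v0_T] u(2)[of "h v0"] h(1) by simp
  moreover have "R False (dg n ?u) (\<sigma> v0) = (\<Sum>i<n. ?u i * \<nu> i) *s \<sigma> v0"
    by (rule wt_dg[OF T_wt[OF T_\<sigma>[OF v0_T]]])
  moreover have "(\<Sum>i<n. ?u i * \<nu> i) = (\<Sum>i<n. 1)"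
    by (intro sum.cong) (use \<nu>(1) in \<open>auto simp: reciprocals_def\<close>)
  moreover have "\<sigma> v0 \<noteq> 0" using \<sigma>_\<sigma>[of v0] \<sigma>_0 hw(2) by metis
  ultimately show ?thesis using n by simp
qed

theorem degenerate_classification:
  assumes Od: "Od = traceless n" and n: "0 < n"
    and \<nu>: "\<forall>i<n. \<nu> i \<noteq> 0" "(\<Sum>i<n. 1 / \<nu> i) = 0"
    and f: "odd_cocycle scale n Od R V \<sigma> \<nu> v0 (- 1) f"
  obtains c where "odd_cocycle scale n Od R V \<sigma> \<nu> v0 (- 1) (\<lambda>X v. f X v - c *s R False X (\<sigma> v))"
    "odd_cocycle.coboundary scale n Od R V \<sigma> (- 1) (\<lambda>X v. f X v - c *s R False X (\<sigma> v))"
proof -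
  interpret F: odd_cocycle scale n Od R V \<sigma> \<nu> v0 "- 1" f by (rule f)
  obtain d where d: "\<And>v. v \<in> T \<Longrightarrow> f (dg n (reciprocals n \<nu>)) v = d *s \<sigma> v"
    using F.degenerate_opposite_parity[OF Od n \<nu> refl] by blast
  \<comment> \<open>At the reciprocals the twist of the even action takes the value
    \<open>n \<sigma>\<close>, so this multiple of it cancels \<open>d \<sigma>\<close>.\<close>
  define c where "c = d / of_nat n"
  interpret S: odd_cocycle scale n Od R V \<sigma> \<nu> v0 "- 1" "\<lambda>X v. c *s R False X (\<sigma> v)"
    by (rule standard_cocycle)
  interpret D: odd_cocycle scale n Od R V \<sigma> \<nu> v0 "- 1" "\<lambda>X v. f X v - c *s R False X (\<sigma> v)"
  proof (unfold_locales, goal_cases)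
    case 1 show ?case by simp
  next
    case (2 X v w) then show ?case using F.f_add[OF 2] S.f_add[OF 2] by (simp add: algebra_simps)
  next
    case (3 X e v) then show ?case using F.f_scale[OF 3] S.f_scale[OF 3] by (simp only: scale_right_diff_distrib)
  next
    case (4 X Y v) then show ?case using F.f_plus[OF 4] S.f_plus[OF 4] by (simp add: algebra_simps)
  next
    case (5 X e v) then show ?case using F.f_smult[OF 5] S.f_smult[OF 5] by (simp only: scale_right_diff_distrib)
  next
    case (6 X v) then show ?case using F.f_V[OF 6] S.f_V[OF 6] subspace_diff[OF V_sub] by blast
  next
    case (7 X v)
    have "\<sigma> (f X v - c *s R False X (\<sigma> v)) = \<sigma> (f X v) - \<sigma> (c *s R False X (\<sigma> v))"
      using \<sigma>_add[of "f X v" "- (c *s R False X (\<sigma> v))"] \<sigma>_uminus by simp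
    then show ?case using F.f_\<sigma>[OF 7, of v] S.f_\<sigma>[OF 7, of v] by simp
  next
    case (8 A X v) then show ?case using F.f_equiv[OF 8, of v] S.f_equiv[OF 8, of v] by (simp add: R_diff algebra_simps)
  next
    case (9 X Y v)
    have "f X (R True Y v) + R True X (f Y v) + f Y (R True X v) + R True Y (f X v)
      - (c *s R False X (\<sigma> (R True Y v)) + R True X (c *s R False Y (\<sigma> v)) + c *s R False Y (\<sigma> (R True X v))
        + R True Y (c *s R False X (\<sigma> v))) = 0"
      unfolding F.f_br[OF 9] S.f_br[OF 9] by simp
    then show ?case using 9 by (simp add: R_diff algebra_simps)
  qed
  have D.coboundary
  proof (rule D.coboundary_degenerate[OF Od n \<nu>])
    fix v assume v: "v \<in> T"
    have "R False (dg n (reciprocals n \<nu>)) (\<sigma> v) = (\<Sum>i<n. reciprocals n \<nu> i * \<nu> i) *s \<sigma> v"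
      by (rule wt_dg[OF T_wt[OF T_\<sigma>[OF v]]])
    moreover have "(\<Sum>i<n. reciprocals n \<nu> i * \<nu> i) = (\<Sum>i<n. 1)"
      by (intro sum.cong) (use \<nu>(1) in \<open>auto simp: reciprocals_def\<close>)
    ultimately show "f (dg n (reciprocals n \<nu>)) v - c *s R False (dg n (reciprocals n \<nu>)) (\<sigma> v) = 0"
      using d[OF v] n by (simp add: c_def)
  qed
  with D.odd_cocycle_axioms show thesis by (rule that)
qed

text \<open>For odd \<open>n\<close> the product of the generators is an odd central element of the Clifford algebra
  of \<open>q(n)\<close>.\<close>

theorem odd_rank_parity_automorphism:
  assumes Od: "Od = carrier_mat n n" and n: "odd n" and \<nu>: "\<forall>i<n. \<nu> i \<noteq> 0"
  obtains h c where "\<And>v w. v \<in> V \<Longrightarrow> w \<in> V \<Longrightarrow> h (v + w) = h v + h w"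
    "\<And>c v. v \<in> V \<Longrightarrow> h (c *s v) = c *s h v" "\<And>v. v \<in> V \<Longrightarrow> h v \<in> V"
    "\<And>v. v \<in> V \<Longrightarrow> h (\<sigma> v) = - \<sigma> (h v)"
    "\<And>a X v. X \<in> G a \<Longrightarrow> v \<in> V \<Longrightarrow> h (R a X v) = R a X (h v)"
    "c \<noteq> 0" "\<And>v. v \<in> V \<Longrightarrow> h (h v) = c *s v"
proof -
  \<comment> \<open>The coordinate vectors are orthogonal, with squares
    \<open>\<nu> i \<noteq> 0\<close>. Their trace is 1, so they are available for
    \<open>q(n)\<close> but not for \<open>sq(n)\<close>.\<close>
  define bs where "bs = map (\<lambda>i j. if j = i then 1 else (0::complex)) [0..<n]"
  have dO: "dg n b \<in> Od" for b by (simp add: Od)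
  have dd: "dform n \<nu> (\<lambda>j. if j = i then 1 else 0) b = b i * \<nu> i" if "i < n" for i b
  proof -
    have "dform n \<nu> (\<lambda>j. if j = i then 1 else 0) b = (\<Sum>j<n. if j = i then b j * \<nu> j else 0)"
      unfolding dform_def by (intro sum.cong) auto
    then show ?thesis using that by simp
  qed
  have orth: "orthogonal_list n \<nu> (map (\<lambda>i j. if j = i then 1 else (0::complex)) xs)"
    if "distinct xs" "set xs \<subseteq> {..<n}" for xs
    using that by (induction xs) (auto simp: dd \<nu>)
  have len: "length bs = n" by (simp add: bs_def)
  \<comment> \<open>An odd number of factors makes the product commute with each generator, by
    \<open>zprod_member\<close>, and anticommute with \<open>\<sigma>\<close>.\<close>
  have sgn: "(- 1) ^ length bs = (- 1 :: complex)" using n by (simp add: len)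
  note z = zprod_linear[OF dO]
  have comm: "y b (zprod bs w) = zprod bs (y b w)" if w: "w \<in> T" for b w
  proof -
    have m: "y c (zprod bs w) = zprod bs (y c w)" if "c \<in> set bs" for c
      using zprod_member[OF dO _ w that] orth[of "[0..<n]"] sgn by (simp add: bs_def atLeast0LessThan)
    have "lincomb (set bs) (\<lambda>j. if j < k then b j else 0)" if "k \<le> n" for k
      using that
    proof (induction k)
      case 0 show ?case by (simp add: lincomb.zero)
    next
      case (Suc k)
      then have "lincomb (set bs) (\<lambda>j. b k * (if j = k then 1 else 0) + (if j < k then b j else 0))"
        by (intro lincomb.step) (auto simp: bs_def)
      moreover have "(\<lambda>j. b k * (if j = k then 1 else 0) + (if j < k then b j else 0))
        = (\<lambda>j. if j < Suc k then b j else 0)" by (rule ext) (auto simp: less_Suc_eq)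
      ultimately show ?case by simp
    qed
    then have "lincomb (set bs) (\<lambda>j. if j < n then b j else 0)" by simp
    then have "y (\<lambda>j. if j < n then b j else 0) (zprod bs w) = zprod bs (y (\<lambda>j. if j < n then b j else 0) w)"
    proof (induction rule: lincomb.induct)
      case zero show ?case using y_zero_fun[OF dO] z(2)[of bs 0 0] by simp
    next
      case (step b' w' c)
      then show ?case by (simp add: y_lin dO z m)
    qed
    moreover have "dg n (\<lambda>j. if j < n then b j else 0) = dg n b" by (rule dg_cong) simp
    ultimately show ?thesis by simp
  qed
  have "cocycle (- 1) (\<lambda>a X v. 0)" by (rule cocycle_zero) simp
  then obtain h where h: "\<And>v w. v \<in> V \<Longrightarrow> w \<in> V \<Longrightarrow> h (v + w) = h v + h w"
    "\<And>c v. v \<in> V \<Longrightarrow> h (c *s v) = c *s h v" "\<And>v. v \<in> V \<Longrightarrow> h v \<in> V"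
    "\<And>v. v \<in> T \<Longrightarrow> h v = zprod bs v" "\<And>v. v \<in> V \<Longrightarrow> h (\<sigma> v) = (- 1) *s \<sigma> (h v)"
    "\<And>a X v. X \<in> G a \<Longrightarrow> v \<in> V \<Longrightarrow> h (R a X v) = R a X (h v) + 0"
  proof (rule extend_from_top[of "- 1" "\<lambda>a X v. 0" "zprod bs"])
    fix a b v assume "dg n b \<in> G a" "v \<in> T"
    then show "zprod bs (R a (dg n b) v) = R a (dg n b) (zprod bs v) + 0"
      using comm wt_dg[OF T_wt] wt_dg[OF T_wt[OF z(3)]] z(2) by (cases a) simp_all
  qed (auto simp: z sgn)
  have h\<sigma>: "h (\<sigma> v) = - \<sigma> (h v)" if "v \<in> V" for v using h(5)[OF that] by simp
  have h_neg: "h (- v) = - h v" if "v \<in> V" for v using h(2)[OF that, of "- 1"] by simp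
  \<comment> \<open>\<open>h\<close> anticommutes with the parity, so Schur's lemma is applied to
    its square.\<close>
  obtain c where c: "\<And>v. v \<in> V \<Longrightarrow> h (h v) = c *s v"
  proof (rule schur[of "\<lambda>v. h (h v)"])
    show "h (h (\<sigma> v)) = \<sigma> (h (h v))" if "v \<in> V" for v
      using that h(3) h\<sigma> h_neg \<sigma>_V by simp
    show "h (h (R a X v)) = R a X (h (h v))" if "X \<in> G a" "v \<in> V" for a X v
      using h(3,6) that by simp
  qed (use h in auto)
  have "c \<noteq> 0"
  proof
    assume "c = 0"
    then have "zprod bs (zprod bs v0) = 0"
      using c[OF hw(1)] h(4)[OF v0_T] h(4)[OF z(3)[OF v0_T]] by simp
    then show False
      using zprod_inj[OF dO, of bs] orth[of "[0..<n]"] z(3)[OF v0_T] v0_T hw(2)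
      by (auto simp: bs_def[symmetric] atLeast0LessThan)
  qed
  then show thesis using that[of h c] h h\<sigma> c by (simp del: G_True G_False)
qed

end

section \<open>Matrices as operators on finitely supported functions\<close>

text \<open>\<open>\<complex>\<^sup>d\<close> is realised as the subspace \<open>fspace d\<close> of a fixed type, so that vectors of all dimensions
  share one additive group.\<close>

definition cscale :: "complex \<Rightarrow> (nat \<Rightarrow> complex) \<Rightarrow> nat \<Rightarrow> complex" where
  "cscale c f = (\<lambda>i. c * f i)"

definition fspace :: "nat \<Rightarrow> (nat \<Rightarrow> complex) set" where
  "fspace d = {f. \<forall>i\<ge>d. f i = 0}"

text \<open>Reads only entries with both indices below \<open>d\<close>, so the result lies in
  \<open>fspace d\<close> whatever the argument.\<close>

definition mop :: "nat \<Rightarrow> complex mat \<Rightarrow> (nat \<Rightarrow> complex) \<Rightarrow> nat \<Rightarrow> complex" where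
  "mop d A f = (\<lambda>i. if i < d then \<Sum>j<d. A $$ (i, j) * f j else 0)"

definition psign :: "bool list \<Rightarrow> (nat \<Rightarrow> complex) \<Rightarrow> nat \<Rightarrow> complex" where
  "psign ps f = (\<lambda>i. if i < length ps \<and> ps ! i then - f i else f i)"

definition fun_of_vec :: "complex vec \<Rightarrow> nat \<Rightarrow> complex" where
  "fun_of_vec w = (\<lambda>i. if i < dim_vec w then w $ i else 0)"

lemma cscale_vector_space: "vector_space cscale"
  by unfold_locales (auto simp: cscale_def algebra_simps)

lemma mop_fspace: "mop d A f \<in> fspace d"
  by (simp add: mop_def fspace_def)

lemma vec_fun_of_vec [simp]: "w \<in> carrier_vec d \<Longrightarrow> vec d (fun_of_vec w) = w"
  by (intro eq_vecI) (auto simp: fun_of_vec_def)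

lemma fun_of_vec_vec [simp]: "f \<in> fspace d \<Longrightarrow> fun_of_vec (vec d f) = f"
  by (auto simp: fun_of_vec_def fspace_def)

lemma fun_of_vec_fspace: "w \<in> carrier_vec d \<Longrightarrow> fun_of_vec w \<in> fspace d"
  by (auto simp: fun_of_vec_def fspace_def)

lemma mult_mat_vec_vec:
  assumes "A \<in> carrier_mat d d"
  shows "A *\<^sub>v vec d f = vec d (mop d A f)"
  using assms by (intro eq_vecI) (auto simp: mop_def scalar_prod_def atLeast0LessThan intro!: sum.cong)

lemma vec_add: "vec d f + vec d g = vec d (f + g)"
  by (intro eq_vecI) auto

lemma vec_cscale: "c \<cdot>\<^sub>v vec d f = vec d (cscale c f)"
  by (intro eq_vecI) (auto simp: cscale_def)

lemma vec_eq_iff_fspace: "f \<in> fspace d \<Longrightarrow> g \<in> fspace d \<Longrightarrow> vec d f = vec d g \<longleftrightarrow> f = g"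
  by (metis fun_of_vec_vec)

lemma mop_add: "mop d A (f + g) = mop d A f + mop d A g"
  by (auto simp: mop_def distrib_left sum.distrib)

lemma mop_cscale: "mop d A (cscale c f) = cscale c (mop d A f)"
  by (auto simp: mop_def cscale_def sum_distrib_left mult.left_commute)

lemma mop_mat_add:
  assumes "A \<in> carrier_mat d d" "B \<in> carrier_mat d d"
  shows "mop d (A + B) f = mop d A f + mop d B f"
proof
  fix i
  have "(\<Sum>j<d. (A + B) $$ (i, j) * f j) = (\<Sum>j<d. A $$ (i, j) * f j + B $$ (i, j) * f j)" if "i < d"
    by (intro sum.cong) (use assms that in \<open>auto simp: distrib_right\<close>)
  then show "mop d (A + B) f i = (mop d A f + mop d B f) i" by (simp add: mop_def sum.distrib)
qed

lemma mop_mat_minus: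
  assumes "A \<in> carrier_mat d d" "B \<in> carrier_mat d d"
  shows "mop d (A - B) f = mop d A f - mop d B f"
proof
  fix i
  have "(\<Sum>j<d. (A - B) $$ (i, j) * f j) = (\<Sum>j<d. A $$ (i, j) * f j - B $$ (i, j) * f j)" if "i < d"
    by (intro sum.cong) (use assms that in \<open>auto simp: left_diff_distrib\<close>)
  then show "mop d (A - B) f i = (mop d A f - mop d B f) i" by (simp add: mop_def sum_subtractf)
qed

lemma mop_mat_smult:
  assumes "A \<in> carrier_mat d d"
  shows "mop d (c \<cdot>\<^sub>m A) f = cscale c (mop d A f)"
proof
  fix i
  have "(\<Sum>j<d. (c \<cdot>\<^sub>m A) $$ (i, j) * f j) = (\<Sum>j<d. c * (A $$ (i, j) * f j))" if "i < d"
    by (intro sum.cong) (use assms that in auto)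
  then show "mop d (c \<cdot>\<^sub>m A) f i = cscale c (mop d A f) i" by (simp add: mop_def cscale_def sum_distrib_left)
qed

lemma mop_mat_mult:
  assumes "A \<in> carrier_mat d d" "B \<in> carrier_mat d d"
  shows "mop d (A * B) f = mop d A (mop d B f)"
proof
  fix i
  show "mop d (A * B) f i = mop d A (mop d B f) i"
  proof (cases "i < d")
    case True
    have "mop d (A * B) f i = (\<Sum>j<d. \<Sum>k<d. A $$ (i, k) * B $$ (k, j) * f j)"
      using True by (simp add: mop_def mult_mat_index[OF assms True] sum_distrib_right)
    also have "\<dots> = (\<Sum>k<d. \<Sum>j<d. A $$ (i, k) * B $$ (k, j) * f j)" by (rule sum.swap)
    also have "\<dots> = mop d A (mop d B f) i"
      using True by (auto simp: mop_def sum_distrib_left mult.assoc intro!: sum.cong)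
    finally show ?thesis .
  qed (simp add: mop_def)
qed

lemma mop_zero_mat: "mop d (0\<^sub>m d d) f = 0"
  by (auto simp: mop_def)

lemma mop_unit:
  assumes "i < d" "j < d"
  shows "mop d A (\<lambda>k. if k = j then 1 else 0) i = A $$ (i, j)"
proof -
  have "(\<Sum>k<d. A $$ (i, k) * (if k = j then 1 else 0)) = (\<Sum>k<d. if k = j then A $$ (i, k) else 0)"
    by (intro sum.cong) auto
  then show ?thesis using assms by (simp add: mop_def)
qed

lemma mop_eq_imp_mat_eq:
  assumes "A \<in> carrier_mat d d" "B \<in> carrier_mat d d" "\<And>f. f \<in> fspace d \<Longrightarrow> mop d A f = mop d B f"
  shows "A = B"
proof (rule eq_matI)
  fix i j assume "i < dim_row B" "j < dim_col B"
  then have ij: "i < d" "j < d" using assms(2) by auto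
  have "(\<lambda>k. if k = j then 1 else 0) \<in> fspace d" using ij by (auto simp: fspace_def)
  from assms(3)[OF this] show "A $$ (i, j) = B $$ (i, j)" using ij by (metis mop_unit)
qed (use assms in auto)

lemma linear_is_mop:
  assumes add: "\<And>f g. f \<in> fspace d \<Longrightarrow> g \<in> fspace d \<Longrightarrow> F (f + g) = F f + F g"
    and scale: "\<And>c f. f \<in> fspace d \<Longrightarrow> F (cscale c f) = cscale c (F f)"
    and F: "\<And>f. f \<in> fspace d \<Longrightarrow> F f \<in> fspace d"
  obtains A where "A \<in> carrier_mat d d" "\<And>f. f \<in> fspace d \<Longrightarrow> F f = mop d A f"
proof
  let ?e = "\<lambda>j k. if k = j then 1 else (0 :: complex)"
  let ?A = "mat d d (\<lambda>(i, j). F (?e j) i)"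
  show "?A \<in> carrier_mat d d" by simp
  have unit: "F (?e j) = mop d ?A (?e j)" if "j < d" for j
  proof
    fix i
    have "?e j \<in> fspace d" using that by (auto simp: fspace_def)
    then have "F (?e j) \<in> fspace d" by (rule F)
    then show "F (?e j) i = mop d ?A (?e j) i"
      using mop_unit[of i d j ?A] that by (cases "i < d") (auto simp: fspace_def mop_def)
  qed
  have *: "f \<in> fspace k \<Longrightarrow> k \<le> d \<Longrightarrow> F f = mop d ?A f" for f k
  proof (induction k arbitrary: f)
    case 0
    then have f: "f = cscale 0 f" by (auto simp: fspace_def cscale_def)
    have "f \<in> fspace d" using 0 by (auto simp: fspace_def)
    then have "F f = cscale 0 (F f)" using scale f by metis
    moreover have "mop d ?A f = cscale 0 (mop d ?A f)" using f mop_cscale by metis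
    ultimately show ?case by (auto simp: cscale_def fun_eq_iff)
  next
    case (Suc k)
    let ?g = "\<lambda>i. if i = k then 0 else f i"
    have g: "?g \<in> fspace k" using Suc.prems by (auto simp: fspace_def)
    have f: "f = cscale (f k) (?e k) + ?g" by (auto simp: cscale_def)
    have mem: "?e k \<in> fspace d" "cscale (f k) (?e k) \<in> fspace d" "?g \<in> fspace d"
      using Suc.prems by (auto simp: fspace_def cscale_def)
    have "F f = cscale (f k) (F (?e k)) + F ?g"
      by (subst f) (simp only: add[OF mem(2,3)] scale[OF mem(1)])
    also have "\<dots> = cscale (f k) (mop d ?A (?e k)) + mop d ?A ?g"
      using unit[of k] Suc.IH[OF g] Suc.prems(2) by simp
    also have "\<dots> = mop d ?A (cscale (f k) (?e k) + ?g)" by (simp only: mop_add mop_cscale)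
    finally show ?case using f by simp
  qed
  show "F f = mop d ?A f" if "f \<in> fspace d" for f using *[OF that] by simp
qed

lemma mop_eigenvector:
  assumes "A \<in> carrier_mat d d" "0 < d"
  obtains c f where "f \<in> fspace d" "f \<noteq> 0" "mop d A f = cscale c f"
proof -
  obtain c where "eigenvalue A c"
    using spectrum_non_empty[OF assms(1)] assms(2) by (auto simp: spectrum_def)
  then obtain v where v: "v \<in> carrier_vec d" "v \<noteq> 0\<^sub>v d" "A *\<^sub>v v = c \<cdot>\<^sub>v v"
    using assms(1) by (auto simp: eigenvalue_def eigenvector_def)
  let ?f = "fun_of_vec v"
  have f: "?f \<in> fspace d" by (rule fun_of_vec_fspace[OF v(1)])
  have "vec d (mop d A ?f) = vec d (cscale c ?f)"
    using v(1,3) mult_mat_vec_vec[OF assms(1), of ?f] by (simp add: vec_cscale[symmetric])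
  moreover have "cscale c ?f \<in> fspace d" using f by (auto simp: fspace_def cscale_def)
  ultimately have "mop d A ?f = cscale c ?f" using vec_eq_iff_fspace mop_fspace by blast
  moreover have "?f \<noteq> 0"
  proof
    assume "?f = 0"
    then have "v = vec d 0" using vec_fun_of_vec[OF v(1)] by simp
    then show False using v(2) by (auto simp: zero_vec_def zero_fun_def)
  qed
  ultimately show thesis using that f by blast
qed

lemma finite_mop_eigenvalues:
  assumes "A \<in> carrier_mat d d"
  shows "finite {c. \<exists>f\<in>fspace d. f \<noteq> 0 \<and> mop d A f = cscale c f}"
proof (rule finite_subset[OF _ card_finite_spectrum(1)[OF assms]])
  show "{c. \<exists>f\<in>fspace d. f \<noteq> 0 \<and> mop d A f = cscale c f} \<subseteq> spectrum A"
  proof safe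
    fix c f assume f: "f \<in> fspace d" "f \<noteq> 0" "mop d A f = cscale c f"
    have "A *\<^sub>v vec d f = c \<cdot>\<^sub>v vec d f" using f(3) by (simp add: mult_mat_vec_vec[OF assms] vec_cscale)
    moreover have "vec d f \<noteq> 0\<^sub>v d"
    proof
      assume "vec d f = 0\<^sub>v d"
      then have "f = fun_of_vec (0\<^sub>v d)" using fun_of_vec_vec[OF f(1)] by simp
      then show False using f(2) by (auto simp: fun_of_vec_def)
    qed
    ultimately show "c \<in> spectrum A"
      using assms by (auto simp: spectrum_def eigenvalue_def eigenvector_def intro!: exI[of _ "vec d f"])
  qed
qed

section \<open>Parity as a sign operator\<close>

lemma psign_add: "psign ps (f + g) = psign ps f + psign ps g"
  and psign_cscale: "psign ps (cscale c f) = cscale c (psign ps f)"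
  and psign_psign: "psign ps (psign ps f) = f"
  and psign_fspace: "f \<in> fspace d \<Longrightarrow> psign ps f \<in> fspace d"
  by (auto simp: psign_def cscale_def fspace_def)

lemma psign_Not: "f \<in> fspace (length ps) \<Longrightarrow> psign (map Not ps) f = - psign ps f"
  by (auto simp: psign_def fspace_def)

text \<open>At a nonzero entry the row and column parities differ exactly if \<open>a\<close> holds,
  so row sign and column sign differ by the sign of \<open>a\<close>.\<close>

lemma homog_psign:
  assumes "homog rs cs a F" "length rs = d" "length cs = d"
  shows "psign rs (mop d F f) = cscale (if a then - 1 else 1) (mop d F (psign cs f))"
proof
  fix i
  show "psign rs (mop d F f) i = cscale (if a then - 1 else 1) (mop d F (psign cs f)) i"
  proof (cases "i < d")
    case True
    have "(if rs ! i then - 1 else 1) * (F $$ (i, j) * f j)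
        = (if a then - 1 else 1) * (F $$ (i, j) * psign cs f j)" if "j < d" for j
      using assms True that by (cases "F $$ (i, j) = 0") (auto simp: homog_def psign_def)
    then have "(if rs ! i then - 1 else 1) * (\<Sum>j<d. F $$ (i, j) * f j)
        = (if a then - 1 else 1) * (\<Sum>j<d. F $$ (i, j) * psign cs f j)"
      unfolding sum_distrib_left by (intro sum.cong) auto
    then show ?thesis using True assms(2) by (auto simp: psign_def mop_def cscale_def)
  qed (use assms(2) in \<open>simp add: psign_def mop_def cscale_def\<close>)
qed

lemma homog_if_psign:
  assumes "F \<in> carrier_mat d d" "length rs = d" "length cs = d"
    and "\<And>f. f \<in> fspace d \<Longrightarrow> psign rs (mop d F f) = cscale (if a then - 1 else 1) (mop d F (psign cs f))"
  shows "homog rs cs a F"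
  unfolding homog_def
proof (intro conjI allI impI)
  show "F \<in> carrier_mat (length rs) (length cs)" using assms by simp
  fix i j assume ij: "i < length rs" "j < length cs" "F $$ (i, j) \<noteq> 0"
  let ?e = "\<lambda>k. if k = j then 1 else (0 :: complex)"
  have e: "?e \<in> fspace d" using ij assms by (auto simp: fspace_def)
  have "psign cs ?e = cscale (if cs ! j then - 1 else 1) ?e" using ij by (auto simp: psign_def cscale_def)
  then have "psign rs (mop d F ?e) i = cscale (if a then - 1 else 1) (cscale (if cs ! j then - 1 else 1) (mop d F ?e)) i"
    using assms(4)[OF e] by (simp add: mop_cscale)
  then show "(rs ! i \<noteq> cs ! j) = a"
    using ij assms mop_unit[of i d j F] by (auto simp: psign_def cscale_def split: if_splits)
qed

lemma cvec_subspace_iff: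
  "cvec_subspace d W \<longleftrightarrow> W \<subseteq> carrier_vec d \<and> 0\<^sub>v d \<in> W \<and>
    (\<forall>v\<in>W. \<forall>w\<in>W. v + w \<in> W) \<and> (\<forall>c. \<forall>v\<in>W. c \<cdot>\<^sub>v v \<in> W)"
proof -
  interpret vec_space "TYPE(complex)" d .
  show ?thesis
    unfolding VectorSpace.subspace_def submodule_def
    using vectorspace_axioms module_axioms by (auto simp: module_vec_simps)
qed

definition fset_of :: "nat \<Rightarrow> complex vec set \<Rightarrow> (nat \<Rightarrow> complex) set" where
  "fset_of d W = {f \<in> fspace d. vec d f \<in> W}"

lemma fset_of_subspace:
  assumes "cvec_subspace d W"
  shows "module.subspace cscale (fset_of d W)"
proof -
  interpret vector_space cscale by (rule cscale_vector_space)
  have z: "vec d 0 = (0\<^sub>v d :: complex vec)" by (intro eq_vecI) auto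
  show ?thesis
    using assms unfolding cvec_subspace_iff subspace_def fset_of_def
    by (auto simp: z vec_add[symmetric] vec_cscale[symmetric]) (auto simp: fspace_def cscale_def)
qed

lemma vec_image_subspace:
  assumes "module.subspace cscale U" "U \<subseteq> fspace d"
  shows "cvec_subspace d (vec d ` U)"
proof -
  interpret vector_space cscale by (rule cscale_vector_space)
  have z: "vec d 0 = (0\<^sub>v d :: complex vec)" by (intro eq_vecI) auto
  show ?thesis
    using assms(1) unfolding cvec_subspace_iff
    by (auto simp: subspace_def vec_add vec_cscale) (metis z imageI)
qed

section \<open>Supermodules as triangular representations\<close>

definition emb :: "nat \<Rightarrow> bool \<Rightarrow> complex mat \<Rightarrow> complex mat" where
  "emb n a X = (if a then q_mat (0\<^sub>m n n) X else q_mat X (0\<^sub>m n n))"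

text \<open>The subalgebra of \<open>q(n)\<close> with full even part and odd blocks
  \<open>Od\<close>, which covers \<open>q_alg\<close> and \<open>sq_alg\<close> at once.\<close>

definition gsub :: "nat \<Rightarrow> complex mat set \<Rightarrow> superalg" where
  "gsub n Od a = emb n a ` homog_part n Od a"

definition srep :: "nat \<Rightarrow> smod \<Rightarrow> bool \<Rightarrow> complex mat \<Rightarrow> (nat \<Rightarrow> complex) \<Rightarrow> nat \<Rightarrow> complex" where
  "srep n M a X = mop (sdim M) (act M (emb n a X))"

text \<open>The requirements of \<open>tri_rep\<close> that concern \<open>Od\<close> alone, so that
  they are checked once for each choice of odd part and not for each module.\<close>

definition triangular_odd :: "nat \<Rightarrow> complex mat set \<Rightarrow> bool" where
  "triangular_odd n Od \<longleftrightarrow> Od \<subseteq> carrier_mat n n \<and> 0\<^sub>m n n \<in> Od \<and>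
    (\<forall>X\<in>Od. lower_part n X \<in> Od \<and> dg n (\<lambda>i. X $$ (i, i)) \<in> Od \<and> upper_part n X \<in> Od) \<and>
    (\<forall>X\<in>Od. \<forall>i<n. \<forall>j<n. i \<noteq> j \<and> X $$ (i, j) \<noteq> 0 \<longrightarrow> munit n i j \<in> Od) \<and>
    (\<forall>X\<in>Od. \<forall>Y\<in>Od. X + Y \<in> Od) \<and> (\<forall>c. \<forall>X\<in>Od. c \<cdot>\<^sub>m X \<in> Od) \<and>
    (\<forall>A\<in>carrier_mat n n. \<forall>X\<in>Od. A * X - X * A \<in> Od \<and> X * A - A * X \<in> Od)"

lemma q_alg_gsub: "q_alg n = gsub n (carrier_mat n n)"
  by (rule ext) (auto simp: q_alg_def gsub_def emb_def homog_part_def)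

lemma sq_alg_gsub: "sq_alg n = gsub n (traceless n)"
  by (rule ext) (auto simp: sq_alg_def gsub_def emb_def homog_part_def traceless_def)

lemma triangular_odd_carrier: "triangular_odd n (carrier_mat n n)"
  unfolding triangular_odd_def by auto

lemma trace_commutator:
  fixes A X :: "complex mat"
  assumes "A \<in> carrier_mat n n" "X \<in> carrier_mat n n"
  shows "(\<Sum>i<n. (A * X - X * A) $$ (i, i)) = 0"
proof -
  have "(\<Sum>i<n. (A * X - X * A) $$ (i, i)) = (\<Sum>i<n. (A * X) $$ (i, i)) - (\<Sum>i<n. (X * A) $$ (i, i))"
  proof -
    have "(\<Sum>i<n. (A * X - X * A) $$ (i, i)) = (\<Sum>i<n. (A * X) $$ (i, i) - (X * A) $$ (i, i))"
      by (intro sum.cong refl index_minus_mat) (use assms in auto)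
    then show ?thesis by (simp only: sum_subtractf)
  qed
  also have "(\<Sum>i<n. (A * X) $$ (i, i)) = (\<Sum>i<n. \<Sum>k<n. A $$ (i, k) * X $$ (k, i))"
    by (intro sum.cong refl mult_mat_index[OF assms]) auto
  also have "\<dots> = (\<Sum>k<n. \<Sum>i<n. A $$ (i, k) * X $$ (k, i))" by (rule sum.swap)
  also have "\<dots> = (\<Sum>k<n. (X * A) $$ (k, k))"
    by (intro sum.cong refl) (auto simp: mult_mat_index[OF assms(2,1)] mult.commute)
  finally show ?thesis by simp
qed

lemma triangular_odd_traceless: "triangular_odd n (traceless n)"
proof -
  define tr :: "complex mat \<Rightarrow> complex" where "tr X = (\<Sum>i<n. X $$ (i, i))" for X
  have tl: "traceless n = {X \<in> carrier_mat n n. tr X = 0}" by (simp add: traceless_def tr_def)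
  have "tr (dg n (\<lambda>i. X $$ (i, i))) = tr X" for X
    unfolding tr_def by (intro sum.cong) (auto simp: dg_def)
  moreover have "tr (X + Y) = tr X + tr Y" if "X \<in> carrier_mat n n" "Y \<in> carrier_mat n n" for X Y
    unfolding tr_def sum.distrib[symmetric] by (intro sum.cong) (use that in auto)
  moreover have "tr (c \<cdot>\<^sub>m X) = c * tr X" if "X \<in> carrier_mat n n" for X and c
    unfolding tr_def sum_distrib_left by (intro sum.cong) (use that in auto)
  moreover have "tr (lower_part n X) = 0" "tr (upper_part n X) = 0" for X
    by (simp_all add: tr_def lower_part_def upper_part_def)
  moreover have "tr (munit n i j) = 0" if "i \<noteq> j" for i j
    unfolding tr_def by (rule sum.neutral) (use that in \<open>auto simp: munit_def\<close>)
  moreover have "tr (0\<^sub>m n n) = 0" by (simp add: tr_def)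
  moreover have "tr (A * X - X * A) = 0" if "A \<in> carrier_mat n n" "X \<in> carrier_mat n n" for A X
    unfolding tr_def by (rule trace_commutator[OF that])
  ultimately show ?thesis unfolding triangular_odd_def tl by auto
qed

lemma triangular_odd_zero: "triangular_odd n {0\<^sub>m n n}"
proof -
  have "lower_part n (0\<^sub>m n n) = 0\<^sub>m n n" "upper_part n (0\<^sub>m n n) = 0\<^sub>m n n"
    "dg n (\<lambda>i. 0\<^sub>m n n $$ (i, i)) = 0\<^sub>m n n"
    by (intro eq_matI; auto simp: lower_part_def upper_part_def dg_def)+
  then show ?thesis unfolding triangular_odd_def by auto
qed

lemma emb_add: "X \<in> carrier_mat n n \<Longrightarrow> Y \<in> carrier_mat n n \<Longrightarrow> emb n a (X + Y) = emb n a X + emb n a Y"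
  by (auto simp: emb_def q_mat_def add_four_block_mat[of _ n n _ n _ n])

lemma emb_smult: "X \<in> carrier_mat n n \<Longrightarrow> emb n a (c \<cdot>\<^sub>m X) = c \<cdot>\<^sub>m emb n a X"
  by (auto simp: emb_def q_mat_def smult_four_block_mat[of _ n n _ n _ n])

lemma emb_mult:
  assumes "X \<in> carrier_mat n n" "Y \<in> carrier_mat n n"
  shows "emb n a X * emb n b Y = emb n (a \<noteq> b) (X * Y)"
  using assms by (auto simp: emb_def q_mat_def mult_four_block_mat[of _ n n _ n _ n _ _ n _ n])

lemma emb_carrier: "X \<in> carrier_mat n n \<Longrightarrow> emb n a X \<in> carrier_mat (n + n) (n + n)"
  by (auto simp: emb_def q_mat_def)

text \<open>\<open>emb\<close> is multiplicative, with parities added, so brackets of supermatrices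
  can be computed on their blocks.\<close>

lemma supercomm_emb:
  assumes "X \<in> carrier_mat n n" "Y \<in> carrier_mat n n"
  shows "supercomm a b (emb n a X) (emb n b Y) = emb n (a \<noteq> b) (supercomm a b X Y)"
proof -
  have minus: "emb n c P - emb n c Q = emb n c (P - Q)" if "P \<in> carrier_mat n n" "Q \<in> carrier_mat n n" for c P Q
    using that by (intro eq_matI) (auto simp: emb_def q_mat_def)
  have ba: "(b \<noteq> a) = (a \<noteq> b)" by auto
  show ?thesis
    using assms unfolding supercomm_def emb_mult[OF assms] emb_mult[OF assms(2,1)] ba
    by (simp add: minus emb_add)
qed

lemma elements_gsub:
  assumes "triangular_odd n Od"
  shows "X \<in> homog_part n Od a \<Longrightarrow> emb n a X \<in> elements (gsub n Od)"
    "Z \<in> elements (gsub n Od) \<Longrightarrow> \<exists>X Y. X \<in> carrier_mat n n \<and> Y \<in> Od \<and> Z = emb n False X + emb n True Y"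
proof -
  have c: "Od \<subseteq> carrier_mat n n" "0\<^sub>m n n \<in> Od" using assms by (auto simp: triangular_odd_def)
  have z: "emb n True (0\<^sub>m n n) = 0\<^sub>m (n + n) (n + n)" "emb n False (0\<^sub>m n n) = 0\<^sub>m (n + n) (n + n)"
    by (simp_all add: emb_def q_mat_def)
  show "emb n a X \<in> elements (gsub n Od)" if "X \<in> homog_part n Od a"
  proof (cases a)
    case True
    then have "emb n a X = emb n False (0\<^sub>m n n) + emb n True X"
      using that c emb_carrier[of X n True] by (auto simp: z homog_part_def)
    moreover have "emb n False (0\<^sub>m n n) \<in> gsub n Od False" "emb n True X \<in> gsub n Od True"
      using that True by (simp_all add: gsub_def homog_part_def)
    ultimately show ?thesis unfolding elements_def by blast
  next
    case False
    then have "emb n a X = emb n False X + emb n True (0\<^sub>m n n)"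
      using that emb_carrier[of X n False] by (auto simp: z homog_part_def)
    moreover have "emb n False X \<in> gsub n Od False" "emb n True (0\<^sub>m n n) \<in> gsub n Od True"
      using that False c by (simp_all add: gsub_def homog_part_def)
    ultimately show ?thesis unfolding elements_def by blast
  qed
  show "\<exists>X Y. X \<in> carrier_mat n n \<and> Y \<in> Od \<and> Z = emb n False X + emb n True Y" if "Z \<in> elements (gsub n Od)"
    using that by (auto simp: elements_def gsub_def homog_part_def)
qed

lemma gsub_elements: "triangular_odd n Od \<Longrightarrow> Z \<in> gsub n Od a \<Longrightarrow> Z \<in> elements (gsub n Od)"
  using elements_gsub(1) by (auto simp: gsub_def)

lemma triangular_odd_parts:
  assumes "triangular_odd n Od"
  shows "X \<in> homog_part n Od a \<Longrightarrow> X \<in> carrier_mat n n"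
    "X \<in> homog_part n Od a \<Longrightarrow> Y \<in> homog_part n Od a \<Longrightarrow> X + Y \<in> homog_part n Od a"
    "X \<in> homog_part n Od a \<Longrightarrow> c \<cdot>\<^sub>m X \<in> homog_part n Od a"
    "X \<in> homog_part n Od a \<Longrightarrow> Y \<in> homog_part n Od b \<Longrightarrow> supercomm a b X Y \<in> homog_part n Od (a \<noteq> b)"
proof -
  have c: "Od \<subseteq> carrier_mat n n" using assms by (auto simp: triangular_odd_def)
  then show C: "X \<in> homog_part n Od a \<Longrightarrow> X \<in> carrier_mat n n" for a X by (auto simp: homog_part_def split: if_splits)
  show "X \<in> homog_part n Od a \<Longrightarrow> Y \<in> homog_part n Od a \<Longrightarrow> X + Y \<in> homog_part n Od a"
    and "X \<in> homog_part n Od a \<Longrightarrow> c \<cdot>\<^sub>m X \<in> homog_part n Od a"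
    using assms by (auto simp: homog_part_def triangular_odd_def)
  assume X: "X \<in> homog_part n Od a" and Y: "Y \<in> homog_part n Od b"
  show "supercomm a b X Y \<in> homog_part n Od (a \<noteq> b)"
  proof (cases "a = b")
    case True
    then show ?thesis using supercomm_carrier[OF C[OF X] C[OF Y], of a b] by (simp add: homog_part_def)
  next
    case False
    then show ?thesis using assms X Y by (cases a; cases b) (auto simp: homog_part_def triangular_odd_def supercomm_def)
  qed
qed

lemma tri_repI:
  assumes "vector_space sc" "triangular_odd n Od"
    and "\<And>a X v w. X \<in> homog_part n Od a \<Longrightarrow> R a X (v + w) = R a X v + R a X w"
    and "\<And>a X c v. X \<in> homog_part n Od a \<Longrightarrow> R a X (sc c v) = sc c (R a X v)"
    and "\<And>a X Y v. X \<in> homog_part n Od a \<Longrightarrow> Y \<in> homog_part n Od a \<Longrightarrow> R a (X + Y) v = R a X v + R a Y v"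
    and "\<And>a c X v. X \<in> homog_part n Od a \<Longrightarrow> R a (c \<cdot>\<^sub>m X) v = sc c (R a X v)"
    and "\<And>a b X Y v. X \<in> homog_part n Od a \<Longrightarrow> Y \<in> homog_part n Od b \<Longrightarrow> R (a \<noteq> b) (supercomm a b X Y) v =
         (if a \<and> b then R a X (R b Y v) + R b Y (R a X v) else R a X (R b Y v) - R b Y (R a X v))"
  shows "tri_rep sc n Od R"
proof (rule tri_rep.intro[OF assms(1)], rule tri_rep_axioms.intro)
  note d = assms(2)[unfolded triangular_odd_def]
  show "Od \<subseteq> carrier_mat n n" using d by blast
  show "lower_part n X \<in> Od" if "X \<in> Od" for X using d that by blast
  show "dg n (\<lambda>i. X $$ (i, i)) \<in> Od" if "X \<in> Od" for X using d that by blast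
  show "upper_part n X \<in> Od" if "X \<in> Od" for X using d that by blast
  show "munit n i j \<in> Od" if "X \<in> Od" "i < n" "j < n" "i \<noteq> j" "X $$ (i, j) \<noteq> 0" for X i j
    using d that by blast
qed (fact triangular_odd_parts(2-4)[OF assms(2)] assms(3-7))+

lemma supermodule_act:
  assumes "supermodule (gsub n Od) M" "triangular_odd n Od" "X \<in> homog_part n Od a"
  shows "act M (emb n a X) \<in> carrier_mat (sdim M) (sdim M)"
    "homog (par M) (par M) a (act M (emb n a X))"
    "Y \<in> homog_part n Od a \<Longrightarrow> act M (emb n a (X + Y)) = act M (emb n a X) + act M (emb n a Y)"
    "act M (emb n a (c \<cdot>\<^sub>m X)) = c \<cdot>\<^sub>m act M (emb n a X)"
    "Y \<in> homog_part n Od b \<Longrightarrow> act M (emb n (a \<noteq> b) (supercomm a b X Y)) =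
      supercomm a b (act M (emb n a X)) (act M (emb n b Y))"
proof -
  note M = assms(1)[unfolded supermodule_def]
  note el = elements_gsub(1)[OF assms(2)] and C = triangular_odd_parts(1)[OF assms(2)]
  have g: "emb n a X \<in> gsub n Od a" if "X \<in> homog_part n Od a" for a X using that by (simp add: gsub_def)
  show "act M (emb n a X) \<in> carrier_mat (sdim M) (sdim M)" using M el[OF assms(3)] by blast
  show "homog (par M) (par M) a (act M (emb n a X))" using M g[OF assms(3)] by blast
  show "act M (emb n a (X + Y)) = act M (emb n a X) + act M (emb n a Y)" if "Y \<in> homog_part n Od a"
    using M el[OF assms(3)] el[OF that] emb_add[OF C[OF assms(3)] C[OF that]] by simp
  show "act M (emb n a (c \<cdot>\<^sub>m X)) = c \<cdot>\<^sub>m act M (emb n a X)"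
    using M el[OF assms(3)] emb_smult[OF C[OF assms(3)]] by simp
  show "act M (emb n (a \<noteq> b) (supercomm a b X Y)) = supercomm a b (act M (emb n a X)) (act M (emb n b Y))"
    if "Y \<in> homog_part n Od b"
    using M g[OF assms(3)] g[OF that] supercomm_emb[OF C[OF assms(3)] C[OF that], of a b] by metis
qed

lemma srep_br:
  assumes "supermodule (gsub n Od) M" "triangular_odd n Od" "X \<in> homog_part n Od a" "Y \<in> homog_part n Od b"
  shows "srep n M (a \<noteq> b) (supercomm a b X Y) v =
    (if a \<and> b then srep n M a X (srep n M b Y v) + srep n M b Y (srep n M a X v)
     else srep n M a X (srep n M b Y v) - srep n M b Y (srep n M a X v))"
proof -
  note A = supermodule_act(1)[OF assms(1-3)] and B = supermodule_act(1)[OF assms(1,2,4)]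
  note AB = mult_carrier_mat[OF A B] and BA = mult_carrier_mat[OF B A]
  note mops = mop_mat_mult[OF A B] mop_mat_mult[OF B A]
  show ?thesis
  proof (cases "a \<and> b")
    case True
    show ?thesis
      unfolding srep_def supermodule_act(5)[OF assms]
      unfolding supercomm_def if_P[OF True] mop_mat_add[OF AB BA] mops ..
  next
    case False
    show ?thesis
      unfolding srep_def supermodule_act(5)[OF assms]
      unfolding supercomm_def if_not_P[OF False] mop_mat_minus[OF AB BA] mops ..
  qed
qed

lemma srep_tri_rep:
  assumes "supermodule (gsub n Od) M" "triangular_odd n Od"
  shows "tri_rep cscale n Od (srep n M)"
proof (rule tri_repI[OF cscale_vector_space assms(2)])
  note act = supermodule_act[OF assms]
  show "srep n M a X (v + w) = srep n M a X v + srep n M a X w" for a X v w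
    by (simp add: srep_def mop_add)
  show "srep n M a X (cscale c v) = cscale c (srep n M a X v)" for a X c v
    by (simp add: srep_def mop_cscale)
  show "srep n M a (X + Y) v = srep n M a X v + srep n M a Y v"
    if "X \<in> homog_part n Od a" "Y \<in> homog_part n Od a" for a X Y v
    using act(3)[OF that] act(1)[OF that(1)] act(1)[OF that(2)] by (simp add: srep_def mop_mat_add)
  show "srep n M a (c \<cdot>\<^sub>m X) v = cscale c (srep n M a X v)" if "X \<in> homog_part n Od a" for a c X v
    using act(4)[OF that] act(1)[OF that] by (simp add: srep_def mop_mat_smult)
qed (rule srep_br[OF assms])

lemma fspace_subspace: "module.subspace cscale (fspace d)"
proof -
  interpret vector_space cscale by (rule cscale_vector_space)
  show ?thesis by (auto simp: subspace_def fspace_def cscale_def)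
qed

lemma srep_fin_rep:
  assumes "supermodule (gsub n Od) M" "triangular_odd n Od"
  shows "fin_rep cscale n Od (srep n M) (fspace (sdim M))"
proof -
  interpret tri_rep cscale n Od "srep n M" by (rule srep_tri_rep[OF assms])
  show ?thesis
  proof unfold_locales
    show "subspace (fspace (sdim M))" by (rule fspace_subspace)
    show "finite {c. \<exists>w\<in>fspace (sdim M). w \<noteq> 0 \<and>
        srep n M False (dg n (\<lambda>i. of_nat n - of_nat i)) w = cscale c w}"
      unfolding srep_def by (rule finite_mop_eigenvalues[OF supermodule_act(1)[OF assms]]) simp
  qed (simp add: srep_def mop_fspace)
qed

lemma zero_strictly_upper: "0\<^sub>m n n \<in> strictly_upper n"
  by (auto simp: strictly_upper_def)

text \<open>Graded submodules of column vectors correspond to \<open>\<sigma>\<close>-stable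
  submodules of \<open>fspace\<close>, which transfers simplicity; the weight is extended by zero to
  fit \<open>wt\<close>.\<close>

theorem srep_hw_rep:
  assumes M: "simple_highest_weight (gsub n Od) n \<nu> M" and Od: "triangular_odd n Od"
  obtains v0 where
    "hw_rep cscale n Od (srep n M) (fspace (sdim M)) (psign (par M)) (\<lambda>i. if i < n then \<nu> $ i else 0) v0"
proof -
  let ?d = "sdim M" and ?\<nu> = "\<lambda>i. if i < n then \<nu> $ i else 0"
  have sm: "supermodule (gsub n Od) M" and d: "?d \<noteq> 0"
    and simp: "\<And>W. graded_subspace (par M) W \<Longrightarrow> stable_under (elements (gsub n Od)) M W \<Longrightarrow>
      W = {0\<^sub>v ?d} \<or> W = carrier_vec ?d"
    using M unfolding simple_highest_weight_def simple_smod_def by blast+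
  obtain v where v: "v \<in> carrier_vec ?d" "v \<noteq> 0\<^sub>v ?d"
    "\<And>A B. A \<in> strictly_upper n \<Longrightarrow> B \<in> strictly_upper n \<Longrightarrow> act M (q_mat A B) *\<^sub>v v = 0\<^sub>v ?d"
    "\<And>i. i < n \<Longrightarrow> act M (q_mat (diag_unit n i) (0\<^sub>m n n)) *\<^sub>v v = (\<nu> $ i) \<cdot>\<^sub>v v"
    using M unfolding simple_highest_weight_def has_highest_weight_def by blast
  note act = supermodule_act[OF sm Od]
  interpret fin_rep cscale n Od "srep n M" "fspace ?d" by (rule srep_fin_rep[OF sm Od])
  let ?v0 = "fun_of_vec v"
  have v0: "?v0 \<in> fspace ?d" by (rule fun_of_vec_fspace[OF v(1)])
  have fv: "vec ?d ?v0 = v" by (rule vec_fun_of_vec[OF v(1)])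
  have zero_fun: "vec ?d f = 0\<^sub>v ?d \<longleftrightarrow> f = 0" if "f \<in> fspace ?d" for f
  proof -
    have z: "vec ?d 0 = (0\<^sub>v ?d :: complex vec)" by (intro eq_vecI) auto
    have "0 \<in> fspace ?d" by (simp add: fspace_def)
    then show ?thesis using vec_eq_iff_fspace[OF that, of 0] z by simp
  qed
  have "hw_rep cscale n Od (srep n M) (fspace ?d) (psign (par M)) ?\<nu> ?v0"
  proof unfold_locales
    fix v w c d
    show "psign (par M) (v + w) = psign (par M) v + psign (par M) w"
      "psign (par M) (cscale c v) = cscale c (psign (par M) v)" "psign (par M) (psign (par M) v) = v"
      by (simp_all add: psign_add psign_cscale psign_psign)
    show "psign (par M) v \<in> fspace (sdim M)" if "v \<in> fspace (sdim M)" using psign_fspace[OF that] .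
  next
    fix X a v assume "X \<in> G a"
    from homog_psign[OF act(2)[OF this]]
    show "psign (par M) (srep n M a X v) = cscale (if a then - 1 else 1) (srep n M a X (psign (par M) v))"
      by (simp add: srep_def sdim_def)
  next
    fix U assume U: "subspace U" "U \<subseteq> fspace ?d" "\<And>a X u. X \<in> G a \<Longrightarrow> u \<in> U \<Longrightarrow> srep n M a X u \<in> U"
      "\<And>u. u \<in> U \<Longrightarrow> psign (par M) u \<in> U"
    let ?W = "vec ?d ` U"
    have "graded_subspace (par M) ?W"
      unfolding graded_subspace_def
    proof (intro conjI ballI allI)
      show "cvec_subspace (length (par M)) ?W" using vec_image_subspace[OF U(1,2)] by (simp add: sdim_def)
      fix w a assume "w \<in> ?W"
      then obtain u where u: "u \<in> U" "w = vec ?d u" by blast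
      \<comment> \<open>The projection to parity \<open>a\<close> is
        \<open>(1 + \<sigma>) / 2\<close> or \<open>(1 - \<sigma>) / 2\<close>, so
        \<open>\<sigma>\<close>-stable subspaces are graded.\<close>
      let ?p = "cscale (1/2) (u + cscale (if a then - 1 else 1) (psign (par M) u))"
      have "?p \<in> U" by (intro subspace_scale[OF U(1)] subspace_add[OF U(1)] U(4) u(1))
      moreover have "vec (length (par M)) (\<lambda>i. if par M ! i = a then w $ i else 0) = vec ?d ?p"
        by (intro eq_vecI) (auto simp: u(2) sdim_def cscale_def psign_def)
      ultimately show "vec (length (par M)) (\<lambda>i. if par M ! i = a then w $ i else 0) \<in> ?W" by blast
    qed
    moreover have "stable_under (elements (gsub n Od)) M ?W"
      unfolding stable_under_def
    proof (intro ballI)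
      fix Z w assume "Z \<in> elements (gsub n Od)" "w \<in> ?W"
      then obtain X Y u where Z: "X \<in> carrier_mat n n" "Y \<in> Od" "Z = emb n False X + emb n True Y"
        and u: "u \<in> U" "w = vec ?d u" using elements_gsub(2)[OF Od] by blast
      have X: "X \<in> homog_part n Od False" and Y: "Y \<in> homog_part n Od True" using Z by auto
      have "act M Z = act M (emb n False X) + act M (emb n True Y)"
        using sm elements_gsub(1)[OF Od] X Y unfolding supermodule_def Z(3) by blast
      then have "act M Z *\<^sub>v w = vec ?d (srep n M False X u + srep n M True Y u)"
        unfolding u(2) srep_def
        using mult_mat_vec_vec[of "act M Z" ?d u] act(1)[OF X] act(1)[OF Y] by (simp add: mop_mat_add)
      moreover have "srep n M False X u + srep n M True Y u \<in> U"
        using U(3)[OF X u(1)] U(3)[OF Y u(1)] subspace_add[OF U(1)] by blast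
      ultimately show "act M Z *\<^sub>v w \<in> ?W" by blast
    qed
    ultimately have "?W = {0\<^sub>v ?d} \<or> ?W = carrier_vec ?d" by (rule simp)
    then show "U = {0} \<or> U = fspace ?d"
    proof
      assume W: "?W = {0\<^sub>v ?d}"
      have "u = 0" if "u \<in> U" for u using zero_fun[of u] that U(2) W by blast
      then show ?thesis using subspace_0[OF U(1)] by blast
    next
      assume W: "?W = carrier_vec ?d"
      have "f \<in> U" if f: "f \<in> fspace ?d" for f
      proof -
        have "vec ?d f \<in> ?W" using W by simp
        then obtain u where "u \<in> U" "vec ?d f = vec ?d u" by blast
        then show ?thesis using vec_eq_iff_fspace[OF f, of u] U(2) by blast
      qed
      then show ?thesis using U(2) by blast
    qed
  next
    show "?v0 \<in> fspace ?d" by (rule v0)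
    show "?v0 \<noteq> 0" using zero_fun[OF v0] v(2) by (simp add: fv)
    show "upkilled ?v0"
      unfolding upkilled_def
    proof (intro allI impI)
      fix a X assume X: "X \<in> G a" "X \<in> strictly_upper n"
      have "act M (emb n a X) *\<^sub>v v = 0\<^sub>v ?d"
        using v(3)[OF X(2) zero_strictly_upper] v(3)[OF zero_strictly_upper X(2)] by (simp add: emb_def)
      then have "vec ?d (srep n M a X ?v0) = 0\<^sub>v ?d"
        using mult_mat_vec_vec[OF act(1)[OF X(1)], of ?v0] by (simp add: srep_def fv)
      then show "srep n M a X ?v0 = 0" using zero_fun by (simp add: srep_def mop_fspace)
    qed
    show "wt ?\<nu> ?v0"
      unfolding wt_def
    proof (intro conjI allI impI)
      fix i assume i: "i < n"
      have "diag_unit n i = munit n i i" by (simp add: diag_unit_def munit_def)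
      then have "act M (emb n False (munit n i i)) *\<^sub>v v = (\<nu> $ i) \<cdot>\<^sub>v v" using v(4)[OF i] by (simp add: emb_def)
      then have "vec ?d (srep n M False (munit n i i) ?v0) = vec ?d (cscale (\<nu> $ i) ?v0)"
        using mult_mat_vec_vec[OF act(1), of "munit n i i" False ?v0]
        by (simp add: srep_def fv vec_cscale[symmetric])
      moreover have "cscale (\<nu> $ i) ?v0 \<in> fspace ?d" using v0 by (auto simp: fspace_def cscale_def)
      ultimately show "srep n M False (munit n i i) ?v0 = cscale (?\<nu> i) ?v0"
        using vec_eq_iff_fspace i by (simp add: srep_def mop_fspace)
    qed simp
  next
    fix F :: "(nat \<Rightarrow> complex) \<Rightarrow> nat \<Rightarrow> complex"
    assume F: "\<And>v w. v \<in> fspace ?d \<Longrightarrow> w \<in> fspace ?d \<Longrightarrow> F (v + w) = F v + F w"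
      "\<And>c v. v \<in> fspace ?d \<Longrightarrow> F (cscale c v) = cscale c (F v)" "\<And>v. v \<in> fspace ?d \<Longrightarrow> F v \<in> fspace ?d"
    obtain A where A: "A \<in> carrier_mat ?d ?d" "\<And>f. f \<in> fspace ?d \<Longrightarrow> F f = mop ?d A f"
      using linear_is_mop[of ?d F] F by blast
    obtain c f where "f \<in> fspace ?d" "f \<noteq> 0" "mop ?d A f = cscale c f"
      using mop_eigenvector[OF A(1)] d by blast
    then show "\<exists>c w. w \<in> fspace ?d \<and> w \<noteq> 0 \<and> F w = cscale c w" using A(2) by metis
  qed
  then show thesis by (rule that)
qed

section \<open>Semisimplicity over the even part\<close>

text \<open>The criterion for membership in the category: unlike semisimplicity it passes directly
  to extensions whose cocycle vanishes on the even part.\<close>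

definition weight_spanned :: "nat \<Rightarrow> smod \<Rightarrow> bool" where
  "weight_spanned n M \<longleftrightarrow> fspace (sdim M) \<subseteq> module.span cscale
    {w \<in> fspace (sdim M). \<exists>\<mu>. (\<forall>i\<ge>n. \<mu> i = 0) \<and> (\<forall>i<n. srep n M False (munit n i i) w = cscale (\<mu> i) w)}"

text \<open>Forgets the odd action: the only odd element left is the zero matrix, acting by
  zero.\<close>

lemma even_tri_rep:
  assumes "supermodule (gsub n Od) M" "triangular_odd n Od"
  shows "tri_rep cscale n {0\<^sub>m n n} (\<lambda>a X. if a then (\<lambda>_. 0) else srep n M False X)"
proof (rule tri_repI[OF cscale_vector_space triangular_odd_zero])
  interpret M: tri_rep cscale n Od "srep n M" by (rule srep_tri_rep[OF assms])
  let ?R = "\<lambda>a X. if a then (\<lambda>_. 0) else srep n M False X"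
  have hp: "X \<in> carrier_mat n n" if "X \<in> homog_part n {0\<^sub>m n n} a" for X a
    using that by (auto simp: homog_part_def split: if_splits)
  have c0: "cscale c 0 = 0" for c by (auto simp: cscale_def)
  show "?R a X (v + w) = ?R a X v + ?R a X w" if "X \<in> homog_part n {0\<^sub>m n n} a" for a X v w
    using M.R_add[of X False] hp[OF that] by simp
  show "?R a X (cscale c v) = cscale c (?R a X v)" if "X \<in> homog_part n {0\<^sub>m n n} a" for a X c v
    using M.R_scale[of X False] hp[OF that] by (simp add: c0)
  show "?R a (X + Y) v = ?R a X v + ?R a Y v"
    if "X \<in> homog_part n {0\<^sub>m n n} a" "Y \<in> homog_part n {0\<^sub>m n n} a" for a X Y v
    using M.R_plus[of X False Y] hp[OF that(1)] hp[OF that(2)] by simp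
  show "?R a (c \<cdot>\<^sub>m X) v = cscale c (?R a X v)" if "X \<in> homog_part n {0\<^sub>m n n} a" for a c X v
    using M.R_smult[of X False] hp[OF that] by (simp add: c0)
  fix a b X Y v assume X: "X \<in> homog_part n {0\<^sub>m n n} a" and Y: "Y \<in> homog_part n {0\<^sub>m n n} b"
  consider "\<not> a" "\<not> b" | "a" "b" | "a \<noteq> b" by blast
  then show "?R (a \<noteq> b) (supercomm a b X Y) v =
      (if a \<and> b then ?R a X (?R b Y v) + ?R b Y (?R a X v) else ?R a X (?R b Y v) - ?R b Y (?R a X v))"
  proof cases
    case 1
    then show ?thesis using M.R_br[of X False Y False v] hp[OF X] hp[OF Y] by simp
  next
    case 2
    then have "supercomm a b X Y = 0\<^sub>m n n" using X Y by (simp add: homog_part_def supercomm_def)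
    then show ?thesis using 2 M.R_zero_mat[of False v] by simp
  next
    case 3
    then show ?thesis using M.R_zero[of X False] M.R_zero[of Y False] hp[OF X] hp[OF Y] by auto
  qed
qed

theorem weight_spanned_semisimple:
  assumes sm: "supermodule (gsub n Od) M" and Od: "triangular_odd n Od" and ws: "weight_spanned n M"
  shows "semisimple_over_even (gsub n Od) M"
  unfolding semisimple_over_even_def
proof (intro allI impI)
  let ?d = "sdim M" and ?R = "\<lambda>a X. if a then (\<lambda>_. 0) else srep n M False X"
  note act = supermodule_act[OF sm Od]
  interpret E: tri_rep cscale n "{0\<^sub>m n n}" ?R by (rule even_tri_rep[OF sm Od])
  interpret F: fin_rep cscale n Od "srep n M" "fspace ?d" by (rule srep_fin_rep[OF sm Od])
  interpret gl_rep cscale n "{0\<^sub>m n n}" ?R "fspace ?d"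
  proof unfold_locales
    show "E.subspace (fspace ?d)" by (rule fspace_subspace)
    show "?R a X v \<in> fspace ?d" if "v \<in> fspace ?d" for a X v
      by (cases a) (simp_all add: srep_def mop_fspace, simp add: fspace_def)
    show "finite {c. \<exists>w\<in>fspace ?d. w \<noteq> 0 \<and> ?R False (dg n (\<lambda>i. of_nat n - of_nat i)) w = cscale c w}"
      using F.V_fin by simp
    show "{0\<^sub>m n n} = {0\<^sub>m n n}" ..
    show "fspace ?d \<subseteq> E.span {w \<in> fspace ?d. \<exists>\<mu>. E.wt \<mu> w}"
      using ws unfolding weight_spanned_def E.wt_def by simp
  qed
  fix W assume W: "cvec_subspace ?d W \<and> stable_under (gsub n Od False) M W"
  let ?W = "fset_of ?d W"
  have act_vec: "act M (emb n False X) *\<^sub>v vec ?d f = vec ?d (srep n M False X f)" if "X \<in> carrier_mat n n" for X f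
    using mult_mat_vec_vec[OF act(1)[of X False]] that by (simp add: srep_def)
  have eW: "E.estable ?W"
    unfolding E.estable_def
  proof (intro conjI allI impI ballI)
    show "E.subspace ?W" using fset_of_subspace W by blast
    fix i j f assume "f \<in> ?W"
    then have "act M (emb n False (munit n i j)) *\<^sub>v vec ?d f \<in> W"
      using W by (auto simp: stable_under_def fset_of_def gsub_def)
    then show "?R False (munit n i j) f \<in> ?W"
      by (simp add: act_vec fset_of_def) (simp add: srep_def mop_fspace)
  qed
  have WV: "?W \<subseteq> fspace ?d" by (auto simp: fset_of_def)
  obtain U where U: "E.estable U" "U \<subseteq> fspace ?d" "?W \<inter> U = {0}"
    "{w + w' | w w'. w \<in> ?W \<and> w' \<in> U} = fspace ?d"
    by (rule complete_reducibility[OF eW WV])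
  let ?U = "vec ?d ` U"
  have z: "vec ?d 0 = (0\<^sub>v ?d :: complex vec)" by (intro eq_vecI) auto
  have "cvec_subspace ?d ?U" by (rule vec_image_subspace[OF E.estable_subspace[OF U(1)] U(2)])
  moreover have "stable_under (gsub n Od False) M ?U"
    unfolding stable_under_def
  proof (intro ballI)
    fix X w assume "X \<in> gsub n Od False" "w \<in> ?U"
    then obtain A u where A: "A \<in> carrier_mat n n" "X = emb n False A" and u: "u \<in> U" "w = vec ?d u"
      by (auto simp: gsub_def homog_part_def)
    have "?R False A u \<in> U"
    proof (rule E.R_unit_induct)
      show "A \<in> E.G False" using A(1) by simp
      show "E.subspace U" by (rule E.estable_subspace[OF U(1)])
      show "munit n i j \<in> E.G False \<and> ?R False (munit n i j) u \<in> U" if "i < n" "j < n" for i j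
        using E.estable_e[OF U(1) that u(1)] by simp
    qed
    then have "srep n M False A u \<in> U" by simp
    then have "vec ?d (srep n M False A u) \<in> ?U" by (rule imageI)
    then show "act M X *\<^sub>v w \<in> ?U" unfolding A(2) u(2) act_vec[OF A(1)] .
  qed
  moreover have "W \<inter> ?U = {0\<^sub>v ?d}"
  proof
    show "{0\<^sub>v ?d} \<subseteq> W \<inter> ?U"
    proof -
      have "0\<^sub>v ?d \<in> W" using W unfolding cvec_subspace_iff by blast
      moreover have "0\<^sub>v ?d \<in> ?U"
        unfolding z[symmetric] by (rule imageI[OF E.subspace_0[OF E.estable_subspace[OF U(1)]]])
      ultimately show ?thesis by blast
    qed
    show "W \<inter> ?U \<subseteq> {0\<^sub>v ?d}"
    proof
      fix w assume w: "w \<in> W \<inter> ?U"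
      then obtain u where u: "u \<in> U" "w = vec ?d u" by blast
      then have "u \<in> ?W \<inter> U" using w U(2) by (auto simp: fset_of_def)
      then have "u = 0" using U(3) by blast
      then show "w \<in> {0\<^sub>v ?d}" using u z by simp
    qed
  qed
  moreover have "{w + w' | w w'. w \<in> W \<and> w' \<in> ?U} = carrier_vec ?d"
  proof
    show "{w + w' | w w'. w \<in> W \<and> w' \<in> ?U} \<subseteq> carrier_vec ?d"
    proof -
      have "W \<subseteq> carrier_vec ?d" using W unfolding cvec_subspace_iff by blast
      then show ?thesis by fastforce
    qed
    show "carrier_vec ?d \<subseteq> {w + w' | w w'. w \<in> W \<and> w' \<in> ?U}"
    proof
      fix v :: "complex vec" assume v: "v \<in> carrier_vec ?d"
      then have "fun_of_vec v \<in> {w + w' | w w'. w \<in> ?W \<and> w' \<in> U}"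
        unfolding U(4) by (rule fun_of_vec_fspace)
      then obtain w w' where w: "w \<in> ?W" "w' \<in> U" "fun_of_vec v = w + w'" by blast
      have "v = vec ?d w + vec ?d w'" using vec_fun_of_vec[OF v] w(3) by (simp add: vec_add)
      moreover have "vec ?d w \<in> W" using w(1) by (simp add: fset_of_def)
      ultimately show "v \<in> {w + w' | w w'. w \<in> W \<and> w' \<in> ?U}" using w(2) by blast
    qed
  qed
  ultimately show "\<exists>W'. cvec_subspace ?d W' \<and> stable_under (gsub n Od False) M W' \<and>
      W \<inter> W' = {0\<^sub>v ?d} \<and> {w + w' | w w'. w \<in> W \<and> w' \<in> W'} = carrier_vec ?d"
    by blast
qed

section \<open>Extensions and their cocycles\<close>

lemma mm_assoc: "dim_col A = dim_row B \<Longrightarrow> dim_col B = dim_row C \<Longrightarrow> A * B * C = A * (B * C)"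
  for A B C :: "complex mat"
  by (rule assoc_mult_mat[of _ "dim_row A" "dim_col A" _ "dim_col B" _ "dim_col C"]) auto

lemma mm_distl: "dim_col A = dim_row B \<Longrightarrow> dim_row B = dim_row C \<Longrightarrow> dim_col B = dim_col C \<Longrightarrow>
    A * (B + C) = A * B + A * C"
  for A B C :: "complex mat"
  by (rule mult_add_distrib_mat[of _ "dim_row A" "dim_col A" _ "dim_col B"]) auto

lemma mm_distr: "dim_col A = dim_row C \<Longrightarrow> dim_row A = dim_row B \<Longrightarrow> dim_col A = dim_col B \<Longrightarrow>
    (A + B) * C = A * C + B * C"
  for A B C :: "complex mat"
  by (rule add_mult_distrib_mat[of _ "dim_row A" "dim_col A" _ _ "dim_col C"]) auto

text \<open>Applies a known product inside a product nested to the right. As in the rules before it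
  the side conditions concern dimensions only, which suits rewriting.\<close>

lemma mm_cancel: "A * B = D \<Longrightarrow> dim_col A = dim_row B \<Longrightarrow> dim_col B = dim_row C \<Longrightarrow> A * (B * C) = D * C"
  for A B C D :: "complex mat"
  using mm_assoc[of A B C] by simp

lemma madd_assoc: "dim_row A = dim_row B \<Longrightarrow> dim_col A = dim_col B \<Longrightarrow> dim_row B = dim_row C \<Longrightarrow>
    dim_col B = dim_col C \<Longrightarrow> A + B + C = A + (B + C)"
  for A B C :: "complex mat"
  by (intro eq_matI) auto

lemma homog_carrier: "homog rs cs a F \<Longrightarrow> F \<in> carrier_mat (length rs) (length cs)"
  by (simp add: homog_def)

lemma homog_mult:
  assumes "homog rs ms a A" "homog ms cs b B"
  shows "homog rs cs (a \<noteq> b) (A * B)"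
  unfolding homog_def
proof (intro conjI allI impI)
  note c = homog_carrier[OF assms(1)] homog_carrier[OF assms(2)]
  show "A * B \<in> carrier_mat (length rs) (length cs)" using c by simp
  fix i j assume ij: "i < length rs" "j < length cs" "(A * B) $$ (i, j) \<noteq> 0"
  have "(A * B) $$ (i, j) = (\<Sum>k<length ms. A $$ (i, k) * B $$ (k, j))"
    using c ij by (auto simp: scalar_prod_def atLeast0LessThan intro!: sum.cong)
  then obtain k where "k < length ms" "A $$ (i, k) * B $$ (k, j) \<noteq> 0"
    using ij(3) by (metis (no_types, lifting) lessThan_iff sum.neutral)
  then have "(rs ! i \<noteq> ms ! k) = a" "(ms ! k \<noteq> cs ! j) = b" using assms ij by (auto simp: homog_def)
  then show "(rs ! i \<noteq> cs ! j) = (a \<noteq> b)" by auto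
qed

lemma homog_add: "homog rs cs a A \<Longrightarrow> homog rs cs a B \<Longrightarrow> homog rs cs a (A + B)"
  unfolding homog_def by auto (metis add.right_neutral)+

lemma homog_smult: "homog rs cs a A \<Longrightarrow> homog rs cs a (c \<cdot>\<^sub>m A)"
  unfolding homog_def by auto

lemma homog_one: "homog rs rs False (1\<^sub>m (length rs))"
  by (auto simp: homog_def)

lemma homog_zero: "homog rs cs a (0\<^sub>m (length rs) (length cs))"
  by (auto simp: homog_def)

text \<open>The parity-preserving component of a map; it serves to make a linear splitting
  homogeneous.\<close>

definition even_part :: "bool list \<Rightarrow> bool list \<Rightarrow> complex mat \<Rightarrow> complex mat" where
  "even_part rs cs F = mat (length rs) (length cs) (\<lambda>(i, j). if rs ! i = cs ! j then F $$ (i, j) else 0)"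

lemma even_part_homog: "homog rs cs False (even_part rs cs F)"
  by (auto simp: even_part_def homog_def)

lemma even_part_id: "homog rs cs False F \<Longrightarrow> even_part rs cs F = F"
  by (intro eq_matI) (auto simp: even_part_def homog_def, metis+)

lemma even_part_mult:
  assumes "A \<in> carrier_mat (length rs) (length ms)" "B \<in> carrier_mat (length ms) (length cs)"
  shows "homog ms cs False B \<Longrightarrow> even_part rs cs (A * B) = even_part rs ms A * B"
    "homog rs ms False A \<Longrightarrow> even_part rs cs (A * B) = A * even_part ms cs B"
proof -
  have prod: "(P * Q) $$ (i, j) = (\<Sum>k<length ms. P $$ (i, k) * Q $$ (k, j))"
    if "P \<in> carrier_mat (length rs) (length ms)" "Q \<in> carrier_mat (length ms) (length cs)"
      "i < length rs" "j < length cs" for P Q :: "complex mat" and i j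
    using that by (auto simp: scalar_prod_def atLeast0LessThan intro!: sum.cong)
  have eA: "even_part rs ms A \<in> carrier_mat (length rs) (length ms)"
    and eB: "even_part ms cs B \<in> carrier_mat (length ms) (length cs)"
    by (simp_all add: even_part_def)
  {
    assume h: "homog ms cs False B"
    show "even_part rs cs (A * B) = even_part rs ms A * B"
    proof (rule eq_matI)
      fix i j assume "i < dim_row (even_part rs ms A * B)" "j < dim_col (even_part rs ms A * B)"
      then have ij: "i < length rs" "j < length cs" using assms by (auto simp: even_part_def)
      have "(even_part rs ms A * B) $$ (i, j) = (\<Sum>k<length ms. if rs ! i = cs ! j then A $$ (i, k) * B $$ (k, j) else 0)"
        unfolding prod[OF eA assms(2) ij]
        using h ij by (intro sum.cong refl) (auto simp: homog_def even_part_def)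
      then show "even_part rs cs (A * B) $$ (i, j) = (even_part rs ms A * B) $$ (i, j)"
        using ij prod[OF assms ij] by (simp add: even_part_def)
    qed (use assms in \<open>auto simp: even_part_def\<close>)
  }
  {
    assume h: "homog rs ms False A"
    show "even_part rs cs (A * B) = A * even_part ms cs B"
    proof (rule eq_matI)
      fix i j assume "i < dim_row (A * even_part ms cs B)" "j < dim_col (A * even_part ms cs B)"
      then have ij: "i < length rs" "j < length cs" using assms by (auto simp: even_part_def)
      have "(A * even_part ms cs B) $$ (i, j) = (\<Sum>k<length ms. if rs ! i = cs ! j then A $$ (i, k) * B $$ (k, j) else 0)"
        unfolding prod[OF assms(1) eB ij]
        using h ij by (intro sum.cong refl) (auto simp: homog_def even_part_def)
      then show "even_part rs cs (A * B) $$ (i, j) = (A * even_part ms cs B) $$ (i, j)"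
        using ij prod[OF assms ij] by (simp add: even_part_def)
    qed (use assms in \<open>auto simp: even_part_def\<close>)
  }
qed

lemma mat_eq_if_mult_vec_eq:
  fixes A B :: "complex mat"
  assumes "A \<in> carrier_mat r c" "B \<in> carrier_mat r c" "\<And>v. v \<in> carrier_vec c \<Longrightarrow> A *\<^sub>v v = B *\<^sub>v v"
  shows "A = B"
proof (rule eq_matI)
  fix i j assume "i < dim_row B" "j < dim_col B"
  then have ij: "i < r" "j < c" using assms(2) by auto
  have "(A *\<^sub>v unit_vec c j) $ i = (B *\<^sub>v unit_vec c j) $ i" using assms(3)[of "unit_vec c j"] by simp
  then show "A $$ (i, j) = B $$ (i, j)" using ij assms(1,2) by simp
qed (use assms in auto)

lemma linear_is_mult_mat_vec:
  fixes F :: "complex vec \<Rightarrow> complex vec"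
  assumes add: "\<And>v w. v \<in> carrier_vec c \<Longrightarrow> w \<in> carrier_vec c \<Longrightarrow> F (v + w) = F v + F w"
    and smult: "\<And>a v. v \<in> carrier_vec c \<Longrightarrow> F (a \<cdot>\<^sub>v v) = a \<cdot>\<^sub>v F v"
    and F: "\<And>v. v \<in> carrier_vec c \<Longrightarrow> F v \<in> carrier_vec r"
  obtains A where "A \<in> carrier_mat r c" "\<And>v. v \<in> carrier_vec c \<Longrightarrow> F v = A *\<^sub>v v"
proof
  let ?A = "mat r c (\<lambda>(i, j). F (unit_vec c j) $ i)"
  show A: "?A \<in> carrier_mat r c" by simp
  have unit: "F (unit_vec c j) = ?A *\<^sub>v unit_vec c j" if "j < c" for j
    using that F[of "unit_vec c j"] by (intro eq_vecI) auto
  have *: "v \<in> carrier_vec c \<Longrightarrow> (\<And>i. k \<le> i \<Longrightarrow> i < c \<Longrightarrow> v $ i = 0) \<Longrightarrow> k \<le> c \<Longrightarrow> F v = ?A *\<^sub>v v" for v k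
  proof (induction k arbitrary: v)
    case 0
    then have v: "v = 0 \<cdot>\<^sub>v v" by (intro eq_vecI) auto
    have "F v = 0 \<cdot>\<^sub>v F v" using smult[OF 0(1), of 0] v by simp
    then have Fv: "F v $ i = 0" if "i < r" for i using F[OF 0(1)] that
      by (metis carrier_vecD index_smult_vec(1) mult_zero_left)
    have "(?A *\<^sub>v v) $ i = 0" if "i < r" for i
    proof -
      have "?A *\<^sub>v v = 0 \<cdot>\<^sub>v (?A *\<^sub>v v)" using v mult_mat_vec[OF A 0(1), of 0] by simp
      then show ?thesis using that by (metis A carrier_matD(1) dim_mult_mat_vec index_smult_vec(1) mult_zero_left)
    qed
    then show ?case using Fv F[OF 0(1)] by (intro eq_vecI) auto
  next
    case (Suc k)
    let ?w = "vec c (\<lambda>i. if i = k then 0 else v $ i)"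
    have w: "?w \<in> carrier_vec c" and u: "v $ k \<cdot>\<^sub>v unit_vec c k \<in> carrier_vec c" by auto
    have v: "v = v $ k \<cdot>\<^sub>v unit_vec c k + ?w"
      using Suc.prems by (intro eq_vecI) auto
    have "F v = v $ k \<cdot>\<^sub>v F (unit_vec c k) + F ?w"
      by (subst v) (simp only: add[OF u w] smult[OF unit_vec_carrier])
    also have "\<dots> = v $ k \<cdot>\<^sub>v (?A *\<^sub>v unit_vec c k) + ?A *\<^sub>v ?w"
      using unit[of k] Suc.IH[OF w] Suc.prems by auto
    also have "\<dots> = ?A *\<^sub>v (v $ k \<cdot>\<^sub>v unit_vec c k + ?w)"
      by (simp only: mult_add_distrib_mat_vec[OF A u w] mult_mat_vec[OF A unit_vec_carrier])
    finally show ?case using v by simp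
  qed
  show "F v = ?A *\<^sub>v v" if "v \<in> carrier_vec c" for v using *[OF that, of c] by simp
qed

lemma homog_one_minus:
  assumes "homog rs rs False A"
  shows "homog rs rs False (1\<^sub>m (length rs) - A)"
  using assms unfolding homog_def by (auto split: if_splits)

section \<open>Splittings of short exact sequences over the even part\<close>

locale sub_q =
  fixes n :: nat and Od :: "complex mat set"
  assumes Od: "triangular_odd n Od"
begin

abbreviation g :: superalg where "g \<equiv> gsub n Od"

lemma g_elements: "X \<in> g a \<Longrightarrow> X \<in> elements g"
  by (rule gsub_elements[OF Od])

lemma act_carrier: "supermodule g M \<Longrightarrow> X \<in> elements g \<Longrightarrow> act M X \<in> carrier_mat (sdim M) (sdim M)"
  by (auto simp: supermodule_def)

lemma act_dims:
  assumes "supermodule g M" "X \<in> elements g"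
  shows "dim_row (act M X) = sdim M" "dim_col (act M X) = sdim M"
  using act_carrier[OF assms] by auto

lemma elements_add:
  assumes X: "X \<in> elements g" and Y: "Y \<in> elements g"
  shows "X + Y \<in> elements g"
proof -
  obtain A B where A: "A \<in> carrier_mat n n" "B \<in> Od" "X = emb n False A + emb n True B"
    using elements_gsub(2)[OF Od X] by blast
  obtain A' B' where A': "A' \<in> carrier_mat n n" "B' \<in> Od" "Y = emb n False A' + emb n True B'"
    using elements_gsub(2)[OF Od Y] by blast
  have Bc: "B \<in> carrier_mat n n" "B' \<in> carrier_mat n n" using A A' Od by (auto simp: triangular_odd_def)
  have "X + Y = emb n False (A + A') + emb n True (B + B')"
    unfolding A(3) A'(3) emb_add[OF A(1) A'(1)] emb_add[OF Bc]
    using emb_carrier[OF A(1), of False] emb_carrier[OF A'(1), of False] emb_carrier[OF Bc(1), of True] emb_carrier[OF Bc(2), of True]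
    by (intro eq_matI) auto
  moreover have "B + B' \<in> Od" using A A' Od by (auto simp: triangular_odd_def)
  moreover have "A + A' \<in> carrier_mat n n" using A A' by simp
  ultimately show ?thesis unfolding elements_def gsub_def homog_part_def by auto
qed

lemma elements_smult:
  assumes X: "X \<in> elements g"
  shows "c \<cdot>\<^sub>m X \<in> elements g"
proof -
  obtain A B where A: "A \<in> carrier_mat n n" "B \<in> Od" "X = emb n False A + emb n True B"
    using elements_gsub(2)[OF Od X] by blast
  have Bc: "B \<in> carrier_mat n n" using A Od by (auto simp: triangular_odd_def)
  have "c \<cdot>\<^sub>m X = emb n False (c \<cdot>\<^sub>m A) + emb n True (c \<cdot>\<^sub>m B)"
    unfolding A(3) emb_smult[OF A(1)] emb_smult[OF Bc]
    using emb_carrier[OF A(1), of False] emb_carrier[OF Bc, of True] by (intro eq_matI) (auto simp: algebra_simps)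
  moreover have "c \<cdot>\<^sub>m B \<in> Od" using A Od by (auto simp: triangular_odd_def)
  moreover have "c \<cdot>\<^sub>m A \<in> carrier_mat n n" using A by simp
  ultimately show ?thesis unfolding elements_def gsub_def homog_part_def by auto
qed

lemma supercomm_in_g:
  assumes X: "X \<in> g a" and Y: "Y \<in> g b"
  shows "supercomm a b X Y \<in> g (a \<noteq> b)"
proof -
  obtain A B where A: "A \<in> homog_part n Od a" "X = emb n a A" and B: "B \<in> homog_part n Od b" "Y = emb n b B"
    using X Y by (auto simp: gsub_def)
  show ?thesis
    unfolding A(2) B(2) supercomm_emb[OF triangular_odd_parts(1)[OF Od A(1)] triangular_odd_parts(1)[OF Od B(1)]]
    using triangular_odd_parts(4)[OF Od A(1) B(1)] by (simp add: gsub_def)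
qed

lemma homs:
  assumes "i \<in> smod_hom g M N"
  shows "homog (par N) (par M) False i" "i \<in> carrier_mat (sdim N) (sdim M)"
    "dim_row i = sdim N" "dim_col i = sdim M" "X \<in> elements g \<Longrightarrow> i * act M X = act N X * i"
  using assms homog_carrier[of "par N" "par M" False i] by (auto simp: smod_hom_def sdim_def)

lemma hom_one: "supermodule g M \<Longrightarrow> 1\<^sub>m (sdim M) \<in> smod_hom g M M"
  using homog_one[of "par M"] left_mult_one_mat[OF act_carrier] right_mult_one_mat[OF act_carrier]
  by (simp add: smod_hom_def sdim_def)

text \<open>\<open>s\<close> and \<open>r\<close> split the sequence as graded spaces and need not
  be module maps: \<open>r * act E X * s\<close> is the off-diagonal block of the action, the
  cocycle of the extension.\<close>

definition split_seq :: "smod \<Rightarrow> smod \<Rightarrow> ext \<Rightarrow> complex mat \<Rightarrow> complex mat \<Rightarrow> bool" where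
  "split_seq M N e s r = (case e of (E, i, p) \<Rightarrow> supermodule g E \<and> i \<in> smod_hom g N E \<and> p \<in> smod_hom g E M \<and>
     homog (par E) (par M) False s \<and> homog (par N) (par E) False r \<and>
     p * s = 1\<^sub>m (sdim M) \<and> r * i = 1\<^sub>m (sdim N) \<and> r * s = 0\<^sub>m (sdim N) (sdim M) \<and>
     p * i = 0\<^sub>m (sdim M) (sdim N) \<and> i * r + s * p = 1\<^sub>m (sdim E))"

text \<open>A complement of the kernel of \<open>p\<close> under the even part is the image of a
  section that commutes with even elements, and the retraction is then determined by
  \<open>i * r + s * p = 1\<close>. Since \<open>r * s = 0\<close>, the cocycle vanishes on even
  elements.\<close>

lemma split_seq_exists:
  assumes e: "(E, i, p) \<in> extensions g M N" and sM: "supermodule g M" and sN: "supermodule g N"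
  obtains s r where "split_seq M N (E, i, p) s r" "\<And>X. X \<in> g False \<Longrightarrow> r * act E X * s = 0\<^sub>m (sdim N) (sdim M)"
proof -
  have sE: "supermodule g E" and ssE: "semisimple_over_even g E" and i: "i \<in> smod_hom g N E"
    and p: "p \<in> smod_hom g E M" and ker: "mat_kernel i = {0\<^sub>v (sdim N)}"
    and ex: "(\<lambda>v. i *\<^sub>v v) ` carrier_vec (sdim N) = mat_kernel p"
    and sur: "(\<lambda>v. p *\<^sub>v v) ` carrier_vec (sdim E) = carrier_vec (sdim M)"
    using e by (auto simp: extensions_def cat_F_def)
  note iC = homs(2)[OF i] and pC = homs(2)[OF p]
  have K: "mat_kernel p = {v \<in> carrier_vec (sdim E). p *\<^sub>v v = 0\<^sub>v (sdim M)}"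
    using mat_kernel[OF pC] .
  have pX: "p *\<^sub>v (act E X *\<^sub>v v) = act M X *\<^sub>v (p *\<^sub>v v)" if "X \<in> elements g" "v \<in> carrier_vec (sdim E)" for X v
    using homs(5)[OF p that(1)] assoc_mult_mat_vec[OF pC act_carrier[OF sE that(1)] that(2)]
      assoc_mult_mat_vec[OF act_carrier[OF sM that(1)] pC that(2)] by simp
  have sub: "cvec_subspace (sdim E) (mat_kernel p)"
    unfolding cvec_subspace_iff K using pC
    by (auto simp: mult_add_distrib_mat_vec[OF pC] mult_mat_vec[OF pC])
  have st: "stable_under (g False) E (mat_kernel p)"
    unfolding stable_under_def K
  proof (intro ballI)
    fix X w assume X: "X \<in> g False" and w: "w \<in> {v \<in> carrier_vec (sdim E). p *\<^sub>v v = 0\<^sub>v (sdim M)}"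
    have "act M X *\<^sub>v 0\<^sub>v (sdim M) = 0\<^sub>v (sdim M)"
      using act_carrier[OF sM g_elements[OF X]] by auto
    then show "act E X *\<^sub>v w \<in> {v \<in> carrier_vec (sdim E). p *\<^sub>v v = 0\<^sub>v (sdim M)}"
      using w pX[OF g_elements[OF X]] act_carrier[OF sE g_elements[OF X]] by auto
  qed
  obtain W' where W'_all: "cvec_subspace (sdim E) W' \<and> stable_under (g False) E W' \<and>
    mat_kernel p \<inter> W' = {0\<^sub>v (sdim E)} \<and> {w + w' | w w'. w \<in> mat_kernel p \<and> w' \<in> W'} = carrier_vec (sdim E)"
    using ssE[unfolded semisimple_over_even_def, THEN spec, THEN mp, OF conjI[OF sub st]] by (elim exE)
  note W' = W'_all[THEN conjunct1] W'_all[THEN conjunct2, THEN conjunct1]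
    W'_all[THEN conjunct2, THEN conjunct2, THEN conjunct1] W'_all[THEN conjunct2, THEN conjunct2, THEN conjunct2]
  have W'C: "w \<in> carrier_vec (sdim E)" if "w \<in> W'" for w using W'(1) that by (auto simp: cvec_subspace_iff)
  have W'_add: "v + w \<in> W'" and W'_smult: "c \<cdot>\<^sub>v v \<in> W'" if "v \<in> W'" "w \<in> W'" for v w c
    using W'(1) that by (auto simp: cvec_subspace_iff)
  have uniq: "w = w'" if "w \<in> W'" "w' \<in> W'" "p *\<^sub>v w = p *\<^sub>v w'" for w w'
  proof -
    have mem: "w + (- 1) \<cdot>\<^sub>v w' \<in> W'" using that W'_add W'_smult by blast
    have "p *\<^sub>v (w + (- 1) \<cdot>\<^sub>v w') = p *\<^sub>v w + (- 1) \<cdot>\<^sub>v (p *\<^sub>v w')"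
      using W'C that pC by (simp add: mult_add_distrib_mat_vec[OF pC] mult_mat_vec[OF pC])
    also have "\<dots> = 0\<^sub>v (sdim M)" unfolding that(3) using pC by (intro eq_vecI) auto
    finally have "w + (- 1) \<cdot>\<^sub>v w' \<in> mat_kernel p \<inter> W'" using mem W'C by (simp add: K)
    then have z: "w + (- 1) \<cdot>\<^sub>v w' = 0\<^sub>v (sdim E)" using W'(3) by blast
    show "w = w'"
    proof (rule eq_vecI)
      fix j assume "j < dim_vec w'"
      then have j: "j < sdim E" using W'C[OF that(2)] by simp
      have "(w + (- 1) \<cdot>\<^sub>v w') $ j = 0" unfolding z using j by simp
      then show "w $ j = w' $ j" using j W'C[OF that(1)] W'C[OF that(2)] by simp
    qed (use W'C that in \<open>metis carrier_vecD\<close>)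
  qed
  have "\<exists>w. w \<in> W' \<and> p *\<^sub>v w = m" if m: "m \<in> carrier_vec (sdim M)" for m
  proof -
    obtain v where v: "v \<in> carrier_vec (sdim E)" "p *\<^sub>v v = m" using m sur by (metis imageE)
    then obtain w w' where w: "w \<in> mat_kernel p" "w' \<in> W'" "v = w + w'" using W'(4) by blast
    have "p *\<^sub>v v = p *\<^sub>v w + p *\<^sub>v w'"
      unfolding w(3) by (rule mult_add_distrib_mat_vec[OF pC]) (use w W'C K in auto)
    also have "\<dots> = p *\<^sub>v w'" using w(1) pC W'C[OF w(2)] by (simp add: K)
    finally show ?thesis using w(2) v(2) by auto
  qed
  then obtain S where S: "\<And>m. m \<in> carrier_vec (sdim M) \<Longrightarrow> S m \<in> W'"
    "\<And>m. m \<in> carrier_vec (sdim M) \<Longrightarrow> p *\<^sub>v S m = m" by metis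
  obtain s0 where s0: "s0 \<in> carrier_mat (sdim E) (sdim M)" "\<And>m. m \<in> carrier_vec (sdim M) \<Longrightarrow> S m = s0 *\<^sub>v m"
  proof (rule linear_is_mult_mat_vec[of "sdim M" S "sdim E"])
    show "S (v + w) = S v + S w" if "v \<in> carrier_vec (sdim M)" "w \<in> carrier_vec (sdim M)" for v w
    proof (rule uniq[OF S(1) W'_add[OF S(1)[OF that(1)] S(1)[OF that(2)]]])
      have "p *\<^sub>v (S v + S w) = v + w"
        unfolding mult_add_distrib_mat_vec[OF pC W'C[OF S(1)[OF that(1)]] W'C[OF S(1)[OF that(2)]]]
          S(2)[OF that(1)] S(2)[OF that(2)] ..
      then show "p *\<^sub>v S (v + w) = p *\<^sub>v (S v + S w)" using S(2)[of "v + w"] that by simp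
    qed (use that in simp)
    show "S (a \<cdot>\<^sub>v v) = a \<cdot>\<^sub>v S v" if "v \<in> carrier_vec (sdim M)" for a v
    proof (rule uniq[OF S(1) W'_smult[OF S(1)[OF that] S(1)[OF that]]])
      have "p *\<^sub>v (a \<cdot>\<^sub>v S v) = a \<cdot>\<^sub>v v"
        unfolding mult_mat_vec[OF pC W'C[OF S(1)[OF that]]] S(2)[OF that] ..
      then show "p *\<^sub>v S (a \<cdot>\<^sub>v v) = p *\<^sub>v (a \<cdot>\<^sub>v S v)" using S(2)[of "a \<cdot>\<^sub>v v"] that by simp
    qed (use that in simp)
  qed (use S W'C in auto)
  have ps0: "p * s0 = 1\<^sub>m (sdim M)"
    by (rule mat_eq_if_mult_vec_eq[of _ "sdim M" "sdim M"])
      (use pC s0 S in \<open>auto simp: assoc_mult_mat_vec[OF pC s0(1)]\<close>)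
  have Xs0: "act E X * s0 = s0 * act M X" if X: "X \<in> g False" for X
  proof (rule mat_eq_if_mult_vec_eq)
    note XE = act_carrier[OF sE g_elements[OF X]] and XM = act_carrier[OF sM g_elements[OF X]]
    show "act E X * s0 \<in> carrier_mat (sdim E) (sdim M)" "s0 * act M X \<in> carrier_mat (sdim E) (sdim M)"
      using XE XM s0 by auto
    fix m :: "complex vec" assume m: "m \<in> carrier_vec (sdim M)"
    have Xm: "act M X *\<^sub>v m \<in> carrier_vec (sdim M)" using XM m by simp
    have "act E X *\<^sub>v S m = S (act M X *\<^sub>v m)"
    proof (rule uniq)
      show "act E X *\<^sub>v S m \<in> W'" using W'(2) X S(1)[OF m] by (simp add: stable_under_def)
      show "S (act M X *\<^sub>v m) \<in> W'" by (rule S(1)[OF Xm])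
      show "p *\<^sub>v (act E X *\<^sub>v S m) = p *\<^sub>v S (act M X *\<^sub>v m)"
        using pX[OF g_elements[OF X] W'C[OF S(1)[OF m]]] S(2)[OF m] S(2)[OF Xm] by simp
    qed
    then show "act E X * s0 *\<^sub>v m = s0 * act M X *\<^sub>v m"
      using m Xm s0 assoc_mult_mat_vec[OF XE s0(1) m] assoc_mult_mat_vec[OF s0(1) XM m] by simp
  qed
  \<comment> \<open>The complement need not be graded, so \<open>s0\<close> may mix parities. Its
    parity-preserving component is still an equivariant section, because \<open>p\<close> and the
    even elements preserve parity.\<close>
  define s where "s = even_part (par E) (par M) s0"
  have sh: "homog (par E) (par M) False s" unfolding s_def by (rule even_part_homog)
  have sC: "s \<in> carrier_mat (sdim E) (sdim M)" using homog_carrier[OF sh] by (simp add: sdim_def)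
  have ps: "p * s = 1\<^sub>m (sdim M)"
  proof -
    have "p * s = even_part (par M) (par M) (p * s0)"
      unfolding s_def by (rule even_part_mult(2)[symmetric]) (use pC s0 homs(1)[OF p] in \<open>auto simp: sdim_def\<close>)
    also have "\<dots> = 1\<^sub>m (sdim M)" unfolding ps0 using even_part_id[OF homog_one[of "par M"]] by (simp add: sdim_def)
    finally show ?thesis .
  qed
  have Xs: "act E X * s = s * act M X" if X: "X \<in> g False" for X
  proof -
    have h: "homog (par E) (par E) False (act E X)" "homog (par M) (par M) False (act M X)"
      using sE sM X by (auto simp: supermodule_def)
    have "act E X * s = even_part (par E) (par M) (act E X * s0)"
      unfolding s_def by (rule even_part_mult(2)[symmetric])
        (use h s0 homog_carrier[OF h(1)] in \<open>auto simp: sdim_def\<close>)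
    also have "\<dots> = s * act M X"
      unfolding Xs0[OF X] s_def by (rule even_part_mult(1))
        (use h s0 homog_carrier[OF h(2)] in \<open>auto simp: sdim_def\<close>)
    finally show ?thesis .
  qed
  have inj: "x = y" if "x \<in> carrier_vec (sdim N)" "y \<in> carrier_vec (sdim N)" "i *\<^sub>v x = i *\<^sub>v y" for x y
  proof -
    have "i *\<^sub>v (x - y) = i *\<^sub>v x - i *\<^sub>v y"
      using that iC by (simp add: mult_minus_distrib_mat_vec[OF iC])
    also have "\<dots> = 0\<^sub>v (sdim E)" unfolding that(3) using that iC by (intro eq_vecI) auto
    finally have "x - y \<in> mat_kernel i" using mat_kernel[OF iC] that by simp
    then have z: "x - y = 0\<^sub>v (sdim N)" using ker by blast
    show "x = y"
    proof (rule eq_vecI)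
      fix j assume j: "j < dim_vec y"
      have "(x - y) $ j = 0" unfolding z using j that by simp
      then show "x $ j = y $ j" using j that by simp
    qed (use that in auto)
  qed
  \<comment> \<open>The projection onto the kernel of \<open>p\<close> along the image of
    \<open>s\<close>. The kernel is the image of the injective \<open>i\<close>, so the projection
    factors uniquely as \<open>i * r\<close>.\<close>
  let ?q = "1\<^sub>m (sdim E) - s * p"
  have qC: "?q \<in> carrier_mat (sdim E) (sdim E)" using sC pC by auto
  have pq: "p * ?q = 0\<^sub>m (sdim M) (sdim E)"
  proof -
    have "p * ?q = p * 1\<^sub>m (sdim E) - p * (s * p)"
      by (rule mult_minus_distrib_mat[OF pC]) (use sC pC in auto)
    also have "p * (s * p) = p" using pC sC ps by (simp add: mm_cancel)
    finally show ?thesis using pC by auto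
  qed
  have "\<exists>x\<in>carrier_vec (sdim N). i *\<^sub>v x = ?q *\<^sub>v v" if v: "v \<in> carrier_vec (sdim E)" for v
  proof -
    have "p *\<^sub>v (?q *\<^sub>v v) = 0\<^sub>m (sdim M) (sdim E) *\<^sub>v v"
      unfolding pq[symmetric] by (rule assoc_mult_mat_vec[symmetric, OF pC qC v])
    also have "\<dots> = 0\<^sub>v (sdim M)" using v by (intro eq_vecI) auto
    finally have "?q *\<^sub>v v \<in> mat_kernel p" unfolding K using mult_mat_vec_carrier[OF qC v] by blast
    then show ?thesis using ex by (metis (no_types, lifting) imageE)
  qed
  then obtain Q where Q: "\<And>v. v \<in> carrier_vec (sdim E) \<Longrightarrow> Q v \<in> carrier_vec (sdim N)"
    "\<And>v. v \<in> carrier_vec (sdim E) \<Longrightarrow> i *\<^sub>v Q v = ?q *\<^sub>v v" by metis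
  obtain r where r: "r \<in> carrier_mat (sdim N) (sdim E)"
    and rQ: "\<And>v. v \<in> carrier_vec (sdim E) \<Longrightarrow> Q v = r *\<^sub>v v"
  proof (rule linear_is_mult_mat_vec[of "sdim E" Q "sdim N"])
    show "Q (v + w) = Q v + Q w" if "v \<in> carrier_vec (sdim E)" "w \<in> carrier_vec (sdim E)" for v w
    proof (rule inj[OF Q(1) add_carrier_vec[OF Q(1)[OF that(1)] Q(1)[OF that(2)]]])
      show "i *\<^sub>v Q (v + w) = i *\<^sub>v (Q v + Q w)"
        unfolding mult_add_distrib_mat_vec[OF iC Q(1)[OF that(1)] Q(1)[OF that(2)]] Q(2)[OF that(1)] Q(2)[OF that(2)]
          Q(2)[OF add_carrier_vec[OF that]] mult_add_distrib_mat_vec[OF qC that] ..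
    qed (use that in simp)
    show "Q (a \<cdot>\<^sub>v v) = a \<cdot>\<^sub>v Q v" if "v \<in> carrier_vec (sdim E)" for a v
    proof (rule inj[OF Q(1) smult_carrier_vec[THEN iffD2, OF Q(1)[OF that]]])
      show "i *\<^sub>v Q (a \<cdot>\<^sub>v v) = i *\<^sub>v (a \<cdot>\<^sub>v Q v)"
        unfolding mult_mat_vec[OF iC Q(1)[OF that]] Q(2)[OF that] Q(2)[OF smult_carrier_vec[THEN iffD2, OF that]]
          mult_mat_vec[OF qC that] ..
    qed (use that in simp)
  qed (use Q(1) in auto)
  have ir: "i * r = ?q"
  proof (rule mat_eq_if_mult_vec_eq[OF mult_carrier_mat[OF iC r] qC])
    fix v :: "complex vec" assume v: "v \<in> carrier_vec (sdim E)"
    show "i * r *\<^sub>v v = ?q *\<^sub>v v" unfolding assoc_mult_mat_vec[OF iC r v] rQ[OF v, symmetric] by (rule Q(2)[OF v])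
  qed
  have i_cancel: "A = B" if "A \<in> carrier_mat (sdim N) c" "B \<in> carrier_mat (sdim N) c" "i * A = i * B" for A B c
  proof (rule mat_eq_if_mult_vec_eq[OF that(1,2)])
    fix v :: "complex vec" assume v: "v \<in> carrier_vec c"
    have "i *\<^sub>v (A *\<^sub>v v) = i *\<^sub>v (B *\<^sub>v v)"
      unfolding assoc_mult_mat_vec[OF iC that(1) v, symmetric] that(3) by (rule assoc_mult_mat_vec[OF iC that(2) v])
    then show "A *\<^sub>v v = B *\<^sub>v v"
      by (rule inj[OF mult_mat_vec_carrier[OF that(1) v] mult_mat_vec_carrier[OF that(2) v]])
  qed
  have pi: "p * i = 0\<^sub>m (sdim M) (sdim N)"
  proof (rule mat_eq_if_mult_vec_eq)
    fix v :: "complex vec" assume v: "v \<in> carrier_vec (sdim N)"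
    have "i *\<^sub>v v \<in> mat_kernel p" using ex v by blast
    then have "p *\<^sub>v (i *\<^sub>v v) = 0\<^sub>v (sdim M)" by (simp add: K)
    then have "p * i *\<^sub>v v = 0\<^sub>v (sdim M)" using assoc_mult_mat_vec[OF pC iC v] by simp
    also have "\<dots> = 0\<^sub>m (sdim M) (sdim N) *\<^sub>v v" using v by (intro eq_vecI) auto
    finally show "p * i *\<^sub>v v = 0\<^sub>m (sdim M) (sdim N) *\<^sub>v v" .
  qed (use pC iC in auto)
  have rh: "homog (par N) (par E) False r"
  proof -
    have h: "homog (par E) (par E) False ?q"
      using homog_one_minus[of "par E" "s * p"] homog_mult[OF sh homs(1)[OF p]] by (simp add: sdim_def)
    have 1: "i \<in> carrier_mat (length (par E)) (length (par N))" and 2: "r \<in> carrier_mat (length (par N)) (length (par E))"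
      using iC r by (simp_all add: sdim_def)
    have "i * even_part (par N) (par E) r = even_part (par E) (par E) (i * r)"
      by (rule even_part_mult(2)[OF 1 2 homs(1)[OF i], symmetric])
    also have "\<dots> = i * r" unfolding ir by (rule even_part_id[OF h])
    finally have eq: "i * even_part (par N) (par E) r = i * r" .
    have "even_part (par N) (par E) r \<in> carrier_mat (sdim N) (sdim E)" by (simp add: even_part_def sdim_def)
    then have "even_part (par N) (par E) r = r" by (rule i_cancel[OF _ r eq])
    then show ?thesis using even_part_homog[of "par N" "par E" r] by simp
  qed
  have irsp: "i * r + s * p = 1\<^sub>m (sdim E)"
    unfolding ir using sC pC by (intro eq_matI) auto
  note dims = carrier_matD[OF iC] carrier_matD[OF pC] carrier_matD[OF sC] carrier_matD[OF r]
  have ri: "r * i = 1\<^sub>m (sdim N)"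
  proof (rule i_cancel[OF mult_carrier_mat[OF r iC] one_carrier_mat])
    have "i * (r * i) = ?q * i" using ir by (simp add: mm_cancel dims)
    also have "\<dots> = 1\<^sub>m (sdim E) * i - s * p * i"
      by (rule minus_mult_distrib_mat[OF one_carrier_mat mult_carrier_mat[OF sC pC] iC])
    also have "s * p * i = 0\<^sub>m (sdim E) (sdim N)"
      unfolding assoc_mult_mat[OF sC pC iC] pi by (rule right_mult_zero_mat[OF sC])
    also have "1\<^sub>m (sdim E) * i - 0\<^sub>m (sdim E) (sdim N) = i" using iC by (intro eq_matI) auto
    finally show "i * (r * i) = i * 1\<^sub>m (sdim N)" using iC by simp
  qed
  have rs: "r * s = 0\<^sub>m (sdim N) (sdim M)"
  proof (rule i_cancel[OF mult_carrier_mat[OF r sC] zero_carrier_mat])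
    have "i * (r * s) = ?q * s" using ir by (simp add: mm_cancel dims)
    also have "\<dots> = 1\<^sub>m (sdim E) * s - s * p * s"
      by (rule minus_mult_distrib_mat[OF one_carrier_mat mult_carrier_mat[OF sC pC] sC])
    also have "s * p * s = s" unfolding assoc_mult_mat[OF sC pC sC] ps by (rule right_mult_one_mat[OF sC])
    finally show "i * (r * s) = i * 0\<^sub>m (sdim N) (sdim M)"
      using sC by (simp add: right_mult_zero_mat[OF iC])
  qed
  show thesis
  proof (rule that)
    show "split_seq M N (E, i, p) s r"
      unfolding split_seq_def using sE i p sh rh ps ri rs pi irsp by simp
    fix X assume X: "X \<in> g False"
    have "r * act E X * s = r * (act E X * s)"
      using r sC act_carrier[OF sE g_elements[OF X]] by (simp add: mm_assoc)
    also have "\<dots> = (r * s) * act M X"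
      unfolding Xs[OF X] using r sC act_carrier[OF sM g_elements[OF X]] by (simp add: mm_assoc)
    also have "\<dots> = 0\<^sub>m (sdim N) (sdim M)"
      unfolding rs using act_carrier[OF sM g_elements[OF X]] by simp
    finally show "r * act E X * s = 0\<^sub>m (sdim N) (sdim M)" .
  qed
qed

text \<open>Inserting \<open>i * r + s * p = 1\<close> shows that the action on \<open>E\<close> is
  block triangular; these are the column of \<open>M\<close> and the row of
  \<open>N\<close>.\<close>

lemma split_seq_facts:
  assumes "split_seq M N (E, i, p) s r" and X: "X \<in> elements g" and sM: "supermodule g M" and sN: "supermodule g N"
  shows "r * act E X * s \<in> carrier_mat (sdim N) (sdim M)"
    "act E X * s = i * (r * act E X * s) + s * act M X"
    "r * act E X = act N X * r + r * act E X * s * p"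
proof -
  have sE: "supermodule g E" and i: "i \<in> smod_hom g N E" and p: "p \<in> smod_hom g E M"
    and sh: "homog (par E) (par M) False s" and rh: "homog (par N) (par E) False r"
    and ids: "p * s = 1\<^sub>m (sdim M)" "r * i = 1\<^sub>m (sdim N)" "i * r + s * p = 1\<^sub>m (sdim E)"
    using assms(1) by (auto simp: split_seq_def)
  note C = homs(2)[OF i] homs(2)[OF p] act_carrier[OF sE X] act_carrier[OF sM X] act_carrier[OF sN X]
    homog_carrier[OF sh, folded sdim_def] homog_carrier[OF rh, folded sdim_def]
  show "r * act E X * s \<in> carrier_mat (sdim N) (sdim M)" using C by auto
  have "act E X * s = (i * r + s * p) * (act E X * s)" unfolding ids using C by auto
  also have "\<dots> = i * (r * act E X * s) + s * ((p * act E X) * s)" using C by (simp add: mm_assoc mm_distr)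
  also have "(p * act E X) * s = act M X" unfolding homs(5)[OF p X] using C ids by (simp add: mm_assoc)
  finally show "act E X * s = i * (r * act E X * s) + s * act M X" .
  have "r * act E X = r * act E X * (i * r + s * p)" unfolding ids using C by auto
  also have "\<dots> = r * (act E X * i) * r + r * act E X * s * p" using C by (simp add: mm_assoc mm_distl)
  also have "r * (act E X * i) = act N X" unfolding homs(5)[OF i X, symmetric] using C ids by (simp add: mm_cancel)
  finally show "r * act E X = act N X * r + r * act E X * s * p" .
qed

text \<open>A morphism of sequences is determined by its component from the quotient to the subobject.\<close>

theorem ext_map_iff:
  assumes e: "split_seq M N (E, i, p) s r" and e': "split_seq M' N' (E', i', p') s' r'"
    and sm: "supermodule g M" "supermodule g N" "supermodule g M'" "supermodule g N'"
    and a: "a \<in> smod_hom g N N'" and c: "c \<in> smod_hom g M M'"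
  shows "ext_map g a c (E, i, p) (E', i', p') \<longleftrightarrow>
    (\<exists>h. homog (par N') (par M) False h \<and> (\<forall>X\<in>elements g.
      a * (r * act E X * s) + h * act M X = act N' X * h + (r' * act E' X * s') * c))"
proof -
  have sE: "supermodule g E" and i: "i \<in> smod_hom g N E" and p: "p \<in> smod_hom g E M"
    and sh: "homog (par E) (par M) False s" and rh: "homog (par N) (par E) False r"
    and ids: "p * s = 1\<^sub>m (sdim M)" "r * i = 1\<^sub>m (sdim N)" "i * r + s * p = 1\<^sub>m (sdim E)"
      "p * i = 0\<^sub>m (sdim M) (sdim N)" "r * s = 0\<^sub>m (sdim N) (sdim M)"
    using e by (auto simp: split_seq_def)
  have sE': "supermodule g E'" and i': "i' \<in> smod_hom g N' E'" and p': "p' \<in> smod_hom g E' M'"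
    and sh': "homog (par E') (par M') False s'" and rh': "homog (par N') (par E') False r'"
    and ids': "p' * s' = 1\<^sub>m (sdim M')" "r' * i' = 1\<^sub>m (sdim N')" "i' * r' + s' * p' = 1\<^sub>m (sdim E')"
      "p' * i' = 0\<^sub>m (sdim M') (sdim N')" "r' * s' = 0\<^sub>m (sdim N') (sdim M')"
    using e' by (auto simp: split_seq_def)
  note C = homs(2)[OF i] homs(2)[OF p] homog_carrier[OF sh, folded sdim_def] homog_carrier[OF rh, folded sdim_def]
    homs(2)[OF i'] homs(2)[OF p'] homog_carrier[OF sh', folded sdim_def] homog_carrier[OF rh', folded sdim_def]
    homs(2)[OF a] homs(2)[OF c]
  note CX = act_carrier[OF sE] act_carrier[OF sE'] act_carrier[OF sm(1)] act_carrier[OF sm(2)]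
    act_carrier[OF sm(3)] act_carrier[OF sm(4)]
  show ?thesis
  proof
    assume "ext_map g a c (E, i, p) (E', i', p')"
    then obtain \<phi> where \<phi>: "\<phi> \<in> smod_hom g E E'" "\<phi> * i = i' * a" "p' * \<phi> = c * p" by auto
    note F = homs(2)[OF \<phi>(1)]
    \<comment> \<open>The block of \<open>\<phi>\<close> from the quotient \<open>M\<close> to the
      subobject \<open>N'\<close>; the other blocks are prescribed by \<open>a\<close> and
      \<open>c\<close>.\<close>
    let ?h = "r' * \<phi> * s"
    have h: "homog (par N') (par M) False ?h"
      using homog_mult[OF homog_mult[OF rh' homs(1)[OF \<phi>(1)]] sh] by simp
    have hC: "?h \<in> carrier_mat (sdim N') (sdim M)" using C F by auto
    have \<phi>s: "\<phi> * s = i' * ?h + s' * c"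
    proof -
      have "\<phi> * s = (i' * r' + s' * p') * (\<phi> * s)" unfolding ids' using C F by auto
      also have "\<dots> = i' * ?h + s' * ((p' * \<phi>) * s)" using C F by (simp add: mm_assoc mm_distr)
      also have "(p' * \<phi>) * s = c" unfolding \<phi>(3) using C ids by (simp add: mm_assoc)
      finally show ?thesis .
    qed
    have "a * (r * act E X * s) + ?h * act M X = act N' X * ?h + (r' * act E' X * s') * c" if X: "X \<in> elements g" for X
    proof -
      note CX' = CX[OF X]
      let ?f = "r * act E X * s" and ?f' = "r' * act E' X * s'"
      note sf = split_seq_facts[OF e X sm(1,2)] and sf' = split_seq_facts[OF e' X sm(3,4)]
      have "r' * ((\<phi> * act E X) * s) = r' * (\<phi> * (i * ?f + s * act M X))"
        unfolding sf(2)[symmetric] using C F CX' by (simp add: mm_assoc)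
      also have "\<dots> = r' * ((\<phi> * i) * ?f) + ?h * act M X" using C F CX' by (simp add: mm_assoc mm_distl)
      also have "r' * ((\<phi> * i) * ?f) = a * ?f"
        unfolding \<phi>(2) using C CX' ids' by (simp add: mm_assoc mm_cancel[OF ids'(2)])
      finally have 1: "r' * ((\<phi> * act E X) * s) = a * ?f + ?h * act M X" .
      have "r' * ((\<phi> * act E X) * s) = (r' * act E' X) * (\<phi> * s)"
        unfolding homs(5)[OF \<phi>(1) X] using C F CX' by (simp add: mm_assoc)
      also have "\<dots> = (act N' X * r' + ?f' * p') * (\<phi> * s)" unfolding sf'(3)[symmetric] ..
      also have "\<dots> = act N' X * ?h + ?f' * ((p' * \<phi>) * s)" using C F CX' by (simp add: mm_assoc mm_distr)
      also have "(p' * \<phi>) * s = c" unfolding \<phi>(3) using C ids by (simp add: mm_assoc)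
      finally show ?thesis using 1 by simp
    qed
    then show "\<exists>h. homog (par N') (par M) False h \<and> (\<forall>X\<in>elements g.
      a * (r * act E X * s) + h * act M X = act N' X * h + (r' * act E' X * s') * c)" using h by blast
  next
    assume "\<exists>h. homog (par N') (par M) False h \<and> (\<forall>X\<in>elements g.
      a * (r * act E X * s) + h * act M X = act N' X * h + (r' * act E' X * s') * c)"
    then obtain h where h: "homog (par N') (par M) False h" and hX: "\<And>X. X \<in> elements g \<Longrightarrow>
      a * (r * act E X * s) + h * act M X = act N' X * h + (r' * act E' X * s') * c" by blast
    note H = homog_carrier[OF h, folded sdim_def]
    \<comment> \<open>The component of the desired morphism in \<open>N'\<close>; its component in
      \<open>M'\<close> is \<open>c * p\<close>.\<close>
    let ?u = "a * r + h * p"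
    let ?\<phi> = "i' * ?u + s' * (c * p)"
    have u: "?u \<in> carrier_mat (sdim N') (sdim E)" using C H by auto
    have hom: "homog (par E') (par E) False ?\<phi>"
      using homog_mult[OF homs(1)[OF i'] homog_add[OF homog_mult[OF homs(1)[OF a] rh] homog_mult[OF h homs(1)[OF p]]]]
        homog_mult[OF sh' homog_mult[OF homs(1)[OF c] homs(1)[OF p]]]
      by (intro homog_add) simp_all
    have "?\<phi> * act E X = act E' X * ?\<phi>" if X: "X \<in> elements g" for X
    proof -
      note CX' = CX[OF X]
      let ?f = "r * act E X * s" and ?f' = "r' * act E' X * s'"
      note sf = split_seq_facts[OF e X sm(1,2)] and sf' = split_seq_facts[OF e' X sm(3,4)]
      have "?\<phi> * act E X = i' * (a * (r * act E X) + h * (p * act E X)) + s' * (c * (p * act E X))"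
        using C H CX' by (simp add: mm_assoc mm_distr)
      also have "a * (r * act E X) + h * (p * act E X) = (a * act N X) * r + (a * ?f + h * act M X) * p"
      proof -
        have "(a * act N X) * r + (a * ?f + h * act M X) * p = a * (act N X * r + ?f * p) + h * (act M X * p)"
          using C H CX' by (simp add: mm_assoc mm_distl mm_distr madd_assoc)
        then show ?thesis unfolding sf(3)[symmetric] homs(5)[OF p X] by simp
      qed
      also have "\<dots> = (act N' X * a) * r + (act N' X * h + ?f' * c) * p"
        unfolding hX[OF X] homs(5)[OF a X] ..
      also have "\<dots> = act N' X * ?u + ?f' * (c * p)"
        using C H CX' sf'(1) by (simp add: mm_assoc mm_distl mm_distr madd_assoc)
      also have "c * (p * act E X) = act M' X * (c * p)"
      proof -
        have "c * (p * act E X) = (c * act M X) * p" unfolding homs(5)[OF p X] using C CX' by (simp add: mm_assoc)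
        then show ?thesis unfolding homs(5)[OF c X] using C CX' by (simp add: mm_assoc)
      qed
      finally have 1: "?\<phi> * act E X = i' * (act N' X * ?u + ?f' * (c * p)) + s' * (act M' X * (c * p))" .
      have "act E' X * ?\<phi> = (act E' X * i') * ?u + (act E' X * s') * (c * p)"
        using C H CX' u by (simp add: mm_assoc mm_distl)
      also have "act E' X * i' = i' * act N' X" using homs(5)[OF i' X] by simp
      also have "act E' X * s' = i' * ?f' + s' * act M' X" by (rule sf'(2))
      also have "(i' * act N' X) * ?u + (i' * ?f' + s' * act M' X) * (c * p)
          = i' * (act N' X * ?u + ?f' * (c * p)) + s' * (act M' X * (c * p))"
        using C H CX' u sf'(1) by (simp add: mm_assoc mm_distl mm_distr madd_assoc)
      finally show ?thesis using 1 by simp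
    qed
    then have \<phi>: "?\<phi> \<in> smod_hom g E E'" using hom by (simp add: smod_hom_def)
    have "?\<phi> * i = i' * a"
    proof -
      have "?\<phi> * i = i' * (a * (r * i) + h * (p * i)) + s' * (c * (p * i))"
        using C H u by (simp add: mm_assoc mm_distr)
      then show ?thesis unfolding ids using C H by simp
    qed
    moreover have "p' * ?\<phi> = c * p"
    proof -
      have "p' * ?\<phi> = (p' * i') * ?u + (p' * s') * (c * p)"
        using C H u by (simp add: mm_assoc mm_distl)
      moreover have "0\<^sub>m (sdim M') (sdim N') * ?u = 0\<^sub>m (sdim M') (sdim E)" by (rule left_mult_zero_mat[OF u])
      ultimately show ?thesis unfolding ids' using C by simp
    qed
    ultimately show "ext_map g a c (E, i, p) (E', i', p')" using \<phi> by auto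
  qed
qed

end

section \<open>Standard extensions\<close>

text \<open>The inclusion of a block of coordinates at offset \<open>c\<close>; its transpose is the
  projection onto that block.\<close>

definition sel_mat :: "nat \<Rightarrow> nat \<Rightarrow> nat \<Rightarrow> complex mat" where
  "sel_mat R C c = mat R C (\<lambda>(a, b). if a = b + c then 1 else 0)"

lemma sel_mat_carrier [simp]: "sel_mat R C c \<in> carrier_mat R C"
  by (simp add: sel_mat_def)

lemma sel_mat_dims [simp]: "dim_row (sel_mat R C c) = R" "dim_col (sel_mat R C c) = C"
  by (simp_all add: sel_mat_def)

lemma prod_index:
  fixes A B :: "complex mat"
  assumes "A \<in> carrier_mat r m" "B \<in> carrier_mat m c" "i < r" "j < c"
  shows "(A * B) $$ (i, j) = (\<Sum>k<m. A $$ (i, k) * B $$ (k, j))"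
  using assms by (auto simp: scalar_prod_def atLeast0LessThan intro!: sum.cong)

lemma mult_sel_mat:
  assumes "X \<in> carrier_mat r R" "c + C \<le> R"
  shows "X * sel_mat R C c = mat r C (\<lambda>(a, b). X $$ (a, b + c))"
proof (rule eq_matI)
  fix i j assume "i < dim_row (mat r C (\<lambda>(a, b). X $$ (a, b + c)))" "j < dim_col (mat r C (\<lambda>(a, b). X $$ (a, b + c)))"
  then have ij: "i < r" "j < C" by auto
  have "(X * sel_mat R C c) $$ (i, j) = (\<Sum>k<R. if k = j + c then X $$ (i, k) else 0)"
    unfolding prod_index[OF assms(1) sel_mat_carrier ij] using ij by (intro sum.cong) (auto simp: sel_mat_def)
  then show "(X * sel_mat R C c) $$ (i, j) = mat r C (\<lambda>(a, b). X $$ (a, b + c)) $$ (i, j)"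
    using ij assms(2) by simp
qed (use assms in auto)

lemma sel_mat_mult:
  assumes "X \<in> carrier_mat C q"
  shows "sel_mat R C c * X = mat R q (\<lambda>(a, b). if c \<le> a \<and> a < c + C then X $$ (a - c, b) else 0)"
    (is "_ = ?M")
proof (rule eq_matI)
  fix i j assume "i < dim_row ?M" "j < dim_col ?M"
  then have ij: "i < R" "j < q" by auto
  have "(sel_mat R C c * X) $$ (i, j) = (\<Sum>k<C. if k = i - c then (if c \<le> i then X $$ (i - c, j) else 0) else 0)"
    unfolding prod_index[OF sel_mat_carrier assms ij] using ij by (intro sum.cong) (auto simp: sel_mat_def)
  then show "(sel_mat R C c * X) $$ (i, j) = ?M $$ (i, j)"
    using ij by (auto simp: less_diff_conv2)
qed (use assms in auto)

lemma transpose_sel_mat_mult: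
  assumes "X \<in> carrier_mat R q" "c + C \<le> R"
  shows "transpose_mat (sel_mat R C c) * X = mat C q (\<lambda>(a, b). X $$ (a + c, b))"
proof -
  have "transpose_mat (sel_mat R C c) * X = transpose_mat (transpose_mat X * sel_mat R C c)"
    using transpose_mult[of "transpose_mat X" q R "sel_mat R C c" C] assms(1) by simp
  also have "\<dots> = mat C q (\<lambda>(a, b). X $$ (a + c, b))"
    unfolding mult_sel_mat[OF transpose_carrier_mat[THEN iffD2, OF assms(1)] assms(2)]
    using assms by (intro eq_matI) auto
  finally show ?thesis .
qed

lemma mult_transpose_sel_mat:
  assumes "X \<in> carrier_mat r C"
  shows "X * transpose_mat (sel_mat R C c) = mat r R (\<lambda>(a, b). if c \<le> b \<and> b < c + C then X $$ (a, b - c) else 0)"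
proof -
  have "X * transpose_mat (sel_mat R C c) = transpose_mat (sel_mat R C c * transpose_mat X)"
    using transpose_mult[of "sel_mat R C c" R C "transpose_mat X" r] assms by simp
  also have "\<dots> = mat r R (\<lambda>(a, b). if c \<le> b \<and> b < c + C then X $$ (a, b - c) else 0)"
    unfolding sel_mat_mult[OF transpose_carrier_mat[THEN iffD2, OF assms]]
    using assms by (intro eq_matI) auto
  finally show ?thesis .
qed

lemma append_rows_eq_sel_mat:
  "1\<^sub>m m @\<^sub>r 0\<^sub>m k m = sel_mat (m + k) m 0" "0\<^sub>m k m @\<^sub>r 1\<^sub>m m = sel_mat (k + m) m k"
  by (rule eq_matI; auto simp: append_rows_def sel_mat_def)+

lemma homog_sel_mat_left: "homog (ps @ qs) ps False (sel_mat (length ps + length qs) (length ps) 0)"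
  and homog_sel_mat_right: "homog (ps @ qs) qs False (sel_mat (length ps + length qs) (length qs) (length ps))"
  by (auto simp: homog_def sel_mat_def nth_append split: if_splits)

lemma homog_transpose: "homog rs cs a F \<Longrightarrow> homog cs rs a (transpose_mat F)"
  by (auto simp: homog_def)

section \<open>Cocycles in matrix form and equivalence of extensions\<close>

context sub_q
begin

text \<open>Cocycles with values in the linear maps from \<open>M\<close> to \<open>N\<close>,
  normalised to vanish on the even part. The last clause is the bracket relation for the
  off-diagonal block of a block triangular action.\<close>

definition mcocycle :: "smod \<Rightarrow> smod \<Rightarrow> (complex mat \<Rightarrow> complex mat) \<Rightarrow> bool" where
  "mcocycle M N f \<longleftrightarrow>
     (\<forall>X\<in>elements g. f X \<in> carrier_mat (sdim N) (sdim M)) \<and>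
     (\<forall>X\<in>elements g. \<forall>Y\<in>elements g. f (X + Y) = f X + f Y) \<and>
     (\<forall>c. \<forall>X\<in>elements g. f (c \<cdot>\<^sub>m X) = c \<cdot>\<^sub>m f X) \<and>
     (\<forall>a. \<forall>X\<in>g a. homog (par N) (par M) a (f X)) \<and>
     (\<forall>X\<in>g False. f X = 0\<^sub>m (sdim N) (sdim M)) \<and>
     (\<forall>a b. \<forall>X\<in>g a. \<forall>Y\<in>g b. f (supercomm a b X Y) =
        (if a \<and> b then (act N X * f Y + f X * act M Y) + (act N Y * f X + f Y * act M X)
         else (act N X * f Y + f X * act M Y) - (act N Y * f X + f Y * act M X)))"

text \<open>The form that \<open>ext_map_iff\<close> takes for identities at both ends. If both
  cocycles vanish on the even part, \<open>h\<close> is automatically equivariant under it.\<close>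

definition cobounds :: "smod \<Rightarrow> smod \<Rightarrow> (complex mat \<Rightarrow> complex mat) \<Rightarrow> (complex mat \<Rightarrow> complex mat) \<Rightarrow> bool" where
  "cobounds M N f f' \<longleftrightarrow> (\<exists>h. homog (par N) (par M) False h \<and>
     (\<forall>X\<in>elements g. f X + h * act M X = act N X * h + f' X))"

text \<open>A relation and not a function, because the cocycle depends on the choice of
  \<open>s\<close> and \<open>r\<close>.\<close>

definition has_cocycle :: "smod \<Rightarrow> smod \<Rightarrow> ext \<Rightarrow> (complex mat \<Rightarrow> complex mat) \<Rightarrow> bool" where
  "has_cocycle M N e f \<longleftrightarrow> e \<in> extensions g M N \<and>
     (\<exists>s r. split_seq M N e s r \<and> (\<forall>X\<in>elements g. f X = r * act (fst e) X * s))"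

lemma has_cocycleD:
  assumes "has_cocycle M N (E, i, p) f"
  obtains s r where "split_seq M N (E, i, p) s r" "\<And>X. X \<in> elements g \<Longrightarrow> f X = r * act E X * s"
  using assms by (auto simp: has_cocycle_def)

lemma split_seq_mcocycle:
  assumes e: "split_seq M N (E, i, p) s r" and sM: "supermodule g M" and sN: "supermodule g N"
    and even: "\<And>X. X \<in> g False \<Longrightarrow> r * act E X * s = 0\<^sub>m (sdim N) (sdim M)"
  shows "mcocycle M N (\<lambda>X. r * act E X * s)"
proof -
  have sE: "supermodule g E" and i: "i \<in> smod_hom g N E" and p: "p \<in> smod_hom g E M"
    and sh: "homog (par E) (par M) False s" and rh: "homog (par N) (par E) False r"
    and ids: "p * s = 1\<^sub>m (sdim M)" "r * i = 1\<^sub>m (sdim N)" "i * r + s * p = 1\<^sub>m (sdim E)"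
      "p * i = 0\<^sub>m (sdim M) (sdim N)" "r * s = 0\<^sub>m (sdim N) (sdim M)"
    using e by (auto simp: split_seq_def)
  note C = homs(2)[OF i] homs(2)[OF p] homog_carrier[OF sh, folded sdim_def] homog_carrier[OF rh, folded sdim_def]
  note sE' = sE[unfolded supermodule_def]
  let ?f = "\<lambda>X. r * act E X * s"
  note sf = split_seq_facts[OF e _ sM sN]
  have prod: "r * (act E X * act E Y) * s = act N X * ?f Y + ?f X * act M Y"
    if X: "X \<in> elements g" and Y: "Y \<in> elements g" for X Y
  proof -
    note CX = act_carrier[OF sE X] act_carrier[OF sE Y] act_carrier[OF sM Y] act_carrier[OF sN X]
    note fX = sf(1)[OF X] and fY = sf(1)[OF Y]
    have "r * (act E X * act E Y) * s = (r * act E X) * (act E Y * s)"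
      using C CX by (simp add: mm_assoc)
    also have "\<dots> = (r * act E X) * (i * ?f Y + s * act M Y)" unfolding sf(2)[OF Y, symmetric] ..
    also have "\<dots> = r * (act E X * i) * ?f Y + ?f X * act M Y"
      using C CX fY by (simp add: mm_assoc mm_distl)
    also have "r * (act E X * i) = act N X"
      unfolding homs(5)[OF i X, symmetric] using C CX ids by (simp add: mm_cancel)
    finally show ?thesis .
  qed
  show ?thesis
    unfolding mcocycle_def
  proof (intro conjI ballI allI)
    fix X assume X: "X \<in> elements g"
    show "?f X \<in> carrier_mat (sdim N) (sdim M)" by (rule sf(1)[OF X])
    show "?f (c \<cdot>\<^sub>m X) = c \<cdot>\<^sub>m ?f X" for c
    proof -
      have "act E (c \<cdot>\<^sub>m X) = c \<cdot>\<^sub>m act E X" using sE' X by blast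
      then show ?thesis
        using mult_smult_distrib[OF C(4) act_carrier[OF sE X], of c]
          mult_smult_assoc_mat[OF mult_carrier_mat[OF C(4) act_carrier[OF sE X]] C(3), of c] by simp
    qed
    fix Y assume Y: "Y \<in> elements g"
    have "act E (X + Y) = act E X + act E Y" using sE' X Y by blast
    then show "?f (X + Y) = ?f X + ?f Y"
      using C act_carrier[OF sE X] act_carrier[OF sE Y] by (simp add: mm_distl mm_distr)
  next
    fix a X assume X: "X \<in> g a"
    have "homog (par E) (par E) a (act E X)" using sE' X by blast
    from homog_mult[OF homog_mult[OF rh this] sh] show "homog (par N) (par M) a (?f X)" by simp
  next
    fix X assume "X \<in> g False"
    then show "?f X = 0\<^sub>m (sdim N) (sdim M)" by (rule even)
  next
    fix a b X Y assume X: "X \<in> g a" and Y: "Y \<in> g b"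
    note X' = g_elements[OF X] and Y' = g_elements[OF Y]
    note A = act_carrier[OF sE X'] and B = act_carrier[OF sE Y']
    note AB = mult_carrier_mat[OF A B] and BA = mult_carrier_mat[OF B A]
    have br: "act E (supercomm a b X Y) = supercomm a b (act E X) (act E Y)" using sE' X Y by blast
    show "?f (supercomm a b X Y) =
        (if a \<and> b then (act N X * ?f Y + ?f X * act M Y) + (act N Y * ?f X + ?f Y * act M X)
         else (act N X * ?f Y + ?f X * act M Y) - (act N Y * ?f X + ?f Y * act M X))"
    proof (cases "a \<and> b")
      case True
      have "?f (supercomm a b X Y) = r * (act E X * act E Y) * s + r * (act E Y * act E X) * s"
        unfolding br
        unfolding supercomm_def if_P[OF True] mult_add_distrib_mat[OF C(4) AB BA]
        by (rule add_mult_distrib_mat[OF mult_carrier_mat[OF C(4) AB] mult_carrier_mat[OF C(4) BA] C(3)])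
      then show ?thesis unfolding if_P[OF True] prod[OF X' Y'] prod[OF Y' X'] .
    next
      case False
      have "?f (supercomm a b X Y) = r * (act E X * act E Y) * s - r * (act E Y * act E X) * s"
        unfolding br
        unfolding supercomm_def if_not_P[OF False] mult_minus_distrib_mat[OF C(4) AB BA]
        by (rule minus_mult_distrib_mat[OF mult_carrier_mat[OF C(4) AB] mult_carrier_mat[OF C(4) BA] C(3)])
      then show ?thesis unfolding if_not_P[OF False] prod[OF X' Y'] prod[OF Y' X'] .
    qed
  qed
qed

lemma has_cocycle_exists:
  assumes "e \<in> extensions g M N" "supermodule g M" "supermodule g N"
  obtains f where "has_cocycle M N e f" "mcocycle M N f"
proof -
  obtain E i p where e: "e = (E, i, p)" by (cases e)
  obtain s r where sr: "split_seq M N (E, i, p) s r" "\<And>X. X \<in> g False \<Longrightarrow> r * act E X * s = 0\<^sub>m (sdim N) (sdim M)"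
    using split_seq_exists[OF assms(1)[unfolded e] assms(2,3)] by blast
  show thesis
  proof (rule that)
    show "has_cocycle M N e (\<lambda>X. r * act E X * s)" using assms(1) sr by (auto simp: has_cocycle_def e)
    show "mcocycle M N (\<lambda>X. r * act E X * s)" by (rule split_seq_mcocycle[OF sr(1) assms(2,3) sr(2)])
  qed
qed

lemma has_cocycle_map_iff:
  assumes e: "has_cocycle M N e f" and e': "has_cocycle M' N' e' f'"
    and sm: "supermodule g M" "supermodule g N" "supermodule g M'" "supermodule g N'"
    and a: "a \<in> smod_hom g N N'" and c: "c \<in> smod_hom g M M'"
  shows "ext_map g a c e e' \<longleftrightarrow> (\<exists>h. homog (par N') (par M) False h \<and>
    (\<forall>X\<in>elements g. a * f X + h * act M X = act N' X * h + f' X * c))"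
proof -
  obtain E i p where E: "e = (E, i, p)" by (cases e)
  obtain E' i' p' where E': "e' = (E', i', p')" by (cases e')
  obtain s r where sr: "split_seq M N (E, i, p) s r" "\<And>X. X \<in> elements g \<Longrightarrow> f X = r * act E X * s"
    using has_cocycleD[OF e[unfolded E]] by blast
  obtain s' r' where sr': "split_seq M' N' (E', i', p') s' r'" "\<And>X. X \<in> elements g \<Longrightarrow> f' X = r' * act E' X * s'"
    using has_cocycleD[OF e'[unfolded E']] by blast
  show ?thesis unfolding E E' ext_map_iff[OF sr(1) sr'(1) sm a c] using sr(2) sr'(2) by simp
qed

lemma ext_equiv_iff:
  assumes e: "has_cocycle M N e f" and e': "has_cocycle M N e' f'"
    and sm: "supermodule g M" "supermodule g N"
  shows "(e, e') \<in> ext_equiv g M N \<longleftrightarrow> cobounds M N f f'"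
proof -
  have f: "1\<^sub>m (sdim N) * f X = f X" "f' X * 1\<^sub>m (sdim M) = f' X" if X: "X \<in> elements g" for X
  proof -
    obtain E i p where E: "e = (E, i, p)" by (cases e)
    obtain E' i' p' where E': "e' = (E', i', p')" by (cases e')
    obtain s r where sr: "split_seq M N (E, i, p) s r" "f X = r * act E X * s"
      using has_cocycleD[OF e[unfolded E]] X by metis
    obtain s' r' where sr': "split_seq M N (E', i', p') s' r'" "f' X = r' * act E' X * s'"
      using has_cocycleD[OF e'[unfolded E']] X by metis
    show "1\<^sub>m (sdim N) * f X = f X" "f' X * 1\<^sub>m (sdim M) = f' X"
      unfolding sr(2) sr'(2)
      by (rule left_mult_one_mat[OF split_seq_facts(1)[OF sr(1) X sm]],
          rule right_mult_one_mat[OF split_seq_facts(1)[OF sr'(1) X sm]])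
  qed
  show ?thesis
    unfolding ext_equiv_def cobounds_def
    using has_cocycle_map_iff[OF e e' sm sm hom_one[OF sm(2)] hom_one[OF sm(1)]] e e' f
    by (simp add: has_cocycle_def)
qed

lemma cobounds_refl:
  assumes "supermodule g M" "supermodule g N" "mcocycle M N f"
  shows "cobounds M N f f"
proof -
  have "f X + 0\<^sub>m (sdim N) (sdim M) * act M X = act N X * 0\<^sub>m (sdim N) (sdim M) + f X" if "X \<in> elements g" for X
  proof -
    have "f X \<in> carrier_mat (sdim N) (sdim M)" using assms(3) that by (auto simp: mcocycle_def)
    moreover have "0\<^sub>m (sdim N) (sdim M) * act M X = 0\<^sub>m (sdim N) (sdim M)"
      by (rule left_mult_zero_mat[OF act_carrier[OF assms(1) that]])
    moreover have "act N X * 0\<^sub>m (sdim N) (sdim M) = 0\<^sub>m (sdim N) (sdim M)"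
      by (rule right_mult_zero_mat[OF act_carrier[OF assms(2) that]])
    ultimately show ?thesis by simp
  qed
  then show ?thesis unfolding cobounds_def using homog_zero[of "par N" "par M" False] by (auto simp: sdim_def)
qed

lemma mat_identity_neg:
  fixes A B C D :: "complex mat"
  assumes "A + B = C + D" "A \<in> carrier_mat r c" "B \<in> carrier_mat r c" "C \<in> carrier_mat r c" "D \<in> carrier_mat r c"
  shows "D + - 1 \<cdot>\<^sub>m B = - 1 \<cdot>\<^sub>m C + A"
proof (rule eq_matI)
  fix i j assume "i < dim_row (- 1 \<cdot>\<^sub>m C + A)" "j < dim_col (- 1 \<cdot>\<^sub>m C + A)"
  then have ij: "i < r" "j < c" using assms by auto
  have "(A + B) $$ (i, j) = (C + D) $$ (i, j)" using assms(1) by simp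
  then show "(D + - 1 \<cdot>\<^sub>m B) $$ (i, j) = (- 1 \<cdot>\<^sub>m C + A) $$ (i, j)"
    using ij assms(2-5) by (simp add: algebra_simps)
qed (use assms in auto)

lemma cobounds_sym:
  assumes "supermodule g M" "supermodule g N" "mcocycle M N f" "mcocycle M N f'" "cobounds M N f f'"
  shows "cobounds M N f' f"
proof -
  obtain h where h: "homog (par N) (par M) False h" "\<And>X. X \<in> elements g \<Longrightarrow> f X + h * act M X = act N X * h + f' X"
    using assms(5) by (auto simp: cobounds_def)
  have hC: "h \<in> carrier_mat (sdim N) (sdim M)" using homog_carrier[OF h(1)] by (simp add: sdim_def)
  have "f' X + (- 1 \<cdot>\<^sub>m h) * act M X = act N X * (- 1 \<cdot>\<^sub>m h) + f X" if X: "X \<in> elements g" for X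
  proof -
    note a = act_carrier[OF assms(1) X] act_carrier[OF assms(2) X]
    have fC: "f X \<in> carrier_mat (sdim N) (sdim M)" "f' X \<in> carrier_mat (sdim N) (sdim M)"
      using assms(3,4) X by (auto simp: mcocycle_def)
    show ?thesis
      unfolding mult_smult_assoc_mat[OF hC a(1)] mult_smult_distrib[OF a(2) hC]
      by (rule mat_identity_neg[OF h(2)[OF X] fC(1) mult_carrier_mat[OF hC a(1)] mult_carrier_mat[OF a(2) hC] fC(2)])
  qed
  then show ?thesis unfolding cobounds_def using homog_smult[OF h(1)] by blast
qed

lemma mat_identity_trans:
  fixes A B C D :: "complex mat"
  assumes "A + B = C + D" "D + B' = C' + D'" "A \<in> carrier_mat r c" "B \<in> carrier_mat r c" "C \<in> carrier_mat r c"
    "D \<in> carrier_mat r c" "B' \<in> carrier_mat r c" "C' \<in> carrier_mat r c" "D' \<in> carrier_mat r c"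
  shows "A + (B + B') = (C + C') + D'"
proof (rule eq_matI)
  fix i j assume "i < dim_row ((C + C') + D')" "j < dim_col ((C + C') + D')"
  then have ij: "i < r" "j < c" using assms by auto
  have "(A + B) $$ (i, j) = (C + D) $$ (i, j)" "(D + B') $$ (i, j) = (C' + D') $$ (i, j)" using assms(1,2) by simp_all
  then have "A $$ (i, j) + B $$ (i, j) = C $$ (i, j) + D $$ (i, j)"
    "D $$ (i, j) + B' $$ (i, j) = C' $$ (i, j) + D' $$ (i, j)"
    using ij assms(3-9) by simp_all
  then have "A $$ (i, j) + (B $$ (i, j) + B' $$ (i, j)) = C $$ (i, j) + C' $$ (i, j) + D' $$ (i, j)"
    by (metis (no_types, lifting) add.assoc)
  then show "(A + (B + B')) $$ (i, j) = ((C + C') + D') $$ (i, j)"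
    using ij assms(3-9) by simp
qed (use assms in auto)

lemma cobounds_trans:
  assumes "supermodule g M" "supermodule g N" "mcocycle M N f" "mcocycle M N f'" "mcocycle M N f''"
    and "cobounds M N f f'" "cobounds M N f' f''"
  shows "cobounds M N f f''"
proof -
  obtain h where h: "homog (par N) (par M) False h" "\<And>X. X \<in> elements g \<Longrightarrow> f X + h * act M X = act N X * h + f' X"
    using assms(6) by (auto simp: cobounds_def)
  obtain k where k: "homog (par N) (par M) False k" "\<And>X. X \<in> elements g \<Longrightarrow> f' X + k * act M X = act N X * k + f'' X"
    using assms(7) by (auto simp: cobounds_def)
  note C = homog_carrier[OF h(1), folded sdim_def] homog_carrier[OF k(1), folded sdim_def]
  have "f X + (h + k) * act M X = act N X * (h + k) + f'' X" if X: "X \<in> elements g" for X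
  proof -
    note a = act_carrier[OF assms(1) X] act_carrier[OF assms(2) X]
    have fC: "f X \<in> carrier_mat (sdim N) (sdim M)" "f' X \<in> carrier_mat (sdim N) (sdim M)" "f'' X \<in> carrier_mat (sdim N) (sdim M)"
      using assms(3-5) X by (auto simp: mcocycle_def)
    show ?thesis
      unfolding add_mult_distrib_mat[OF C a(1)] mult_add_distrib_mat[OF a(2) C]
      by (rule mat_identity_trans[OF h(2)[OF X] k(2)[OF X] fC(1) mult_carrier_mat[OF C(1) a(1)]
        mult_carrier_mat[OF a(2) C(1)] fC(2) mult_carrier_mat[OF C(2) a(1)] mult_carrier_mat[OF a(2) C(2)] fC(3)])
  qed
  then show ?thesis unfolding cobounds_def using homog_add[OF h(1) k(1)] by blast
qed

text \<open>\<open>ext_map\<close> is directed; symmetry becomes visible on cocycles, where it is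
  the passage from \<open>h\<close> to \<open>- h\<close>.\<close>

theorem equiv_ext_equiv:
  assumes sm: "supermodule g M" "supermodule g N"
  shows "equiv (extensions g M N) (ext_equiv g M N)"
proof (rule equivI)
  have co: "\<exists>f. has_cocycle M N e f \<and> mcocycle M N f" if "e \<in> extensions g M N" for e
    using has_cocycle_exists[OF that sm] by blast
  show "ext_equiv g M N \<subseteq> extensions g M N \<times> extensions g M N" by (auto simp: ext_equiv_def)
  show "refl_on (extensions g M N) (ext_equiv g M N)"
  proof (rule refl_onI)
    fix e assume "e \<in> extensions g M N"
    then obtain f where "has_cocycle M N e f" "mcocycle M N f" using co by blast
    then show "(e, e) \<in> ext_equiv g M N" using ext_equiv_iff[OF _ _ sm] cobounds_refl[OF sm] by blast
  qed
  show "sym (ext_equiv g M N)"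
  proof (rule symI)
    fix e e' assume ee': "(e, e') \<in> ext_equiv g M N"
    then have "e \<in> extensions g M N" "e' \<in> extensions g M N" by (auto simp: ext_equiv_def)
    then obtain f f' where f: "has_cocycle M N e f" "mcocycle M N f" "has_cocycle M N e' f'" "mcocycle M N f'"
      using co by metis
    then have "cobounds M N f f'" using ext_equiv_iff[OF f(1,3) sm] ee' by blast
    then show "(e', e) \<in> ext_equiv g M N"
      using ext_equiv_iff[OF f(3,1) sm] cobounds_sym[OF sm f(2,4)] by blast
  qed
  show "trans (ext_equiv g M N)"
  proof (rule transI)
    fix e e' e'' assume 1: "(e, e') \<in> ext_equiv g M N" and 2: "(e', e'') \<in> ext_equiv g M N"
    then have "e \<in> extensions g M N" "e' \<in> extensions g M N" "e'' \<in> extensions g M N" by (auto simp: ext_equiv_def)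
    then obtain f f' f'' where f: "has_cocycle M N e f" "mcocycle M N f" "has_cocycle M N e' f'" "mcocycle M N f'"
      "has_cocycle M N e'' f''" "mcocycle M N f''" using co by metis
    have "cobounds M N f f'" "cobounds M N f' f''"
      using ext_equiv_iff[OF f(1,3) sm] ext_equiv_iff[OF f(3,5) sm] 1 2 by blast+
    then show "(e, e'') \<in> ext_equiv g M N"
      using ext_equiv_iff[OF f(1,5) sm] cobounds_trans[OF sm f(2,4,6)] by blast
  qed
qed

text \<open>The zero block takes its dimensions from the actions, as in \<open>mat_dsum\<close>, so
  that \<open>split_ext\<close> is literally the instance with zero cocycle.\<close>

definition std_ext :: "smod \<Rightarrow> smod \<Rightarrow> (complex mat \<Rightarrow> complex mat) \<Rightarrow> ext" where
  "std_ext M N f = (\<lparr>par = par N @ par M, act = (\<lambda>X. four_block_mat (act N X) (f X)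
       (0\<^sub>m (dim_row (act M X)) (dim_col (act N X))) (act M X))\<rparr>,
     1\<^sub>m (sdim N) @\<^sub>r 0\<^sub>m (sdim M) (sdim N), transpose_mat (0\<^sub>m (sdim N) (sdim M) @\<^sub>r 1\<^sub>m (sdim M)))"

lemma split_ext_eq_std_ext:
  "split_ext M N = std_ext M N (\<lambda>X. 0\<^sub>m (dim_row (act N X)) (dim_col (act M X)))"
  by (simp add: split_ext_def std_ext_def smod_dsum_def mat_dsum_def)

lemma std_ext_act:
  assumes "supermodule g M" "supermodule g N" "X \<in> elements g"
  shows "act (fst (std_ext M N f)) X = four_block_mat (act N X) (f X) (0\<^sub>m (sdim M) (sdim N)) (act M X)"
  using act_dims[OF assms(1,3)] act_dims[OF assms(2,3)] by (simp add: std_ext_def)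

lemma std_ext_supermodule:
  assumes sm: "supermodule g M" "supermodule g N" and f: "mcocycle M N f"
  shows "supermodule g (fst (std_ext M N f))"
proof -
  let ?E = "fst (std_ext M N f)"
  have par: "par ?E = par N @ par M" and d: "sdim ?E = sdim N + sdim M"
    by (simp_all add: std_ext_def sdim_def)
  note act = std_ext_act[OF sm]
  have fC: "f X \<in> carrier_mat (sdim N) (sdim M)" if "X \<in> elements g" for X using f that by (auto simp: mcocycle_def)
  note aM = act_carrier[OF sm(1)] and aN = act_carrier[OF sm(2)]
  show ?thesis
    unfolding supermodule_def
  proof (intro conjI ballI allI)
    fix X assume X: "X \<in> elements g"
    show "act ?E X \<in> carrier_mat (sdim ?E) (sdim ?E)"
      unfolding act[OF X] d by (rule four_block_carrier_mat[OF aN[OF X] aM[OF X]])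
    fix c
    have 1: "act M (c \<cdot>\<^sub>m X) = c \<cdot>\<^sub>m act M X" "act N (c \<cdot>\<^sub>m X) = c \<cdot>\<^sub>m act N X" "f (c \<cdot>\<^sub>m X) = c \<cdot>\<^sub>m f X"
      using sm f X by (auto simp: supermodule_def mcocycle_def)
    show "act ?E (c \<cdot>\<^sub>m X) = c \<cdot>\<^sub>m act ?E X"
      unfolding act[OF X] act[OF elements_smult[OF X]] 1
      using smult_four_block_mat[OF aN[OF X] fC[OF X] zero_carrier_mat aM[OF X], of c] by simp
  next
    fix X Y assume X: "X \<in> elements g" and Y: "Y \<in> elements g"
    have 1: "act M (X + Y) = act M X + act M Y" "act N (X + Y) = act N X + act N Y" "f (X + Y) = f X + f Y"
      using sm f X Y by (auto simp: supermodule_def mcocycle_def)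
    show "act ?E (X + Y) = act ?E X + act ?E Y"
      unfolding act[OF X] act[OF Y] act[OF elements_add[OF X Y]] 1
      using add_four_block_mat[OF aN[OF X] fC[OF X] zero_carrier_mat aM[OF X] aN[OF Y] fC[OF Y] zero_carrier_mat aM[OF Y]]
      by simp
  next
    fix a X assume X: "X \<in> g a"
    have h: "homog (par N) (par N) a (act N X)" "homog (par M) (par M) a (act M X)" "homog (par N) (par M) a (f X)"
      using sm f X by (auto simp: supermodule_def mcocycle_def)
    show "homog (par ?E) (par ?E) a (act ?E X)"
      unfolding act[OF g_elements[OF X]] par homog_def
    proof (intro conjI allI impI)
      show "four_block_mat (act N X) (f X) (0\<^sub>m (sdim M) (sdim N)) (act M X)
          \<in> carrier_mat (length (par N @ par M)) (length (par N @ par M))"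
        using four_block_carrier_mat[OF aN[OF g_elements[OF X]] aM[OF g_elements[OF X]]] by (simp add: sdim_def)
      fix i j assume ij: "i < length (par N @ par M)" "j < length (par N @ par M)"
        "four_block_mat (act N X) (f X) (0\<^sub>m (sdim M) (sdim N)) (act M X) $$ (i, j) \<noteq> 0"
      note dims = carrier_matD[OF aN[OF g_elements[OF X]]] carrier_matD[OF aM[OF g_elements[OF X]]]
      have lens: "length (par N) = sdim N" "length (par M) = sdim M" by (simp_all add: sdim_def)
      show "((par N @ par M) ! i \<noteq> (par N @ par M) ! j) = a"
        using ij h dims by (auto simp: homog_def nth_append lens split: if_splits)
    qed
  next
    fix a b X Y assume X: "X \<in> g a" and Y: "Y \<in> g b"
    note X' = g_elements[OF X] and Y' = g_elements[OF Y]
    have 1: "act M (supercomm a b X Y) = supercomm a b (act M X) (act M Y)"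
        "act N (supercomm a b X Y) = supercomm a b (act N X) (act N Y)"
      using sm X Y by (auto simp: supermodule_def)
    have 2: "f (supercomm a b X Y) =
        (if a \<and> b then (act N X * f Y + f X * act M Y) + (act N Y * f X + f Y * act M X)
         else (act N X * f Y + f X * act M Y) - (act N Y * f X + f Y * act M X))"
      using f X Y by (auto simp: mcocycle_def)
    have prod: "act ?E X * act ?E Y = four_block_mat (act N X * act N Y) (act N X * f Y + f X * act M Y)
        (0\<^sub>m (sdim M) (sdim N)) (act M X * act M Y)" if X': "X \<in> elements g" and Y': "Y \<in> elements g" for X Y
    proof -
      note cs = aN[OF X'] fC[OF X'] zero_carrier_mat[of "sdim M" "sdim N"] aM[OF X']
        aN[OF Y'] fC[OF Y'] zero_carrier_mat[of "sdim M" "sdim N"] aM[OF Y']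
      show ?thesis
        unfolding act[OF X'] act[OF Y'] mult_four_block_mat[OF cs] using cs by simp
    qed
    note cX = aN[OF X'] fC[OF X'] aM[OF X'] and cY = aN[OF Y'] fC[OF Y'] aM[OF Y']
    have blk: "four_block_mat A B (0\<^sub>m (sdim M) (sdim N)) D + four_block_mat A' B' (0\<^sub>m (sdim M) (sdim N)) D'
        = four_block_mat (A + A') (B + B') (0\<^sub>m (sdim M) (sdim N)) (D + D')"
      "four_block_mat A B (0\<^sub>m (sdim M) (sdim N)) D - four_block_mat A' B' (0\<^sub>m (sdim M) (sdim N)) D'
        = four_block_mat (A - A') (B - B') (0\<^sub>m (sdim M) (sdim N)) (D - D')"
      if "A \<in> carrier_mat (sdim N) (sdim N)" "A' \<in> carrier_mat (sdim N) (sdim N)"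
        "B \<in> carrier_mat (sdim N) (sdim M)" "B' \<in> carrier_mat (sdim N) (sdim M)"
        "D \<in> carrier_mat (sdim M) (sdim M)" "D' \<in> carrier_mat (sdim M) (sdim M)" for A A' B B' D D' :: "complex mat"
      using that by (intro eq_matI; auto)+
    have cs: "act N X * act N Y \<in> carrier_mat (sdim N) (sdim N)" "act N Y * act N X \<in> carrier_mat (sdim N) (sdim N)"
      "act N X * f Y + f X * act M Y \<in> carrier_mat (sdim N) (sdim M)"
      "act N Y * f X + f Y * act M X \<in> carrier_mat (sdim N) (sdim M)"
      "act M X * act M Y \<in> carrier_mat (sdim M) (sdim M)" "act M Y * act M X \<in> carrier_mat (sdim M) (sdim M)"
      using cX cY by auto
    show "act ?E (supercomm a b X Y) = supercomm a b (act ?E X) (act ?E Y)"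
    proof (cases "a \<and> b")
      case True
      show ?thesis
        unfolding act[OF g_elements[OF supercomm_in_g[OF X Y]]] 1 2
        unfolding supercomm_def if_P[OF True] prod[OF X' Y'] prod[OF Y' X'] blk(1)[OF cs] ..
    next
      case False
      show ?thesis
        unfolding act[OF g_elements[OF supercomm_in_g[OF X Y]]] 1 2
        unfolding supercomm_def if_not_P[OF False] prod[OF X' Y'] prod[OF Y' X'] blk(2)[OF cs] ..
    qed
  qed
qed

lemma extension_if_split_seq:
  assumes e: "split_seq M N (E, i, p) s r" and E: "E \<in> cat_F g"
  shows "(E, i, p) \<in> extensions g M N"
proof -
  have i: "i \<in> smod_hom g N E" and p: "p \<in> smod_hom g E M"
    and sh: "homog (par E) (par M) False s" and rh: "homog (par N) (par E) False r"
    and ids: "p * s = 1\<^sub>m (sdim M)" "r * i = 1\<^sub>m (sdim N)" "i * r + s * p = 1\<^sub>m (sdim E)"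
      "p * i = 0\<^sub>m (sdim M) (sdim N)"
    using e by (auto simp: split_seq_def)
  note iC = homs(2)[OF i] and pC = homs(2)[OF p] and sC = homog_carrier[OF sh, folded sdim_def]
    and rC = homog_carrier[OF rh, folded sdim_def]
  have "mat_kernel i = {0\<^sub>v (sdim N)}"
  proof
    show "mat_kernel i \<subseteq> {0\<^sub>v (sdim N)}"
    proof
      fix v assume "v \<in> mat_kernel i"
      then have v: "v \<in> carrier_vec (sdim N)" "i *\<^sub>v v = 0\<^sub>v (sdim E)" using mat_kernel[OF iC] by auto
      have "v = r * i *\<^sub>v v" unfolding ids using v by simp
      also have "\<dots> = 0\<^sub>v (sdim N)" unfolding assoc_mult_mat_vec[OF rC iC v(1)] v(2) using rC by auto
      finally show "v \<in> {0\<^sub>v (sdim N)}" by simp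
    qed
    have "i *\<^sub>v 0\<^sub>v (sdim N) = 0\<^sub>v (sdim E)" using iC by auto
    then show "{0\<^sub>v (sdim N)} \<subseteq> mat_kernel i" unfolding mat_kernel[OF iC] by simp
  qed
  moreover have "(\<lambda>v. i *\<^sub>v v) ` carrier_vec (sdim N) = mat_kernel p"
  proof
    show "(\<lambda>v. i *\<^sub>v v) ` carrier_vec (sdim N) \<subseteq> mat_kernel p"
    proof
      fix w assume "w \<in> (\<lambda>v. i *\<^sub>v v) ` carrier_vec (sdim N)"
      then obtain v where v: "v \<in> carrier_vec (sdim N)" "w = i *\<^sub>v v" by blast
      have "p *\<^sub>v w = p * i *\<^sub>v v" unfolding v(2) assoc_mult_mat_vec[OF pC iC v(1)] ..
      also have "\<dots> = 0\<^sub>v (sdim M)" unfolding ids using v(1) by auto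
      finally show "w \<in> mat_kernel p" unfolding mat_kernel[OF pC] using iC v by auto
    qed
    show "mat_kernel p \<subseteq> (\<lambda>v. i *\<^sub>v v) ` carrier_vec (sdim N)"
    proof
      fix v assume "v \<in> mat_kernel p"
      then have v: "v \<in> carrier_vec (sdim E)" "p *\<^sub>v v = 0\<^sub>v (sdim M)" using mat_kernel[OF pC] by auto
      have "v = (i * r + s * p) *\<^sub>v v" unfolding ids using v by simp
      also have "\<dots> = i *\<^sub>v (r *\<^sub>v v) + s *\<^sub>v (p *\<^sub>v v)"
        unfolding add_mult_distrib_mat_vec[OF mult_carrier_mat[OF iC rC] mult_carrier_mat[OF sC pC] v(1)]
          assoc_mult_mat_vec[OF iC rC v(1)] assoc_mult_mat_vec[OF sC pC v(1)] ..
      also have "\<dots> = i *\<^sub>v (r *\<^sub>v v)"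
      proof -
        have "s *\<^sub>v (p *\<^sub>v v) = 0\<^sub>v (sdim E)" unfolding v(2) using sC by auto
        then show ?thesis using iC rC v(1) by simp
      qed
      finally show "v \<in> (\<lambda>v. i *\<^sub>v v) ` carrier_vec (sdim N)"
        using mult_mat_vec_carrier[OF rC v(1)] by blast
    qed
  qed
  moreover have "(\<lambda>v. p *\<^sub>v v) ` carrier_vec (sdim E) = carrier_vec (sdim M)"
  proof
    show "carrier_vec (sdim M) \<subseteq> (\<lambda>v. p *\<^sub>v v) ` carrier_vec (sdim E)"
    proof
      fix v :: "complex vec" assume v: "v \<in> carrier_vec (sdim M)"
      have "v = p * s *\<^sub>v v" unfolding ids using v by simp
      also have "\<dots> = p *\<^sub>v (s *\<^sub>v v)" by (rule assoc_mult_mat_vec[OF pC sC v])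
      finally show "v \<in> (\<lambda>v. p *\<^sub>v v) ` carrier_vec (sdim E)" using mult_mat_vec_carrier[OF sC v] by blast
    qed
    show "(\<lambda>v. p *\<^sub>v v) ` carrier_vec (sdim E) \<subseteq> carrier_vec (sdim M)"
      using mult_mat_vec_carrier[OF pC] by blast
  qed
  ultimately show ?thesis using E i p by (simp add: extensions_def)
qed

lemma std_ext_split_seq:
  assumes sm: "supermodule g M" "supermodule g N" and f: "mcocycle M N f"
  shows "split_seq M N (std_ext M N f) (sel_mat (sdim N + sdim M) (sdim M) (sdim N))
      (transpose_mat (sel_mat (sdim N + sdim M) (sdim N) 0))" (is "split_seq M N _ ?s ?r")
    "X \<in> elements g \<Longrightarrow> transpose_mat (sel_mat (sdim N + sdim M) (sdim N) 0) * act (fst (std_ext M N f)) X *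
      sel_mat (sdim N + sdim M) (sdim M) (sdim N) = f X"
proof -
  let ?E = "fst (std_ext M N f)" and ?i = "sel_mat (sdim N + sdim M) (sdim N) 0" and ?p = "transpose_mat ?s"
  have e: "std_ext M N f = (?E, ?i, ?p)" by (simp add: std_ext_def append_rows_eq_sel_mat)
  have par: "par ?E = par N @ par M" and d: "sdim ?E = sdim N + sdim M"
    by (simp_all add: std_ext_def sdim_def)
  have lens: "length (par N) = sdim N" "length (par M) = sdim M" by (simp_all add: sdim_def)
  have le: "0 + sdim N \<le> sdim N + sdim M" by simp
  note hi = homog_sel_mat_left[of "par N" "par M", unfolded lens] and hs = homog_sel_mat_right[of "par N" "par M", unfolded lens]
  note sE = std_ext_supermodule[OF sm f]
  have blocks: "act ?E X = four_block_mat (act N X) (f X) (0\<^sub>m (sdim M) (sdim N)) (act M X)"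
    and cX: "act ?E X \<in> carrier_mat (sdim N + sdim M) (sdim N + sdim M)"
      "act M X \<in> carrier_mat (sdim M) (sdim M)" "act N X \<in> carrier_mat (sdim N) (sdim N)"
      "f X \<in> carrier_mat (sdim N) (sdim M)" if "X \<in> elements g" for X
    using std_ext_act[OF sm that] act_carrier[OF sE that] act_carrier[OF sm(1) that] act_carrier[OF sm(2) that] f that
    by (auto simp: d mcocycle_def)
  have "?i * act N X = act ?E X * ?i" if X: "X \<in> elements g" for X
    unfolding sel_mat_mult[OF cX(3)[OF X]] mult_sel_mat[OF cX(1)[OF X] le]
    unfolding blocks[OF X]
    using carrier_matD[OF cX(3)[OF X]] carrier_matD[OF cX(2)[OF X]] by (intro eq_matI) auto
  then have i: "?i \<in> smod_hom g N ?E" using hi by (simp add: smod_hom_def par)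
  have "?p * act ?E X = act M X * ?p" if X: "X \<in> elements g" for X
    unfolding mult_transpose_sel_mat[OF cX(2)[OF X]] transpose_sel_mat_mult[OF cX(1)[OF X] le_refl]
    unfolding blocks[OF X]
    using carrier_matD[OF cX(3)[OF X]] carrier_matD[OF cX(2)[OF X]] by (intro eq_matI) auto
  then have p: "?p \<in> smod_hom g ?E M" using homog_transpose[OF hs] by (simp add: smod_hom_def par)
  have 1: "?p * ?s = 1\<^sub>m (sdim M)"
    unfolding transpose_sel_mat_mult[OF sel_mat_carrier le_refl] by (intro eq_matI) (auto simp: sel_mat_def)
  have 2: "?r * ?i = 1\<^sub>m (sdim N)"
    unfolding transpose_sel_mat_mult[OF sel_mat_carrier le]
    by (intro eq_matI) (auto simp: sel_mat_def)
  have 3: "?r * ?s = 0\<^sub>m (sdim N) (sdim M)"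
    unfolding transpose_sel_mat_mult[OF sel_mat_carrier le]
    by (intro eq_matI) (auto simp: sel_mat_def)
  have 4: "?p * ?i = 0\<^sub>m (sdim M) (sdim N)"
    unfolding transpose_sel_mat_mult[OF sel_mat_carrier le_refl] by (intro eq_matI) (auto simp: sel_mat_def)
  have tr: "transpose_mat (sel_mat R C c) \<in> carrier_mat C R" for R C c by simp
  have 5: "?i * ?r + ?s * ?p = 1\<^sub>m (sdim ?E)"
    unfolding sel_mat_mult[OF tr] d by (intro eq_matI) (auto simp: sel_mat_def)
  show "split_seq M N (std_ext M N f) ?s ?r"
    by (subst e) (unfold split_seq_def, use sE i p hs homog_transpose[OF hi] 1 2 3 4 5 in \<open>simp add: par\<close>)
  show "?r * act ?E X * ?s = f X" if X: "X \<in> elements g"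
  proof -
    have "?r * act ?E X = mat (sdim N) (sdim N + sdim M) (\<lambda>(a, b). act ?E X $$ (a, b))"
      using transpose_sel_mat_mult[OF cX(1)[OF X] le] by simp
    moreover have "mat (sdim N) (sdim N + sdim M) (\<lambda>(a, b). act ?E X $$ (a, b)) * ?s
        = mat (sdim N) (sdim M) (\<lambda>(a, b). act ?E X $$ (a, b + sdim N))"
      by (subst mult_sel_mat[of _ "sdim N"]) (auto intro!: eq_matI)
    moreover have "\<dots> = f X"
      unfolding blocks[OF X] using carrier_matD[OF cX(3)[OF X]] carrier_matD[OF cX(2)[OF X]] carrier_matD[OF cX(4)[OF X]]
      by (intro eq_matI) auto
    ultimately show ?thesis by simp
  qed
qed

end

lemma sum_lessThan_add: "(\<Sum>k<a + b. f k) = (\<Sum>k<a. f k) + (\<Sum>k<b. f (k + a) :: complex)" for a b :: nat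
  by (induction b) (simp_all add: add.commute add.left_commute)

lemma mop_block_diag:
  assumes "A \<in> carrier_mat a a" "D \<in> carrier_mat b b"
  shows "v \<in> fspace a \<Longrightarrow> mop (a + b) (four_block_mat A (0\<^sub>m a b) (0\<^sub>m b a) D) v = mop a A v"
    "mop (a + b) (four_block_mat A (0\<^sub>m a b) (0\<^sub>m b a) D) (\<lambda>k. if a \<le> k then w (k - a) else 0)
      = (\<lambda>k. if a \<le> k then mop b D w (k - a) else 0)"
proof -
  let ?B = "four_block_mat A (0\<^sub>m a b) (0\<^sub>m b a) D"
  note dims = carrier_matD[OF assms(1)] carrier_matD[OF assms(2)]
  have l: "(\<Sum>k<a. ?B $$ (i, k) * v k) = (if i < a then \<Sum>k<a. A $$ (i, k) * v k else 0)" if "i < a + b" for i v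
    using that dims by (auto intro!: sum.cong sum.neutral)
  have r: "(\<Sum>k<b. ?B $$ (i, k + a) * v (k + a)) = (if i < a then 0 else \<Sum>k<b. D $$ (i - a, k) * v (k + a))"
    if "i < a + b" for i v
    using that dims by (auto intro!: sum.cong sum.neutral)
  show "mop (a + b) ?B v = mop a A v" if "v \<in> fspace a"
  proof
    fix i
    have "(\<Sum>k<b. D $$ (i - a, k) * v (k + a)) = 0"
      by (rule sum.neutral) (use that in \<open>auto simp: fspace_def\<close>)
    then show "mop (a + b) ?B v i = mop a A v i" unfolding mop_def sum_lessThan_add using l r by auto
  qed
  show "mop (a + b) ?B (\<lambda>k. if a \<le> k then w (k - a) else 0) = (\<lambda>k. if a \<le> k then mop b D w (k - a) else 0)"
  proof
    fix i
    have "(\<Sum>k<a. A $$ (i, k) * (if a \<le> k then w (k - a) else 0)) = 0"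
      by (rule sum.neutral) auto
    then show "mop (a + b) ?B (\<lambda>k. if a \<le> k then w (k - a) else 0) i = (if a \<le> i then mop b D w (i - a) else 0)"
      unfolding mop_def sum_lessThan_add
      using l[of i "\<lambda>k. if a \<le> k then w (k - a) else 0"] r[of i "\<lambda>k. if a \<le> k then w (k - a) else 0"] by auto
  qed
qed

lemma mat_dsum_mult:
  assumes "dim_col A = dim_row C" "dim_col B = dim_row D"
  shows "mat_dsum A B * mat_dsum C D = mat_dsum (A * C) (B * D)"
proof -
  have c: "A \<in> carrier_mat (dim_row A) (dim_col A)" "0\<^sub>m (dim_row A) (dim_col B) \<in> carrier_mat (dim_row A) (dim_col B)"
    "0\<^sub>m (dim_row B) (dim_col A) \<in> carrier_mat (dim_row B) (dim_col A)" "B \<in> carrier_mat (dim_row B) (dim_col B)"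
    "C \<in> carrier_mat (dim_col A) (dim_col C)" "0\<^sub>m (dim_row C) (dim_col D) \<in> carrier_mat (dim_col A) (dim_col D)"
    "0\<^sub>m (dim_row D) (dim_col C) \<in> carrier_mat (dim_col B) (dim_col C)" "D \<in> carrier_mat (dim_col B) (dim_col D)"
    using assms by auto
  show ?thesis
    unfolding mat_dsum_def mult_four_block_mat[OF c] using assms
    by (intro cong_four_block_mat eq_matI) auto
qed

lemma homog_mat_dsum:
  assumes "homog rs cs a A" "homog rs' cs' a B"
  shows "homog (rs @ rs') (cs @ cs') a (mat_dsum A B)"
  using assms homog_carrier[OF assms(1)] homog_carrier[OF assms(2)]
  by (auto simp: homog_def mat_dsum_def nth_append split: if_splits)

lemma diag_map_eq: "diag_map d = sel_mat (d + d) d 0 + sel_mat (d + d) d d"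
  unfolding diag_map_def by (intro eq_matI) (auto simp: append_rows_def sel_mat_def)

lemma codiag_map_eq: "codiag_map d = transpose_mat (sel_mat (d + d) d 0) + transpose_mat (sel_mat (d + d) d d)"
  unfolding codiag_map_def diag_map_eq by (intro eq_matI) auto

lemma smult_sum4:
  fixes P Q P' Q' :: "complex mat"
  assumes "P \<in> carrier_mat r c" "Q \<in> carrier_mat r c" "P' \<in> carrier_mat r c" "Q' \<in> carrier_mat r c"
  shows "x \<cdot>\<^sub>m (P + Q + (P' + Q')) = x \<cdot>\<^sub>m P + x \<cdot>\<^sub>m Q + (x \<cdot>\<^sub>m P' + x \<cdot>\<^sub>m Q')"
    "x \<cdot>\<^sub>m (P + Q - (P' + Q')) = x \<cdot>\<^sub>m P + x \<cdot>\<^sub>m Q - (x \<cdot>\<^sub>m P' + x \<cdot>\<^sub>m Q')"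
  using assms by (intro eq_matI; auto simp: algebra_simps)+

lemma add_sum4:
  fixes P Q P' Q' :: "complex mat"
  assumes "P \<in> carrier_mat r c" "Q \<in> carrier_mat r c" "P' \<in> carrier_mat r c" "Q' \<in> carrier_mat r c"
    "R \<in> carrier_mat r c" "S \<in> carrier_mat r c" "R' \<in> carrier_mat r c" "S' \<in> carrier_mat r c"
  shows "P + Q + (P' + Q') + (R + S + (R' + S')) = P + R + (Q + S) + (P' + R' + (Q' + S'))"
    "P + Q - (P' + Q') + (R + S - (R' + S')) = P + R + (Q + S) - (P' + R' + (Q' + S'))"
  using assms by (intro eq_matI; auto simp: algebra_simps)+

section \<open>Extensions with a prescribed cocycle, and operations on cocycles\<close>

context sub_q
begin

text \<open>The cocycle vanishes on even elements, so the even diagonal acts block diagonally, and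
  weight vectors of \<open>N\<close> and of \<open>M\<close>, the latter shifted by
  \<open>sdim N\<close>, remain weight vectors.\<close>

lemma weight_spanned_std_ext:
  assumes sm: "supermodule g M" "supermodule g N" and f: "mcocycle M N f"
    and ws: "weight_spanned n M" "weight_spanned n N"
  shows "weight_spanned n (fst (std_ext M N f))"
proof -
  interpret vector_space cscale by (rule cscale_vector_space)
  let ?E = "fst (std_ext M N f)"
  have d: "sdim ?E = sdim N + sdim M" by (simp add: std_ext_def sdim_def)
  define H where "H K i = srep n K False (munit n i i)" for K i
  let ?wts = "\<lambda>K. {w \<in> fspace (sdim K). \<exists>\<mu>. (\<forall>i\<ge>n. \<mu> i = 0) \<and> (\<forall>i<n. H K i w = cscale (\<mu> i) w)}"
  have ws': "fspace (sdim M) \<subseteq> span (?wts M)" "fspace (sdim N) \<subseteq> span (?wts N)"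
    using ws unfolding weight_spanned_def H_def by auto
  have el: "emb n False (munit n i i) \<in> g False" for i by (simp add: gsub_def homog_part_def)
  have actE: "act ?E (emb n False (munit n i i)) = four_block_mat (act N (emb n False (munit n i i)))
      (0\<^sub>m (sdim N) (sdim M)) (0\<^sub>m (sdim M) (sdim N)) (act M (emb n False (munit n i i)))" for i
    using std_ext_act[OF sm g_elements[OF el]] f el by (simp add: mcocycle_def)
  note cX = act_carrier[OF sm(2) g_elements[OF el]] act_carrier[OF sm(1) g_elements[OF el]]
  let ?\<iota> = "\<lambda>w k. if sdim N \<le> k then w (k - sdim N) else 0"
  have H1: "H ?E i v = H N i v" if "v \<in> fspace (sdim N)" for i v
    unfolding H_def srep_def d actE by (rule mop_block_diag(1)[OF cX that])
  have H2: "H ?E i (?\<iota> w) = ?\<iota> (H M i w)" for i w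
    unfolding H_def srep_def d actE by (rule mop_block_diag(2)[OF cX])
  have 1: "v \<in> span (?wts ?E)" if v: "v \<in> fspace (sdim N)" for v
  proof -
    have "?wts N \<subseteq> ?wts ?E" using H1 by (auto simp: d fspace_def)
    then show ?thesis using span_mono ws'(2) v by blast
  qed
  have 2: "?\<iota> w \<in> span (?wts ?E)" if w: "w \<in> fspace (sdim M)" for w
  proof -
    have "w \<in> span (?wts M)" using ws'(1) w by blast
    then show ?thesis
    proof (induction rule: span_induct_alt)
      case base
      have z: "?\<iota> 0 = 0" by auto
      show ?case by (subst z) (rule span_zero)
    next
      case (step c y z)
      then obtain \<mu> where \<mu>: "y \<in> fspace (sdim M)" "\<forall>i\<ge>n. \<mu> i = 0" "\<forall>i<n. H M i y = cscale (\<mu> i) y" by blast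
      have "H ?E i (?\<iota> y) = cscale (\<mu> i) (?\<iota> y)" if "i < n" for i
        unfolding H2 using \<mu>(3) that by (auto simp: cscale_def)
      then have y: "?\<iota> y \<in> ?wts ?E" using \<mu>(1,2) by (auto simp: d fspace_def)
      have "cscale c (?\<iota> y) + ?\<iota> z \<in> span (?wts ?E)"
        by (rule span_add[OF span_scale[OF span_base[OF y]] step(2)])
      moreover have "?\<iota> (cscale c y + z) = cscale c (?\<iota> y) + ?\<iota> z" by (auto simp: cscale_def)
      ultimately show ?case by simp
    qed
  qed
  have "v \<in> span (?wts ?E)" if v: "v \<in> fspace (sdim ?E)" for v
  proof -
    let ?a = "\<lambda>k. if k < sdim N then v k else 0" and ?b = "\<lambda>k. v (k + sdim N)"
    have "?a \<in> fspace (sdim N)" "?b \<in> fspace (sdim M)" using v by (auto simp: fspace_def d)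
    then have "?a + ?\<iota> ?b \<in> span (?wts ?E)" using 1 2 span_add by blast
    moreover have "?a + ?\<iota> ?b = v" by auto
    ultimately show ?thesis by simp
  qed
  then show ?thesis unfolding weight_spanned_def H_def by auto
qed

text \<open>Realises every normalised cocycle inside the category; semisimplicity over the even part
  comes from \<open>weight_spanned_semisimple\<close>.\<close>

lemma std_ext_has_cocycle:
  assumes sm: "supermodule g M" "supermodule g N" and f: "mcocycle M N f"
    and ws: "weight_spanned n M" "weight_spanned n N"
  shows "has_cocycle M N (std_ext M N f) f"
proof -
  obtain E i p where e: "std_ext M N f = (E, i, p)" by (cases "std_ext M N f")
  note S = std_ext_split_seq[OF sm f, unfolded e fst_conv]
  have "supermodule g E" using std_ext_supermodule[OF sm f] by (simp add: e)
  moreover have "weight_spanned n E" using weight_spanned_std_ext[OF sm f ws] by (simp add: e)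
  ultimately have "E \<in> cat_F g" using weight_spanned_semisimple[OF _ Od] by (simp add: cat_F_def)
  then have "(E, i, p) \<in> extensions g M N" by (rule extension_if_split_seq[OF S(1)])
  then show ?thesis unfolding has_cocycle_def e using S by (auto intro!: exI)
qed

lemma mcocycleD:
  assumes "mcocycle M N f"
  shows "X \<in> elements g \<Longrightarrow> f X \<in> carrier_mat (sdim N) (sdim M)"
    "X \<in> elements g \<Longrightarrow> Y \<in> elements g \<Longrightarrow> f (X + Y) = f X + f Y"
    "X \<in> elements g \<Longrightarrow> f (c \<cdot>\<^sub>m X) = c \<cdot>\<^sub>m f X"
    "X \<in> g a \<Longrightarrow> homog (par N) (par M) a (f X)"
    "X \<in> g False \<Longrightarrow> f X = 0\<^sub>m (sdim N) (sdim M)"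
    "X \<in> g a \<Longrightarrow> Y \<in> g b \<Longrightarrow> f (supercomm a b X Y) =
        (if a \<and> b then (act N X * f Y + f X * act M Y) + (act N Y * f X + f Y * act M X)
         else (act N X * f Y + f X * act M Y) - (act N Y * f X + f Y * act M X))"
  using assms unfolding mcocycle_def by blast+

lemma mcocycle_zero:
  assumes sm: "supermodule g M" "supermodule g N"
  shows "mcocycle M N (\<lambda>X. 0\<^sub>m (dim_row (act N X)) (dim_col (act M X)))"
proof -
  let ?f = "\<lambda>X. 0\<^sub>m (dim_row (act N X)) (dim_col (act M X)) :: complex mat"
  have z: "?f X = 0\<^sub>m (sdim N) (sdim M)" if "X \<in> elements g" for X
    using act_dims[OF sm(1) that] act_dims[OF sm(2) that] by simp
  have h: "homog (par N) (par M) a (0\<^sub>m (sdim N) (sdim M))" for a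
    using homog_zero[of "par N" "par M" a] by (simp add: sdim_def)
  show ?thesis
    unfolding mcocycle_def
  proof (intro conjI ballI allI)
    fix a b X Y assume X: "X \<in> g a" and Y: "Y \<in> g b"
    note X' = g_elements[OF X] and Y' = g_elements[OF Y]
    show "?f (supercomm a b X Y) =
        (if a \<and> b then (act N X * ?f Y + ?f X * act M Y) + (act N Y * ?f X + ?f Y * act M X)
         else (act N X * ?f Y + ?f X * act M Y) - (act N Y * ?f X + ?f Y * act M X))"
      unfolding z[OF X'] z[OF Y'] z[OF g_elements[OF supercomm_in_g[OF X Y]]]
      using right_mult_zero_mat[OF act_carrier[OF sm(2) X']] right_mult_zero_mat[OF act_carrier[OF sm(2) Y']]
        left_mult_zero_mat[OF act_carrier[OF sm(1) X']] left_mult_zero_mat[OF act_carrier[OF sm(1) Y']]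
      by (auto intro!: eq_matI)
  next
    fix X assume X: "X \<in> elements g"
    show "?f X \<in> carrier_mat (sdim N) (sdim M)" unfolding z[OF X] by simp
    show "?f (c \<cdot>\<^sub>m X) = c \<cdot>\<^sub>m ?f X" for c unfolding z[OF X] z[OF elements_smult[OF X]] by (intro eq_matI) auto
    show "?f (X + Y) = ?f X + ?f Y" if "Y \<in> elements g" for Y
      unfolding z[OF X] z[OF that] z[OF elements_add[OF X that]] by (intro eq_matI) auto
  next
    show "homog (par N) (par M) a (?f X)" if "X \<in> g a" for a X unfolding z[OF g_elements[OF that]] by (rule h)
    show "?f X = 0\<^sub>m (sdim N) (sdim M)" if "X \<in> g False" for X by (rule z[OF g_elements[OF that]])
  qed
qed

lemma mcocycle_smult:
  assumes sm: "supermodule g M" "supermodule g N" and f: "mcocycle M N f"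
  shows "mcocycle M N (\<lambda>X. c \<cdot>\<^sub>m f X)"
  unfolding mcocycle_def
proof (intro conjI ballI allI)
  note fd = mcocycleD[OF f]
  fix X assume X: "X \<in> elements g"
  show "c \<cdot>\<^sub>m f X \<in> carrier_mat (sdim N) (sdim M)" using fd(1)[OF X] by simp
  show "c \<cdot>\<^sub>m f (d \<cdot>\<^sub>m X) = d \<cdot>\<^sub>m (c \<cdot>\<^sub>m f X)" for d
    unfolding fd(3)[OF X] using fd(1)[OF X] by (intro eq_matI) auto
  show "c \<cdot>\<^sub>m f (X + Y) = c \<cdot>\<^sub>m f X + c \<cdot>\<^sub>m f Y" if "Y \<in> elements g" for Y
    unfolding fd(2)[OF X that] using fd(1)[OF X] fd(1)[OF that] by (intro eq_matI) (auto simp: algebra_simps)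
next
  note fd = mcocycleD[OF f]
  show "homog (par N) (par M) a (c \<cdot>\<^sub>m f X)" if "X \<in> g a" for a X using homog_smult[OF fd(4)[OF that]] .
  show "c \<cdot>\<^sub>m f X = 0\<^sub>m (sdim N) (sdim M)" if "X \<in> g False" for X unfolding fd(5)[OF that] by (intro eq_matI) auto
  fix a b X Y assume X: "X \<in> g a" and Y: "Y \<in> g b"
  note X' = g_elements[OF X] and Y' = g_elements[OF Y]
  note N = act_carrier[OF sm(2) X'] act_carrier[OF sm(2) Y'] and M = act_carrier[OF sm(1) X'] act_carrier[OF sm(1) Y']
  note F = fd(1)[OF X'] fd(1)[OF Y']
  have c: "act N X * f Y \<in> carrier_mat (sdim N) (sdim M)" "f X * act M Y \<in> carrier_mat (sdim N) (sdim M)"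
    "act N Y * f X \<in> carrier_mat (sdim N) (sdim M)" "f Y * act M X \<in> carrier_mat (sdim N) (sdim M)"
    using N M F by auto
  show "c \<cdot>\<^sub>m f (supercomm a b X Y) =
        (if a \<and> b then (act N X * (c \<cdot>\<^sub>m f Y) + (c \<cdot>\<^sub>m f X) * act M Y) + (act N Y * (c \<cdot>\<^sub>m f X) + (c \<cdot>\<^sub>m f Y) * act M X)
         else (act N X * (c \<cdot>\<^sub>m f Y) + (c \<cdot>\<^sub>m f X) * act M Y) - (act N Y * (c \<cdot>\<^sub>m f X) + (c \<cdot>\<^sub>m f Y) * act M X))"
    unfolding fd(6)[OF X Y] mult_smult_distrib[OF N(1) F(2)] mult_smult_distrib[OF N(2) F(1)]
      mult_smult_assoc_mat[OF F(1) M(2)] mult_smult_assoc_mat[OF F(2) M(1)]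
    by (cases "a \<and> b") (simp_all only: smult_sum4[OF c] if_True if_False simp_thms)
qed

lemma mcocycle_add:
  assumes sm: "supermodule g M" "supermodule g N" and f: "mcocycle M N f" "mcocycle M N f'"
  shows "mcocycle M N (\<lambda>X. f X + f' X)"
  unfolding mcocycle_def
proof (intro conjI ballI allI)
  note fd = mcocycleD[OF f(1)] and fd' = mcocycleD[OF f(2)]
  fix X assume X: "X \<in> elements g"
  show "f X + f' X \<in> carrier_mat (sdim N) (sdim M)" using fd(1)[OF X] fd'(1)[OF X] by simp
  show "f (d \<cdot>\<^sub>m X) + f' (d \<cdot>\<^sub>m X) = d \<cdot>\<^sub>m (f X + f' X)" for d
    unfolding fd(3)[OF X] fd'(3)[OF X] using fd(1)[OF X] fd'(1)[OF X] by (intro eq_matI) (auto simp: algebra_simps)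
  show "f (X + Y) + f' (X + Y) = f X + f' X + (f Y + f' Y)" if "Y \<in> elements g" for Y
    unfolding fd(2)[OF X that] fd'(2)[OF X that] using fd(1)[OF X] fd(1)[OF that] fd'(1)[OF X] fd'(1)[OF that]
    by (intro eq_matI) (auto simp: algebra_simps)
next
  note fd = mcocycleD[OF f(1)] and fd' = mcocycleD[OF f(2)]
  show "homog (par N) (par M) a (f X + f' X)" if "X \<in> g a" for a X using homog_add[OF fd(4)[OF that] fd'(4)[OF that]] .
  show "f X + f' X = 0\<^sub>m (sdim N) (sdim M)" if "X \<in> g False" for X
    unfolding fd(5)[OF that] fd'(5)[OF that] by (intro eq_matI) auto
  fix a b X Y assume X: "X \<in> g a" and Y: "Y \<in> g b"
  note X' = g_elements[OF X] and Y' = g_elements[OF Y]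
  note N = act_carrier[OF sm(2) X'] act_carrier[OF sm(2) Y'] and M = act_carrier[OF sm(1) X'] act_carrier[OF sm(1) Y']
  note F = fd(1)[OF X'] fd(1)[OF Y'] fd'(1)[OF X'] fd'(1)[OF Y']
  have c: "act N X * f Y \<in> carrier_mat (sdim N) (sdim M)" "f X * act M Y \<in> carrier_mat (sdim N) (sdim M)"
    "act N Y * f X \<in> carrier_mat (sdim N) (sdim M)" "f Y * act M X \<in> carrier_mat (sdim N) (sdim M)"
    "act N X * f' Y \<in> carrier_mat (sdim N) (sdim M)" "f' X * act M Y \<in> carrier_mat (sdim N) (sdim M)"
    "act N Y * f' X \<in> carrier_mat (sdim N) (sdim M)" "f' Y * act M X \<in> carrier_mat (sdim N) (sdim M)"
    using N M F by auto
  show "f (supercomm a b X Y) + f' (supercomm a b X Y) =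
        (if a \<and> b then (act N X * (f Y + f' Y) + (f X + f' X) * act M Y) + (act N Y * (f X + f' X) + (f Y + f' Y) * act M X)
         else (act N X * (f Y + f' Y) + (f X + f' X) * act M Y) - (act N Y * (f X + f' X) + (f Y + f' Y) * act M X))"
    unfolding fd(6)[OF X Y] fd'(6)[OF X Y] mult_add_distrib_mat[OF N(1) F(2,4)] mult_add_distrib_mat[OF N(2) F(1,3)]
      add_mult_distrib_mat[OF F(1,3) M(2)] add_mult_distrib_mat[OF F(2,4) M(1)]
    by (cases "a \<and> b") (simp_all only: add_sum4[OF c] if_True if_False simp_thms)
qed

text \<open>The cocycle of the pullback along \<open>c\<close>.\<close>

lemma mcocycle_comp:
  assumes sm: "supermodule g M" "supermodule g N" "supermodule g M'" and f: "mcocycle M N f" and c: "c \<in> smod_hom g M' M"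
  shows "mcocycle M' N (\<lambda>X. f X * c)"
  unfolding mcocycle_def
proof (intro conjI ballI allI)
  note fd = mcocycleD[OF f] and cC = homs(2)[OF c]
  fix X assume X: "X \<in> elements g"
  show "f X * c \<in> carrier_mat (sdim N) (sdim M')" using fd(1)[OF X] cC by simp
  show "f (d \<cdot>\<^sub>m X) * c = d \<cdot>\<^sub>m (f X * c)" for d
    unfolding fd(3)[OF X] by (rule mult_smult_assoc_mat[OF fd(1)[OF X] cC])
  show "f (X + Y) * c = f X * c + f Y * c" if "Y \<in> elements g" for Y
    unfolding fd(2)[OF X that] by (rule add_mult_distrib_mat[OF fd(1)[OF X] fd(1)[OF that] cC])
next
  note fd = mcocycleD[OF f] and cC = homs(2)[OF c]
  show "homog (par N) (par M') a (f X * c)" if "X \<in> g a" for a X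
    using homog_mult[OF fd(4)[OF that] homs(1)[OF c]] by simp
  show "f X * c = 0\<^sub>m (sdim N) (sdim M')" if "X \<in> g False" for X
    unfolding fd(5)[OF that] by (rule left_mult_zero_mat[OF cC])
  fix a b X Y assume X: "X \<in> g a" and Y: "Y \<in> g b"
  note X' = g_elements[OF X] and Y' = g_elements[OF Y]
  note N = act_carrier[OF sm(2) X'] act_carrier[OF sm(2) Y'] and M = act_carrier[OF sm(1) X'] act_carrier[OF sm(1) Y']
    and M' = act_carrier[OF sm(3) X'] act_carrier[OF sm(3) Y']
  note F = fd(1)[OF X'] fd(1)[OF Y']
  have c1: "(act N P * f Q + f P * act M Q) * c = act N P * (f Q * c) + (f P * c) * act M' Q"
    if P: "P \<in> elements g" and Q: "Q \<in> elements g" for P Q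
  proof -
    note cs = act_carrier[OF sm(2) P] fd(1)[OF Q] fd(1)[OF P] act_carrier[OF sm(1) Q] act_carrier[OF sm(3) Q] cC
    have "(f P * act M Q) * c = f P * (c * act M' Q)"
      unfolding homs(5)[OF c Q] using cs by (simp add: mm_assoc)
    then show ?thesis using cs by (simp add: mm_assoc mm_distr)
  qed
  have cc: "act N X * f Y + f X * act M Y \<in> carrier_mat (sdim N) (sdim M)"
    "act N Y * f X + f Y * act M X \<in> carrier_mat (sdim N) (sdim M)"
    using N M F by auto
  show "f (supercomm a b X Y) * c =
        (if a \<and> b then (act N X * (f Y * c) + (f X * c) * act M' Y) + (act N Y * (f X * c) + (f Y * c) * act M' X)
         else (act N X * (f Y * c) + (f X * c) * act M' Y) - (act N Y * (f X * c) + (f Y * c) * act M' X))"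
    unfolding fd(6)[OF X Y] c1[OF X' Y', symmetric] c1[OF Y' X', symmetric]
    by (cases "a \<and> b")
      (simp_all only: add_mult_distrib_mat[OF cc cC] minus_mult_distrib_mat[OF cc cC] if_True if_False simp_thms)
qed

lemma cobounds_zero_iff:
  assumes sm: "supermodule g M" "supermodule g N" and f: "mcocycle M N f"
    and h: "homog (par N) (par M) False h" "\<And>X. X \<in> elements g \<Longrightarrow> f X + h * act M X = act N X * h"
  shows "cobounds M N f (\<lambda>X. 0\<^sub>m (dim_row (act N X)) (dim_col (act M X)))"
  unfolding cobounds_def
proof (intro exI[of _ h] conjI ballI)
  fix X assume X: "X \<in> elements g"
  have "act N X * h \<in> carrier_mat (sdim N) (sdim M)"
    using act_carrier[OF sm(2) X] homog_carrier[OF h(1)] by (auto simp: sdim_def)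
  then show "f X + h * act M X = act N X * h + 0\<^sub>m (dim_row (act N X)) (dim_col (act M X))"
    using h(2)[OF X] act_dims[OF sm(1) X] act_dims[OF sm(2) X] by simp
qed (rule h(1))

theorem is_zero_space_Ext1:
  assumes sm: "supermodule g M" "supermodule g N" and ws: "weight_spanned n M" "weight_spanned n N"
    and all: "\<And>f. mcocycle M N f \<Longrightarrow> \<exists>h. homog (par N) (par M) False h \<and>
      (\<forall>X\<in>elements g. f X + h * act M X = act N X * h)"
  shows "is_zero_space (Ext1 g M N)"
proof -
  let ?z = "\<lambda>X. 0\<^sub>m (dim_row (act N X)) (dim_col (act M X))"
  have z: "has_cocycle M N (split_ext M N) ?z"
    unfolding split_ext_eq_std_ext by (rule std_ext_has_cocycle[OF sm mcocycle_zero[OF sm] ws])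
  then have zE: "split_ext M N \<in> extensions g M N" by (simp add: has_cocycle_def)
  note eq = equiv_ext_equiv[OF sm]
  have cls: "ext_equiv g M N `` {e} = ext_equiv g M N `` {split_ext M N}" if e: "e \<in> extensions g M N" for e
  proof -
    obtain f where f: "has_cocycle M N e f" "mcocycle M N f" using has_cocycle_exists[OF e sm] by blast
    obtain h where "homog (par N) (par M) False h" "\<forall>X\<in>elements g. f X + h * act M X = act N X * h"
      using all[OF f(2)] by blast
    then have "cobounds M N f ?z" using cobounds_zero_iff[OF sm f(2)] by blast
    then have "(e, split_ext M N) \<in> ext_equiv g M N" using ext_equiv_iff[OF f(1) z sm] by blast
    then show ?thesis by (rule equiv_class_eq[OF eq])
  qed
  have "extensions g M N // ext_equiv g M N = {ext_equiv g M N `` {split_ext M N}}"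
  proof
    show "extensions g M N // ext_equiv g M N \<subseteq> {ext_equiv g M N `` {split_ext M N}}"
    proof
      fix C assume "C \<in> extensions g M N // ext_equiv g M N"
      then obtain e where "e \<in> extensions g M N" "C = ext_equiv g M N `` {e}" by (rule quotientE)
      then show "C \<in> {ext_equiv g M N `` {split_ext M N}}" using cls by simp
    qed
    show "{ext_equiv g M N `` {split_ext M N}} \<subseteq> extensions g M N // ext_equiv g M N"
      using quotientI[OF zE] by simp
  qed
  then show ?thesis unfolding is_zero_space_def Ext1_def by simp
qed

end

section \<open>The vector space structure of \<open>Ext\<^sup>1\<close>\<close>

lemma mult_diag_map:
  assumes "X \<in> carrier_mat r (d + d)"
  shows "X * diag_map d = mat r d (\<lambda>(a, b). X $$ (a, b) + X $$ (a, b + d))"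
proof -
  have 1: "X * sel_mat (d + d) d 0 = mat r d (\<lambda>(a, b). X $$ (a, b + 0))"
    and 2: "X * sel_mat (d + d) d d = mat r d (\<lambda>(a, b). X $$ (a, b + d))"
    by (rule mult_sel_mat[OF assms]; simp)+
  show ?thesis
    unfolding diag_map_eq mult_add_distrib_mat[OF assms sel_mat_carrier sel_mat_carrier] 1 2
    by (intro eq_matI) auto
qed

lemma codiag_map_mult:
  assumes "X \<in> carrier_mat (d + d) q"
  shows "codiag_map d * X = mat d q (\<lambda>(a, b). X $$ (a, b) + X $$ (a + d, b))"
proof -
  have 1: "transpose_mat (sel_mat (d + d) d 0) * X = mat d q (\<lambda>(a, b). X $$ (a + 0, b))"
    and 2: "transpose_mat (sel_mat (d + d) d d) * X = mat d q (\<lambda>(a, b). X $$ (a + d, b))"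
    by (rule transpose_sel_mat_mult[OF assms]; simp)+
  have t: "transpose_mat (sel_mat R C c) \<in> carrier_mat C R" for R C c by simp
  show ?thesis
    unfolding codiag_map_eq add_mult_distrib_mat[OF t t assms] 1 2 by (intro eq_matI) auto
qed

lemma mat_dsum_carrier [simp]:
  "A \<in> carrier_mat r c \<Longrightarrow> B \<in> carrier_mat r' c' \<Longrightarrow> mat_dsum A B \<in> carrier_mat (r + r') (c + c')"
  by (simp add: mat_dsum_def)

lemma mat_dsum_add:
  assumes "A \<in> carrier_mat r c" "B \<in> carrier_mat r' c'" "A' \<in> carrier_mat r c" "B' \<in> carrier_mat r' c'"
  shows "mat_dsum A B + mat_dsum A' B' = mat_dsum (A + A') (B + B')"
  unfolding mat_dsum_def using assms by (intro eq_matI) auto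

lemma mat_dsum_one: "mat_dsum (1\<^sub>m a) (1\<^sub>m b) = 1\<^sub>m (a + b)"
  and mat_dsum_zero: "mat_dsum (0\<^sub>m a b) (0\<^sub>m c d) = 0\<^sub>m (a + c) (b + d)"
  by (intro eq_matI; auto simp: mat_dsum_def)+

text \<open>The Baer sum on blocks: the codiagonal adds the two block rows and gives the row
  \<open>[A B]\<close>, the diagonal then adds its two block columns.\<close>

lemma fold_cocycles:
  assumes "A \<in> carrier_mat r c" "B \<in> carrier_mat r c"
  shows "codiag_map r * mat_dsum A B = A * transpose_mat (sel_mat (c + c) c 0) + B * transpose_mat (sel_mat (c + c) c c)"
    and "(A * transpose_mat (sel_mat (c + c) c 0) + B * transpose_mat (sel_mat (c + c) c c)) * diag_map c = A + B"
proof -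
  have S: "A * transpose_mat (sel_mat (c + c) c 0) + B * transpose_mat (sel_mat (c + c) c c)
      = mat r (c + c) (\<lambda>(i, j). if j < c then A $$ (i, j) else B $$ (i, j - c))"
    unfolding mult_transpose_sel_mat[OF assms(1)] mult_transpose_sel_mat[OF assms(2)] by (intro eq_matI) auto
  show "codiag_map r * mat_dsum A B = A * transpose_mat (sel_mat (c + c) c 0) + B * transpose_mat (sel_mat (c + c) c c)"
    unfolding S codiag_map_mult[OF mat_dsum_carrier[OF assms]]
    using assms by (intro eq_matI) (auto simp: mat_dsum_def)
  have C: "mat r (c + c) (\<lambda>(i, j). if j < c then A $$ (i, j) else B $$ (i, j - c)) \<in> carrier_mat r (c + c)" by simp
  show "(A * transpose_mat (sel_mat (c + c) c 0) + B * transpose_mat (sel_mat (c + c) c c)) * diag_map c = A + B"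
    unfolding S mult_diag_map[OF C] using assms by (intro eq_matI) auto
qed

section \<open>Baer sums and scalar multiples on the level of cocycles\<close>

context sub_q
begin

lemma hom_add: "i \<in> smod_hom g M N \<Longrightarrow> j \<in> smod_hom g M N \<Longrightarrow> supermodule g M \<Longrightarrow> supermodule g N \<Longrightarrow> i + j \<in> smod_hom g M N"
proof -
  assume i: "i \<in> smod_hom g M N" and j: "j \<in> smod_hom g M N" and sm: "supermodule g M" "supermodule g N"
  have "(i + j) * act M X = act N X * (i + j)" if X: "X \<in> elements g" for X
    unfolding add_mult_distrib_mat[OF homs(2)[OF i] homs(2)[OF j] act_carrier[OF sm(1) X]]
      mult_add_distrib_mat[OF act_carrier[OF sm(2) X] homs(2)[OF i] homs(2)[OF j]] homs(5)[OF i X] homs(5)[OF j X] ..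
  then show ?thesis using homog_add[OF homs(1)[OF i] homs(1)[OF j]] by (simp add: smod_hom_def)
qed

lemma hom_smult_one: "supermodule g M \<Longrightarrow> c \<cdot>\<^sub>m 1\<^sub>m (sdim M) \<in> smod_hom g M M"
proof -
  assume sm: "supermodule g M"
  have "(c \<cdot>\<^sub>m 1\<^sub>m (sdim M)) * act M X = act M X * (c \<cdot>\<^sub>m 1\<^sub>m (sdim M))" if X: "X \<in> elements g" for X
    unfolding mult_smult_assoc_mat[OF one_carrier_mat act_carrier[OF sm X]]
      mult_smult_distrib[OF act_carrier[OF sm X] one_carrier_mat]
    using left_mult_one_mat[OF act_carrier[OF sm X]] right_mult_one_mat[OF act_carrier[OF sm X]] by simp
  then show ?thesis using homog_smult[OF homog_one[of "par M"]] by (simp add: smod_hom_def sdim_def)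
qed

lemma smod_dsum_eq: "smod_dsum N M = fst (split_ext M N)"
  by (simp add: split_ext_def)

lemma smod_dsum_supermodule:
  assumes "supermodule g M" "supermodule g N"
  shows "supermodule g (smod_dsum N M)"
  unfolding smod_dsum_eq split_ext_eq_std_ext by (rule std_ext_supermodule[OF assms mcocycle_zero[OF assms]])

lemma sdim_dsum: "sdim (smod_dsum N M) = sdim N + sdim M"
  by (simp add: smod_dsum_def sdim_def)

text \<open>Two of the maps belong to the split sequence; its section and retraction are morphisms
  as well, because the cocycle they define is zero.\<close>

lemma dsum_homs:
  assumes sm: "supermodule g M" "supermodule g N"
  shows "sel_mat (sdim N + sdim M) (sdim N) 0 \<in> smod_hom g N (smod_dsum N M)"
    "sel_mat (sdim N + sdim M) (sdim M) (sdim N) \<in> smod_hom g M (smod_dsum N M)"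
    "transpose_mat (sel_mat (sdim N + sdim M) (sdim N) 0) \<in> smod_hom g (smod_dsum N M) N"
    "transpose_mat (sel_mat (sdim N + sdim M) (sdim M) (sdim N)) \<in> smod_hom g (smod_dsum N M) M"
proof -
  let ?i = "sel_mat (sdim N + sdim M) (sdim N) 0" and ?s = "sel_mat (sdim N + sdim M) (sdim M) (sdim N)"
  let ?D = "smod_dsum N M"
  have e: "split_ext M N = (?D, ?i, transpose_mat ?s)"
    by (simp add: split_ext_def append_rows_eq_sel_mat)
  note z = mcocycle_zero[OF sm]
  note S = std_ext_split_seq[OF sm z, folded split_ext_eq_std_ext, unfolded e fst_conv]
  show i: "?i \<in> smod_hom g N ?D" and p: "transpose_mat ?s \<in> smod_hom g ?D M"
    using S(1) by (auto simp: split_seq_def)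
  have sh: "homog (par ?D) (par M) False ?s" and rh: "homog (par N) (par ?D) False (transpose_mat ?i)"
    using S(1) by (auto simp: split_seq_def)
  have f: "transpose_mat ?i * act ?D X * ?s = 0\<^sub>m (sdim N) (sdim M)" if X: "X \<in> elements g" for X
    using S(2)[OF X] act_dims[OF sm(1) X] act_dims[OF sm(2) X] by simp
  have "?s * act M X = act ?D X * ?s" if X: "X \<in> elements g" for X
  proof -
    have "?s * act M X \<in> carrier_mat (sdim N + sdim M) (sdim M)"
      by (rule mult_carrier_mat[OF sel_mat_carrier act_carrier[OF sm(1) X]])
    moreover have "?i * 0\<^sub>m (sdim N) (sdim M) = 0\<^sub>m (sdim N + sdim M) (sdim M)"
      by (rule right_mult_zero_mat[OF sel_mat_carrier])
    ultimately show ?thesis using split_seq_facts(2)[OF S(1) X sm] unfolding f[OF X] by simp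
  qed
  then show "?s \<in> smod_hom g M ?D" using sh by (simp add: smod_hom_def)
  have "transpose_mat ?i * act ?D X = act N X * transpose_mat ?i" if X: "X \<in> elements g" for X
  proof -
    have "act N X * transpose_mat ?i \<in> carrier_mat (sdim N) (sdim N + sdim M)"
      by (rule mult_carrier_mat[OF act_carrier[OF sm(2) X]]) simp
    moreover have "0\<^sub>m (sdim N) (sdim M) * transpose_mat ?s = 0\<^sub>m (sdim N) (sdim N + sdim M)"
      by (rule left_mult_zero_mat) simp
    ultimately show ?thesis using split_seq_facts(3)[OF S(1) X sm] unfolding f[OF X] by simp
  qed
  then show "transpose_mat ?i \<in> smod_hom g ?D N" using rh by (simp add: smod_hom_def)
qed

lemma diag_map_hom: "supermodule g M \<Longrightarrow> diag_map (sdim M) \<in> smod_hom g M (smod_dsum M M)"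
  unfolding diag_map_eq by (intro hom_add dsum_homs smod_dsum_supermodule)

lemma codiag_map_hom: "supermodule g N \<Longrightarrow> codiag_map (sdim N) \<in> smod_hom g (smod_dsum N N) N"
  unfolding codiag_map_eq by (intro hom_add dsum_homs smod_dsum_supermodule)

lemma ext_dsum_split_seq:
  assumes e1: "split_seq M N (E1, i1, p1) s1 r1" and e2: "split_seq M N (E2, i2, p2) s2 r2"
    and sm: "supermodule g M" "supermodule g N"
  shows "split_seq (smod_dsum M M) (smod_dsum N N) (smod_dsum E1 E2, mat_dsum i1 i2, mat_dsum p1 p2)
      (mat_dsum s1 s2) (mat_dsum r1 r2)"
    "X \<in> elements g \<Longrightarrow> mat_dsum r1 r2 * act (smod_dsum E1 E2) X * mat_dsum s1 s2
      = mat_dsum (r1 * act E1 X * s1) (r2 * act E2 X * s2)"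
proof -
  have 1: "supermodule g E1" "i1 \<in> smod_hom g N E1" "p1 \<in> smod_hom g E1 M"
    "homog (par E1) (par M) False s1" "homog (par N) (par E1) False r1" "p1 * s1 = 1\<^sub>m (sdim M)" "r1 * i1 = 1\<^sub>m (sdim N)"
    "r1 * s1 = 0\<^sub>m (sdim N) (sdim M)" "p1 * i1 = 0\<^sub>m (sdim M) (sdim N)" "i1 * r1 + s1 * p1 = 1\<^sub>m (sdim E1)"
    using e1 by (auto simp: split_seq_def)
  have 2: "supermodule g E2" "i2 \<in> smod_hom g N E2" "p2 \<in> smod_hom g E2 M"
    "homog (par E2) (par M) False s2" "homog (par N) (par E2) False r2" "p2 * s2 = 1\<^sub>m (sdim M)" "r2 * i2 = 1\<^sub>m (sdim N)"
    "r2 * s2 = 0\<^sub>m (sdim N) (sdim M)" "p2 * i2 = 0\<^sub>m (sdim M) (sdim N)" "i2 * r2 + s2 * p2 = 1\<^sub>m (sdim E2)"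
    using e2 by (auto simp: split_seq_def)
  note C1 = homs(2)[OF 1(2)] homs(2)[OF 1(3)] homog_carrier[OF 1(4), folded sdim_def] homog_carrier[OF 1(5), folded sdim_def]
  note C2 = homs(2)[OF 2(2)] homs(2)[OF 2(3)] homog_carrier[OF 2(4), folded sdim_def] homog_carrier[OF 2(5), folded sdim_def]
  have act: "act (smod_dsum A B) X = mat_dsum (act A X) (act B X)" and par: "par (smod_dsum A B) = par A @ par B" for A B X
    by (simp_all add: smod_dsum_def)
  have hom: "mat_dsum a b \<in> smod_hom g (smod_dsum A B) (smod_dsum A' B')"
    if a: "a \<in> smod_hom g A A'" and b: "b \<in> smod_hom g B B'" and s: "supermodule g A" "supermodule g B" "supermodule g A'" "supermodule g B'"
    for a b A B A' B'
  proof -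
    have "mat_dsum a b * mat_dsum (act A X) (act B X) = mat_dsum (act A' X) (act B' X) * mat_dsum a b"
      if X: "X \<in> elements g" for X
      using homs(3,4)[OF a] homs(3,4)[OF b] act_dims[OF s(1) X] act_dims[OF s(2) X] act_dims[OF s(3) X] act_dims[OF s(4) X]
        homs(5)[OF a X] homs(5)[OF b X] by (simp add: mat_dsum_mult)
    then show ?thesis using homog_mat_dsum[OF homs(1)[OF a] homs(1)[OF b]] by (simp add: smod_hom_def act par)
  qed
  show "split_seq (smod_dsum M M) (smod_dsum N N) (smod_dsum E1 E2, mat_dsum i1 i2, mat_dsum p1 p2)
      (mat_dsum s1 s2) (mat_dsum r1 r2)"
    unfolding split_seq_def prod.case sdim_dsum par
  proof (intro conjI)
    show "supermodule g (smod_dsum E1 E2)" by (rule smod_dsum_supermodule[OF 2(1) 1(1)])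
    show "mat_dsum i1 i2 \<in> smod_hom g (smod_dsum N N) (smod_dsum E1 E2)" by (rule hom[OF 1(2) 2(2) sm(2) sm(2) 1(1) 2(1)])
    show "mat_dsum p1 p2 \<in> smod_hom g (smod_dsum E1 E2) (smod_dsum M M)" by (rule hom[OF 1(3) 2(3) 1(1) 2(1) sm(1) sm(1)])
    show "homog (par E1 @ par E2) (par M @ par M) False (mat_dsum s1 s2)" by (rule homog_mat_dsum[OF 1(4) 2(4)])
    show "homog (par N @ par N) (par E1 @ par E2) False (mat_dsum r1 r2)" by (rule homog_mat_dsum[OF 1(5) 2(5)])
    show "mat_dsum p1 p2 * mat_dsum s1 s2 = 1\<^sub>m (sdim M + sdim M)"
      using C1 C2 1(6) 2(6) by (simp add: mat_dsum_mult mat_dsum_one)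
    show "mat_dsum r1 r2 * mat_dsum i1 i2 = 1\<^sub>m (sdim N + sdim N)"
      using C1 C2 1(7) 2(7) by (simp add: mat_dsum_mult mat_dsum_one)
    show "mat_dsum r1 r2 * mat_dsum s1 s2 = 0\<^sub>m (sdim N + sdim N) (sdim M + sdim M)"
      using C1 C2 1(8) 2(8) by (simp add: mat_dsum_mult mat_dsum_zero)
    show "mat_dsum p1 p2 * mat_dsum i1 i2 = 0\<^sub>m (sdim M + sdim M) (sdim N + sdim N)"
      using C1 C2 1(9) 2(9) by (simp add: mat_dsum_mult mat_dsum_zero)
    have "mat_dsum i1 i2 * mat_dsum r1 r2 + mat_dsum s1 s2 * mat_dsum p1 p2
        = mat_dsum (i1 * r1) (i2 * r2) + mat_dsum (s1 * p1) (s2 * p2)"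
      using C1 C2 by (simp add: mat_dsum_mult)
    also have "\<dots> = mat_dsum (i1 * r1 + s1 * p1) (i2 * r2 + s2 * p2)"
      by (rule mat_dsum_add[of _ "sdim E1" "sdim E1" _ "sdim E2" "sdim E2"]) (use C1 C2 in auto)
    finally show "mat_dsum i1 i2 * mat_dsum r1 r2 + mat_dsum s1 s2 * mat_dsum p1 p2 = 1\<^sub>m (sdim E1 + sdim E2)"
      using 1(10) 2(10) by (simp add: mat_dsum_one)
  qed
  show "mat_dsum r1 r2 * act (smod_dsum E1 E2) X * mat_dsum s1 s2
      = mat_dsum (r1 * act E1 X * s1) (r2 * act E2 X * s2)" if X: "X \<in> elements g"
    unfolding act using C1 C2 act_dims[OF 1(1) X] act_dims[OF 2(1) X] by (simp add: mat_dsum_mult)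
qed

lemma cobounds_add:
  assumes sm: "supermodule g M" "supermodule g N"
    and m: "mcocycle M N f" "mcocycle M N f'" "mcocycle M N k" "mcocycle M N k'"
    and c: "cobounds M N f f'" "cobounds M N k k'"
  shows "cobounds M N (\<lambda>X. f X + k X) (\<lambda>X. f' X + k' X)"
proof -
  obtain h where h: "homog (par N) (par M) False h" "\<And>X. X \<in> elements g \<Longrightarrow> f X + h * act M X = act N X * h + f' X"
    using c(1) by (auto simp: cobounds_def)
  obtain l where l: "homog (par N) (par M) False l" "\<And>X. X \<in> elements g \<Longrightarrow> k X + l * act M X = act N X * l + k' X"
    using c(2) by (auto simp: cobounds_def)
  note C = homog_carrier[OF h(1), folded sdim_def] homog_carrier[OF l(1), folded sdim_def]
  have "(f X + k X) + (h + l) * act M X = act N X * (h + l) + (f' X + k' X)" if X: "X \<in> elements g" for X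
  proof -
    note a = act_carrier[OF sm(1) X] act_carrier[OF sm(2) X]
    note F = mcocycleD(1)[OF m(1) X] mcocycleD(1)[OF m(2) X] mcocycleD(1)[OF m(3) X] mcocycleD(1)[OF m(4) X]
    have P: "h * act M X \<in> carrier_mat (sdim N) (sdim M)" "l * act M X \<in> carrier_mat (sdim N) (sdim M)"
      "act N X * h \<in> carrier_mat (sdim N) (sdim M)" "act N X * l \<in> carrier_mat (sdim N) (sdim M)"
      using C a by auto
    have sw: "A + B + (D + E) = (A + D) + (B + E)"
      if "A \<in> carrier_mat r c" "B \<in> carrier_mat r c" "D \<in> carrier_mat r c" "E \<in> carrier_mat r c"
      for A B D E :: "complex mat" and r c
      using that by (intro eq_matI) auto
    show ?thesis
      unfolding add_mult_distrib_mat[OF C a(1)] mult_add_distrib_mat[OF a(2) C]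
        sw[OF F(1) F(3) P(1,2)] sw[OF P(3,4) F(2,4)] h(2)[OF X] l(2)[OF X] ..
  qed
  then show ?thesis unfolding cobounds_def using homog_add[OF h(1) l(1)] by blast
qed

lemma cobounds_smult:
  assumes sm: "supermodule g M" "supermodule g N" and m: "mcocycle M N f" "mcocycle M N f'"
    and c: "cobounds M N f f'"
  shows "cobounds M N (\<lambda>X. d \<cdot>\<^sub>m f X) (\<lambda>X. d \<cdot>\<^sub>m f' X)"
proof -
  obtain h where h: "homog (par N) (par M) False h" "\<And>X. X \<in> elements g \<Longrightarrow> f X + h * act M X = act N X * h + f' X"
    using c by (auto simp: cobounds_def)
  note C = homog_carrier[OF h(1), folded sdim_def]
  have "d \<cdot>\<^sub>m f X + (d \<cdot>\<^sub>m h) * act M X = act N X * (d \<cdot>\<^sub>m h) + d \<cdot>\<^sub>m f' X" if X: "X \<in> elements g" for X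
  proof -
    note a = act_carrier[OF sm(1) X] act_carrier[OF sm(2) X]
    note F = mcocycleD(1)[OF m(1) X] mcocycleD(1)[OF m(2) X]
    have P: "h * act M X \<in> carrier_mat (sdim N) (sdim M)" "act N X * h \<in> carrier_mat (sdim N) (sdim M)"
      using C a by auto
    show ?thesis
      unfolding mult_smult_assoc_mat[OF C a(1)] mult_smult_distrib[OF a(2) C]
        add_smult_distrib_left_mat[OF F(1) P(1), symmetric] add_smult_distrib_left_mat[OF P(2) F(2), symmetric] h(2)[OF X] ..
  qed
  then show ?thesis unfolding cobounds_def using homog_smult[OF h(1)] by blast
qed

lemma ext_class_iff:
  assumes sm: "supermodule g M" "supermodule g N" and e: "has_cocycle M N e0 f0" "mcocycle M N f0"
  shows "e \<in> ext_equiv g M N `` {e0} \<longleftrightarrow> (\<exists>f. has_cocycle M N e f \<and> mcocycle M N f \<and> cobounds M N f f0)"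
proof
  assume "e \<in> ext_equiv g M N `` {e0}"
  then have ee: "(e0, e) \<in> ext_equiv g M N" by simp
  then have "e \<in> extensions g M N" by (auto simp: ext_equiv_def)
  then obtain f where f: "has_cocycle M N e f" "mcocycle M N f" using has_cocycle_exists[OF _ sm] by blast
  have "cobounds M N f0 f" using ext_equiv_iff[OF e(1) f(1) sm] ee by blast
  then show "\<exists>f. has_cocycle M N e f \<and> mcocycle M N f \<and> cobounds M N f f0"
    using f cobounds_sym[OF sm e(2) f(2)] by blast
next
  assume "\<exists>f. has_cocycle M N e f \<and> mcocycle M N f \<and> cobounds M N f f0"
  then obtain f where f: "has_cocycle M N e f" "mcocycle M N f" "cobounds M N f f0" by blast
  then show "e \<in> ext_equiv g M N `` {e0}"
    using ext_equiv_iff[OF e(1) f(1) sm] cobounds_sym[OF sm f(2) e(2) f(3)] by blast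
qed

text \<open>Both morphisms in the definition of the Baer sum become coboundary relations: one
  compares the middle extension with the block row of the two cocycles, the other restricts it to
  the diagonal. Independence of representatives is the compatibility of \<open>cobounds\<close> with
  sums.\<close>

lemma baer_sum_class:
  assumes sm: "supermodule g M" "supermodule g N" and ws: "weight_spanned n M" "weight_spanned n N"
    and e: "has_cocycle M N e1 f1" "has_cocycle M N e2 f2" and f: "mcocycle M N f1" "mcocycle M N f2"
  shows "baer_sum g M N (ext_equiv g M N `` {e1}) (ext_equiv g M N `` {e2}) =
    {e. \<exists>f. has_cocycle M N e f \<and> mcocycle M N f \<and> cobounds M N f (\<lambda>X. f1 X + f2 X)}" (is "?B = ?R")
proof -
  let ?D = "smod_dsum M M" and ?D' = "smod_dsum N N" and ?d = "sdim M"
  let ?\<pi>1 = "transpose_mat (sel_mat (?d + ?d) ?d 0)" and ?\<pi>2 = "transpose_mat (sel_mat (?d + ?d) ?d ?d)"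
  have sD: "supermodule g ?D" and sD': "supermodule g ?D'"
    using smod_dsum_supermodule sm by blast+
  have dD: "sdim ?D = ?d + ?d" by (rule sdim_dsum)
  have wD: "weight_spanned n ?D"
    unfolding smod_dsum_eq split_ext_eq_std_ext
    by (rule weight_spanned_std_ext[OF sm(1) sm(1) mcocycle_zero[OF sm(1) sm(1)] ws(1) ws(1)])
  note dh = diag_map_hom[OF sm(1)] and ch = codiag_map_hom[OF sm(2)]
  note \<pi> = dsum_homs(3,4)[OF sm(1) sm(1)]
  have dsum_iff: "ext_map g (codiag_map (sdim N)) (1\<^sub>m (sdim ?D)) (ext_dsum u1 u2) e' \<longleftrightarrow>
      (\<exists>h. homog (par N) (par ?D) False h \<and>
        (\<forall>X\<in>elements g. (k1 X * ?\<pi>1 + k2 X * ?\<pi>2) + h * act ?D X = act N X * h + f' X))"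
    if u: "has_cocycle M N u1 k1" "has_cocycle M N u2 k2" "mcocycle M N k1" "mcocycle M N k2"
      and e': "has_cocycle ?D N e' f'" "mcocycle ?D N f'" for u1 u2 k1 k2 e' f'
  proof -
    obtain E1 i1 p1 where u1: "u1 = (E1, i1, p1)" by (cases u1)
    obtain E2 i2 p2 where u2: "u2 = (E2, i2, p2)" by (cases u2)
    obtain E' i' p' where E': "e' = (E', i', p')" by (cases e')
    obtain s1 r1 where 1: "split_seq M N (E1, i1, p1) s1 r1" "\<And>X. X \<in> elements g \<Longrightarrow> k1 X = r1 * act E1 X * s1"
      using has_cocycleD[OF u(1)[unfolded u1]] by blast
    obtain s2 r2 where 2: "split_seq M N (E2, i2, p2) s2 r2" "\<And>X. X \<in> elements g \<Longrightarrow> k2 X = r2 * act E2 X * s2"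
      using has_cocycleD[OF u(2)[unfolded u2]] by blast
    obtain s' r' where 3: "split_seq ?D N (E', i', p') s' r'" "\<And>X. X \<in> elements g \<Longrightarrow> f' X = r' * act E' X * s'"
      using has_cocycleD[OF e'(1)[unfolded E']] by blast
    note ds = ext_dsum_split_seq[OF 1(1) 2(1) sm]
    have eq: "codiag_map (sdim N) * (mat_dsum r1 r2 * act (smod_dsum E1 E2) X * mat_dsum s1 s2)
        = k1 X * ?\<pi>1 + k2 X * ?\<pi>2" and eq': "(r' * act E' X * s') * 1\<^sub>m (sdim ?D) = f' X" if X: "X \<in> elements g" for X
    proof -
      show "codiag_map (sdim N) * (mat_dsum r1 r2 * act (smod_dsum E1 E2) X * mat_dsum s1 s2)
        = k1 X * ?\<pi>1 + k2 X * ?\<pi>2"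
        unfolding ds(2)[OF X] 1(2)[OF X, symmetric] 2(2)[OF X, symmetric]
        by (rule fold_cocycles(1)[OF mcocycleD(1)[OF u(3) X] mcocycleD(1)[OF u(4) X]])
      show "(r' * act E' X * s') * 1\<^sub>m (sdim ?D) = f' X"
        unfolding 3(2)[OF X, symmetric] by (rule right_mult_one_mat[OF mcocycleD(1)[OF e'(2) X]])
    qed
    show ?thesis
      unfolding u1 u2 E' ext_dsum.simps ext_map_iff[OF ds(1) 3(1) sD sD' sD sm(2) ch hom_one[OF sD]]
      using eq eq' by simp
  qed
  have diag_iff: "ext_map g (1\<^sub>m (sdim N)) (diag_map ?d) u e' \<longleftrightarrow> cobounds M N k (\<lambda>X. f' X * diag_map ?d)"
    if "has_cocycle M N u k" "mcocycle M N k" "has_cocycle ?D N e' f'" for u k e' f'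
    unfolding has_cocycle_map_iff[OF that(1,3) sm sD sm(2) hom_one[OF sm(2)] dh] cobounds_def
    using left_mult_one_mat[OF mcocycleD(1)[OF that(2)]] by simp
  show ?thesis
  proof
    show "?B \<subseteq> ?R"
    proof
      fix e assume "e \<in> ?B"
      then obtain u1 u2 e' where eE: "e \<in> extensions g M N" and u: "u1 \<in> ext_equiv g M N `` {e1}" "u2 \<in> ext_equiv g M N `` {e2}"
        and e': "e' \<in> extensions g ?D N"
        and m: "ext_map g (codiag_map (sdim N)) (1\<^sub>m (sdim ?D)) (ext_dsum u1 u2) e'"
          "ext_map g (1\<^sub>m (sdim N)) (diag_map ?d) e e'"
        unfolding baer_sum_def by blast
      obtain k1 where k1: "has_cocycle M N u1 k1" "mcocycle M N k1" "cobounds M N k1 f1"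
        using ext_class_iff[OF sm e(1) f(1)] u(1) by blast
      obtain k2 where k2: "has_cocycle M N u2 k2" "mcocycle M N k2" "cobounds M N k2 f2"
        using ext_class_iff[OF sm e(2) f(2)] u(2) by blast
      obtain f' where f': "has_cocycle ?D N e' f'" "mcocycle ?D N f'" using has_cocycle_exists[OF e' sD sm(2)] by blast
      obtain k where k: "has_cocycle M N e k" "mcocycle M N k" using has_cocycle_exists[OF eE sm] by blast
      have 1: "cobounds M N k (\<lambda>X. f' X * diag_map ?d)" using diag_iff[OF k f'(1)] m(2) by blast
      obtain h where h: "homog (par N) (par ?D) False h"
        "\<And>X. X \<in> elements g \<Longrightarrow> (k1 X * ?\<pi>1 + k2 X * ?\<pi>2) + h * act ?D X = act N X * h + f' X"
        using dsum_iff[OF k1(1) k2(1) k1(2) k2(2) f'] m(1) by blast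
      have hC: "h \<in> carrier_mat (sdim N) (?d + ?d)" using homog_carrier[OF h(1)] by (simp add: sdim_def smod_dsum_def)
      have dC: "diag_map ?d \<in> carrier_mat (?d + ?d) ?d" using homs(2)[OF dh] by (simp add: dD)
      \<comment> \<open>The relation for the middle extension, multiplied on the right by the
        diagonal map, which is a morphism and so passes through the actions.\<close>
      have 2: "cobounds M N (\<lambda>X. k1 X + k2 X) (\<lambda>X. f' X * diag_map ?d)"
        unfolding cobounds_def
      proof (intro exI[of _ "h * diag_map ?d"] conjI ballI)
        show "homog (par N) (par M) False (h * diag_map ?d)" using homog_mult[OF h(1) homs(1)[OF dh]] by simp
        fix X assume X: "X \<in> elements g"
        note K = mcocycleD(1)[OF k1(2) X] mcocycleD(1)[OF k2(2) X]
        have A: "k1 X * ?\<pi>1 + k2 X * ?\<pi>2 \<in> carrier_mat (sdim N) (?d + ?d)" using K by auto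
        note aD = act_carrier[OF sD X, unfolded dD] and aN = act_carrier[OF sm(2) X] and aM = act_carrier[OF sm(1) X]
        have F: "f' X \<in> carrier_mat (sdim N) (?d + ?d)" using mcocycleD(1)[OF f'(2) X] by (simp add: dD)
        have "(k1 X * ?\<pi>1 + k2 X * ?\<pi>2 + h * act ?D X) * diag_map ?d = (act N X * h + f' X) * diag_map ?d"
          using h(2)[OF X] by simp
        moreover have "(k1 X * ?\<pi>1 + k2 X * ?\<pi>2 + h * act ?D X) * diag_map ?d
            = (k1 X + k2 X) + h * diag_map ?d * act M X"
          unfolding add_mult_distrib_mat[OF A mult_carrier_mat[OF hC aD] dC] fold_cocycles(2)[OF K]
            assoc_mult_mat[OF hC aD dC] homs(5)[OF dh X, symmetric] assoc_mult_mat[OF hC dC aM] ..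
        moreover have "(act N X * h + f' X) * diag_map ?d = act N X * (h * diag_map ?d) + f' X * diag_map ?d"
          unfolding add_mult_distrib_mat[OF mult_carrier_mat[OF aN hC] F dC] assoc_mult_mat[OF aN hC dC] ..
        ultimately show "k1 X + k2 X + h * diag_map ?d * act M X = act N X * (h * diag_map ?d) + f' X * diag_map ?d"
          by simp
      qed
      note mk = mcocycle_add[OF sm k1(2) k2(2)] and mf = mcocycle_comp[OF sD sm(2) sm(1) f'(2) dh]
      have "cobounds M N k (\<lambda>X. k1 X + k2 X)"
        by (rule cobounds_trans[OF sm k(2) mf mk 1 cobounds_sym[OF sm mk mf 2]])
      then have "cobounds M N k (\<lambda>X. f1 X + f2 X)"
        by (rule cobounds_trans[OF sm k(2) mk mcocycle_add[OF sm f] _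
            cobounds_add[OF sm k1(2) f(1) k2(2) f(2) k1(3) k2(3)]])
      then show "e \<in> ?R" using k by blast
    qed
    show "?R \<subseteq> ?B"
    proof
      fix e assume "e \<in> ?R"
      then obtain k where k: "has_cocycle M N e k" "mcocycle M N k" "cobounds M N k (\<lambda>X. f1 X + f2 X)" by blast
      \<comment> \<open>The block row \<open>[f1 f2]\<close>; the standard extension with this
        cocycle serves as the middle extension.\<close>
      let ?f' = "\<lambda>X. f1 X * ?\<pi>1 + f2 X * ?\<pi>2"
      have f': "mcocycle ?D N ?f'"
        by (rule mcocycle_add[OF sD sm(2) mcocycle_comp[OF sm sD f(1) \<pi>(1)] mcocycle_comp[OF sm sD f(2) \<pi>(2)]])
      have e': "has_cocycle ?D N (std_ext ?D N ?f') ?f'" by (rule std_ext_has_cocycle[OF sD sm(2) f' wD ws(2)])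
      have "ext_map g (codiag_map (sdim N)) (1\<^sub>m (sdim ?D)) (ext_dsum e1 e2) (std_ext ?D N ?f')"
        unfolding dsum_iff[OF e f e' f'] using cobounds_refl[OF sD sm(2) f'] by (simp add: cobounds_def)
      moreover have "ext_map g (1\<^sub>m (sdim N)) (diag_map ?d) e (std_ext ?D N ?f')"
      proof -
        have "?f' X * diag_map ?d = f1 X + f2 X" if "X \<in> elements g" for X
          by (rule fold_cocycles(2)[OF mcocycleD(1)[OF f(1) that] mcocycleD(1)[OF f(2) that]])
        then have "cobounds M N k (\<lambda>X. ?f' X * diag_map ?d)" using k(3) by (simp add: cobounds_def)
        then show ?thesis using diag_iff[OF k(1,2) e'] by blast
      qed
      moreover have "e1 \<in> ext_equiv g M N `` {e1}" "e2 \<in> ext_equiv g M N `` {e2}"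
        using ext_class_iff[OF sm e(1) f(1)] ext_class_iff[OF sm e(2) f(2)] e f cobounds_refl[OF sm] by blast+
      moreover have "e \<in> extensions g M N" "std_ext ?D N ?f' \<in> extensions g ?D N"
        using k(1) e' by (simp_all add: has_cocycle_def)
      ultimately show "e \<in> ?B" unfolding baer_sum_def by blast
    qed
  qed
qed

lemma ext_smult_class:
  assumes sm: "supermodule g M" "supermodule g N"
    and e: "has_cocycle M N e1 f1" and f: "mcocycle M N f1"
  shows "ext_smult g M N c (ext_equiv g M N `` {e1}) =
    {e. \<exists>f. has_cocycle M N e f \<and> mcocycle M N f \<and> cobounds M N f (\<lambda>X. c \<cdot>\<^sub>m f1 X)}" (is "?B = ?R")
proof -
  have map_iff: "ext_map g (c \<cdot>\<^sub>m 1\<^sub>m (sdim N)) (1\<^sub>m (sdim M)) u u' \<longleftrightarrow> cobounds M N (\<lambda>X. c \<cdot>\<^sub>m k X) k'"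
    if "has_cocycle M N u k" "mcocycle M N k" "has_cocycle M N u' k'" "mcocycle M N k'" for u u' k k'
  proof -
    have "c \<cdot>\<^sub>m 1\<^sub>m (sdim N) * k X = c \<cdot>\<^sub>m k X" "k' X * 1\<^sub>m (sdim M) = k' X" if X: "X \<in> elements g" for X
    proof -
      note K = mcocycleD(1)[OF \<open>mcocycle M N k\<close> X]
      show "c \<cdot>\<^sub>m 1\<^sub>m (sdim N) * k X = c \<cdot>\<^sub>m k X"
        unfolding mult_smult_assoc_mat[OF one_carrier_mat K] left_mult_one_mat[OF K] ..
      show "k' X * 1\<^sub>m (sdim M) = k' X" by (rule right_mult_one_mat[OF mcocycleD(1)[OF \<open>mcocycle M N k'\<close> X]])
    qed
    then show ?thesis
      unfolding has_cocycle_map_iff[OF that(1,3) sm sm hom_smult_one[OF sm(2)] hom_one[OF sm(1)]] cobounds_def by simp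
  qed
  show ?thesis
  proof
    show "?B \<subseteq> ?R"
    proof
      fix e assume "e \<in> ?B"
      then obtain u where eE: "e \<in> extensions g M N" and u: "u \<in> ext_equiv g M N `` {e1}"
        and m: "ext_map g (c \<cdot>\<^sub>m 1\<^sub>m (sdim N)) (1\<^sub>m (sdim M)) u e"
        unfolding ext_smult_def by blast
      obtain k1 where k1: "has_cocycle M N u k1" "mcocycle M N k1" "cobounds M N k1 f1"
        using ext_class_iff[OF sm e f] u by blast
      obtain k where k: "has_cocycle M N e k" "mcocycle M N k" using has_cocycle_exists[OF eE sm] by blast
      note ck = mcocycle_smult[OF sm k1(2), of c]
      have "cobounds M N k (\<lambda>X. c \<cdot>\<^sub>m k1 X)"
        using map_iff[OF k1(1,2) k] m cobounds_sym[OF sm ck k(2)] by blast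
      then have "cobounds M N k (\<lambda>X. c \<cdot>\<^sub>m f1 X)"
        by (rule cobounds_trans[OF sm k(2) ck mcocycle_smult[OF sm f] _ cobounds_smult[OF sm k1(2) f k1(3)]])
      then show "e \<in> ?R" using k by blast
    qed
    show "?R \<subseteq> ?B"
    proof
      fix e assume "e \<in> ?R"
      then obtain k where k: "has_cocycle M N e k" "mcocycle M N k" "cobounds M N k (\<lambda>X. c \<cdot>\<^sub>m f1 X)" by blast
      have "ext_map g (c \<cdot>\<^sub>m 1\<^sub>m (sdim N)) (1\<^sub>m (sdim M)) e1 e"
        using map_iff[OF e f k(1,2)] cobounds_sym[OF sm k(2) mcocycle_smult[OF sm f] k(3)] by blast
      moreover have "e1 \<in> ext_equiv g M N `` {e1}" using ext_class_iff[OF sm e f] e f cobounds_refl[OF sm] by blast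
      moreover have "e \<in> extensions g M N" using k(1) by (simp add: has_cocycle_def)
      ultimately show "e \<in> ?B" unfolding ext_smult_def by blast
    qed
  qed
qed

text \<open>\<open>all\<close> and \<open>inj\<close> say that \<open>f0\<close> is a basis of the
  cocycles modulo coboundaries. The isomorphism sends \<open>x\<close> to the class of the standard
  extension with cocycle \<open>x\<close> times \<open>f0\<close>.\<close>

theorem iso_to_C_Ext1:
  assumes sm: "supermodule g M" "supermodule g N" and ws: "weight_spanned n M" "weight_spanned n N"
    and f0: "mcocycle M N f0"
    and all: "\<And>f. mcocycle M N f \<Longrightarrow> \<exists>c. cobounds M N f (\<lambda>X. c \<cdot>\<^sub>m f0 X)"
    and inj: "\<And>x y. cobounds M N (\<lambda>X. x \<cdot>\<^sub>m f0 X) (\<lambda>X. y \<cdot>\<^sub>m f0 X) \<Longrightarrow> x = y"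
  shows "iso_to_C (Ext1 g M N)"
proof -
  define st where "st x = std_ext M N (\<lambda>X. x \<cdot>\<^sub>m f0 X)" for x
  define \<phi> where "\<phi> x = ext_equiv g M N `` {st x}" for x
  have mc: "mcocycle M N (\<lambda>X. x \<cdot>\<^sub>m f0 X)" for x by (rule mcocycle_smult[OF sm f0])
  have st: "has_cocycle M N (st x) (\<lambda>X. x \<cdot>\<^sub>m f0 X)" for x
    unfolding st_def by (rule std_ext_has_cocycle[OF sm mc ws])
  have stE: "st x \<in> extensions g M N" for x using st by (simp add: has_cocycle_def)
  have \<phi>_eq: "\<phi> x = {e. \<exists>f. has_cocycle M N e f \<and> mcocycle M N f \<and> cobounds M N f (\<lambda>X. x \<cdot>\<^sub>m f0 X)}" for x
    unfolding \<phi>_def using ext_class_iff[OF sm st mc] by blast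
  note eq = equiv_ext_equiv[OF sm]
  have "inj \<phi>"
  proof (rule injI)
    fix x y assume "\<phi> x = \<phi> y"
    then have "(st x, st y) \<in> ext_equiv g M N"
      unfolding \<phi>_def using eq_equiv_class[OF _ eq stE] by blast
    then show "x = y" using ext_equiv_iff[OF st st sm] inj by blast
  qed
  moreover have "range \<phi> = extensions g M N // ext_equiv g M N"
  proof
    show "range \<phi> \<subseteq> extensions g M N // ext_equiv g M N" unfolding \<phi>_def using quotientI[OF stE] by blast
    show "extensions g M N // ext_equiv g M N \<subseteq> range \<phi>"
    proof
      fix C assume "C \<in> extensions g M N // ext_equiv g M N"
      then obtain e where e: "e \<in> extensions g M N" "C = ext_equiv g M N `` {e}" by (rule quotientE)
      obtain f where f: "has_cocycle M N e f" "mcocycle M N f" using has_cocycle_exists[OF e(1) sm] by blast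
      obtain c where "cobounds M N f (\<lambda>X. c \<cdot>\<^sub>m f0 X)" using all[OF f(2)] by blast
      then have "(e, st c) \<in> ext_equiv g M N" using ext_equiv_iff[OF f(1) st sm] by blast
      then have "C = \<phi> c" unfolding e(2) \<phi>_def by (rule equiv_class_eq[OF eq])
      then show "C \<in> range \<phi>" by blast
    qed
  qed
  ultimately have "bij_betw \<phi> UNIV (carrier (Ext1 g M N))" by (simp add: bij_betw_def Ext1_def)
  moreover have "\<phi> (x + y) = \<phi> x \<oplus>\<^bsub>Ext1 g M N\<^esub> \<phi> y" for x y
  proof -
    have s: "x \<cdot>\<^sub>m f0 X + y \<cdot>\<^sub>m f0 X = (x + y) \<cdot>\<^sub>m f0 X" for X
      by (intro eq_matI) (auto simp: algebra_simps)
    have "baer_sum g M N (\<phi> x) (\<phi> y) = \<phi> (x + y)"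
      unfolding \<phi>_eq[of "x + y"] unfolding \<phi>_def baer_sum_class[OF sm ws st st mc mc] s ..
    then show ?thesis by (simp add: Ext1_def)
  qed
  moreover have "\<phi> (c * x) = c \<odot>\<^bsub>Ext1 g M N\<^esub> \<phi> x" for c x
  proof -
    have s: "c \<cdot>\<^sub>m (x \<cdot>\<^sub>m f0 X) = (c * x) \<cdot>\<^sub>m f0 X" for X by (intro eq_matI) auto
    have "ext_smult g M N c (\<phi> x) = \<phi> (c * x)"
      unfolding \<phi>_eq[of "c * x"] unfolding \<phi>_def ext_smult_class[OF sm st mc] s ..
    then show ?thesis by (simp add: Ext1_def)
  qed
  ultimately show ?thesis unfolding iso_to_C_def by blast
qed

end

section \<open>Self-extensions of simple highest weight modules\<close>

lemma homog_map_Not: "homog (map Not rs) (map Not cs) a F \<longleftrightarrow> homog rs cs a F"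
  and homog_Not_swap: "homog (map Not rs) cs a F \<longleftrightarrow> homog rs (map Not cs) a F"
  by (auto simp: homog_def)

lemma supermodule_parity_change: "supermodule h M \<Longrightarrow> supermodule h (parity_change M)"
  by (simp add: supermodule_def parity_change_def sdim_def homog_map_Not)

lemma weight_spanned_parity_change: "weight_spanned n M \<Longrightarrow> weight_spanned n (parity_change M)"
  by (simp add: weight_spanned_def srep_def parity_change_def sdim_def)

lemma mat_move_left:
  fixes A B C D :: "complex mat"
  assumes "A + (- c) \<cdot>\<^sub>m B + C = D" "A \<in> carrier_mat r s" "B \<in> carrier_mat r s" "C \<in> carrier_mat r s"
  shows "A + C = D + c \<cdot>\<^sub>m B"
  unfolding assms(1)[symmetric] using assms(2-) by (intro eq_matI) auto

text \<open>\<open>A\<close> times the diagonal sign matrix of \<open>ps\<close> on the right; this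
  realises the twist by the parity in the standard cocycle.\<close>

definition signed :: "bool list \<Rightarrow> complex mat \<Rightarrow> complex mat" where
  "signed ps A = mat (dim_row A) (dim_col A) (\<lambda>(i, j). if ps ! j then - A $$ (i, j) else A $$ (i, j))"

lemma signed_carrier [simp]: "A \<in> carrier_mat r c \<Longrightarrow> signed ps A \<in> carrier_mat r c"
  by (simp add: signed_def)

lemma mop_signed:
  assumes "A \<in> carrier_mat d d" "length ps = d"
  shows "mop d (signed ps A) v = mop d A (psign ps v)"
  using assms by (auto simp: mop_def signed_def psign_def intro!: ext sum.cong)

text \<open>The upper right block. Composition with it extends a linear function of odd blocks to
  all elements, by zero on even ones.\<close>

definition odd_part :: "nat \<Rightarrow> complex mat \<Rightarrow> complex mat" where
  "odd_part n Z = mat n n (\<lambda>(i, j). Z $$ (i, j + n))"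

lemma odd_part_emb: "X \<in> carrier_mat n n \<Longrightarrow> odd_part n (emb n a X) = (if a then X else 0\<^sub>m n n)"
  by (auto simp: odd_part_def emb_def q_mat_def intro!: eq_matI)

lemma odd_part_add: "X \<in> carrier_mat (n + n) (n + n) \<Longrightarrow> Y \<in> carrier_mat (n + n) (n + n) \<Longrightarrow>
    odd_part n (X + Y) = odd_part n X + odd_part n Y"
  and odd_part_smult: "X \<in> carrier_mat (n + n) (n + n) \<Longrightarrow> odd_part n (c \<cdot>\<^sub>m X) = c \<cdot>\<^sub>m odd_part n X"
  by (auto simp: odd_part_def intro!: eq_matI)

text \<open>Handles \<open>N = L\<close> and \<open>N = parity_change L\<close> together: the
  underlying space and action agree, and the sign operator of \<open>N\<close> is
  \<open>\<epsilon>\<close> times that of \<open>L\<close>.\<close>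

locale hw_pair = sub_q n Od for n Od +
  fixes L N :: smod and \<nu> :: "nat \<Rightarrow> complex" and v0 :: "nat \<Rightarrow> complex" and \<epsilon> :: complex
  assumes L: "supermodule g L"
    and hw: "hw_rep cscale n Od (srep n L) (fspace (sdim L)) (psign (par L)) \<nu> v0"
    and N: "N = L \<and> \<epsilon> = 1 \<or> N = parity_change L \<and> \<epsilon> = - 1"
begin

abbreviation d :: nat where "d \<equiv> sdim L"
abbreviation \<sigma> :: "(nat \<Rightarrow> complex) \<Rightarrow> nat \<Rightarrow> complex" where "\<sigma> \<equiv> psign (par L)"

sublocale H: hw_rep cscale n Od "srep n L" "fspace d" \<sigma> \<nu> v0 by (rule hw)

lemma N_facts: "sdim N = d" "act N = act L" "length (par N) = d" "length (par L) = d"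
  using N by (auto simp: parity_change_def sdim_def)

lemma psign_N: "v \<in> fspace d \<Longrightarrow> psign (par N) v = cscale \<epsilon> (\<sigma> v)"
  using N psign_Not[of v "par L"] by (auto simp: parity_change_def sdim_def cscale_def)

lemma N_supermodule: "supermodule g N"
  using N L supermodule_parity_change by blast

lemma L_weight_spanned: "weight_spanned n L"
  using H.V_weight_span unfolding H.wt_def weight_spanned_def .

lemma N_weight_spanned: "weight_spanned n N"
  using N L_weight_spanned weight_spanned_parity_change by blast

lemma homog_iff_sign:
  assumes "F \<in> carrier_mat d d"
  shows "homog (par N) (par L) a F \<longleftrightarrow>
    (\<forall>v. cscale \<epsilon> (\<sigma> (mop d F v)) = cscale (if a then - 1 else 1) (mop d F (\<sigma> v)))"
proof -
  have "psign (par N) (mop d F v) = cscale \<epsilon> (\<sigma> (mop d F v))" for v by (rule psign_N[OF mop_fspace])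
  then show ?thesis
    using homog_psign[of "par N" "par L" a F d] homog_if_psign[OF assms, of "par N" "par L" a] N_facts(3,4) by metis
qed

lemma homog_if_sign:
  assumes "F \<in> carrier_mat d d"
    and "\<And>v. v \<in> fspace d \<Longrightarrow> cscale \<epsilon> (\<sigma> (mop d F v)) = cscale (if a then - 1 else 1) (mop d F (\<sigma> v))"
  shows "homog (par N) (par L) a F"
  by (rule homog_if_psign[OF assms(1) N_facts(3,4)]) (use assms(2) psign_N[OF mop_fspace] in simp)

lemma act_emb: "X \<in> homog_part n Od a \<Longrightarrow> act L (emb n a X) \<in> carrier_mat d d"
  by (rule supermodule_act(1)[OF L Od])

lemma emb_g: "X \<in> homog_part n Od a \<Longrightarrow> emb n a X \<in> g a"
  by (auto simp: gsub_def)

lemma g_obtain: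
  assumes "Z \<in> g a"
  obtains X where "X \<in> homog_part n Od a" "Z = emb n a X"
  using assms by (auto simp: gsub_def)

lemma cscale_minus_one: "cscale (- 1) v = - v"
  by (auto simp: cscale_def)

lemma mcocycle_imp_odd_cocycle:
  assumes f: "mcocycle L N f"
  shows "odd_cocycle cscale n Od (srep n L) (fspace d) \<sigma> \<nu> v0 \<epsilon> (\<lambda>X. mop d (f (emb n True X)))"
proof (intro odd_cocycle.intro odd_cocycle_axioms.intro hw)
  note D = mcocycleD[OF f, unfolded N_facts]
  have E: "emb n True X \<in> elements g" if "X \<in> Od" for X using g_elements[OF emb_g[of X True]] that by simp
  have C: "X \<in> carrier_mat n n" if "X \<in> Od" for X using triangular_odd_parts(1)[OF Od, of X True] that by simp
  note fC = D(1)[OF E]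
  have aC: "act L (emb n True X) \<in> carrier_mat d d" if "X \<in> Od" for X using act_emb[of X True] that by simp
  have aF: "act L (emb n False A) \<in> carrier_mat d d" if "A \<in> carrier_mat n n" for A using act_emb[of A False] that by simp
  show "\<epsilon> * \<epsilon> = 1" using N by auto
  show "mop d (f (emb n True X)) (v + w) = mop d (f (emb n True X)) v + mop d (f (emb n True X)) w" for X v w
    by (rule mop_add)
  show "mop d (f (emb n True X)) (cscale c v) = cscale c (mop d (f (emb n True X)) v)" for X v c
    by (rule mop_cscale)
  show "mop d (f (emb n True X)) v \<in> fspace d" for X v by (rule mop_fspace)
  show "mop d (f (emb n True (X + Y))) v = mop d (f (emb n True X)) v + mop d (f (emb n True Y)) v"
    if "X \<in> Od" "Y \<in> Od" for X Y v
    unfolding emb_add[OF C[OF that(1)] C[OF that(2)]] D(2)[OF E[OF that(1)] E[OF that(2)]]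
    by (rule mop_mat_add[OF fC[OF that(1)] fC[OF that(2)]])
  show "mop d (f (emb n True (c \<cdot>\<^sub>m X))) v = cscale c (mop d (f (emb n True X)) v)" if "X \<in> Od" for X c v
    unfolding emb_smult[OF C[OF that]] D(3)[OF E[OF that]] by (rule mop_mat_smult[OF fC[OF that]])
  show "cscale \<epsilon> (\<sigma> (mop d (f (emb n True X)) v)) = - mop d (f (emb n True X)) (\<sigma> v)" if X: "X \<in> Od" for X v
    using homog_iff_sign[OF fC[OF X], of True] mcocycleD(4)[OF f emb_g[of X True]] X
    by (simp add: cscale_minus_one)
  show "mop d (f (emb n True (A * X - X * A))) v =
      srep n L False A (mop d (f (emb n True X)) v) - mop d (f (emb n True X)) (srep n L False A v)"
    if A: "A \<in> carrier_mat n n" and X: "X \<in> Od" for A X v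
  proof -
    have "f (emb n True (A * X - X * A)) = f (supercomm False True (emb n False A) (emb n True X))"
      using supercomm_emb[OF A C[OF X], of False True] by (simp add: supercomm_def)
    also have "\<dots> = (act L (emb n False A) * f (emb n True X) + 0\<^sub>m d d * act L (emb n True X))
        - (act L (emb n True X) * 0\<^sub>m d d + f (emb n True X) * act L (emb n False A))"
      using D(6)[OF emb_g[of A False] emb_g[of X True]] D(5)[OF emb_g[of A False]] A X by simp
    also have "\<dots> = act L (emb n False A) * f (emb n True X) - f (emb n True X) * act L (emb n False A)"
      using fC[OF X] aC[OF X] aF[OF A] by (intro eq_matI) auto
    finally show ?thesis
      using mop_mat_minus[OF mult_carrier_mat[OF aF[OF A] fC[OF X]] mult_carrier_mat[OF fC[OF X] aF[OF A]]]
        mop_mat_mult[OF aF[OF A] fC[OF X]] mop_mat_mult[OF fC[OF X] aF[OF A]] by (simp add: srep_def)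
  qed
  show "mop d (f (emb n True X)) (srep n L True Y v) + srep n L True X (mop d (f (emb n True Y)) v) +
      mop d (f (emb n True Y)) (srep n L True X v) + srep n L True Y (mop d (f (emb n True X)) v) = 0"
    if X: "X \<in> Od" and Y: "Y \<in> Od" for X Y v
  proof -
    let ?X = "emb n True X" and ?Y = "emb n True Y"
    note c = fC[OF X] fC[OF Y] aC[OF X] aC[OF Y]
    have "supercomm True True ?X ?Y \<in> g False"
      using supercomm_in_g[OF emb_g[of X True] emb_g[of Y True]] X Y by simp
    then have "(act L ?X * f ?Y + f ?X * act L ?Y) + (act L ?Y * f ?X + f ?Y * act L ?X) = 0\<^sub>m d d"
      using D(6)[OF emb_g[of X True] emb_g[of Y True]] D(5) X Y by simp
    then have "mop d ((act L ?X * f ?Y + f ?X * act L ?Y) + (act L ?Y * f ?X + f ?Y * act L ?X)) v = 0"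
      by (simp add: mop_zero_mat)
    then have "(mop d (act L ?X) (mop d (f ?Y) v) + mop d (f ?X) (mop d (act L ?Y) v)) +
        (mop d (act L ?Y) (mop d (f ?X) v) + mop d (f ?Y) (mop d (act L ?X) v)) = 0"
      using c by (simp add: mop_mat_add[of _ d] mop_mat_mult)
    then show ?thesis by (simp add: srep_def algebra_simps)
  qed
qed

lemma odd_cocycle_imp_mcocycle:
  assumes F: "odd_cocycle cscale n Od (srep n L) (fspace d) \<sigma> \<nu> v0 \<epsilon> F"
    and K: "\<And>X. X \<in> Od \<Longrightarrow> K X \<in> carrier_mat d d" "\<And>X v. X \<in> Od \<Longrightarrow> F X v = mop d (K X) v"
  shows "mcocycle L N (\<lambda>Z. K (odd_part n Z))"
proof -
  interpret F: odd_cocycle cscale n Od "srep n L" "fspace d" \<sigma> \<nu> v0 \<epsilon> F by (rule F)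
  have C: "X \<in> carrier_mat n n" if "X \<in> homog_part n Od a" for X a by (rule triangular_odd_parts(1)[OF Od that])
  have Od0: "0\<^sub>m n n \<in> Od" using Od by (simp add: triangular_odd_def)
  have K0: "K (0\<^sub>m n n) = 0\<^sub>m d d"
    by (rule mop_eq_imp_mat_eq[OF K(1)[OF Od0]])
      (use F.f_zero_mat[OF Od0] in \<open>simp_all add: K(2)[OF Od0, symmetric] mop_zero_mat\<close>)
  have Kplus: "K (X + Y) = K X + K Y" if "X \<in> Od" "Y \<in> Od" for X Y
  proof (rule mop_eq_imp_mat_eq[of _ d])
    have s: "X + Y \<in> Od" using H.part_add[of X True Y] that by simp
    show "K (X + Y) \<in> carrier_mat d d" "K X + K Y \<in> carrier_mat d d" using K(1) s that by simp_all
    show "mop d (K (X + Y)) v = mop d (K X + K Y) v" for v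
      using F.f_plus[OF that, of v] K(2) s that mop_mat_add[OF K(1)[OF that(1)] K(1)[OF that(2)]] by simp
  qed
  have Ksmult: "K (c \<cdot>\<^sub>m X) = c \<cdot>\<^sub>m K X" if "X \<in> Od" for X c
  proof (rule mop_eq_imp_mat_eq[of _ d])
    have s: "c \<cdot>\<^sub>m X \<in> Od" using triangular_odd_parts(3)[OF Od, of X True c] that by simp
    show "K (c \<cdot>\<^sub>m X) \<in> carrier_mat d d" "c \<cdot>\<^sub>m K X \<in> carrier_mat d d" using K(1) s that by simp_all
    show "mop d (K (c \<cdot>\<^sub>m X)) v = mop d (c \<cdot>\<^sub>m K X) v" for v
      using F.f_smult[OF that, of c v] K(2) s that mop_mat_smult[OF K(1)[OF that]] by simp
  qed
  have kE: "K (odd_part n (emb n a X)) = (if a then K X else 0\<^sub>m d d)" if "X \<in> homog_part n Od a" for a X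
    using odd_part_emb[OF C[OF that], of a] K0 by simp
  have kC: "(if a then K X else 0\<^sub>m d d) \<in> carrier_mat d d" if "X \<in> homog_part n Od a" for a X
    using that K(1) by (cases a) auto
  have kF: "mop d (if a then K X else 0\<^sub>m d d) v = (if a then F X v else 0)" if "X \<in> homog_part n Od a" for a X v
    using that K(2) by (cases a) (auto simp: mop_zero_mat)
  have el: "Z \<in> carrier_mat (n + n) (n + n) \<and> odd_part n Z \<in> Od" if Z: "Z \<in> elements g" for Z
  proof -
    obtain A X where A: "A \<in> carrier_mat n n" and X: "X \<in> Od" "Z = emb n False A + emb n True X"
      using elements_gsub(2)[OF Od Z] by blast
    have CX: "X \<in> carrier_mat n n" using C[of X True] X by simp
    have "odd_part n Z = 0\<^sub>m n n + X"
      unfolding X(2) odd_part_add[OF emb_carrier[OF A] emb_carrier[OF CX]] odd_part_emb[OF A] odd_part_emb[OF CX] by simp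
    then show ?thesis using X emb_carrier[OF A] emb_carrier[OF CX] CX by simp
  qed
  show ?thesis
    unfolding mcocycle_def N_facts
  proof (intro conjI ballI allI)
    show "K (odd_part n Z) \<in> carrier_mat d d" if "Z \<in> elements g" for Z using el[OF that] K(1) by blast
    show "K (odd_part n (Y + Z)) = K (odd_part n Y) + K (odd_part n Z)"
      if "Y \<in> elements g" "Z \<in> elements g" for Y Z
      using el[OF that(1)] el[OF that(2)] by (simp add: odd_part_add Kplus)
    show "K (odd_part n (c \<cdot>\<^sub>m Z)) = c \<cdot>\<^sub>m K (odd_part n Z)" if "Z \<in> elements g" for Z c
      using el[OF that] by (simp add: odd_part_smult Ksmult)
    fix a Z assume "Z \<in> g a"
    then obtain X where X: "X \<in> homog_part n Od a" "Z = emb n a X" by (rule g_obtain)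
    show "homog (par N) (par L) a (K (odd_part n Z))"
      unfolding X(2) kE[OF X(1)] homog_iff_sign[OF kC[OF X(1)]] kF[OF X(1)]
      using X(1) F.f_\<sigma>[of X] by (cases a) (auto simp: cscale_minus_one H.\<sigma>_0 H.scale_zero_right)
  next
    fix Z assume "Z \<in> g False"
    then obtain X where X: "X \<in> homog_part n Od False" "Z = emb n False X" by (rule g_obtain)
    show "K (odd_part n Z) = 0\<^sub>m d d" unfolding X(2) kE[OF X(1)] by simp
  next
    fix a b Y Z assume "Y \<in> g a" "Z \<in> g b"
    obtain X where X: "X \<in> homog_part n Od a" "Y = emb n a X" using \<open>Y \<in> g a\<close> by (rule g_obtain)
    obtain W where W: "W \<in> homog_part n Od b" "Z = emb n b W" using \<open>Z \<in> g b\<close> by (rule g_obtain)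
    let ?k = "\<lambda>a X. if a then K X else 0\<^sub>m d d"
    note c = kC[OF X(1)] kC[OF W(1)] act_emb[OF X(1)] act_emb[OF W(1)]
    note s = triangular_odd_parts(4)[OF Od X(1) W(1)]
    have m: "act L Y * ?k b W \<in> carrier_mat d d" "?k a X * act L Z \<in> carrier_mat d d"
      "act L Z * ?k a X \<in> carrier_mat d d" "?k b W * act L Y \<in> carrier_mat d d"
      unfolding X(2) W(2) using c by (auto intro: mult_carrier_mat)
    have "?k (a \<noteq> b) (supercomm a b X W) =
      (if a \<and> b then (act L Y * ?k b W + ?k a X * act L Z) + (act L Z * ?k a X + ?k b W * act L Y)
       else (act L Y * ?k b W + ?k a X * act L Z) - (act L Z * ?k a X + ?k b W * act L Y))" (is "?l = ?r")
    proof (rule mop_eq_imp_mat_eq[of _ d])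
      show "?l \<in> carrier_mat d d" by (rule kC[OF s])
      show "?r \<in> carrier_mat d d"
      proof (cases "a \<and> b")
        case True
        show ?thesis unfolding if_P[OF True] by (intro add_carrier_mat m)
      next
        case False
        show ?thesis unfolding if_not_P[OF False] by (intro minus_carrier_mat add_carrier_mat m)
      qed
      fix v
      have p: "mop d (act L Y * ?k b W) v = srep n L a X (if b then F W v else 0)"
        "mop d (?k a X * act L Z) v = (if a then F X (srep n L b W v) else 0)"
        "mop d (act L Z * ?k a X) v = srep n L b W (if a then F X v else 0)"
        "mop d (?k b W * act L Y) v = (if b then F W (srep n L a X v) else 0)"
        unfolding X(2) W(2) mop_mat_mult[OF c(3,2)] mop_mat_mult[OF c(1,4)] mop_mat_mult[OF c(4,1)]
          mop_mat_mult[OF c(2,3)] kF[OF X(1)] kF[OF W(1)] srep_def by (rule refl)+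
      have "mop d ?r v = (mop d (?k a X * act L Z) v + mop d (act L Y * ?k b W) v) +
          cscale (if a \<and> b then 1 else - 1) (mop d (?k b W * act L Y) v + mop d (act L Z * ?k a X) v)"
      proof (cases "a \<and> b")
        case True
        then show ?thesis using mop_mat_add[OF add_carrier_mat[OF m(2), of "act L Y * ?k b W"] add_carrier_mat[OF m(4)]]
            mop_mat_add[OF m(1,2)] mop_mat_add[OF m(3,4)] by (simp add: algebra_simps)
      next
        case False
        then show ?thesis
          unfolding if_not_P[OF False] mop_mat_minus[OF add_carrier_mat[OF m(2), of "act L Y * ?k b W"] add_carrier_mat[OF m(4)]]
            mop_mat_add[OF m(1,2)] mop_mat_add[OF m(3,4)] cscale_minus_one by (simp only: add.commute diff_conv_add_uminus)
      qed
      then show "mop d ?l v = mop d ?r v"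
        unfolding kF[OF s] p using F.cocycle_full X(1) W(1) unfolding H.cocycle_def by (metis (no_types, lifting))
    qed
    then show "K (odd_part n (supercomm a b Y Z)) =
      (if a \<and> b then (act L Y * K (odd_part n Z) + K (odd_part n Y) * act L Z) + (act L Z * K (odd_part n Y) + K (odd_part n Z) * act L Y)
       else (act L Y * K (odd_part n Z) + K (odd_part n Y) * act L Z) - (act L Z * K (odd_part n Y) + K (odd_part n Z) * act L Y))"
      unfolding X(2) W(2) supercomm_emb[OF C[OF X(1)] C[OF W(1)]] kE[OF s] kE[OF X(1)] kE[OF W(1)] .
  qed
qed

text \<open>Also applied with the zero cocycle, where \<open>B\<close> is a morphism from
  \<open>L\<close> to \<open>N\<close>; that use needs the explicit description of \<open>B\<close>
  in the third clause.\<close>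

lemma coboundary_matrix:
  assumes k: "mcocycle L N k"
    and h: "\<And>v w. v \<in> fspace d \<Longrightarrow> w \<in> fspace d \<Longrightarrow> h (v + w) = h v + h w"
      "\<And>c v. v \<in> fspace d \<Longrightarrow> h (cscale c v) = cscale c (h v)" "\<And>v. v \<in> fspace d \<Longrightarrow> h v \<in> fspace d"
      "\<And>v. v \<in> fspace d \<Longrightarrow> h (\<sigma> v) = cscale \<epsilon> (\<sigma> (h v))"
      "\<And>A v. A \<in> carrier_mat n n \<Longrightarrow> v \<in> fspace d \<Longrightarrow> h (srep n L False A v) = srep n L False A (h v)"
      "\<And>X v. X \<in> Od \<Longrightarrow> v \<in> fspace d \<Longrightarrow>
        h (srep n L True X v) = srep n L True X (h v) + mop d (k (emb n True X)) v"
  obtains B where "homog (par N) (par L) False B" "\<And>X. X \<in> elements g \<Longrightarrow> k X + B * act L X = act N X * B"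
    "\<And>v. v \<in> fspace d \<Longrightarrow> mop d B v = - h v"
proof -
  \<comment> \<open>The sign turns \<open>h X = X h + k X\<close> into
    \<open>k X + B X = X B\<close>, the form used by \<open>cobounds\<close>.\<close>
  have "\<exists>B \<in> carrier_mat d d. \<forall>v\<in>fspace d. - h v = mop d B v"
  proof (rule linear_is_mop[of d "\<lambda>v. - h v"])
    show "- h (v + w) = - h v + - h w" if "v \<in> fspace d" "w \<in> fspace d" for v w using h(1)[OF that] by simp
    show "- h (cscale c v) = cscale c (- h v)" if "v \<in> fspace d" for c v
      using h(2)[OF that] by (auto simp: cscale_def)
    show "- h v \<in> fspace d" if "v \<in> fspace d" for v using h(3)[OF that] by (simp add: fspace_def)
  qed blast
  then obtain B where B: "B \<in> carrier_mat d d" "\<And>v. v \<in> fspace d \<Longrightarrow> mop d B v = - h v" by fastforce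
  show thesis
  proof (rule that[OF _ _ B(2)])
    show "homog (par N) (par L) False B"
    proof (rule homog_if_sign[OF B(1)])
      fix v assume v: "v \<in> fspace d"
      show "cscale \<epsilon> (\<sigma> (mop d B v)) = cscale (if False then - 1 else 1) (mop d B (\<sigma> v))"
        unfolding B(2)[OF v] B(2)[OF psign_fspace[OF v]] h(4)[OF v] by (auto simp: cscale_def psign_def)
    qed
    fix Z assume Z: "Z \<in> elements g"
    note aZ = act_carrier[OF L Z] and kZ = mcocycleD(1)[OF k Z, unfolded N_facts]
    obtain A X where A: "A \<in> carrier_mat n n" and X: "X \<in> Od" and ZZ: "Z = emb n False A + emb n True X"
      using elements_gsub(2)[OF Od Z] by blast
    have eA: "emb n False A \<in> g False" and eX: "emb n True X \<in> g True"
      using emb_g[of A False] emb_g[of X True] A X by simp_all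
    have aE: "act L (emb n False A) \<in> carrier_mat d d" "act L (emb n True X) \<in> carrier_mat d d"
      using act_emb[of A False] act_emb[of X True] A X by simp_all
    have aS: "act L Z = act L (emb n False A) + act L (emb n True X)"
      using L g_elements[OF eA] g_elements[OF eX] unfolding ZZ supermodule_def by blast
    have kS: "k Z = k (emb n True X)"
      unfolding ZZ mcocycleD(2)[OF k g_elements[OF eA] g_elements[OF eX]] mcocycleD(5)[OF k eA]
      by (rule left_add_zero_mat[OF mcocycleD(1)[OF k g_elements[OF eX]]])
    have "k Z + B * act L Z = act L Z * B"
    proof (rule mop_eq_imp_mat_eq)
      show "k Z + B * act L Z \<in> carrier_mat d d" "act L Z * B \<in> carrier_mat d d" using kZ aZ B(1) by auto
      fix v assume v: "v \<in> fspace d"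
      let ?RA = "srep n L False A" and ?RX = "srep n L True X"
      have R: "mop d (act L Z) w = ?RA w + ?RX w" for w
        unfolding aS mop_mat_add[OF aE] srep_def ..
      have Rf: "?RA w \<in> fspace d" "?RX w \<in> fspace d" for w by (simp_all add: srep_def mop_fspace)
      have "mop d (k Z + B * act L Z) v = mop d (k (emb n True X)) v + (- h (?RA v) + - h (?RX v))"
        unfolding mop_mat_add[OF kZ mult_carrier_mat[OF B(1) aZ]] mop_mat_mult[OF B(1) aZ] R mop_add B(2)[OF Rf(1)] B(2)[OF Rf(2)]
        unfolding kS ..
      moreover have "?RA (- h v) = - ?RA (h v)" "?RX (- h v) = - ?RX (h v)"
        unfolding srep_def cscale_minus_one[symmetric] mop_cscale by (rule refl)+
      ultimately show "mop d (k Z + B * act L Z) v = mop d (act L Z * B) v"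
        unfolding mop_mat_mult[OF aZ B(1)] R B(2)[OF v] h(5)[OF A v] h(6)[OF X v] by simp
    qed
    then show "k Z + B * act L Z = act N Z * B" by (simp add: N_facts)
  qed
qed

lemma coboundary_matrixE:
  assumes k: "mcocycle L N k" and F: "odd_cocycle cscale n Od (srep n L) (fspace d) \<sigma> \<nu> v0 \<epsilon> F"
    and kF: "\<And>X v. X \<in> Od \<Longrightarrow> v \<in> fspace d \<Longrightarrow> F X v = mop d (k (emb n True X)) v"
    and cob: "odd_cocycle.coboundary cscale n Od (srep n L) (fspace d) \<sigma> \<epsilon> F"
  shows "\<exists>B. homog (par N) (par L) False B \<and> (\<forall>X\<in>elements g. k X + B * act L X = act N X * B)"
proof -
  obtain h where h: "\<forall>v\<in>fspace d. \<forall>w\<in>fspace d. h (v + w) = h v + h w"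
    "\<forall>c. \<forall>v\<in>fspace d. h (cscale c v) = cscale c (h v)" "\<forall>v\<in>fspace d. h v \<in> fspace d"
    "\<forall>v\<in>fspace d. h (\<sigma> v) = cscale \<epsilon> (\<sigma> (h v))"
    "\<forall>A\<in>carrier_mat n n. \<forall>v\<in>fspace d. h (srep n L False A v) = srep n L False A (h v)"
    "\<forall>X\<in>Od. \<forall>v\<in>fspace d. h (srep n L True X v) = srep n L True X (h v) + F X v"
    using cob unfolding odd_cocycle.coboundary_def[OF F] by auto
  show ?thesis
    by (rule coboundary_matrix[OF k, of h]) (use h kF in auto)
qed

lemma Ext1_zero:
  assumes "\<And>f. odd_cocycle cscale n Od (srep n L) (fspace d) \<sigma> \<nu> v0 \<epsilon> f \<Longrightarrow>
    odd_cocycle.coboundary cscale n Od (srep n L) (fspace d) \<sigma> \<epsilon> f"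
  shows "is_zero_space (Ext1 g L N)"
proof (rule is_zero_space_Ext1[OF L N_supermodule L_weight_spanned N_weight_spanned])
  fix f assume f: "mcocycle L N f"
  note F = mcocycle_imp_odd_cocycle[OF f]
  show "\<exists>h. homog (par N) (par L) False h \<and> (\<forall>X\<in>elements g. f X + h * act L X = act N X * h)"
    by (rule coboundary_matrixE[OF f F refl assms[OF F]])
qed

text \<open>The generator \<open>f0\<close> is the standard cocycle with coefficient 1.
  \<open>degenerate_classification\<close> shows that its class spans,
  \<open>standard_cocycle_not_coboundary\<close> that it is nonzero.\<close>

theorem Ext1_degenerate:
  assumes tr: "Od = traceless n" and n: "0 < n" and \<nu>: "\<forall>i<n. \<nu> i \<noteq> 0" "(\<Sum>i<n. 1 / \<nu> i) = 0" and \<epsilon>: "\<epsilon> = - 1"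
  shows "iso_to_C (Ext1 g L N)"
proof -
  define K where "K X = signed (par L) (act L (emb n False X))" for X
  define f0 where "f0 Z = K (odd_part n Z)" for Z
  have C: "X \<in> carrier_mat n n" if "X \<in> Od" for X using triangular_odd_parts(1)[OF Od, of X True] that by simp
  have aC: "act L (emb n False X) \<in> carrier_mat d d" if "X \<in> Od" for X using act_emb[of X False] C[OF that] by simp
  have KC: "K X \<in> carrier_mat d d" if "X \<in> Od" for X using aC[OF that] by (simp add: K_def)
  have Kop: "mop d (K X) v = srep n L False X (\<sigma> v)" if "X \<in> Od" for X v
    unfolding K_def srep_def by (rule mop_signed[OF aC[OF that] N_facts(4)])
  have one: "cscale 1 v = v" for v by (simp add: cscale_def)
  have f0: "mcocycle L N f0"
    unfolding f0_def
    by (rule odd_cocycle_imp_mcocycle[OF H.standard_cocycle[of 1, folded \<epsilon>] KC]) (simp_all add: Kop one)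
  have f0E: "mop d (f0 (emb n True X)) v = srep n L False X (\<sigma> v)" if "X \<in> Od" for X v
    unfolding f0_def odd_part_emb[OF C[OF that]] by (simp add: Kop[OF that])
  have el: "emb n True X \<in> elements g" if "X \<in> Od" for X using g_elements[OF emb_g[of X True]] that by simp
  have elF: "emb n False A \<in> elements g" if "A \<in> carrier_mat n n" for A using g_elements[OF emb_g[of A False]] that by simp
  note D0 = mcocycleD[OF f0, unfolded N_facts]
  show ?thesis
  proof (rule iso_to_C_Ext1[OF L N_supermodule L_weight_spanned N_weight_spanned f0])
    fix f assume f: "mcocycle L N f"
    note Df = mcocycleD[OF f, unfolded N_facts]
    obtain c where c: "odd_cocycle cscale n Od (srep n L) (fspace d) \<sigma> \<nu> v0 (- 1)
        (\<lambda>X v. mop d (f (emb n True X)) v - cscale c (srep n L False X (\<sigma> v)))"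
      "odd_cocycle.coboundary cscale n Od (srep n L) (fspace d) \<sigma> (- 1)
        (\<lambda>X v. mop d (f (emb n True X)) v - cscale c (srep n L False X (\<sigma> v)))"
      by (rule H.degenerate_classification[OF tr n \<nu> mcocycle_imp_odd_cocycle[OF f, unfolded \<epsilon>]])
    note k = mcocycle_add[OF L N_supermodule f mcocycle_smult[OF L N_supermodule f0, of "- c"]]
    have "mop d (f (emb n True X)) v - cscale c (srep n L False X (\<sigma> v))
        = mop d (f (emb n True X) + - c \<cdot>\<^sub>m f0 (emb n True X)) v" if X: "X \<in> Od" for X v
      unfolding mop_mat_add[OF Df(1)[OF el[OF X]] smult_carrier_mat[OF D0(1)[OF el[OF X]]]]
        mop_mat_smult[OF D0(1)[OF el[OF X]]] f0E[OF X] by (auto simp: cscale_def)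
    then obtain B where B: "homog (par N) (par L) False B"
      "\<And>X. X \<in> elements g \<Longrightarrow> f X + - c \<cdot>\<^sub>m f0 X + B * act L X = act N X * B"
      using coboundary_matrixE[OF k c(1)[folded \<epsilon>] _ c(2)[folded \<epsilon>]] by blast
    have BC: "B \<in> carrier_mat d d" using homog_carrier[OF B(1)] by (simp add: N_facts)
    have "f X + B * act L X = act N X * B + c \<cdot>\<^sub>m f0 X" if X: "X \<in> elements g" for X
      by (rule mat_move_left[OF B(2)[OF X] Df(1)[OF X] D0(1)[OF X] mult_carrier_mat[OF BC act_carrier[OF L X]]])
    then show "\<exists>c. cobounds L N f (\<lambda>X. c \<cdot>\<^sub>m f0 X)" using B(1) unfolding cobounds_def by blast
  next
    fix x y assume "cobounds L N (\<lambda>X. x \<cdot>\<^sub>m f0 X) (\<lambda>X. y \<cdot>\<^sub>m f0 X)"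
    then obtain B where B: "homog (par N) (par L) False B"
      "\<And>X. X \<in> elements g \<Longrightarrow> x \<cdot>\<^sub>m f0 X + B * act L X = act L X * B + y \<cdot>\<^sub>m f0 X"
      unfolding cobounds_def N_facts by blast
    have BC: "B \<in> carrier_mat d d" using homog_carrier[OF B(1)] by (simp add: N_facts)
    have E: "cscale x (mop d (f0 X) v) + mop d B (mop d (act L X) v) = mop d (act L X) (mop d B v) + cscale y (mop d (f0 X) v)"
      if X: "X \<in> elements g" for X v
    proof -
      note c = D0(1)[OF X] act_carrier[OF L X]
      have "mop d (x \<cdot>\<^sub>m f0 X + B * act L X) v = mop d (act L X * B + y \<cdot>\<^sub>m f0 X) v" using B(2)[OF X] by simp
      then show ?thesis
        unfolding mop_mat_add[OF smult_carrier_mat[OF c(1)] mult_carrier_mat[OF BC c(2)]]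
          mop_mat_add[OF mult_carrier_mat[OF c(2) BC] smult_carrier_mat[OF c(1)]]
          mop_mat_smult[OF c(1)] mop_mat_mult[OF BC c(2)] mop_mat_mult[OF c(2) BC] .
    qed
    \<comment> \<open>The difference of the two multiples is the standard cocycle with coefficient
      \<open>y - x\<close>, and \<open>B\<close> exhibits it as a coboundary.\<close>
    have "y - x = 0"
    proof (rule H.standard_cocycle_not_coboundary[OF tr n \<nu>, of "mop d B"])
      show "mop d B 0 = 0" by (auto simp: mop_def)
      show "mop d B v \<in> fspace d" for v by (rule mop_fspace)
      show "mop d B (cscale c v) = cscale c (mop d B v)" for c v by (rule mop_cscale)
      show "mop d B (srep n L False A v) = srep n L False A (mop d B v)" if A: "A \<in> carrier_mat n n" for A v
      proof -
        have "emb n False A \<in> g False" using emb_g[of A False] A by simp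
        then have "f0 (emb n False A) = 0\<^sub>m d d" by (rule D0(5))
        then show ?thesis using E[OF elF[OF A], of v] by (simp add: srep_def mop_zero_mat H.scale_zero_right)
      qed
      show "mop d B (srep n L True X v) = srep n L True X (mop d B v) + cscale (y - x) (srep n L False X (\<sigma> v))"
        if X: "X \<in> Od" for X v
        using E[OF el[OF X], of v] unfolding f0E[OF X] H.scale_left_diff_distrib srep_def by (simp add: algebra_simps)
    qed
    then show "x = y" by simp
  qed
qed

end

text \<open>The parity automorphism, read as a matrix \<open>B\<close> through
  \<open>coboundary_matrix\<close> with zero cocycle, is a morphism to the parity change; as
  \<open>B * B\<close> is a nonzero scalar \<open>c\<close>, its inverse is \<open>B\<close> divided
  by \<open>c\<close>.\<close>

theorem odd_rank_parity_iso:
  assumes M: "simple_highest_weight (q_alg n) n \<nu> M" and n: "odd n" and \<nu>: "\<forall>i<n. \<nu> $ i \<noteq> 0"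
  shows "smod_iso (q_alg n) M (parity_change M)"
proof -
  note M' = M[unfolded q_alg_gsub]
  interpret sub_q n "carrier_mat n n" by unfold_locales (rule triangular_odd_carrier)
  have sm: "supermodule g M" using M' unfolding simple_highest_weight_def simple_smod_def by blast
  obtain v0 where hw: "hw_rep cscale n (carrier_mat n n) (srep n M) (fspace (sdim M)) (psign (par M))
      (\<lambda>i. if i < n then \<nu> $ i else 0) v0"
    by (rule srep_hw_rep[OF M' Od])
  interpret hw_pair n "carrier_mat n n" M "parity_change M" "\<lambda>i. if i < n then \<nu> $ i else 0" v0 "- 1"
    by (intro hw_pair.intro hw_pair_axioms.intro sub_q_axioms sm hw) simp
  have "\<forall>i<n. (if i < n then \<nu> $ i else 0) \<noteq> 0" using \<nu> by simp
  then obtain h c where h: "\<And>v w. v \<in> fspace d \<Longrightarrow> w \<in> fspace d \<Longrightarrow> h (v + w) = h v + h w"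
    "\<And>c v. v \<in> fspace d \<Longrightarrow> h (cscale c v) = cscale c (h v)" "\<And>v. v \<in> fspace d \<Longrightarrow> h v \<in> fspace d"
    "\<And>v. v \<in> fspace d \<Longrightarrow> h (\<sigma> v) = - \<sigma> (h v)"
    "\<And>a X v. X \<in> homog_part n (carrier_mat n n) a \<Longrightarrow> v \<in> fspace d \<Longrightarrow> h (srep n M a X v) = srep n M a X (h v)"
    "c \<noteq> 0" "\<And>v. v \<in> fspace d \<Longrightarrow> h (h v) = cscale c v"
    by (rule H.odd_rank_parity_automorphism[OF refl n]) blast
  note z = mcocycle_zero[OF L N_supermodule]
  have zero: "mop d (0\<^sub>m (dim_row (act (parity_change M) X)) (dim_col (act M X))) v = 0"
    if "X \<in> elements g" for X v
    using act_dims[OF sm that] by (simp add: N_facts mop_zero_mat)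
  have h\<sigma>: "h (\<sigma> v) = cscale (- 1) (\<sigma> (h v))" if "v \<in> fspace d" for v using h(4)[OF that] by (simp add: cscale_minus_one)
  have hF: "h (srep n M False A v) = srep n M False A (h v)" if "A \<in> carrier_mat n n" "v \<in> fspace d" for A v
    using h(5)[of A False v] that by simp
  have hT: "h (srep n M True X v) = srep n M True X (h v) +
      mop d (0\<^sub>m (dim_row (act (parity_change M) (emb n True X))) (dim_col (act M (emb n True X)))) v"
    if "X \<in> carrier_mat n n" "v \<in> fspace d" for X v
    using h(5)[of X True v] zero[OF g_elements[OF emb_g[of X True]]] that by simp
  have "\<exists>B. homog (par (parity_change M)) (par M) False B \<and> (\<forall>X\<in>elements g.
      0\<^sub>m (dim_row (act (parity_change M) X)) (dim_col (act M X)) + B * act M X = act (parity_change M) X * B) \<and>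
      (\<forall>v\<in>fspace d. mop d B v = - h v)"
    by (rule coboundary_matrix[OF z, of h]) (use h(1-3) h\<sigma> hF hT in blast)+
  then obtain B where B: "homog (par (parity_change M)) (par M) False B"
    "\<And>X. X \<in> elements g \<Longrightarrow>
      0\<^sub>m (dim_row (act (parity_change M) X)) (dim_col (act M X)) + B * act M X = act (parity_change M) X * B"
    "\<And>v. v \<in> fspace d \<Longrightarrow> mop d B v = - h v"
    by blast
  have BC: "B \<in> carrier_mat d d" using homog_carrier[OF B(1)] by (simp add: N_facts)
  have comm: "B * act M X = act M X * B" if X: "X \<in> elements g" for X
    using B(2)[OF X] left_add_zero_mat[OF mult_carrier_mat[OF BC act_carrier[OF sm X]]] act_dims[OF sm X]
    by (simp add: N_facts)
  have BB: "B * B = c \<cdot>\<^sub>m 1\<^sub>m d"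
  proof (rule mop_eq_imp_mat_eq)
    show "B * B \<in> carrier_mat d d" "c \<cdot>\<^sub>m 1\<^sub>m d \<in> carrier_mat d d" using BC by auto
    fix v assume v: "v \<in> fspace d"
    have "mop d (1\<^sub>m d) v = v"
      using v by (auto simp: mop_def fspace_def if_distrib[of "\<lambda>x. x * _"] cong: if_cong intro!: ext)
    moreover have "mop d B (mop d B v) = cscale c v"
      unfolding B(3)[OF v] cscale_minus_one[symmetric] mop_cscale B(3)[OF h(3)[OF v]] h(7)[OF v] by (simp add: cscale_def)
    ultimately show "mop d (B * B) v = mop d (c \<cdot>\<^sub>m 1\<^sub>m d) v"
      by (simp add: mop_mat_mult[OF BC BC] mop_mat_smult[of "1\<^sub>m d" d])
  qed
  let ?G = "(1 / c) \<cdot>\<^sub>m B"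
  have "B \<in> smod_hom g M (parity_change M)" using B(1) comm by (simp add: smod_hom_def N_facts)
  moreover have "?G \<in> smod_hom g (parity_change M) M"
  proof -
    have "homog (par M) (par (parity_change M)) False ?G"
      using homog_smult[OF B(1)] by (simp add: parity_change_def homog_Not_swap)
    moreover have "?G * act M X = act M X * ?G" if X: "X \<in> elements g" for X
      unfolding mult_smult_assoc_mat[OF BC act_carrier[OF sm X]] mult_smult_distrib[OF act_carrier[OF sm X] BC] comm[OF X] ..
    ultimately show ?thesis by (simp add: smod_hom_def N_facts)
  qed
  moreover have "(1 / c) \<cdot>\<^sub>m (c \<cdot>\<^sub>m 1\<^sub>m d) = 1\<^sub>m d" using h(6) by (intro eq_matI) auto
  then have "?G * B = 1\<^sub>m d" "B * ?G = 1\<^sub>m d"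
    by (simp_all add: mult_smult_assoc_mat[OF BC BC] mult_smult_distrib[OF BC BC] BB)
  ultimately show ?thesis unfolding smod_iso_def q_alg_gsub N_facts by blast
qed

theorem theorem4p5:
  fixes n k m :: nat
    and lam :: "nat \<Rightarrow> real"
    and \<nu> :: "complex vec"
    and L :: smod
  assumes "1 \<le> n"
    and "k + m \<le> n"
    and "\<forall>i < n. i < k \<or> k + m \<le> i \<longrightarrow> lam i > 0"
    and "\<nu> = vec n (\<lambda>i. if i < k then complex_of_real (lam i)
                        else if i < k + m then 0 else - complex_of_real (lam i))"
    and "\<nu> \<in> dominant_integral n"
    and "simple_highest_weight (sq_alg n) n \<nu> L"
  shows "(\<forall>Lq. simple_highest_weight (q_alg n) n \<nu> Lq \<and> \<not> smod_iso (q_alg n) Lq (parity_change Lq)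
            \<longrightarrow> is_zero_space (Ext1 (sq_alg n) L L))
    \<and> (m > 0 \<or> (m = 0 \<and> (\<Sum>i<n. 1 / \<nu> $ i) \<noteq> 0)
            \<longrightarrow> is_zero_space (Ext1 (sq_alg n) L (parity_change L)) \<and>
                is_zero_space (Ext1 (sq_alg n) L L))
    \<and> (m = 0 \<and> (\<Sum>i<n. 1 / \<nu> $ i) = 0
            \<longrightarrow> iso_to_C (Ext1 (sq_alg n) L (parity_change L)))"
proof -
  let ?\<nu> = "\<lambda>i. if i < n then \<nu> $ i else 0"
  note Lhw = assms(6)[unfolded sq_alg_gsub]
  interpret sub_q n "traceless n" by unfold_locales (rule triangular_odd_traceless)
  have sm: "supermodule g L" using Lhw unfolding simple_highest_weight_def simple_smod_def by blast
  obtain v0 where hw: "hw_rep cscale n (traceless n) (srep n L) (fspace (sdim L)) (psign (par L)) ?\<nu> v0"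
    by (rule srep_hw_rep[OF Lhw Od])
  \<comment> \<open>The prefixes \<open>even\<close> and \<open>odd\<close> refer to the second
    module being \<open>L\<close> or its parity change, not to the parity of
    \<open>n\<close>.\<close>
  interpret even: hw_pair n "traceless n" L L ?\<nu> v0 1
    by (intro hw_pair.intro hw_pair_axioms.intro sub_q_axioms sm hw) simp
  interpret odd: hw_pair n "traceless n" L "parity_change L" ?\<nu> v0 "- 1"
    by (intro hw_pair.intro hw_pair_axioms.intro sub_q_axioms sm hw) simp
  have zeros: "?\<nu> i = 0 \<longleftrightarrow> k \<le> i \<and> i < k + m" if "i < n" for i
    using assms(3) that by (auto simp: assms(4))
  have sum: "(\<Sum>i<n. 1 / ?\<nu> i) = (\<Sum>i<n. 1 / \<nu> $ i)" by (intro sum.cong) auto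
  have nz: "\<forall>i<n. ?\<nu> i \<noteq> 0" if "m = 0" using zeros that by fastforce
  have n: "0 < n" using assms(1) by simp
  have cob: "odd_cocycle.coboundary cscale n (traceless n) (srep n L) (fspace (sdim L)) (psign (par L)) \<epsilon> f"
    if f: "odd_cocycle cscale n (traceless n) (srep n L) (fspace (sdim L)) (psign (par L)) ?\<nu> v0 \<epsilon> f"
      and m: "m > 0 \<or> (m = 0 \<and> (\<Sum>i<n. 1 / \<nu> $ i) \<noteq> 0)" for \<epsilon> f
    using m
  proof
    assume "m > 0"
    then show ?thesis by (rule odd_cocycle.coboundary_zeros[OF f refl assms(2) _ zeros])
  next
    assume "m = 0 \<and> (\<Sum>i<n. 1 / \<nu> $ i) \<noteq> 0"
    then show ?thesis using odd_cocycle.coboundary_nondegenerate[OF f refl] nz sum by simp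
  qed
  have two: "is_zero_space (Ext1 g L (parity_change L))" "is_zero_space (Ext1 g L L)"
    if m: "m > 0 \<or> (m = 0 \<and> (\<Sum>i<n. 1 / \<nu> $ i) \<noteq> 0)"
    using odd.Ext1_zero[OF cob[OF _ m]] even.Ext1_zero[OF cob[OF _ m]] by simp_all
  have three: "iso_to_C (Ext1 g L (parity_change L))" if "m = 0" "(\<Sum>i<n. 1 / \<nu> $ i) = 0"
    by (rule odd.Ext1_degenerate[OF refl n nz[OF that(1)] _ refl]) (use sum that in simp)
  have one: "is_zero_space (Ext1 g L L)"
    if Lq: "simple_highest_weight (q_alg n) n \<nu> Lq" "\<not> smod_iso (q_alg n) Lq (parity_change Lq)" for Lq
  proof (cases "m > 0 \<or> (m = 0 \<and> (\<Sum>i<n. 1 / \<nu> $ i) \<noteq> 0)")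
    case True
    then show ?thesis by (rule two(2))
  next
    case False
    then have m: "m = 0" "(\<Sum>i<n. 1 / \<nu> $ i) = 0" by auto
    \<comment> \<open>The hypothesis on \<open>Lq\<close> enters only here: for odd \<open>n\<close>
      and nonzero weight coordinates it would contradict \<open>odd_rank_parity_iso\<close>.\<close>
    have "even n" using odd_rank_parity_iso[OF Lq(1)] Lq(2) nz[OF m(1)] by auto
    then show ?thesis
      by (intro even.Ext1_zero odd_cocycle.coboundary_even_rank[OF _ refl n _ nz[OF m(1)] _ refl])
        (use sum m in simp_all)
  qed
  show ?thesis unfolding sq_alg_gsub using one two three by blast
qed

end
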